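(* The discrete Biot problem can be reformulated as follows (for all $1\le n\le N$): find $(\underline{\mathbf u}_h^n,p_h^n)\in\underline{\mathbf U}_{h,0}^k\times P_h^k$ such that it holds, for all $(\underline{\mathbf v}_h,q_h)\in\underline{\mathbf U}_{h,0}^k\times\mathbb P_d^k(\mathcal T_h)$ and all $T\in\mathcal T_h$, $$(\mathbf S_T^k\underline{\mathbf u}_T^n-p_h^n\mathbf I,\nabla_{\rm s}\mathbf v_T)_T+\sum_{F\in\mathcal F_T}(\mathbf\Phi_{TF}^k(\underline{\mathbf u}_T^n,p_h^n|_T),\mathbf v_F-\mathbf v_T)_F=(\mathbf f^n,\mathbf v_T)_T,$$ $$(c_0\delta_tp_h^n,q_h)_T-(\delta_t\mathbf u_T^n-\kappa(\nabla_hp_h^n-R_{\kappa,h}^kp_h^n),\nabla_hq_h)_T-\sum_{F\in\mathcal F_T}(\phi_{TF}^k(\delta_t\mathbf u_F^n,p_h^n),q_h|_T)_F=(g^n,q_h)_T,$$ where, for all $T\in\mathcal T_h$ and all $F\in\mathcal F_T$, the numerical traction $\mathbf\Phi_{TF}^k:\underline{\mathbf U}_T^k\times\mathbb P_d^k(T)\to\mathbb P_{d-1}^k(F)^d$ and the mass flux $\phi_{TF}^k:\mathbb P_{d-1}^k(F)^d\times\mathbb P_d^k(\mathcal T_h)\to\mathbb P_{d-1}^k(F)$ are such that $$\mathbf\Phi_{TF}^k(\underline{\mathbf v}_T,q)=(\mathbf S_T^k\underline{\mathbf v}_T-q\mathbf I)\mathbf n_{TF}+2\mu\,\mathbf L_T^{k,*}\big(\mathfrak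 h_{\partial T}^{-1}\mathbf L_T^k(\mathbf v_{\partial T}-\mathbf v_T)\big)\quad\text{(on }F),$$ $$\phi_{TF}^k(\mathbf v_F,q_h)=\begin{cases}\big(-\mathbf v_F+\{\kappa\nabla_hq_h\}_F\big)\cdot\mathbf n_{TF}-\dfrac{\varsigma\lambda_{\kappa,F}}{h_F}[q_h]_F\,(\mathbf n_{TF}\cdot\mathbf n_F)&\text{if }F\in\mathcal F_h^{\rm i},\\0&\text{otherwise,}\end{cases}$$ with $\mathfrak h_{\partial T}$ the piecewise constant function on $\partial T$ such that $\mathfrak h_{\partial T}|_F=h_F$ for all $F\in\mathcal F_T$; and it holds, for all $F\in\mathcal F_h^{\rm i}$ such that $F\in\mathcal F_{T_1}\cap\mathcal F_{T_2}$, $$\mathbf\Phi_{T_1F}^k(\underline{\mathbf u}_{T_1}^n,p_h^n|_{T_1})+\mathbf\Phi_{T_2F}^k(\underline{\mathbf u}_{T_2}^n,p_h^n|_{T_2})=\mathbf 0,\qquad\phi_{T_1F}^k(\delta_t\mathbf u_F^n,p_h^n)+\phi_{T_2F}^k(\delta_t\mathbf u_F^n,p_h^n)=0.$$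
   Context: Let $d\in\{1,2,3\}$ and let $\Omega\subset\mathbb R^d$ be a bounded connected polyhedral domain. For $X\subset\overline\Omega$, $(\cdot,\cdot)_X$ denotes the $L^2(X)$ inner product (scalar-, vector- or tensor-valued), the subscript being omitted if $X=\Omega$. $\mathbf I$ is the identity matrix of $\mathbb R^{d\times d}$. Data. $t_{\rm F}>0$; $c_0\ge0$, $\lambda\ge0$, $\mu>0$ are real numbers; $\kappa$ is a scalar field, piecewise constant on a partition $P_\Omega$ of $\Omega$ into bounded open polyhedra, with $0<\underline\kappa\le\kappa\le\overline\kappa$ a.e.; $\mathbf f\in C^0([0,t_{\rm F}];L^2(\Omega)^d)$, $g\in C^0([0,t_{\rm F}];L^2(\Omega))$, $\int_\Omega g(\cdot,t)=0$ for all $t$ if $c_0=0$, and $p^0\in L^2(\Omega)$ is an initial pressure. Meshes. $\mathcal T_h$ is a finite collection of nonempty disjoint open polyhedral elements $T$ with $\overline\Omega=\bigcup_T\overline T$, belonging to a sequence for which there is $\varrho>0$ independent of $h$ such that each $\mathcal T_h$ admits a matching simplicial submesh $\mathfrak T_h$ with $\varrho h_S\le r_S$ for every $S\in\mathfrak T_h$ (diameter $h_S$, inradius $r_S$) and $\varrho h_T\le h_S$ whenever $S\subset T\in\mathcal T_h$ ($h_T$ the diameter of $T$). $\mathcal T_h$ is compatible with $P_\Omega$, so $\kappa$ is constant, equal to $\kappa_T$, in each $T$. A face $F$ is a hyperplanar closed connected subset of $\overline\Omega$ of positive $(d-1)$-dimensional Hausdorff measure such that either $F\subset\partial T_1\cap\partial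 T_2$ for distinct $T_1,T_2\in\mathcal T_h$ (interface) or $F\subset\partial T\cap\partial\Omega$ for some $T$ (boundary face). $\mathcal F_h^{\rm i},\mathcal F_h^{\rm b}$ are the sets of interfaces and boundary faces, $\mathcal F_h$ their union, $h_F$ the diameter of $F$, $\mathcal F_T=\{F\in\mathcal F_h:F\subset\partial T\}$, $N_\partial$ a uniform bound on the cardinality of $\mathcal F_T$, $\mathbf n_{TF}$ the unit normal to $F$ pointing out of $T$. For each interface an ordering $T_1,T_2$ is fixed and $\mathbf n_F=\mathbf n_{T_1F}$. Displacement space. Fix $k\ge1$. $\mathbb P_d^l(T)$, $\mathbb P_{d-1}^l(F)$ are polynomials of total degree $\le l$ on $T$, $F$; $\mathbb P_d^l(\mathcal T_h)$ the piecewise polynomials of degree $\le l$; $\pi_T^l,\pi_F^l,\pi_h^l$ the $L^2$-orthogonal projectors on $\mathbb P_d^l(T),\mathbb P_{d-1}^l(F),\mathbb P_d^l(\mathcal T_h)$ (componentwise on vectors). $\underline{\mathbf U}_h^k=\prod_{T}\mathbb P_d^k(T)^d\times\prod_{F\in\mathcal F_h}\mathbb P_{d-1}^k(F)^d$, with elements $\underline{\mathbf v}_h=((\mathbf v_T)_T,(\mathbf v_F)_F)$; $\mathbf v_h$ is the broken polynomial with $\mathbf v_h|_T=\mathbf v_T$; $\underline{\mathbf U}_T^k$ and $\underline{\mathbf v}_T=(\mathbf v_T,(\mathbf v_F)_{F\in\mathcal F_T})$ are restrictions to $T$; $\underline{\mathbf U}_{h,0}^k=\{\underline{\mathbf v}_h\in\underline{\mathbf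 U}_h^k:\mathbf v_F=\mathbf 0\ \forall F\in\mathcal F_h^{\rm b}\}$. Elasticity form. With $\nabla_{\rm s},\nabla_{\rm ss}$ the symmetric and skew-symmetric parts of the gradient (convention $(\nabla\mathbf v)_{ij}=\partial_iv_j$), $\mathbf r_T^{k+1}:\underline{\mathbf U}_T^k\to\mathbb P_d^{k+1}(T)^d$ is defined by $(\nabla_{\rm s}\mathbf r_T^{k+1}\underline{\mathbf v}_T,\nabla_{\rm s}\mathbf w)_T=(\nabla_{\rm s}\mathbf v_T,\nabla_{\rm s}\mathbf w)_T+\sum_{F\in\mathcal F_T}(\mathbf v_F-\mathbf v_T,\nabla_{\rm s}\mathbf w\,\mathbf n_{TF})_F$ for all $\mathbf w\in\mathbb P_d^{k+1}(T)^d$, together with $\int_T\mathbf r_T^{k+1}\underline{\mathbf v}_T=\int_T\mathbf v_T$ and $\int_T\nabla_{\rm ss}\mathbf r_T^{k+1}\underline{\mathbf v}_T=\sum_{F\in\mathcal F_T}\int_F\frac12(\mathbf n_{TF}\otimes\mathbf v_F-\mathbf v_F\otimes\mathbf n_{TF})$. $D_T^k:\underline{\mathbf U}_T^k\to\mathbb P_d^k(T)$ is defined by $(D_T^k\underline{\mathbf v}_T,q)_T=(\nabla\cdot\mathbf v_T,q)_T+\sum_{F\in\mathcal F_T}(\mathbf v_F-\mathbf v_T,q\mathbf n_{TF})_F$ for all $q\in\mathbb P_d^k(T)$. With $\mathbf\Delta_{TF}^k\underline{\mathbf w}_T=(\pi_F^k\mathbf r_T^{k+1}\underline{\mathbf w}_T-\mathbf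 w_F)-(\pi_T^k\mathbf r_T^{k+1}\underline{\mathbf w}_T-\mathbf w_T)$ and $s_T(\underline{\mathbf w}_T,\underline{\mathbf v}_T)=\sum_{F\in\mathcal F_T}h_F^{-1}(\mathbf\Delta_{TF}^k\underline{\mathbf w}_T,\mathbf\Delta_{TF}^k\underline{\mathbf v}_T)_F$, set $$a_h(\underline{\mathbf w}_h,\underline{\mathbf v}_h)=\sum_T\Big[2\mu\{(\nabla_{\rm s}\mathbf r_T^{k+1}\underline{\mathbf w}_T,\nabla_{\rm s}\mathbf r_T^{k+1}\underline{\mathbf v}_T)_T+s_T(\underline{\mathbf w}_T,\underline{\mathbf v}_T)\}+\lambda(D_T^k\underline{\mathbf w}_T,D_T^k\underline{\mathbf v}_T)_T\Big].$$ Pressure space and Darcy form. $P_h^k=\mathbb P_d^k(\mathcal T_h)$ if $c_0>0$ and $P_h^k=\{q_h\in\mathbb P_d^k(\mathcal T_h):(q_h,1)=0\}$ if $c_0=0$. On an interface $F\subset\partial T_1\cap\partial T_2$: $[\varphi]_F=\varphi_{T_1}-\varphi_{T_2}$, $\{\varphi\}_F=\omega_{T_1}\varphi_{T_1}+\omega_{T_2}\varphi_{T_2}$ with $\omega_{T_1}=1-\omega_{T_2}=\kappa_{T_2}/(\kappa_{T_1}+\kappa_{T_2})$, and $\lambda_{\kappa,F}=2\kappa_{T_1}\kappa_{T_2}/(\kappa_{T_1}+\kappa_{T_2})$. With $\nabla_h$ the broken gradient, $$c_h(r_h,q_h)=(\kappa\nabla_hr_h,\nabla_hq_h)-\sum_{F\in\mathcal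 F_h^{\rm i}}\big((\{\kappa\nabla_hr_h\}_F\cdot\mathbf n_F,[q_h]_F)_F+([r_h]_F,\{\kappa\nabla_hq_h\}_F\cdot\mathbf n_F)_F\big)+\sum_{F\in\mathcal F_h^{\rm i}}\frac{\varsigma\lambda_{\kappa,F}}{h_F}([r_h]_F,[q_h]_F)_F,$$ with penalty parameter $\varsigma>C_{\rm tr}^2N_\partial$, $C_{\rm tr}$ being the constant of the discrete trace inequality $h_T^{1/2}\|v\|_{L^2(F)}\le C_{\rm tr}\|v\|_{L^2(T)}$ for polynomials $v$ of degree $\le k$ on $T$ and $F\in\mathcal F_T$. Coupling. $b_h(\underline{\mathbf v}_h,q_h)=-\sum_T(D_T^k\underline{\mathbf v}_T,q_h|_T)_T$. Discrete Biot problem. $\tau=t_{\rm F}/N$ with $N$ a positive integer, $t^n=n\tau$, $\varphi^n=\varphi(t^n)$, $\delta_t\varphi^n=(\varphi^n-\varphi^{n-1})/\tau$. For all $1\le n\le N$, $(\underline{\mathbf u}_h^n,p_h^n)\in\underline{\mathbf U}_{h,0}^k\times P_h^k$ is such that, for all $(\underline{\mathbf v}_h,q_h)\in\underline{\mathbf U}_{h,0}^k\times\mathbb P_d^k(\mathcal T_h)$, $$a_h(\underline{\mathbf u}_h^n,\underline{\mathbf v}_h)+b_h(\underline{\mathbf v}_h,p_h^n)=(\mathbf f^n,\mathbf v_h),\qquad(c_0\delta_tp_h^n,q_h)-b_h(\delta_t\underline{\mathbf u}_h^n,q_h)+c_h(p_h^n,q_h)=(g^n,q_h).$$ The initial displacement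 $\underline{\mathbf u}_h^0\in\underline{\mathbf U}_{h,0}^k$ is the unique solution of $a_h(\underline{\mathbf u}_h^0,\underline{\mathbf v}_h)=(\mathbf f^0,\mathbf v_h)-b_h(\underline{\mathbf v}_h,\pi_h^kp^0)$ for all $\underline{\mathbf v}_h\in\underline{\mathbf U}_{h,0}^k$ and, if $c_0>0$, $p_h^0=\pi_h^kp^0$. Operators for the flux formulation. $\mathbf U_{\partial T}$ is the space of functions on $\partial T$ whose restriction to each $F\in\mathcal F_T$ is in $\mathbb P_{d-1}^k(F)^d$. $\mathbf L_T^k:\mathbf U_{\partial T}\to\mathbf U_{\partial T}$ is defined by $$(\mathbf L_T^k\mathbf\varphi)|_F=\pi_F^k\big(\mathbf\varphi|_F-\mathbf r_T^{k+1}(\mathbf 0,(\mathbf\varphi|_{F'})_{F'\in\mathcal F_T})+\pi_T^k\mathbf r_T^{k+1}(\mathbf 0,(\mathbf\varphi|_{F'})_{F'\in\mathcal F_T})\big)\quad\forall F\in\mathcal F_T,$$ and $\mathbf L_T^{k,*}$ is its adjoint for $(\cdot,\cdot)_{\partial T}$. For $\underline{\mathbf v}_T\in\underline{\mathbf U}_T^k$, $\mathbf v_{\partial T}\in\mathbf U_{\partial T}$ is given by $\mathbf v_{\partial T}|_F=\mathbf v_F$ for all $F\in\mathcal F_T$, and $\mathbf S_T^k\underline{\mathbf v}_T=2\mu\nabla_{\rm s}\mathbf r_T^{k+1}\underline{\mathbf v}_T+\lambda\mathbf I\,D_T^k\underline{\mathbf v}_T\in\mathbb P_d^k(T)^{d\times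 d}$. The lifting $R_{\kappa,h}^k:P_h^k\to\mathbb P_d^{k-1}(\mathcal T_h)^d$ is defined by $(R_{\kappa,h}^kq_h,\mathbf\xi_h)=\sum_{F\in\mathcal F_h^{\rm i}}([q_h]_F,\{\kappa\mathbf\xi_h\}_F\cdot\mathbf n_F)_F$ for all $\mathbf\xi_h\in\mathbb P_d^{k-1}(\mathcal T_h)^d$.
   Formalization: The momentum balance on T is required only for test functions with v_F = 0 on all faces of T (with arbitrary v_F it would force zero tractions), and the Darcy term is κ∇_h p − R p instead of κ(∇_h p − R p), since R as defined already contains κ. *)

theory Defs
  imports "HOL-Analysis.Analysis"
begin

section \<open>Differential operators, polynomials, integrals\<close>

definition grad :: "(real^'d \<Rightarrow> real) \<Rightarrow> real^'d \<Rightarrow> real^'d" where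
  "grad q x = (\<chi> i. frechet_derivative q (at x) (axis i 1))"

definition vgrad :: "(real^'d \<Rightarrow> real^'d) \<Rightarrow> real^'d \<Rightarrow> real^'d^'d" where
  "vgrad v x = (\<chi> i j. frechet_derivative v (at x) (axis i 1) $ j)"

definition sgrad :: "(real^'d \<Rightarrow> real^'d) \<Rightarrow> real^'d \<Rightarrow> real^'d^'d" where
  "sgrad v x = (1/2) *\<^sub>R (vgrad v x + transpose (vgrad v x))"

definition ssgrad :: "(real^'d \<Rightarrow> real^'d) \<Rightarrow> real^'d \<Rightarrow> real^'d^'d" where
  "ssgrad v x = (1/2) *\<^sub>R (vgrad v x - transpose (vgrad v x))"

definition divg :: "(real^'d \<Rightarrow> real^'d) \<Rightarrow> real^'d \<Rightarrow> real" where
  "divg v x = trace (vgrad v x)"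

definition tensor :: "real^'d \<Rightarrow> real^'d \<Rightarrow> real^'d^'d" where
  "tensor a b = (\<chi> i j. a $ i * b $ j)"

text \<open>A polynomial on a nonempty open element is identified with the polynomial on the whole
  space; this also supplies its traces on the faces.\<close>

definition polys :: "nat \<Rightarrow> (real^'d \<Rightarrow> real) set" where
  "polys l = {(\<lambda>x. \<Sum>a\<in>{a :: 'd \<Rightarrow> nat. (\<Sum>i\<in>UNIV. a i) \<le> l}. c a * (\<Prod>i\<in>UNIV. (x $ i) ^ a i)) | c. True}"

definition vpolys :: "nat \<Rightarrow> (real^'d \<Rightarrow> real^'d) set" where
  "vpolys l = {v. \<forall>i. (\<lambda>x. v x $ i) \<in> polys l}"

text \<open>Polynomials in \<open>d - 1\<close> variables on a face are the restrictions of polynomials in \<open>d\<close>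
  variables; they are extended by zero so that they form a vector space of functions.\<close>

definition face_polys :: "nat \<Rightarrow> (real^'d) set \<Rightarrow> (real^'d \<Rightarrow> real) set" where
  "face_polys l F = {(\<lambda>x. if x \<in> F then p x else 0) | p. p \<in> polys l}"

definition face_vpolys :: "nat \<Rightarrow> (real^'d) set \<Rightarrow> (real^'d \<Rightarrow> real^'d) set" where
  "face_vpolys l F = {v. \<forall>i. (\<lambda>x. v x $ i) \<in> face_polys l F}"

text \<open>Lebesgue measure of an affine subspace \<open>A\<close>, of the dimension of \<open>A\<close>, transported from
  orthonormal coordinates as in the definition of \<^const>\<open>lborel\<close>.  On a hyperplane it is the
  Hausdorff measure of codimension one (normalised to agree with volume); for a single point it is the unit point mass.\<close>

definition flat_lborel :: "'a::euclidean_space set \<Rightarrow> 'a measure" where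
  "flat_lborel A =
    (let B = (SOME B. pairwise orthogonal B \<and> (\<forall>b\<in>B. norm b = 1)
                 \<and> span B = span {x - y | x y. x \<in> A \<and> y \<in> A});
         a = (SOME a. a \<in> A)
     in distr (\<Pi>\<^sub>M b\<in>B. lborel) borel (\<lambda>f. a + (\<Sum>b\<in>B. f b *\<^sub>R b)))"

definition face_measure :: "'a::euclidean_space set \<Rightarrow> 'a measure" where
  "face_measure F = flat_lborel (affine hull F)"

definition vol_inner :: "'a::euclidean_space set \<Rightarrow> ('a \<Rightarrow> 'b::euclidean_space) \<Rightarrow> ('a \<Rightarrow> 'b) \<Rightarrow> real" where
  "vol_inner X f g = (LINT x:X|lborel. f x \<bullet> g x)"

definition face_inner :: "'a::euclidean_space set \<Rightarrow> ('a \<Rightarrow> 'b::euclidean_space) \<Rightarrow> ('a \<Rightarrow> 'b) \<Rightarrow> real" where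
  "face_inner F f g = (LINT x:F|face_measure F. f x \<bullet> g x)"

definition L2_fun :: "'a::euclidean_space set \<Rightarrow> ('a \<Rightarrow> 'b::euclidean_space) \<Rightarrow> bool" where
  "L2_fun X f \<longleftrightarrow> set_borel_measurable lborel X f \<and> set_integrable lborel X (\<lambda>x. (norm (f x))\<^sup>2)"

definition C0_L2 :: "real \<Rightarrow> 'a::euclidean_space set \<Rightarrow> (real \<Rightarrow> 'a \<Rightarrow> 'b::euclidean_space) \<Rightarrow> bool" where
  "C0_L2 tF X f \<longleftrightarrow> (\<forall>t\<in>{0..tF}. L2_fun X (f t) \<and>
     ((\<lambda>s. LINT x:X|lborel. (norm (f s x - f t x))\<^sup>2) \<longlongrightarrow> 0) (at t within {0..tF}))"

section \<open>Polyhedral meshes\<close>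

text \<open>The interior of a finite union of polytopes; it is regular open, which excludes slits.\<close>

definition open_polyhedron :: "'a::euclidean_space set \<Rightarrow> bool" where
  "open_polyhedron P \<longleftrightarrow> (\<exists>\<Q>. finite \<Q> \<and> (\<forall>Q\<in>\<Q>. polytope Q) \<and> P = interior (\<Union>\<Q>))"

definition polyhedral_partition :: "'a::euclidean_space set \<Rightarrow> 'a set set \<Rightarrow> bool" where
  "polyhedral_partition \<Omega> \<P> \<longleftrightarrow> finite \<P> \<and> (\<forall>P\<in>\<P>. P \<noteq> {} \<and> open_polyhedron P)
     \<and> pairwise disjnt \<P> \<and> closure \<Omega> = (\<Union>P\<in>\<P>. closure P)"

text \<open>\<open>elem1 M F\<close> and \<open>elem2 M F\<close> are the ordered neighbours of the interface \<open>F\<close>.  The length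
  \<open>face_len M F\<close> is the diameter of \<open>F\<close>, except in dimension one, where faces are points
  and any positive length is allowed.\<close>

record 'a mesh =
  elems :: "'a set set"
  faces :: "'a set set"
  elem1 :: "'a set \<Rightarrow> 'a set"
  elem2 :: "'a set \<Rightarrow> 'a set"
  face_len :: "'a set \<Rightarrow> real"

definition elem_faces :: "(real^'d) mesh \<Rightarrow> (real^'d) set \<Rightarrow> (real^'d) set set" where
  "elem_faces M T = {F \<in> faces M. F \<subseteq> frontier T}"

definition interfaces :: "(real^'d) mesh \<Rightarrow> (real^'d) set set" where
  "interfaces M = {F \<in> faces M. \<exists>T1\<in>elems M. \<exists>T2\<in>elems M. T1 \<noteq> T2 \<and> F \<subseteq> frontier T1 \<inter> frontier T2}"

definition boundary_faces :: "(real^'d) set \<Rightarrow> (real^'d) mesh \<Rightarrow> (real^'d) set set" where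
  "boundary_faces \<Omega> M = {F \<in> faces M. \<exists>T\<in>elems M. F \<subseteq> frontier T \<inter> frontier \<Omega>}"

text \<open>The side condition is imposed almost everywhere only: the complement side of \<open>F\<close> may
  still touch \<open>T\<close> along a null set, as happens for nonconvex \<open>T\<close>.\<close>

definition outward_unit_normal :: "(real^'d) set \<Rightarrow> (real^'d) set \<Rightarrow> real^'d \<Rightarrow> bool" where
  "outward_unit_normal T F n \<longleftrightarrow> norm n = 1 \<and> (\<forall>x\<in>F. \<forall>y\<in>F. n \<bullet> (x - y) = 0) \<and>
     (AE x in face_measure F. x \<in> F \<longrightarrow>
        (\<exists>e>0. \<forall>s\<in>{0<..<e}. x - s *\<^sub>R n \<in> T \<and> x + s *\<^sub>R n \<notin> T))"

definition normal :: "(real^'d) set \<Rightarrow> (real^'d) set \<Rightarrow> real^'d" where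
  "normal T F = (THE n. outward_unit_normal T F n)"

definition face_normal :: "(real^'d) mesh \<Rightarrow> (real^'d) set \<Rightarrow> real^'d" where
  "face_normal M F = normal (elem1 M F) F"

definition hyperplanar_face :: "(real^'d) set \<Rightarrow> bool" where
  "hyperplanar_face F \<longleftrightarrow> closed F \<and> connected F
     \<and> aff_dim F = int CARD('d) - 1 \<and> emeasure (face_measure F) F > 0"

definition polyhedral_mesh :: "(real^'d) set \<Rightarrow> (real^'d) mesh \<Rightarrow> bool" where
  "polyhedral_mesh \<Omega> M \<longleftrightarrow>
     polyhedral_partition \<Omega> (elems M) \<and>
     finite (faces M) \<and>
     (\<forall>F\<in>faces M. hyperplanar_face F \<and> F \<subseteq> closure \<Omega>) \<and>
     faces M = interfaces M \<union> boundary_faces \<Omega> M \<and>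
     interfaces M \<inter> boundary_faces \<Omega> M = {} \<and>
     (\<forall>T\<in>elems M. frontier T = \<Union>(elem_faces M T)) \<and>
     (\<forall>F\<in>faces M. \<forall>F'\<in>faces M. F \<noteq> F' \<longrightarrow> emeasure (face_measure F) (F \<inter> F') = 0) \<and>
     (\<forall>T\<in>elems M. \<forall>F\<in>elem_faces M T. \<exists>n. outward_unit_normal T F n) \<and>
     (\<forall>F\<in>interfaces M. elem1 M F \<in> elems M \<and> elem2 M F \<in> elems M \<and> elem1 M F \<noteq> elem2 M F
        \<and> F \<subseteq> frontier (elem1 M F) \<inter> frontier (elem2 M F)) \<and>
     (\<forall>F\<in>faces M. face_len M F > 0 \<and> (CARD('d) \<ge> 2 \<longrightarrow> face_len M F = diameter F))"

definition inradius :: "'a::euclidean_space set \<Rightarrow> real" where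
  "inradius S = Sup {r. \<exists>x. ball x r \<subseteq> S}"

definition shape_regular :: "(real^'d) set \<Rightarrow> (real^'d) mesh \<Rightarrow> real \<Rightarrow> bool" where
  "shape_regular \<Omega> M \<rho> \<longleftrightarrow> (\<exists>\<S>. triangulation \<S> \<and> (\<forall>S\<in>\<S>. int CARD('d) simplex S)
     \<and> \<Union>\<S> = closure \<Omega> \<and> (\<forall>S\<in>\<S>. \<exists>T\<in>elems M. S \<subseteq> closure T)
     \<and> (\<forall>S\<in>\<S>. \<rho> * diameter S \<le> inradius S)
     \<and> (\<forall>S\<in>\<S>. \<forall>T\<in>elems M. S \<subseteq> closure T \<longrightarrow> \<rho> * diameter T \<le> diameter S))"

definition trace_constant :: "(real^'d) mesh \<Rightarrow> nat \<Rightarrow> real \<Rightarrow> bool" where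
  "trace_constant M k C \<longleftrightarrow> (\<forall>T\<in>elems M. \<forall>F\<in>elem_faces M T. \<forall>v\<in>polys k.
     sqrt (diameter T) * sqrt (face_inner F v v) \<le> C * sqrt (vol_inner T v v))"

section \<open>Discrete spaces and projectors\<close>

text \<open>A broken function is a family indexed by the elements, a hybrid vector a pair of families
  indexed by the elements and by the faces; families vanish at all other indices.\<close>

type_synonym ('a, 'b) brk = "'a set \<Rightarrow> 'a \<Rightarrow> 'b"
type_synonym 'a hyb = "('a, 'a) brk \<times> ('a, 'a) brk"

definition glue :: "'a mesh \<Rightarrow> ('a, 'b::real_vector) brk \<Rightarrow> 'a \<Rightarrow> 'b" where
  "glue M v x = (\<Sum>T\<in>elems M. if x \<in> T then v T x else 0)"

definition brk_polys :: "nat \<Rightarrow> (real^'d) mesh \<Rightarrow> (real^'d, real) brk set" where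
  "brk_polys l M = {q. (\<forall>T\<in>elems M. q T \<in> polys l) \<and> (\<forall>T. T \<notin> elems M \<longrightarrow> q T = (\<lambda>x. 0))}"

definition brk_vpolys :: "nat \<Rightarrow> (real^'d) mesh \<Rightarrow> (real^'d, real^'d) brk set" where
  "brk_vpolys l M = {v. (\<forall>T\<in>elems M. v T \<in> vpolys l) \<and> (\<forall>T. T \<notin> elems M \<longrightarrow> v T = (\<lambda>x. 0))}"

definition hyb_space :: "nat \<Rightarrow> (real^'d) mesh \<Rightarrow> (real^'d) hyb set" where
  "hyb_space k M = {v. fst v \<in> brk_vpolys k M \<and> (\<forall>F\<in>faces M. snd v F \<in> face_vpolys k F)
     \<and> (\<forall>F. F \<notin> faces M \<longrightarrow> snd v F = (\<lambda>x. 0))}"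

definition hyb_space0 :: "(real^'d) set \<Rightarrow> nat \<Rightarrow> (real^'d) mesh \<Rightarrow> (real^'d) hyb set" where
  "hyb_space0 \<Omega> k M = {v \<in> hyb_space k M. \<forall>F\<in>boundary_faces \<Omega> M. snd v F = (\<lambda>x. 0)}"

definition press_space :: "(real^'d) set \<Rightarrow> nat \<Rightarrow> (real^'d) mesh \<Rightarrow> real \<Rightarrow> (real^'d, real) brk set" where
  "press_space \<Omega> k M c0 =
     (if c0 > 0 then brk_polys k M
      else {q \<in> brk_polys k M. vol_inner \<Omega> (glue M q) (\<lambda>x. 1) = 0})"

definition proj :: "nat \<Rightarrow> (real^'d) set \<Rightarrow> (real^'d \<Rightarrow> real) \<Rightarrow> real^'d \<Rightarrow> real" where
  "proj l T f = (THE p. p \<in> polys l \<and> (\<forall>q\<in>polys l. vol_inner T p q = vol_inner T f q))"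

definition vproj :: "nat \<Rightarrow> (real^'d) set \<Rightarrow> (real^'d \<Rightarrow> real^'d) \<Rightarrow> real^'d \<Rightarrow> real^'d" where
  "vproj l T f x = (\<chi> i. proj l T (\<lambda>y. f y $ i) x)"

definition brk_proj :: "nat \<Rightarrow> (real^'d) mesh \<Rightarrow> (real^'d \<Rightarrow> real) \<Rightarrow> (real^'d, real) brk" where
  "brk_proj l M f T = (if T \<in> elems M then proj l T f else (\<lambda>x. 0))"

definition face_proj :: "nat \<Rightarrow> (real^'d) set \<Rightarrow> (real^'d \<Rightarrow> real) \<Rightarrow> real^'d \<Rightarrow> real" where
  "face_proj l F f = (THE p. p \<in> face_polys l F \<and> (\<forall>q\<in>face_polys l F. face_inner F p q = face_inner F f q))"

definition face_vproj :: "nat \<Rightarrow> (real^'d) set \<Rightarrow> (real^'d \<Rightarrow> real^'d) \<Rightarrow> real^'d \<Rightarrow> real^'d" where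
  "face_vproj l F f x = (\<chi> i. face_proj l F (\<lambda>y. f y $ i) x)"

section \<open>Elasticity and coupling forms\<close>

text \<open>Local operators on an element \<open>T\<close> take the element component \<open>w\<close> and the family \<open>\<phi>\<close> of
  face components, of which only those on the faces of \<open>T\<close> are used.\<close>

definition recon :: "nat \<Rightarrow> (real^'d) mesh \<Rightarrow> (real^'d) set \<Rightarrow>
    (real^'d \<Rightarrow> real^'d) \<Rightarrow> (real^'d, real^'d) brk \<Rightarrow> real^'d \<Rightarrow> real^'d" where
  "recon k M T w \<phi> = (THE r. r \<in> vpolys (k + 1)
     \<and> (\<forall>z\<in>vpolys (k + 1). vol_inner T (sgrad r) (sgrad z) = vol_inner T (sgrad w) (sgrad z)
          + (\<Sum>F\<in>elem_faces M T. face_inner F (\<lambda>x. \<phi> F x - w x) (\<lambda>x. sgrad z x *v normal T F)))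
     \<and> (LINT x:T|lborel. r x) = (LINT x:T|lborel. w x)
     \<and> (LINT x:T|lborel. ssgrad r x) = (\<Sum>F\<in>elem_faces M T. LINT x:F|face_measure F.
          (1/2) *\<^sub>R (tensor (normal T F) (\<phi> F x) - tensor (\<phi> F x) (normal T F))))"

definition div_recon :: "nat \<Rightarrow> (real^'d) mesh \<Rightarrow> (real^'d) set \<Rightarrow>
    (real^'d \<Rightarrow> real^'d) \<Rightarrow> (real^'d, real^'d) brk \<Rightarrow> real^'d \<Rightarrow> real" where
  "div_recon k M T w \<phi> = (THE D. D \<in> polys k
     \<and> (\<forall>q\<in>polys k. vol_inner T D q = vol_inner T (divg w) q
          + (\<Sum>F\<in>elem_faces M T. face_inner F (\<lambda>x. \<phi> F x - w x) (\<lambda>x. q x *\<^sub>R normal T F))))"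

definition face_resid :: "nat \<Rightarrow> (real^'d) mesh \<Rightarrow> (real^'d) set \<Rightarrow> (real^'d) set \<Rightarrow>
    (real^'d \<Rightarrow> real^'d) \<Rightarrow> (real^'d, real^'d) brk \<Rightarrow> real^'d \<Rightarrow> real^'d" where
  "face_resid k M T F w \<phi> x = (face_vproj k F (recon k M T w \<phi>) x - \<phi> F x)
     - (vproj k T (recon k M T w \<phi>) x - w x)"

definition stab :: "nat \<Rightarrow> (real^'d) mesh \<Rightarrow> (real^'d) set \<Rightarrow> (real^'d) hyb \<Rightarrow> (real^'d) hyb \<Rightarrow> real" where
  "stab k M T w v = (\<Sum>F\<in>elem_faces M T. inverse (face_len M F) *
     face_inner F (face_resid k M T F (fst w T) (snd w)) (face_resid k M T F (fst v T) (snd v)))"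

definition a_form :: "nat \<Rightarrow> (real^'d) mesh \<Rightarrow> real \<Rightarrow> real \<Rightarrow> (real^'d) hyb \<Rightarrow> (real^'d) hyb \<Rightarrow> real" where
  "a_form k M \<mu> lam w v = (\<Sum>T\<in>elems M.
     2 * \<mu> * (vol_inner T (sgrad (recon k M T (fst w T) (snd w))) (sgrad (recon k M T (fst v T) (snd v)))
              + stab k M T w v)
     + lam * vol_inner T (div_recon k M T (fst w T) (snd w)) (div_recon k M T (fst v T) (snd v)))"

definition b_form :: "nat \<Rightarrow> (real^'d) mesh \<Rightarrow> (real^'d) hyb \<Rightarrow> (real^'d, real) brk \<Rightarrow> real" where
  "b_form k M v q = - (\<Sum>T\<in>elems M. vol_inner T (div_recon k M T (fst v T) (snd v)) (q T))"

section \<open>Darcy form\<close>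

definition elem_val :: "(real^'d \<Rightarrow> real) \<Rightarrow> (real^'d) set \<Rightarrow> real" where
  "elem_val \<kappa> T = (THE c. \<forall>x\<in>T. \<kappa> x = c)"

definition jump :: "(real^'d) mesh \<Rightarrow> (real^'d) set \<Rightarrow> (real^'d, real) brk \<Rightarrow> real^'d \<Rightarrow> real" where
  "jump M F q x = q (elem1 M F) x - q (elem2 M F) x"

definition avg :: "(real^'d) mesh \<Rightarrow> (real^'d \<Rightarrow> real) \<Rightarrow> (real^'d) set \<Rightarrow>
    (real^'d, real^'d) brk \<Rightarrow> real^'d \<Rightarrow> real^'d" where
  "avg M \<kappa> F v x =
     (let k1 = elem_val \<kappa> (elem1 M F); k2 = elem_val \<kappa> (elem2 M F); w1 = k2 / (k1 + k2)
      in w1 *\<^sub>R v (elem1 M F) x + (1 - w1) *\<^sub>R v (elem2 M F) x)"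

definition harm_mean :: "(real^'d) mesh \<Rightarrow> (real^'d \<Rightarrow> real) \<Rightarrow> (real^'d) set \<Rightarrow> real" where
  "harm_mean M \<kappa> F =
     (let k1 = elem_val \<kappa> (elem1 M F); k2 = elem_val \<kappa> (elem2 M F) in 2 * k1 * k2 / (k1 + k2))"

definition brk_grad :: "(real^'d, real) brk \<Rightarrow> (real^'d, real^'d) brk" where
  "brk_grad q T = grad (q T)"

definition kscale :: "(real^'d \<Rightarrow> real) \<Rightarrow> (real^'d, real^'d) brk \<Rightarrow> (real^'d, real^'d) brk" where
  "kscale \<kappa> v T x = elem_val \<kappa> T *\<^sub>R v T x"

definition c_form :: "(real^'d) set \<Rightarrow> (real^'d) mesh \<Rightarrow> (real^'d \<Rightarrow> real) \<Rightarrow> real \<Rightarrow>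
    (real^'d, real) brk \<Rightarrow> (real^'d, real) brk \<Rightarrow> real" where
  "c_form \<Omega> M \<kappa> \<sigma> r q =
     vol_inner \<Omega> (\<lambda>x. \<kappa> x *\<^sub>R glue M (brk_grad r) x) (glue M (brk_grad q))
     - (\<Sum>F\<in>interfaces M.
          face_inner F (\<lambda>x. avg M \<kappa> F (kscale \<kappa> (brk_grad r)) x \<bullet> face_normal M F) (jump M F q)
        + face_inner F (jump M F r) (\<lambda>x. avg M \<kappa> F (kscale \<kappa> (brk_grad q)) x \<bullet> face_normal M F))
     + (\<Sum>F\<in>interfaces M. \<sigma> * harm_mean M \<kappa> F / face_len M F * face_inner F (jump M F r) (jump M F q))"

definition lifting :: "(real^'d) set \<Rightarrow> nat \<Rightarrow> (real^'d) mesh \<Rightarrow> (real^'d \<Rightarrow> real) \<Rightarrow>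
    (real^'d, real) brk \<Rightarrow> (real^'d, real^'d) brk" where
  "lifting \<Omega> k M \<kappa> q = (THE R. R \<in> brk_vpolys (k - 1) M \<and> (\<forall>\<xi>\<in>brk_vpolys (k - 1) M.
     vol_inner \<Omega> (glue M R) (glue M \<xi>)
     = (\<Sum>F\<in>interfaces M. face_inner F (jump M F q) (\<lambda>x. avg M \<kappa> F (kscale \<kappa> \<xi>) x \<bullet> face_normal M F))))"

section \<open>Time differences\<close>

definition dt_brk :: "real \<Rightarrow> (nat \<Rightarrow> ('a, 'b::real_vector) brk) \<Rightarrow> nat \<Rightarrow> ('a, 'b) brk" where
  "dt_brk \<tau> w n X x = (w n X x - w (n - 1) X x) /\<^sub>R \<tau>"

definition dt_hyb :: "real \<Rightarrow> (nat \<Rightarrow> ('a::real_vector) hyb) \<Rightarrow> nat \<Rightarrow> 'a hyb" where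
  "dt_hyb \<tau> u n = (dt_brk \<tau> (\<lambda>m. fst (u m)) n, dt_brk \<tau> (\<lambda>m. snd (u m)) n)"

section \<open>Numerical traction and mass flux\<close>

text \<open>Functions on the boundary of an element are families indexed by its faces, so that
  they may be multivalued on the null set where faces meet.\<close>

definition bdry_space :: "nat \<Rightarrow> (real^'d) mesh \<Rightarrow> (real^'d) set \<Rightarrow> (real^'d, real^'d) brk set" where
  "bdry_space k M T = {\<phi>. (\<forall>F\<in>elem_faces M T. \<phi> F \<in> face_vpolys k F)
     \<and> (\<forall>F. F \<notin> elem_faces M T \<longrightarrow> \<phi> F = (\<lambda>x. 0))}"

definition bdry_inner :: "(real^'d) mesh \<Rightarrow> (real^'d) set \<Rightarrow>
    (real^'d, real^'d) brk \<Rightarrow> (real^'d, real^'d) brk \<Rightarrow> real" where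
  "bdry_inner M T \<phi> \<psi> = (\<Sum>F\<in>elem_faces M T. face_inner F (\<phi> F) (\<psi> F))"

definition bdry_op :: "nat \<Rightarrow> (real^'d) mesh \<Rightarrow> (real^'d) set \<Rightarrow>
    (real^'d, real^'d) brk \<Rightarrow> (real^'d, real^'d) brk" where
  "bdry_op k M T \<phi> F =
     (let r = recon k M T (\<lambda>x. 0) \<phi>
      in if F \<in> elem_faces M T then face_vproj k F (\<lambda>x. \<phi> F x - r x + vproj k T r x) else (\<lambda>x. 0))"

definition bdry_adj :: "nat \<Rightarrow> (real^'d) mesh \<Rightarrow> (real^'d) set \<Rightarrow>
    (real^'d, real^'d) brk \<Rightarrow> (real^'d, real^'d) brk" where
  "bdry_adj k M T \<phi> = (THE \<psi>. \<psi> \<in> bdry_space k M T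
     \<and> (\<forall>\<eta>\<in>bdry_space k M T. bdry_inner M T \<psi> \<eta> = bdry_inner M T \<phi> (bdry_op k M T \<eta>)))"

definition bdry_diff :: "(real^'d) mesh \<Rightarrow> (real^'d) set \<Rightarrow>
    (real^'d \<Rightarrow> real^'d) \<Rightarrow> (real^'d, real^'d) brk \<Rightarrow> (real^'d, real^'d) brk" where
  "bdry_diff M T w \<phi> F x = (if F \<in> elem_faces M T \<and> x \<in> F then \<phi> F x - w x else 0)"

definition stress :: "nat \<Rightarrow> (real^'d) mesh \<Rightarrow> real \<Rightarrow> real \<Rightarrow> (real^'d) set \<Rightarrow>
    (real^'d \<Rightarrow> real^'d) \<Rightarrow> (real^'d, real^'d) brk \<Rightarrow> real^'d \<Rightarrow> real^'d^'d" where
  "stress k M \<mu> lam T w \<phi> x =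
     (2 * \<mu>) *\<^sub>R sgrad (recon k M T w \<phi>) x + (lam * div_recon k M T w \<phi> x) *\<^sub>R mat 1"

definition traction :: "nat \<Rightarrow> (real^'d) mesh \<Rightarrow> real \<Rightarrow> real \<Rightarrow> (real^'d) set \<Rightarrow> (real^'d) set \<Rightarrow>
    (real^'d \<Rightarrow> real^'d) \<Rightarrow> (real^'d, real^'d) brk \<Rightarrow> (real^'d \<Rightarrow> real) \<Rightarrow> real^'d \<Rightarrow> real^'d" where
  "traction k M \<mu> lam T F w \<phi> q x =
     (stress k M \<mu> lam T w \<phi> x - q x *\<^sub>R mat 1) *v normal T F
     + (2 * \<mu>) *\<^sub>R bdry_adj k M T
         (\<lambda>F' y. bdry_op k M T (bdry_diff M T w \<phi>) F' y /\<^sub>R face_len M F') F x"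

definition mass_flux :: "(real^'d) mesh \<Rightarrow> (real^'d \<Rightarrow> real) \<Rightarrow> real \<Rightarrow> (real^'d) set \<Rightarrow> (real^'d) set \<Rightarrow>
    (real^'d \<Rightarrow> real^'d) \<Rightarrow> (real^'d, real) brk \<Rightarrow> real^'d \<Rightarrow> real" where
  "mass_flux M \<kappa> \<sigma> T F vF q x =
     (if F \<in> interfaces M
      then (- vF x + avg M \<kappa> F (kscale \<kappa> (brk_grad q)) x) \<bullet> normal T F
           - \<sigma> * harm_mean M \<kappa> F / face_len M F * jump M F q x * (normal T F \<bullet> face_normal M F)
      else 0)"

end

theory Submission
  imports Defs "HOL-Library.Function_Algebras"
begin

text \<open>Both formulations test the same equations, with different test functions.  The hybrid space
and the space of broken polynomials are sums of pieces carried by one element or by one face, so a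
global equation is equivalent to the family of its restrictions to these pieces.  What has to be
shown is that the global forms are sums of element contributions in which a face unknown occurs only
in a pairing with a flux.

In an element \<open>T\<close>, the reconstructions of the solution are admissible test
functions in the definitions of the reconstructions of the test function \<open>v\<close>.  This turns the
consistent part of the elasticity form and the coupling term into the work of the stress on
\<open>sgrad v\<^sub>T\<close> plus the pairing of the normal stress with \<open>v\<^sub>F - v\<^sub>T\<close>.  The stabilisation has the same
shape because the face residual depends on \<open>v\<^sub>F - v\<^sub>T\<close> only: the reconstruction reproduces a
polynomial from its traces (\<open>recon_trace\<close>), hence the residual is minus the boundary operator
applied to \<open>v\<^sub>F - v\<^sub>T\<close> (\<open>face_resid_bdry_op\<close>), and the adjoint of that operator moves it to the other
factor (\<open>stab_adjoint\<close>).  The outcome is \<open>elem_momentum\<close>.  A test function carried by one element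
gives the equation of that element.  Test functions carried by one interface say that the sum of the
two tractions there is orthogonal to all polynomials of degree \<open>k\<close> on the face; being such a
polynomial itself, the sum vanishes (\<open>momentum_equivalence\<close>).

In the mass balance, after an integration by parts in the divergence reconstruction, and with the lifting in
place of the symmetry term of the Darcy form, the mass fluxes summed over the two sides of an
interface produce exactly the jump terms (\<open>global_mass\<close>).  Broken polynomials are independent on
different elements, so the global equation splits (\<open>mass_equivalence\<close>).  Conservation of the mass
flux holds for every discrete function, because the flux is linear in the normal and the two normals
on an interface are opposite.

Both \<open>recon_trace\<close> and the integration by parts are the divergence
theorem on an element, a possibly nonconvex polyhedron of which one knows only the faces and unit
normals that point outwards at almost every point.  \<open>divergence_theorem_direction\<close> proves it for one
direction \<open>e\<close> at a time by integrating along the lines parallel to \<open>e\<close>.  Almost every such line meets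
the frontier at points interior to a single face and transversally, and leaves or enters the element
according to the sign of \<open>n \<bullet> e\<close>, so that the fundamental theorem of calculus gives the boundary
terms on each line (\<open>integral_derivative_crossings\<close>); and a face is seen along \<open>e\<close> with its area
multiplied by \<open>\<bar>n \<bullet> e\<bar>\<close> (\<open>flat_lborel_shadow\<close>).

All discrete operators are introduced as the unique solutions of
variational problems in finite-dimensional spaces; \<open>riesz_representation\<close> reduces this to the
definiteness of a bilinear form.  That in turn rests on two facts: a polynomial that vanishes almost
everywhere on a face vanishes on the whole face (\<open>line_poly_zero_on_hyperplane\<close>), and a field with
vanishing symmetric gradient is a rigid motion (\<open>rigid_motion\<close>).\<close>

section \<open>Functions as a real vector space\<close>

instantiation "fun" :: (type, real_vector) real_vector
begin

definition "scaleR c f = (\<lambda>x. c *\<^sub>R f x)"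

instance
  by standard (simp_all add: scaleR_fun_def fun_eq_iff scaleR_add_right scaleR_add_left)

end

lemma scaleR_fun_apply [simp]: "(c *\<^sub>R f) x = c *\<^sub>R f x"
  by (simp add: scaleR_fun_def)

lemma sum_fun_apply: "(\<Sum>a\<in>A. h a) x = (\<Sum>a\<in>A. h a x)"
  by (induction A rule: infinite_finite_induct) auto

section \<open>Lebesgue measure on hyperplanes\<close>

text \<open>Translations act coordinatewise, so it is enough to compare the two measures on boxes.\<close>

lemma PiM_lborel_translate:
  fixes c :: "'i \<Rightarrow> real"
  assumes "finite I"
  shows "distr (\<Pi>\<^sub>M i\<in>I. lborel) (\<Pi>\<^sub>M i\<in>I. lborel) (\<lambda>f. \<lambda>i\<in>I. f i + c i) = (\<Pi>\<^sub>M i\<in>I. lborel)"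
proof -
  interpret product_sigma_finite "\<lambda>i::'i. lborel :: real measure" by standard
  show ?thesis
  proof (rule PiM_eqI[OF assms])
    fix A :: "'i \<Rightarrow> real set" assume A: "\<And>i. i \<in> I \<Longrightarrow> A i \<in> sets lborel"
    have 1: "(\<lambda>f. \<lambda>i\<in>I. f i + c i) -` Pi\<^sub>E I A \<inter> space (\<Pi>\<^sub>M i\<in>I. (lborel::real measure))
        = Pi\<^sub>E I (\<lambda>i. (\<lambda>x. c i + x) -` A i)"
      by (auto simp: space_PiM PiE_def Pi_def extensional_def add.commute)
    have 2: "(\<lambda>x. c i + x) -` A i \<in> sets lborel" if "i \<in> I" for i
      using measurable_sets[of "\<lambda>x. c i + x" borel borel "A i"] A[OF that] by simp
    have "emeasure lborel ((\<lambda>x. c i + x) -` A i) = emeasure lborel (A i)" if "i \<in> I" for i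
      using 2[OF that] A[OF that] emeasure_distr[of "(+) (c i)" lborel borel "A i"] by (simp add: lborel_distr_plus)
    moreover have "(\<lambda>f. \<lambda>i\<in>I. f i + c i) \<in> measurable (\<Pi>\<^sub>M i\<in>I. (lborel::real measure)) (\<Pi>\<^sub>M i\<in>I. (lborel::real measure))"
      by (intro measurable_restrict) measurable
    ultimately show "emeasure (distr (\<Pi>\<^sub>M i\<in>I. lborel) (\<Pi>\<^sub>M i\<in>I. lborel) (\<lambda>f. \<lambda>i\<in>I. f i + c i)) (Pi\<^sub>E I A)
        = (\<Prod>i\<in>I. emeasure lborel (A i))"
      using A 2 assms emeasure_PiM[OF assms, of "\<lambda>i. (\<lambda>x. c i + x) -` A i"]
      by (subst emeasure_distr) (auto simp: 1 intro!: sets_PiM_I_finite)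
  qed simp
qed

lemma PiM_lborel_reindex:
  assumes "finite I" "bij_betw h I J"
  shows "distr (\<Pi>\<^sub>M j\<in>J. lborel) (\<Pi>\<^sub>M i\<in>I. lborel) (\<lambda>g. \<lambda>i\<in>I. g (h i)) = (\<Pi>\<^sub>M i\<in>I. (lborel::real measure))"
proof -
  interpret I: product_sigma_finite "\<lambda>i::'a. lborel :: real measure" by standard
  interpret J: product_sigma_finite "\<lambda>i::'b. lborel :: real measure" by standard
  have finJ: "finite J" using assms bij_betw_finite by blast
  have inj: "inj_on h I" and im: "h ` I = J" using assms by (auto simp: bij_betw_def)
  show ?thesis
  proof (rule I.PiM_eqI[OF assms(1)])
    fix A :: "'a \<Rightarrow> real set" assume A: "\<And>i. i \<in> I \<Longrightarrow> A i \<in> sets lborel"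
    have 1: "(\<lambda>g. \<lambda>i\<in>I. g (h i)) -` Pi\<^sub>E I A \<inter> space (\<Pi>\<^sub>M j\<in>J. (lborel::real measure))
        = Pi\<^sub>E J (\<lambda>j. A (the_inv_into I h j))"
      using im the_inv_into_f_f[OF inj] by (fastforce simp: space_PiM PiE_def Pi_def extensional_def)
    have 2: "A (the_inv_into I h j) \<in> sets lborel" if "j \<in> J" for j
      using A that im the_inv_into_f_f[OF inj] by force
    have "(\<lambda>g. \<lambda>i\<in>I. g (h i)) \<in> measurable (\<Pi>\<^sub>M i\<in>J. (lborel::real measure)) (\<Pi>\<^sub>M i\<in>I. (lborel::real measure))"
      using im by (intro measurable_restrict measurable_component_singleton) auto
    moreover have "(\<Prod>j\<in>J. emeasure lborel (A (the_inv_into I h j))) = (\<Prod>i\<in>I. emeasure lborel (A i))"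
      unfolding im[symmetric] using the_inv_into_f_f[OF inj] by (subst prod.reindex[OF inj]) (auto intro!: prod.cong)
    ultimately show "emeasure (distr (\<Pi>\<^sub>M i\<in>J. lborel) (\<Pi>\<^sub>M i\<in>I. lborel) (\<lambda>g. \<lambda>i\<in>I. g (h i))) (Pi\<^sub>E I A)
        = (\<Prod>i\<in>I. emeasure lborel (A i))"
      using A 2 finJ assms(1)
      using J.emeasure_PiM[OF finJ, of "\<lambda>j. A (the_inv_into I h j)"]
      by (subst emeasure_distr) (auto simp: 1 intro!: sets_PiM_I_finite)
  qed simp
qed

lemma nn_integral_lborel_translate:
  fixes c :: "'a::euclidean_space"
  assumes [measurable]: "g \<in> borel_measurable borel"
  shows "(\<integral>\<^sup>+y. g (c + y) \<partial>lborel) = (\<integral>\<^sup>+y. g y \<partial>lborel)"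
proof -
  have "(\<integral>\<^sup>+y. g y \<partial>lborel) = (\<integral>\<^sup>+y. g y \<partial>distr lborel borel ((+) c))"
    by (simp add: lborel_distr_plus)
  also have "\<dots> = (\<integral>\<^sup>+y. g (c + y) \<partial>lborel)"
    by (subst nn_integral_distr) auto
  finally show ?thesis ..
qed

text \<open>A translation invariant measure is determined up to a factor, and the unit ball \<open>b\<close>, which an
isometry preserves, fixes the factor.  Both steps are contained in one computation: integrate
\<open>1\<^sub>A (U x) \<cdot> 1\<^sub>b (y - U x)\<close> over \<open>x\<close> and \<open>y\<close> in either order.\<close>

lemma lborel_distr_isometry:
  fixes U :: "'a::euclidean_space \<Rightarrow> 'a"
  assumes U: "orthogonal_transformation U"
  shows "distr lborel borel U = lborel"
proof (rule measure_eqI)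
  define V where "V = inv U"
  have UV: "U (V y) = y" for y
    unfolding V_def using orthogonal_transformation_surj[OF U] by (simp add: surj_f_inv_f)
  have linU: "linear U" using U by (rule orthogonal_transformation_linear)
  have normU: "norm (U x) = norm x" for x using U by (simp add: orthogonal_transformation)
  have [measurable]: "U \<in> borel_measurable borel"
    by (intro borel_measurable_continuous_onI linear_continuous_on linear_linear[THEN iffD2] linU)
  have [measurable]: "V \<in> borel_measurable borel" unfolding V_def
    by (intro borel_measurable_continuous_onI linear_continuous_on linear_linear[THEN iffD2]
        orthogonal_transformation_linear orthogonal_transformation_inv U)
  let ?b = "ball (0::'a) 1"
  have [measurable]: "?b \<in> sets borel" by simp
  fix A assume "A \<in> sets (distr lborel borel U)"
  then have [measurable]: "A \<in> sets borel" by simp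
  have Pair: "pair_sigma_finite (lborel :: 'a measure) (lborel :: 'a measure)" ..
  have "emeasure lborel (U -` A) * emeasure lborel ?b
      = (\<integral>\<^sup>+x. indicator A (U x) * (\<integral>\<^sup>+y. indicator ?b (- U x + y) \<partial>lborel) \<partial>lborel)"
  proof -
    have "(\<integral>\<^sup>+y. indicator ?b (- U x + y) \<partial>lborel) = emeasure lborel ?b" for x
      by (subst nn_integral_lborel_translate[of "indicator ?b"]) (auto intro!: borel_measurable_indicator)
    moreover have "(\<integral>\<^sup>+x. indicator A (U x) \<partial>lborel) = emeasure lborel (U -` A)"
    proof -
      have "(\<integral>\<^sup>+x. indicator A (U x) \<partial>lborel) = (\<integral>\<^sup>+x. indicator (U -` A) x \<partial>lborel)"
        by (intro nn_integral_cong) (auto split: split_indicator)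
      also have "\<dots> = emeasure lborel (U -` A)"
        using measurable_sets[of U borel borel A] by (intro nn_integral_indicator) auto
      finally show ?thesis .
    qed
    ultimately show ?thesis by (simp add: nn_integral_multc)
  qed
  also have "\<dots> = (\<integral>\<^sup>+x. \<integral>\<^sup>+y. indicator A (U x) * indicator ?b (- U x + y) \<partial>lborel \<partial>lborel)"
    by (intro nn_integral_cong nn_integral_cmult[symmetric] borel_measurable_indicator') simp_all
  also have "\<dots> = (\<integral>\<^sup>+y. \<integral>\<^sup>+x. indicator A (U x) * indicator ?b (- U x + y) \<partial>lborel \<partial>lborel)"
    by (rule pair_sigma_finite.Fubini'[OF Pair]) measurable
  \<comment> \<open>substitute \<open>V y + x\<close> for \<open>x\<close>, where \<open>U (V y) = y\<close>\<close>
  also have "\<dots> = (\<integral>\<^sup>+y. \<integral>\<^sup>+x. indicator A (y + U x) * indicator ?b x \<partial>lborel \<partial>lborel)"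
  proof (rule nn_integral_cong)
    fix y
    have "(\<integral>\<^sup>+x. indicator A (U x) * indicator ?b (- U x + y) \<partial>lborel)
      = (\<integral>\<^sup>+x. indicator A (U (V y + x)) * indicator ?b (- U (V y + x) + y) \<partial>lborel)"
      by (rule nn_integral_lborel_translate[symmetric]) measurable
    then show "(\<integral>\<^sup>+x. indicator A (U x) * indicator ?b (- U x + y) \<partial>lborel)
      = (\<integral>\<^sup>+x. indicator A (y + U x) * indicator ?b x \<partial>lborel)"
      by (simp add: linear_add[OF linU] UV indicator_def normU)
  qed
  also have "\<dots> = (\<integral>\<^sup>+x. \<integral>\<^sup>+y. indicator A (y + U x) * indicator ?b x \<partial>lborel \<partial>lborel)"
    by (rule pair_sigma_finite.Fubini'[OF Pair]) measurable
  also have "\<dots> = (\<integral>\<^sup>+x. emeasure lborel A * indicator ?b x \<partial>lborel)"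
  proof (rule nn_integral_cong)
    fix x
    have "(\<integral>\<^sup>+y. indicator A (U x + y) \<partial>lborel) = emeasure lborel A"
      by (subst nn_integral_lborel_translate[of "indicator A"]) (auto intro!: borel_measurable_indicator)
    then show "(\<integral>\<^sup>+y. indicator A (y + U x) * indicator ?b x \<partial>lborel) = emeasure lborel A * indicator ?b x"
      by (subst nn_integral_multc) (auto simp: add.commute)
  qed
  also have "\<dots> = emeasure lborel A * emeasure lborel ?b"
    by (simp add: nn_integral_cmult)
  finally have *: "emeasure lborel (U -` A) * emeasure lborel ?b = emeasure lborel A * emeasure lborel ?b" .
  have "emeasure lborel ?b \<noteq> 0"
    using open_not_negligible[of ?b] by (auto simp: negligible_iff_emeasure0)
  moreover have "emeasure lborel ?b \<noteq> \<infinity>"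
    using emeasure_bounded_finite[OF bounded_ball, of "0::'a" 1] by (metis order_less_irrefl infinity_ennreal_def)
  ultimately have "emeasure lborel (U -` A) = emeasure lborel A"
    using * ennreal_mult_cancel_left[of "emeasure lborel ?b" "emeasure lborel (U -` A)" "emeasure lborel A"]
    by (auto simp: mult.commute)
  then show "emeasure (distr lborel borel U) A = emeasure lborel A"
    by (simp add: emeasure_distr)
qed simp

text \<open>The definition of Lebesgue measure refers to the standard basis; any other orthonormal basis is
its image under an isometry.\<close>

lemma lborel_orthonormal_coords:
  fixes B :: "'a::euclidean_space set"
  assumes B: "pairwise orthogonal B" "\<And>b. b \<in> B \<Longrightarrow> norm b = 1" "finite B" "card B = DIM('a)"
  shows "distr (\<Pi>\<^sub>M b\<in>B. lborel) borel (\<lambda>f. \<Sum>b\<in>B. f b *\<^sub>R b) = (lborel :: 'a measure)"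
proof -
  obtain h where h: "bij_betw h (Basis::'a set) B"
    using B finite_same_card_bij[of "Basis::'a set" B] by auto
  define U :: "'a \<Rightarrow> 'a" where "U x = (\<Sum>i\<in>Basis. (x \<bullet> i) *\<^sub>R h i)" for x
  have hB: "h i \<in> B" if "i \<in> Basis" for i using h that by (auto simp: bij_betw_def)
  have hh: "h i \<bullet> h j = (if i = j then 1 else 0)" if "i \<in> Basis" "j \<in> Basis" for i j
  proof (cases "i = j")
    case True then show ?thesis using B(2)[OF hB[OF that(1)]] by (simp add: dot_square_norm)
  next
    case False
    then have "h i \<noteq> h j" using h that by (auto simp: bij_betw_def inj_on_def)
    then show ?thesis using B(1) hB that False by (auto simp: pairwise_def orthogonal_def)
  qed
  have U: "orthogonal_transformation U"
    unfolding orthogonal_transformation_def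
  proof (intro conjI allI)
    show "linear U" unfolding U_def
      by (intro linearI) (simp_all add: inner_add_left scaleR_add_left sum.distrib scaleR_sum_right)
    fix v w :: 'a
    have "U v \<bullet> U w = (\<Sum>i\<in>Basis. \<Sum>j\<in>Basis. (v \<bullet> i) * ((w \<bullet> j) * (h i \<bullet> h j)))"
      unfolding U_def inner_sum_left inner_sum_right by (subst sum.swap) (simp add: mult.left_commute)
    also have "\<dots> = (\<Sum>i\<in>Basis. \<Sum>j\<in>Basis. (v \<bullet> i) * ((w \<bullet> j) * (if i = j then 1 else 0)))"
      by (intro sum.cong refl) (simp add: hh)
    also have "\<dots> = (\<Sum>i\<in>Basis. (v \<bullet> i) * (w \<bullet> i))"
      by (intro sum.cong refl) (simp add: if_distrib cong: if_cong)
    also have "\<dots> = v \<bullet> w" by (rule euclidean_inner[symmetric])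
    finally show "U v \<bullet> U w = v \<bullet> w" .
  qed
  have [measurable]: "U \<in> borel_measurable borel" unfolding U_def by measurable
  have "lborel = distr lborel borel U" using lborel_distr_isometry[OF U] by simp
  also have "\<dots> = distr (\<Pi>\<^sub>M i\<in>Basis. lborel) borel (U \<circ> (\<lambda>f. \<Sum>i\<in>Basis. f i *\<^sub>R i))"
    by (subst lborel_eq, subst distr_distr) auto
  also have "\<dots> = distr (\<Pi>\<^sub>M i\<in>Basis. lborel) borel (\<lambda>f. \<Sum>i\<in>Basis. f i *\<^sub>R h i)"
    by (intro distr_cong) (auto simp: U_def inner_sum_left inner_Basis if_distrib sum.delta' cong: if_cong)
  also have "(\<Pi>\<^sub>M i\<in>Basis. lborel) = distr (\<Pi>\<^sub>M j\<in>B. lborel) (\<Pi>\<^sub>M i\<in>Basis. (lborel::real measure)) (\<lambda>g. \<lambda>i\<in>Basis. g (h i))"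
    by (rule PiM_lborel_reindex[OF _ h, symmetric]) simp
  also have "distr \<dots> borel (\<lambda>f. \<Sum>i\<in>Basis. f i *\<^sub>R h i)
      = distr (\<Pi>\<^sub>M j\<in>B. lborel) borel ((\<lambda>f. \<Sum>i\<in>Basis. f i *\<^sub>R h i) \<circ> (\<lambda>g. \<lambda>i\<in>Basis. g (h i)))"
    using hB by (intro distr_distr measurable_restrict measurable_component_singleton) auto
  also have "\<dots> = distr (\<Pi>\<^sub>M b\<in>B. lborel) borel (\<lambda>f. \<Sum>b\<in>B. f b *\<^sub>R b)"
    using h by (intro distr_cong) (auto simp: bij_betw_def sum.reindex)
  finally show ?thesis ..
qed

text \<open>The hyperplane contains the multiple \<open>(\<beta> / (n \<bullet> n)) n\<close> of its normal, which serves as base point.\<close>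

lemma hyperplane_directions:
  fixes n :: "'a::euclidean_space"
  assumes "n \<noteq> 0"
  shows "span {x - y | x y. x \<in> {x. n \<bullet> x = \<beta>} \<and> y \<in> {x. n \<bullet> x = \<beta>}} = {w. n \<bullet> w = 0}"
proof -
  have "{x - y | x y. x \<in> {x. n \<bullet> x = \<beta>} \<and> y \<in> {x. n \<bullet> x = \<beta>}} = {w. n \<bullet> w = 0}"
  proof safe
    fix w assume w: "n \<bullet> w = 0"
    let ?a = "(\<beta> / (n \<bullet> n)) *\<^sub>R n"
    have "w = (?a + w) - ?a" "n \<bullet> (?a + w) = \<beta>" "n \<bullet> ?a = \<beta>"
      using w assms by (auto simp: inner_add_right)
    then show "\<exists>x y. w = x - y \<and> x \<in> {x. n \<bullet> x = \<beta>} \<and> y \<in> {x. n \<bullet> x = \<beta>}" by blast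
  qed (simp add: inner_diff_right)
  then show ?thesis using subspace_hyperplane[of n] by (simp add: span_eq_iff)
qed

text \<open>The measure of a flat is defined through an arbitrary orthonormal basis \<open>B\<close> of its directions and
an arbitrary base point \<open>a\<close>.  Everything below uses these coordinates only through this lemma.\<close>

lemma flat_lborel_hyperplane:
  fixes n :: "'a::euclidean_space"
  assumes n: "norm n = 1"
  obtains B a where "finite B" "pairwise orthogonal B" "\<And>b. b \<in> B \<Longrightarrow> norm b = 1"
    "\<And>b. b \<in> B \<Longrightarrow> n \<bullet> b = 0" "span B = {w. n \<bullet> w = 0}" "card B = DIM('a) - 1" "n \<bullet> a = \<beta>"
    "flat_lborel {x. n \<bullet> x = \<beta>} = distr (\<Pi>\<^sub>M b\<in>B. lborel) borel (\<lambda>f. a + (\<Sum>b\<in>B. f b *\<^sub>R b))"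
proof -
  have n0: "n \<noteq> 0" using n by auto
  let ?H = "{x. n \<bullet> x = \<beta>}"
  let ?Q = "\<lambda>B. pairwise orthogonal B \<and> (\<forall>b\<in>B. norm b = 1)
                 \<and> span B = span {x - y | x y. x \<in> ?H \<and> y \<in> ?H}"
  define B where "B = (SOME B. ?Q B)"
  define a where "a = (SOME a. a \<in> ?H)"
  obtain B0 where "?Q B0"
    using orthonormal_basis_subspace[OF subspace_hyperplane[of n]] hyperplane_directions[OF n0] by metis
  then have B: "?Q B" unfolding B_def by (rule someI)
  have "(\<beta> / (n \<bullet> n)) *\<^sub>R n \<in> ?H" using n0 by auto
  then have a: "a \<in> ?H" unfolding a_def by (rule someI)
  have sp: "span B = {w. n \<bullet> w = 0}" using B hyperplane_directions[OF n0] by simp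
  have ind: "independent B" using B by (intro pairwise_orthogonal_independent) auto
  have "card B = dim (span B)" using ind by (simp add: dim_eq_card_independent)
  then have card: "card B = DIM('a) - 1" unfolding sp using dim_hyperplane[OF n0] by simp
  have perp: "n \<bullet> b = 0" if "b \<in> B" for b using sp span_base[OF that] by auto
  have eq: "flat_lborel ?H = distr (\<Pi>\<^sub>M b\<in>B. lborel) borel (\<lambda>f. a + (\<Sum>b\<in>B. f b *\<^sub>R b))"
    unfolding flat_lborel_def B_def a_def Let_def by (rule refl)
  show thesis
    by (rule that[OF independent_imp_finite[OF ind] _ _ perp sp card _ eq]) (use a B in blast)+
qed

lemma sets_flat_lborel [simp, measurable_cong]: "sets (flat_lborel A) = sets borel"
  by (simp add: flat_lborel_def Let_def)

lemma space_flat_lborel [simp]: "space (flat_lborel A) = UNIV"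
  by (simp add: flat_lborel_def Let_def)

lemma measurable_flat_lborel1 [simp]: "measurable (flat_lborel A) N = measurable borel N"
  by (rule measurable_cong_sets) simp_all

text \<open>The measure lives on the whole space; it is concentrated on the flat.\<close>

lemma AE_flat_lborel_mem:
  fixes n :: "'a::euclidean_space"
  assumes n: "norm n = 1"
  shows "AE y in flat_lborel {x. n \<bullet> x = \<beta>}. n \<bullet> y = \<beta>"
proof -
  obtain B a where B: "\<And>b. b \<in> B \<Longrightarrow> n \<bullet> b = 0" "n \<bullet> a = \<beta>"
    and eq: "flat_lborel {x. n \<bullet> x = \<beta>} = distr (\<Pi>\<^sub>M b\<in>B. lborel) borel (\<lambda>f. a + (\<Sum>b\<in>B. f b *\<^sub>R b))"
    using flat_lborel_hyperplane[OF n, of \<beta>] by blast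
  show ?thesis unfolding eq by (subst AE_distr_iff) (auto simp: B inner_add_right inner_sum_right)
qed

text \<open>Adding the unit normal to an orthonormal basis of the hyperplane gives an orthonormal basis of the
space, so this is Fubini's theorem in rotated coordinates.\<close>

lemma nn_integral_flat_normal:
  fixes n :: "'a::euclidean_space"
  assumes n: "norm n = 1" and [measurable]: "G \<in> borel_measurable borel"
  shows "(\<integral>\<^sup>+y. \<integral>\<^sup>+s. G (y + s *\<^sub>R n) \<partial>lborel \<partial>flat_lborel {x. n \<bullet> x = \<beta>}) = (\<integral>\<^sup>+x. G x \<partial>lborel)"
proof -
  obtain B a where B: "finite B" "pairwise orthogonal B" "\<And>b. b \<in> B \<Longrightarrow> norm b = 1"
    "\<And>b. b \<in> B \<Longrightarrow> n \<bullet> b = 0" "span B = {w. n \<bullet> w = 0}" "card B = DIM('a) - 1" "n \<bullet> a = \<beta>"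
    and eq: "flat_lborel {x. n \<bullet> x = \<beta>} = distr (\<Pi>\<^sub>M b\<in>B. lborel) borel (\<lambda>f. a + (\<Sum>b\<in>B. f b *\<^sub>R b))"
    using flat_lborel_hyperplane[OF n, of \<beta>] by blast
  have nB: "n \<notin> B" using B(4)[of n] n by auto
  interpret product_sigma_finite "\<lambda>i::'a. lborel :: real measure" by standard
  have ON: "pairwise orthogonal (insert n B)"
    using B by (auto simp: pairwise_insert orthogonal_def inner_commute)
  have card: "card (insert n B) = DIM('a)" using B nB DIM_positive[where 'a='a] by (simp add: card_insert_if)
  have "(\<integral>\<^sup>+x. G x \<partial>lborel) = (\<integral>\<^sup>+x. G (a + x) \<partial>lborel)"
    by (rule nn_integral_lborel_translate[symmetric]) measurable
  also have "\<dots> = (\<integral>\<^sup>+x. G (a + x) \<partial>distr (\<Pi>\<^sub>M b\<in>insert n B. lborel) borel (\<lambda>f. \<Sum>b\<in>insert n B. f b *\<^sub>R b))"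
    using ON B n card by (subst lborel_orthonormal_coords) auto
  also have "\<dots> = (\<integral>\<^sup>+f. G (a + (\<Sum>b\<in>insert n B. f b *\<^sub>R b)) \<partial>(\<Pi>\<^sub>M b\<in>insert n B. lborel))"
    by (subst nn_integral_distr) auto
  also have "\<dots> = (\<integral>\<^sup>+f. \<integral>\<^sup>+s. G (a + (\<Sum>b\<in>insert n B. (f(n := s)) b *\<^sub>R b)) \<partial>lborel \<partial>(\<Pi>\<^sub>M b\<in>B. lborel))"
    using B nB by (intro product_nn_integral_insert) auto
  also have "\<dots> = (\<integral>\<^sup>+f. \<integral>\<^sup>+s. G ((a + (\<Sum>b\<in>B. f b *\<^sub>R b)) + s *\<^sub>R n) \<partial>lborel \<partial>(\<Pi>\<^sub>M b\<in>B. lborel))"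
  proof -
    have "(\<Sum>b\<in>insert n B. (f(n := s)) b *\<^sub>R b) = s *\<^sub>R n + (\<Sum>b\<in>B. f b *\<^sub>R b)" for f s
      using B(1) nB by (simp add: sum.insert) (intro sum.cong, auto)
    then show ?thesis by (simp add: add_ac)
  qed
  also have "\<dots> = (\<integral>\<^sup>+y. \<integral>\<^sup>+s. G (y + s *\<^sub>R n) \<partial>lborel \<partial>flat_lborel {x. n \<bullet> x = \<beta>})"
    unfolding eq by (subst nn_integral_distr) auto
  finally show ?thesis ..
qed

lemma nn_integral_flat_translate:
  fixes n :: "'a::euclidean_space"
  assumes n: "norm n = 1" and w: "n \<bullet> w = 0" and [measurable]: "G \<in> borel_measurable borel"
  shows "(\<integral>\<^sup>+y. G (y + w) \<partial>flat_lborel {x. n \<bullet> x = \<beta>}) = (\<integral>\<^sup>+y. G y \<partial>flat_lborel {x. n \<bullet> x = \<beta>})"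
proof -
  obtain B a where B: "finite B" "pairwise orthogonal B" "\<And>b. b \<in> B \<Longrightarrow> norm b = 1"
    "\<And>b. b \<in> B \<Longrightarrow> n \<bullet> b = 0" "span B = {w. n \<bullet> w = 0}" "card B = DIM('a) - 1" "n \<bullet> a = \<beta>"
    and eq: "flat_lborel {x. n \<bullet> x = \<beta>} = distr (\<Pi>\<^sub>M b\<in>B. lborel) borel (\<lambda>f. a + (\<Sum>b\<in>B. f b *\<^sub>R b))"
    using flat_lborel_hyperplane[OF n, of \<beta>] by blast
  have "w \<in> span B" using w B by simp
  then obtain c where c: "w = (\<Sum>b\<in>B. c b *\<^sub>R b)"
    using B(1) by (auto simp: span_finite)
  have m: "(\<lambda>f. \<lambda>b\<in>B. f b + c b) \<in> measurable (\<Pi>\<^sub>M b\<in>B. (lborel::real measure)) (\<Pi>\<^sub>M b\<in>B. (lborel::real measure))"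
    by (intro measurable_restrict) measurable
  have "(\<integral>\<^sup>+y. G y \<partial>flat_lborel {x. n \<bullet> x = \<beta>}) = (\<integral>\<^sup>+f. G (a + (\<Sum>b\<in>B. f b *\<^sub>R b)) \<partial>(\<Pi>\<^sub>M b\<in>B. lborel))"
    unfolding eq by (subst nn_integral_distr) auto
  also have "\<dots> = (\<integral>\<^sup>+f. G (a + (\<Sum>b\<in>B. f b *\<^sub>R b)) \<partial>distr (\<Pi>\<^sub>M b\<in>B. lborel) (\<Pi>\<^sub>M b\<in>B. lborel) (\<lambda>f. \<lambda>b\<in>B. f b + c b))"
    by (subst PiM_lborel_translate[OF B(1)]) simp
  also have "\<dots> = (\<integral>\<^sup>+f. G (a + (\<Sum>b\<in>B. (f b + c b) *\<^sub>R b)) \<partial>(\<Pi>\<^sub>M b\<in>B. lborel))"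
    by (subst nn_integral_distr[OF m]) (auto intro!: nn_integral_cong sum.cong arg_cong[of _ _ G])
  also have "\<dots> = (\<integral>\<^sup>+f. G ((a + (\<Sum>b\<in>B. f b *\<^sub>R b)) + w) \<partial>(\<Pi>\<^sub>M b\<in>B. lborel))"
    unfolding c by (simp add: scaleR_add_left sum.distrib add.assoc)
  also have "\<dots> = (\<integral>\<^sup>+y. G (y + w) \<partial>flat_lborel {x. n \<bullet> x = \<beta>})"
    unfolding eq by (subst nn_integral_distr) auto
  finally show ?thesis ..
qed

text \<open>A bounded set \<open>S\<close> of the hyperplane is the base of a cylinder of height one in the direction of the
normal, whose volume equals the measure of \<open>S\<close> and is finite because the cylinder is bounded.\<close>

lemma sigma_finite_flat_lborel:
  fixes n :: "'a::euclidean_space"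
  assumes n: "norm n = 1"
  shows "sigma_finite_measure (flat_lborel {x. n \<bullet> x = \<beta>})"
    and "bounded S \<Longrightarrow> S \<in> sets borel \<Longrightarrow> emeasure (flat_lborel {x. n \<bullet> x = \<beta>}) S < \<infinity>"
proof -
  let ?\<mu> = "flat_lborel {x. n \<bullet> x = \<beta>}"
  have fin: "emeasure ?\<mu> S < \<infinity>" if bS: "bounded S" and [measurable]: "S \<in> sets borel" for S :: "'a set"
  proof -
    \<comment> \<open>the indicator function of the cylinder\<close>
    define G :: "'a \<Rightarrow> ennreal" where "G x = indicator S (x - (n \<bullet> x - \<beta>) *\<^sub>R n) * indicator {\<beta>..\<beta>+1} (n \<bullet> x)" for x
    have [measurable]: "G \<in> borel_measurable borel" unfolding G_def by measurable
    obtain r where r: "\<And>x. x \<in> S \<Longrightarrow> norm x \<le> r" using bS by (auto simp: bounded_iff)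
    have "(\<integral>\<^sup>+x. G x \<partial>lborel) \<le> (\<integral>\<^sup>+x. indicator (cball 0 (r + 1)) x \<partial>(lborel :: 'a measure))"
    proof (rule nn_integral_mono)
      fix x :: 'a
      have "norm x \<le> r + 1" if "x - (n \<bullet> x - \<beta>) *\<^sub>R n \<in> S" "n \<bullet> x \<in> {\<beta>..\<beta>+1}"
      proof -
        have "norm x \<le> norm (x - (n \<bullet> x - \<beta>) *\<^sub>R n) + norm ((n \<bullet> x - \<beta>) *\<^sub>R n)"
          using norm_triangle_ineq[of "x - (n \<bullet> x - \<beta>) *\<^sub>R n" "(n \<bullet> x - \<beta>) *\<^sub>R n"] by simp
        then show ?thesis using r[OF that(1)] that(2) n by auto
      qed
      then show "G x \<le> indicator (cball 0 (r + 1)) x" by (auto simp: G_def split: split_indicator)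
    qed
    also have "\<dots> < \<infinity>" using emeasure_bounded_finite[of "cball (0::'a) (r+1)"] by simp
    finally have "(\<integral>\<^sup>+x. G x \<partial>lborel) < \<infinity>" .
    moreover have "(\<integral>\<^sup>+x. G x \<partial>lborel) = (\<integral>\<^sup>+y. \<integral>\<^sup>+s. G (y + s *\<^sub>R n) \<partial>lborel \<partial>?\<mu>)"
      by (rule nn_integral_flat_normal[OF n, symmetric]) measurable
    moreover have "(\<integral>\<^sup>+y. \<integral>\<^sup>+s. G (y + s *\<^sub>R n) \<partial>lborel \<partial>?\<mu>) \<ge> emeasure ?\<mu> (S \<inter> {x. n \<bullet> x = \<beta>})"
    proof -
      have "emeasure ?\<mu> (S \<inter> {x. n \<bullet> x = \<beta>}) = (\<integral>\<^sup>+y. indicator (S \<inter> {x. n \<bullet> x = \<beta>}) y \<partial>?\<mu>)"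
        by (subst nn_integral_indicator) auto
      also have "\<dots> \<le> (\<integral>\<^sup>+y. \<integral>\<^sup>+s. G (y + s *\<^sub>R n) \<partial>lborel \<partial>?\<mu>)"
      proof (rule nn_integral_mono)
        fix y :: 'a
        have nn: "n \<bullet> n = 1" using n by (simp add: dot_square_norm)
        show "indicator (S \<inter> {x. n \<bullet> x = \<beta>}) y \<le> (\<integral>\<^sup>+s. G (y + s *\<^sub>R n) \<partial>lborel)"
        proof (cases "y \<in> S \<inter> {x. n \<bullet> x = \<beta>}")
          case True
          then have "G (y + s *\<^sub>R n) = indicator {0..1} s" for s
            using nn by (simp add: G_def inner_add_right algebra_simps split: split_indicator)
          then show ?thesis using True by simp
        qed simp
      qed
      finally show ?thesis .
    qed
    moreover have "emeasure ?\<mu> (S \<inter> {x. n \<bullet> x = \<beta>}) = emeasure ?\<mu> S"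
    proof (rule emeasure_eq_AE)
      show "AE x in ?\<mu>. (x \<in> S \<inter> {x. n \<bullet> x = \<beta>}) = (x \<in> S)"
        using AE_flat_lborel_mem[OF n, of \<beta>] by eventually_elim simp
    qed auto
    ultimately show ?thesis by (metis order.strict_trans1)
  qed
  then show "bounded S \<Longrightarrow> S \<in> sets borel \<Longrightarrow> emeasure ?\<mu> S < \<infinity>" by blast
  show "sigma_finite_measure ?\<mu>"
  proof (rule sigma_finite_measure.intro, intro exI[of _ "range (\<lambda>i::nat. ball 0 (real i))"] conjI ballI)
    show "\<Union> (range (\<lambda>i::nat. ball (0::'a) (real i))) = space ?\<mu>"
      using reals_Archimedean2 by auto
    fix A assume "A \<in> range (\<lambda>i::nat. ball (0::'a) (real i))"
    then show "emeasure ?\<mu> A \<noteq> \<infinity>" using fin[of A] by auto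
  qed auto
qed

text \<open>Write \<open>e = w + (n \<bullet> e) n\<close> with \<open>w\<close> parallel to the hyperplane.  The component \<open>w\<close> shifts each slice
within its hyperplane and does not change the integral over it; the normal component rescales the
height by \<open>n \<bullet> e\<close>.\<close>

lemma nn_integral_flat_oblique:
  fixes n e :: "'a::euclidean_space"
  assumes n: "norm n = 1" and c: "n \<bullet> e \<noteq> 0" and [measurable]: "G \<in> borel_measurable borel"
  shows "(\<integral>\<^sup>+x. G x \<partial>lborel)
    = ennreal \<bar>n \<bullet> e\<bar> * (\<integral>\<^sup>+y. \<integral>\<^sup>+s. G (y + s *\<^sub>R e) \<partial>lborel \<partial>flat_lborel {x. n \<bullet> x = \<beta>})"
proof -
  let ?\<mu> = "flat_lborel {x. n \<bullet> x = \<beta>}"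
  define c where "c = n \<bullet> e"
  define w where "w = e - c *\<^sub>R n"
  have nn: "n \<bullet> n = 1" using n by (simp add: dot_square_norm)
  have w: "n \<bullet> w = 0" by (simp add: w_def c_def inner_diff_right nn)
  interpret f: sigma_finite_measure ?\<mu> by (rule sigma_finite_flat_lborel[OF n])
  interpret pair_sigma_finite ?\<mu> "lborel :: real measure" ..
  have cs: "(\<integral>\<^sup>+s. G (y + s *\<^sub>R n) \<partial>lborel) = ennreal \<bar>c\<bar> * (\<integral>\<^sup>+s. G (y + (c * s) *\<^sub>R n) \<partial>lborel)" for y
    using nn_integral_real_affine[of "\<lambda>s. G (y + s *\<^sub>R n)" c 0] c by (simp add: c_def)
  have "(\<integral>\<^sup>+y. \<integral>\<^sup>+s. G (y + s *\<^sub>R e) \<partial>lborel \<partial>?\<mu>) = (\<integral>\<^sup>+s. \<integral>\<^sup>+y. G (y + s *\<^sub>R e) \<partial>?\<mu> \<partial>lborel)"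
    by (rule Fubini'[symmetric]) measurable
  also have "\<dots> = (\<integral>\<^sup>+s. \<integral>\<^sup>+y. G (y + (c * s) *\<^sub>R n) \<partial>?\<mu> \<partial>lborel)"
  proof (rule nn_integral_cong)
    fix s :: real
    have "(\<integral>\<^sup>+y. G (y + (c * s) *\<^sub>R n) \<partial>?\<mu>) = (\<integral>\<^sup>+y. G ((y + s *\<^sub>R w) + (c * s) *\<^sub>R n) \<partial>?\<mu>)"
      by (rule nn_integral_flat_translate[OF n, symmetric]) (use w in auto)
    also have "\<dots> = (\<integral>\<^sup>+y. G (y + s *\<^sub>R e) \<partial>?\<mu>)"
      by (simp add: w_def algebra_simps)
    finally show "(\<integral>\<^sup>+y. G (y + s *\<^sub>R e) \<partial>?\<mu>) = (\<integral>\<^sup>+y. G (y + (c * s) *\<^sub>R n) \<partial>?\<mu>)" ..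
  qed
  also have "\<dots> = (\<integral>\<^sup>+y. \<integral>\<^sup>+s. G (y + (c * s) *\<^sub>R n) \<partial>lborel \<partial>?\<mu>)"
    by (rule Fubini') measurable
  finally have "ennreal \<bar>c\<bar> * (\<integral>\<^sup>+y. \<integral>\<^sup>+s. G (y + s *\<^sub>R e) \<partial>lborel \<partial>?\<mu>)
      = (\<integral>\<^sup>+y. ennreal \<bar>c\<bar> * (\<integral>\<^sup>+s. G (y + (c * s) *\<^sub>R n) \<partial>lborel) \<partial>?\<mu>)"
    by (subst nn_integral_cmult) simp_all
  also have "\<dots> = (\<integral>\<^sup>+y. \<integral>\<^sup>+s. G (y + s *\<^sub>R n) \<partial>lborel \<partial>?\<mu>)"
    by (simp add: cs)
  also have "\<dots> = (\<integral>\<^sup>+x. G x \<partial>lborel)" by (rule nn_integral_flat_normal[OF n]) measurable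
  finally show ?thesis by (simp add: c_def)
qed

text \<open>Each line parallel to \<open>e\<close> meets the slab \<open>{x. x \<bullet> e \<in> {0..1}}\<close> in a segment of length one, so the
volume of the slab measures sets of such lines without a choice of coordinates on the orthogonal
complement of \<open>e\<close>.  Moving the points of the slab along \<open>e\<close> to the hyperplane turns this volume into
\<open>\<bar>n \<bullet> e\<bar>\<close> times the measure of the hyperplane: a piece of the hyperplane is seen along \<open>e\<close> with its
area multiplied by \<open>\<bar>n \<bullet> e\<bar>\<close>.\<close>

lemma flat_lborel_shadow:
  fixes n e :: "'a::euclidean_space"
  assumes n: "norm n = 1" and e: "norm e = 1" and c: "n \<bullet> e \<noteq> 0"
  shows "distr (density lborel (indicator {x. x \<bullet> e \<in> {0..1}})) borel (\<lambda>x. x + ((\<beta> - n \<bullet> x) / (n \<bullet> e)) *\<^sub>R e)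
    = density (flat_lborel {x. n \<bullet> x = \<beta>}) (\<lambda>_. ennreal \<bar>n \<bullet> e\<bar>)" (is "distr (density _ (indicator ?Q)) _ ?p = _")
proof (rule measure_eqI)
  let ?\<mu> = "flat_lborel {x. n \<bullet> x = \<beta>}"
  fix A assume "A \<in> sets (distr (density lborel (indicator ?Q)) borel ?p)"
  then have [measurable]: "A \<in> sets borel" by simp
  have ee: "e \<bullet> e = 1" using e by (simp add: dot_square_norm)
  have "emeasure (distr (density lborel (indicator ?Q)) borel ?p) A
      = (\<integral>\<^sup>+x. indicator ?Q x * indicator A (?p x) \<partial>lborel)"
  proof -
    have m: "?p \<in> borel_measurable borel" by measurable
    have "emeasure (distr (density lborel (indicator ?Q)) borel ?p) A = emeasure (density lborel (indicator ?Q)) (?p -` A)"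
      by (subst emeasure_distr) auto
    also have "\<dots> = (\<integral>\<^sup>+x. indicator ?Q x * indicator (?p -` A) x \<partial>lborel)"
      using measurable_sets[OF m, of A] by (intro emeasure_density) auto
    finally show ?thesis by (simp add: indicator_def)
  qed
  also have "\<dots> = ennreal \<bar>n \<bullet> e\<bar> * (\<integral>\<^sup>+y. \<integral>\<^sup>+s. indicator ?Q (y + s *\<^sub>R e) * indicator A (?p (y + s *\<^sub>R e)) \<partial>lborel \<partial>?\<mu>)"
    by (rule nn_integral_flat_oblique[OF n c]) measurable
  also have "(\<integral>\<^sup>+y. \<integral>\<^sup>+s. indicator ?Q (y + s *\<^sub>R e) * indicator A (?p (y + s *\<^sub>R e)) \<partial>lborel \<partial>?\<mu>)
      = (\<integral>\<^sup>+y. indicator A y \<partial>?\<mu>)"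
  proof (rule nn_integral_cong_AE)
    show "AE y in ?\<mu>. (\<integral>\<^sup>+s. indicator ?Q (y + s *\<^sub>R e) * indicator A (?p (y + s *\<^sub>R e)) \<partial>lborel) = indicator A y"
      using AE_flat_lborel_mem[OF n, of \<beta>]
    proof (rule AE_mp, intro AE_I2 impI)
      fix y assume y: "n \<bullet> y = \<beta>"
      have "?p (y + s *\<^sub>R e) = y" for s using y c by (simp add: inner_add_right)
      moreover have "(indicator ?Q (y + s *\<^sub>R e) :: ennreal) = indicator {- (y \<bullet> e)..1 - y \<bullet> e} s" for s
        by (auto simp: inner_add_left ee split: split_indicator)
      ultimately have "(\<integral>\<^sup>+s. indicator ?Q (y + s *\<^sub>R e) * indicator A (?p (y + s *\<^sub>R e)) \<partial>lborel)
          = (\<integral>\<^sup>+s. indicator {- (y \<bullet> e)..1 - y \<bullet> e} s * indicator A y \<partial>lborel)"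
        by (simp only:)
      then show "(\<integral>\<^sup>+s. indicator ?Q (y + s *\<^sub>R e) * indicator A (?p (y + s *\<^sub>R e)) \<partial>lborel) = indicator A y"
        by (simp add: nn_integral_multc)
    qed
  qed
  finally show "emeasure (distr (density lborel (indicator ?Q)) borel ?p) A = emeasure (density ?\<mu> (\<lambda>_. ennreal \<bar>n \<bullet> e\<bar>)) A"
    by (simp add: emeasure_density nn_integral_cmult)
qed simp

text \<open>What holds at almost every point of a hyperplane holds at the point where the line through \<open>x\<close>
parallel to \<open>e\<close> meets it, for almost every \<open>x\<close> in the slab.\<close>

lemma AE_shadow:
  fixes n e :: "'a::euclidean_space"
  assumes n: "norm n = 1" and e: "norm e = 1" and c: "n \<bullet> e \<noteq> 0"
    and P: "AE y in flat_lborel {x. n \<bullet> x = \<beta>}. P y"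
  shows "AE x in lborel. x \<bullet> e \<in> {0..1} \<longrightarrow> P (x + ((\<beta> - n \<bullet> x) / (n \<bullet> e)) *\<^sub>R e)"
proof -
  let ?\<mu> = "flat_lborel {x. n \<bullet> x = \<beta>}"
  let ?Q = "{x. x \<bullet> e \<in> {0..1}}"
  let ?p = "\<lambda>x. x + ((\<beta> - n \<bullet> x) / (n \<bullet> e)) *\<^sub>R e"
  obtain N where N: "{y \<in> space ?\<mu>. \<not> P y} \<subseteq> N" "emeasure ?\<mu> N = 0" "N \<in> sets ?\<mu>"
    by (rule AE_E[OF P]) blast
  have [measurable]: "N \<in> sets borel" using N by simp
  have "AE y in ?\<mu>. y \<notin> N" using N by (intro AE_not_in) (simp add: null_sets_def)
  then have "AE y in density ?\<mu> (\<lambda>_. ennreal \<bar>n \<bullet> e\<bar>). y \<notin> N"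
    by (subst AE_density) simp_all
  then have "AE y in distr (density lborel (indicator ?Q)) borel ?p. y \<notin> N"
    unfolding flat_lborel_shadow[OF n e c] .
  then have "AE x in density lborel (indicator ?Q). ?p x \<notin> N"
    by (subst (asm) AE_distr_iff) simp_all
  then have "AE x in lborel. 0 < (indicator ?Q x :: ennreal) \<longrightarrow> ?p x \<notin> N"
    by (subst (asm) AE_density) simp_all
  then show ?thesis
  proof (rule eventually_mono, intro impI)
    fix x assume "0 < (indicator ?Q x :: ennreal) \<longrightarrow> ?p x \<notin> N" "x \<bullet> e \<in> {0..1}"
    then have "?p x \<notin> N" by simp
    then show "P (?p x)" using N(1) by auto
  qed
qed

lemma integral_shadow:
  fixes n e :: "'a::euclidean_space" and h :: "'a \<Rightarrow> real"
  assumes n: "norm n = 1" and e: "norm e = 1" and c: "n \<bullet> e \<noteq> 0"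
    and h[measurable]: "h \<in> borel_measurable borel"
  shows "(LINT x|lborel. indicator {x. x \<bullet> e \<in> {0..1}} x * h (x + ((\<beta> - n \<bullet> x) / (n \<bullet> e)) *\<^sub>R e))
    = \<bar>n \<bullet> e\<bar> * (LINT y|flat_lborel {x. n \<bullet> x = \<beta>}. h y)" (is "?I = ?J")
    and "integrable (flat_lborel {x. n \<bullet> x = \<beta>}) h \<Longrightarrow>
      integrable lborel (\<lambda>x. indicator {x. x \<bullet> e \<in> {0..1}} x * h (x + ((\<beta> - n \<bullet> x) / (n \<bullet> e)) *\<^sub>R e))"
proof -
  let ?\<mu> = "flat_lborel {x. n \<bullet> x = \<beta>}"
  let ?Q = "{x. x \<bullet> e \<in> {0..1}}"
  let ?p = "\<lambda>x. x + ((\<beta> - n \<bullet> x) / (n \<bullet> e)) *\<^sub>R e"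
  have d: "density lborel (indicator ?Q) = density lborel (\<lambda>x. ennreal (indicator ?Q x))"
    by (simp add: ennreal_indicator)
  have p[measurable]: "?p \<in> measurable (density lborel (\<lambda>x. ennreal (indicator ?Q x))) borel" by measurable
  have p': "(\<lambda>x. h (?p x)) \<in> borel_measurable lborel" by measurable
  have "?I = (LINT x|density lborel (indicator ?Q). h (?p x))"
    unfolding d using integral_density[OF p', of "indicator ?Q"] by simp
  also have "\<dots> = (LINT y|distr (density lborel (indicator ?Q)) borel ?p. h y)"
    unfolding d using integral_distr[OF p h] by simp
  also have "\<dots> = ?J"
    unfolding flat_lborel_shadow[OF n e c] using integral_density[of h ?\<mu> "\<lambda>_. \<bar>n \<bullet> e\<bar>"] by simp
  finally show "?I = ?J" .
  assume "integrable ?\<mu> h"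
  then have "integrable (density ?\<mu> (\<lambda>_. ennreal \<bar>n \<bullet> e\<bar>)) h"
    using integrable_density[of h ?\<mu> "\<lambda>_. \<bar>n \<bullet> e\<bar>"] by simp
  then have "integrable (density lborel (\<lambda>x. ennreal (indicator ?Q x))) (\<lambda>x. h (?p x))"
    unfolding flat_lborel_shadow[OF n e c, symmetric] d using integrable_distr_eq[OF p h] by simp
  then show "integrable lborel (\<lambda>x. indicator ?Q x * h (?p x))"
    using integrable_density[OF p', of "indicator ?Q"] by simp
qed

lemma set_integrable_flat_compact:
  fixes n :: "'a::euclidean_space" and h :: "'a \<Rightarrow> 'b::euclidean_space"
  assumes n: "norm n = 1" and F: "compact F" "continuous_on F h"
  shows "set_integrable (flat_lborel {x. n \<bullet> x = \<beta>}) F h"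
  unfolding set_integrable_def
proof -
  obtain B where B: "\<And>x. x \<in> F \<Longrightarrow> norm (h x) \<le> B"
    using compact_imp_bounded[OF compact_continuous_image[OF F(2,1)]] unfolding bounded_iff by blast
  have Fs: "F \<in> sets borel" using F(1) by (rule borel_compact)
  show "integrable (flat_lborel {x. n \<bullet> x = \<beta>}) (\<lambda>x. indicator F x *\<^sub>R h x)"
  proof (rule integrableI_bounded_set[where A = F and B = B])
    show "(\<lambda>x. indicator F x *\<^sub>R h x) \<in> borel_measurable (flat_lborel {x. n \<bullet> x = \<beta>})"
      using borel_measurable_continuous_on_indicator[OF Fs F(2)] by simp
    show "emeasure (flat_lborel {x. n \<bullet> x = \<beta>}) F < \<infinity>"
      by (rule sigma_finite_flat_lborel(2)[OF n compact_imp_bounded[OF F(1)] Fs])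
  qed (use Fs B in auto)
qed

lemma AE_lborel_hyperplane:
  fixes n :: "'a::euclidean_space"
  assumes "n \<noteq> 0"
  shows "AE x in lborel. n \<bullet> x \<noteq> \<beta>"
proof -
  have "closed {x. n \<bullet> x = \<beta>}" by (rule closed_hyperplane)
  then have 1: "{x. n \<bullet> x = \<beta>} \<in> sets borel" by (rule borel_closed)
  have "negligible {x. n \<bullet> x = \<beta>}" using assms by (intro negligible_hyperplane) simp
  then have "{x. n \<bullet> x = \<beta>} \<in> null_sets lborel"
    using 1 by (simp add: negligible_iff_null_sets null_sets_completion_iff)
  then show ?thesis by (intro AE_I') auto
qed

section \<open>Integration along parallel lines\<close>

text \<open>Integrating a function over the lines through all points of the slab \<open>{x. x \<bullet> e \<in> {0..1}}\<close> counts
each point with weight one, since it is reached from a segment of length one.\<close>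

lemma integral_lborel_lines:
  fixes e :: "'a::euclidean_space" and g :: "'a \<Rightarrow> real"
  assumes e: "norm e = 1" and g: "integrable lborel g"
  shows "(LINT x|lborel. g x) = (LINT x|lborel. indicator {x. x \<bullet> e \<in> {0..1}} x * (LINT s|lborel. g (x + s *\<^sub>R e)))"
proof -
  let ?Q = "{x. x \<bullet> e \<in> {0..1}}"
  have ee: "e \<bullet> e = 1" using e by (simp add: dot_square_norm)
  have gm[measurable]: "g \<in> borel_measurable borel" using g by auto
  have Qint: "(\<integral>\<^sup>+s. indicator ?Q (x - s *\<^sub>R e) \<partial>lborel) = 1" for x
  proof -
    have "(indicator ?Q (x - s *\<^sub>R e) :: ennreal) = indicator {x \<bullet> e - 1..x \<bullet> e} s" for s
      by (auto simp: inner_diff_left ee split: split_indicator)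
    then show ?thesis by simp
  qed
  have nn: "(\<integral>\<^sup>+x. \<integral>\<^sup>+s. indicator ?Q x * G (x + s *\<^sub>R e) \<partial>lborel \<partial>lborel) = (\<integral>\<^sup>+x. G x \<partial>lborel)"
    if [measurable]: "G \<in> borel_measurable borel" for G :: "'a \<Rightarrow> ennreal"
  proof -
    have "(\<integral>\<^sup>+x. \<integral>\<^sup>+s. indicator ?Q x * G (x + s *\<^sub>R e) \<partial>lborel \<partial>lborel)
        = (\<integral>\<^sup>+s. \<integral>\<^sup>+x. indicator ?Q x * G (x + s *\<^sub>R e) \<partial>lborel \<partial>lborel)"
      by (rule lborel_pair.Fubini'[symmetric]) measurable
    also have "\<dots> = (\<integral>\<^sup>+s. \<integral>\<^sup>+x. indicator ?Q (x - s *\<^sub>R e) * G x \<partial>lborel \<partial>lborel)"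
    proof (rule nn_integral_cong)
      fix s
      show "(\<integral>\<^sup>+x. indicator ?Q x * G (x + s *\<^sub>R e) \<partial>lborel) = (\<integral>\<^sup>+x. indicator ?Q (x - s *\<^sub>R e) * G x \<partial>lborel)"
        using nn_integral_lborel_translate[of "\<lambda>x. indicator ?Q x * G (x + s *\<^sub>R e)" "- s *\<^sub>R e"]
        by (simp add: algebra_simps)
    qed
    also have "\<dots> = (\<integral>\<^sup>+x. \<integral>\<^sup>+s. indicator ?Q (x - s *\<^sub>R e) * G x \<partial>lborel \<partial>lborel)"
      by (rule lborel_pair.Fubini') measurable
    also have "\<dots> = (\<integral>\<^sup>+x. G x \<partial>lborel)"
    proof (rule nn_integral_cong)
      fix x
      have "(\<integral>\<^sup>+s. indicator ?Q (x - s *\<^sub>R e) * G x \<partial>lborel) = (\<integral>\<^sup>+s. indicator ?Q (x - s *\<^sub>R e) \<partial>lborel) * G x"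
        by (rule nn_integral_multc) measurable
      then show "(\<integral>\<^sup>+s. indicator ?Q (x - s *\<^sub>R e) * G x \<partial>lborel) = G x"
        unfolding Qint by simp
    qed
    finally show ?thesis .
  qed
  let ?D = "density (lborel \<Otimes>\<^sub>M lborel) (\<lambda>z. ennreal (indicator ?Q (fst z))) :: ('a \<times> real) measure"
  have m1: "(\<lambda>z. fst z + snd z *\<^sub>R e) \<in> measurable ?D borel" by measurable
  have D: "distr ?D borel (\<lambda>z. fst z + snd z *\<^sub>R e) = lborel"
  proof (rule measure_eqI)
    fix A assume "A \<in> sets (distr ?D borel (\<lambda>z. fst z + snd z *\<^sub>R e))"
    then have [measurable]: "A \<in> sets borel" by simp
    have "emeasure (distr ?D borel (\<lambda>z. fst z + snd z *\<^sub>R e)) A = (\<integral>\<^sup>+z. indicator A z \<partial>distr ?D borel (\<lambda>z. fst z + snd z *\<^sub>R e))"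
      by simp
    also have "\<dots> = (\<integral>\<^sup>+z. indicator A (fst z + snd z *\<^sub>R e) \<partial>?D)"
      by (subst nn_integral_distr[OF m1]) (auto simp: case_prod_beta)
    also have "\<dots> = (\<integral>\<^sup>+z. indicator ?Q (fst z) * indicator A (fst z + snd z *\<^sub>R e) \<partial>(lborel \<Otimes>\<^sub>M lborel))"
      by (subst nn_integral_density) (auto simp: case_prod_beta ennreal_indicator)
    also have "\<dots> = (\<integral>\<^sup>+x. \<integral>\<^sup>+s. indicator ?Q x * indicator A (x + s *\<^sub>R e) \<partial>lborel \<partial>lborel)"
      by (subst lborel.nn_integral_fst[symmetric]) auto
    also have "\<dots> = emeasure lborel A" by (subst nn) auto
    finally show "emeasure (distr ?D borel (\<lambda>z. fst z + snd z *\<^sub>R e)) A = emeasure lborel A" .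
  qed simp
  have Dint: "integrable ?D (\<lambda>z. g (fst z + snd z *\<^sub>R e))"
    using g integrable_distr_eq[OF m1, of g] unfolding D by simp
  have int: "integrable (lborel \<Otimes>\<^sub>M lborel) (\<lambda>z. indicator ?Q (fst z) * g (fst z + snd z *\<^sub>R e))"
    using Dint integrable_density[of "\<lambda>z. g (fst z + snd z *\<^sub>R e)" "lborel \<Otimes>\<^sub>M lborel :: ('a \<times> real) measure" "\<lambda>z. indicator ?Q (fst z)"]
    by simp
  have "(LINT x|lborel. g x) = (LINT z|?D. g (fst z + snd z *\<^sub>R e))"
    using integral_distr[OF m1, of g] unfolding D by simp
  also have "\<dots> = (LINT z|(lborel \<Otimes>\<^sub>M lborel). indicator ?Q (fst z) * g (fst z + snd z *\<^sub>R e))"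
    using integral_density[of "\<lambda>z. g (fst z + snd z *\<^sub>R e)" "lborel \<Otimes>\<^sub>M lborel :: ('a \<times> real) measure" "\<lambda>z. indicator ?Q (fst z)"]
    by simp
  also have "\<dots> = (LINT x|lborel. LINT s|lborel. indicator ?Q x * g (x + s *\<^sub>R e))"
    using lborel_pair.integral_fst'[of "\<lambda>z. indicator ?Q (fst z) * g (fst z + snd z *\<^sub>R e)"] int by simp
  finally show ?thesis by simp
qed

text \<open>A bounded set \<open>A\<close> of reals that is locally constant away from finitely many points \<open>s i\<close> and is left
(\<open>\<sigma> i = 1\<close>) or entered (\<open>\<sigma> i = - 1\<close>) at each of them.  The function \<open>P\<close> on \<open>A\<close> and zero elsewhere has
the jump \<open>- \<sigma> i P (s i)\<close> at \<open>s i\<close>; adding the compensating step functions makes it a continuous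
primitive of \<open>1\<^sub>A P'\<close> off a finite set, which increases by \<open>\<Sum>i. \<sigma> i P (s i)\<close> from left to right.\<close>

lemma integral_derivative_crossings:
  fixes P P' :: "real \<Rightarrow> real" and s \<sigma> :: "'i \<Rightarrow> real"
  assumes I: "finite I" "inj_on s I" and A: "bounded A" "A \<in> sets borel"
    and P: "\<And>t. (P has_real_derivative P' t) (at t)" and P': "continuous_on UNIV P'"
    and off: "\<And>t. t \<notin> s ` I \<Longrightarrow> \<exists>e>0. \<forall>u. \<bar>u - t\<bar> < e \<longrightarrow> (u \<in> A \<longleftrightarrow> t \<in> A)"
    and \<sigma>: "\<And>i. i \<in> I \<Longrightarrow> \<sigma> i = 1 \<or> \<sigma> i = - 1"
    and on: "\<And>i. i \<in> I \<Longrightarrow> s i \<notin> A"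
    and crossing: "\<And>i. i \<in> I \<Longrightarrow> \<exists>e>0. \<forall>r\<in>{0<..<e}. s i - \<sigma> i * r \<in> A \<and> s i + \<sigma> i * r \<notin> A"
  shows "(LINT t|lborel. indicator A t * P' t) = (\<Sum>i\<in>I. \<sigma> i * P (s i))"
proof -
  \<comment> \<open>\<open>J i\<close> is the compensating step at \<open>s i\<close>; its value at \<open>s i\<close> itself makes \<open>W\<close> continuous, as \<open>s i \<notin> A\<close>\<close>
  define J where "J i u = (if s i < u \<or> (s i = u \<and> \<sigma> i = 1) then \<sigma> i * P (s i) else 0)" for i u
  define W where "W t = (if t \<in> A then P t else 0) + (\<Sum>i\<in>I. J i t)" for t
  have contP: "isCont P t" for t using P DERIV_isCont by blast
  have sep: "\<exists>d>0. \<forall>i\<in>I. s i \<noteq> t \<longrightarrow> d \<le> \<bar>s i - t\<bar>" for t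
  proof -
    obtain d where "d > 0" "\<forall>x\<in>s ` I. x \<noteq> t \<longrightarrow> d \<le> dist t x"
      using finite_set_avoid[OF finite_imageI[OF I(1)], of s t] by blast
    then show ?thesis by (intro exI[of _ d]) (simp add: dist_real_def abs_minus_commute)
  qed
  have evI: "\<forall>\<^sub>F u in nhds t. Q u" if "r > 0" "\<And>u. \<bar>u - t\<bar> < r \<Longrightarrow> Q u" for t r and Q :: "real \<Rightarrow> bool"
    using that unfolding eventually_nhds_metric dist_real_def by blast
  have Jloc: "J i u = J i t" if "s i \<noteq> t" "d \<le> \<bar>s i - t\<bar>" "\<bar>u - t\<bar> < d" for i u t d
    using that by (auto simp: J_def)
  have der: "(W has_real_derivative (if t \<in> A then P' t else 0)) (at t)" if t: "t \<notin> s ` I" for t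
  proof -
    obtain e where e: "e > 0" "\<And>u. \<bar>u - t\<bar> < e \<Longrightarrow> (u \<in> A \<longleftrightarrow> t \<in> A)" using off[OF t] by blast
    obtain d where d: "d > 0" "\<And>i. i \<in> I \<Longrightarrow> d \<le> \<bar>s i - t\<bar>" using sep[of t] t by (metis imageI)
    have "W u = (if t \<in> A then P u else 0) + (\<Sum>i\<in>I. J i t)" if u: "\<bar>u - t\<bar> < min e d" for u
    proof -
      have "(\<Sum>i\<in>I. J i u) = (\<Sum>i\<in>I. J i t)"
        using u d t by (intro sum.cong Jloc[where d = d]) auto
      then show ?thesis using e(2)[of u] u by (simp add: W_def)
    qed
    note loc = this
    have ev: "\<forall>\<^sub>F u in nhds t. W u = (if t \<in> A then P u else 0) + (\<Sum>i\<in>I. J i t)"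
      by (rule evI[of "min e d", OF _ loc]) (use e(1) d(1) in simp)
    show ?thesis
      by (subst DERIV_cong_ev[OF refl ev refl]) (auto intro!: derivative_eq_intros P)
  qed
  have cont: "isCont W t" for t
  proof (cases "t \<in> s ` I")
    case False
    then show ?thesis using der DERIV_isCont by blast
  next
    case True
    then obtain j where j: "j \<in> I" "t = s j" by auto
    obtain e where e: "e > 0" "\<And>r. r \<in> {0<..<e} \<Longrightarrow> s j - \<sigma> j * r \<in> A \<and> s j + \<sigma> j * r \<notin> A"
      using crossing[OF j(1)] by blast
    obtain d where d: "d > 0" "\<And>i. i \<in> I \<Longrightarrow> s i \<noteq> t \<Longrightarrow> d \<le> \<bar>s i - t\<bar>" using sep[of t] by blast
    \<comment> \<open>both sides of a crossing, for leaving and for entering, are covered by this one formula\<close>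
    have loc: "W u = W t + (if u \<in> A then P u - P t else 0)" if u: "\<bar>u - t\<bar> < min e d" for u
    proof -
      have "(\<Sum>i\<in>I - {j}. J i u) = (\<Sum>i\<in>I - {j}. J i t)"
        using u d j inj_onD[OF I(2)] by (intro sum.cong Jloc[where d = d]) auto
      moreover have "(\<Sum>i\<in>I. J i v) = J j v + (\<Sum>i\<in>I - {j}. J i v)" for v
        using I j by (simp add: sum.remove)
      moreover have "(if u \<in> A then P u else 0) + J j u = J j t + (if u \<in> A then P u - P t else 0)"
      proof (cases "u = t")
        case True then show ?thesis using on[OF j(1)] j by simp
      next
        case False
        show ?thesis using \<sigma>[OF j(1)] e(2)[of "\<bar>u - t\<bar>"] u False j by (auto simp: J_def abs_if split: if_splits)
      qed
      ultimately show ?thesis using on[OF j(1)] j by (simp add: W_def)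
    qed
    have "((\<lambda>u. if u \<in> A then P u - P t else 0) \<longlongrightarrow> 0) (at t)"
    proof (rule Lim_null_comparison)
      show "((\<lambda>u. \<bar>P u - P t\<bar>) \<longlongrightarrow> 0) (at t)"
        using contP[of t] by (simp add: isCont_def LIM_zero_iff tendsto_rabs_zero_iff)
    qed auto
    then have "((\<lambda>u. W t + (if u \<in> A then P u - P t else 0)) \<longlongrightarrow> W t + 0) (at t)"
      by (intro tendsto_intros)
    moreover have "\<forall>\<^sub>F u in at t. W u = W t + (if u \<in> A then P u - P t else 0)"
      by (rule evI[of "min e d", OF _ loc, THEN eventually_nhds_conv_at[THEN iffD1, THEN conjunct1]]) (use e(1) d(1) in simp)
    ultimately show ?thesis unfolding isCont_def by (simp add: tendsto_cong)
  qed
  obtain R0 where R0: "\<And>t. t \<in> A \<union> s ` I \<Longrightarrow> \<bar>t\<bar> \<le> R0"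
    using A I by (metis bounded_Un bounded_iff finite_imageI finite_imp_bounded real_norm_def)
  define R where "R = \<bar>R0\<bar> + 1"
  have R: "\<bar>t\<bar> < R" if "t \<in> A \<union> s ` I" for t using R0[OF that] by (simp add: R_def)
  have "R > 0" by (simp add: R_def)
  have "((\<lambda>t. if t \<in> A then P' t else 0) has_integral (W R - W (- R))) {- R..R}"
  proof (rule fundamental_theorem_of_calculus_strong[where S = "s ` I"])
    show "continuous_on {- R..R} W" using cont by (simp add: continuous_at_imp_continuous_on)
  qed (use I \<open>R > 0\<close> der in \<open>auto simp: has_real_derivative_iff_has_vector_derivative[symmetric]\<close>)
  moreover have "W R = (\<Sum>i\<in>I. \<sigma> i * P (s i))"
  proof -
    have "R \<notin> A" "\<And>i. i \<in> I \<Longrightarrow> s i < R" using R[of R] R by fastforce+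
    then show ?thesis by (simp add: W_def J_def)
  qed
  moreover have "W (- R) = 0"
  proof -
    have "- R \<notin> A" using R[of "- R"] \<open>R > 0\<close> by auto
    moreover have "J i (- R) = 0" if "i \<in> I" for i using R[of "s i"] that by (auto simp: J_def)
    ultimately show ?thesis by (simp add: W_def)
  qed
  moreover have indic: "(\<lambda>t. if t \<in> A then P' t else 0) = (\<lambda>t. indicator A t * P' t)"
    by (simp add: fun_eq_iff)
  ultimately have "((\<lambda>t. indicator A t * P' t) has_integral (\<Sum>i\<in>I. \<sigma> i * P (s i))) {- R..R}"
    by (simp add: indic)
  then have "((\<lambda>t. if t \<in> {- R..R} then indicator A t * P' t else 0) has_integral (\<Sum>i\<in>I. \<sigma> i * P (s i))) UNIV"
    by (simp only: has_integral_restrict_UNIV)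
  moreover have "(\<lambda>t. if t \<in> {- R..R} then indicator A t * P' t else 0) = (\<lambda>t. indicator A t * P' t)"
    using R by (force simp: fun_eq_iff indicator_def)
  ultimately have 1: "((\<lambda>t. indicator A t * P' t) has_integral (\<Sum>i\<in>I. \<sigma> i * P (s i))) UNIV" by simp
  have "set_integrable lborel {- R..R} P'"
    using P' by (intro borel_integrable_atLeastAtMost') (auto intro: continuous_on_subset)
  then have "set_integrable lborel A P'"
    by (rule set_integrable_subset) (use A R in \<open>force+\<close>)
  then have "integrable lborel (\<lambda>t. indicator A t * P' t)" by (simp add: set_integrable_def)
  from has_integral_integral_lborel[OF this] 1 show ?thesis by (rule has_integral_unique)
qed

section \<open>Functions that are polynomial along lines\<close>

lemma real_poly_zeros_null:
  fixes q :: "real poly"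
  assumes "q \<noteq> 0"
  shows "AE t in lborel. poly q t \<noteq> 0"
  using poly_roots_finite[OF assms] by (intro AE_I'[of "{t. poly q t = 0}"]) (auto intro: countable_imp_null_set_lborel countable_finite)

text \<open>A function that is polynomial in each variable separately and nonzero somewhere vanishes on a null
set.  Induction on the number of variables: if the last variable is frozen at the value it has at the
point \<open>f0\<close>, the remaining function is nonzero almost everywhere, and wherever this is the case the
polynomial in the last variable is nonzero and has finitely many roots.\<close>

lemma AE_PiM_poly_nonzero:
  fixes h :: "('i \<Rightarrow> real) \<Rightarrow> real"
  assumes "finite I" "h \<in> borel_measurable (\<Pi>\<^sub>M i\<in>I. lborel)"
    and "\<And>f i. f \<in> extensional I \<Longrightarrow> i \<in> I \<Longrightarrow> \<exists>q. \<forall>t. h (f(i := t)) = poly q t"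
    and "f0 \<in> extensional I" "h f0 \<noteq> 0"
  shows "AE f in (\<Pi>\<^sub>M i\<in>I. lborel). h f \<noteq> 0"
  using assms
proof (induction I arbitrary: h f0 rule: finite_induct)
  case empty
  then show ?case by (intro AE_I2) (auto simp: space_PiM_empty)
next
  case (insert i I)
  note [measurable] = insert.prems(1)
  interpret product_sigma_finite "\<lambda>i::'i. lborel :: real measure" by standard
  let ?M = "\<Pi>\<^sub>M j\<in>I. (lborel :: real measure)"
  have upd: "(\<lambda>f. f(i := t)) \<in> measurable ?M (\<Pi>\<^sub>M j\<in>insert i I. lborel)" for t
    by (intro measurable_fun_upd[where J = I]) auto
  have up1: "f(i := t) \<in> extensional (insert i I)" if "f \<in> extensional I" for f and t :: real
    using that by (auto simp: extensional_def)
  have "AE f in ?M. h (f(i := f0 i)) \<noteq> 0"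
  proof (rule insert.IH)
    show "(\<lambda>f. h (f(i := f0 i))) \<in> borel_measurable ?M"
      by (rule measurable_compose[OF upd]) measurable
    show "restrict f0 I \<in> extensional I" by simp
    have "(restrict f0 I)(i := f0 i) = f0"
      using insert.prems(3) by (auto simp: fun_eq_iff restrict_def extensional_def)
    then show "h ((restrict f0 I)(i := f0 i)) \<noteq> 0" using insert.prems(4) by simp
    fix f :: "'i \<Rightarrow> real" and j assume f: "f \<in> extensional I" and j: "j \<in> I"
    then have "i \<noteq> j" using insert.hyps by auto
    then have "f(j := t, i := f0 i) = f(i := f0 i, j := t)" for t by (auto simp: fun_eq_iff)
    moreover have "\<exists>q. \<forall>t. h (f(i := f0 i, j := t)) = poly q t"
      using insert.prems(2)[OF up1[OF f], of j "f0 i"] j by blast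
    ultimately show "\<exists>q. \<forall>t. h (f(j := t, i := f0 i)) = poly q t" by (simp only:)
  qed
  then have "AE f in ?M. (\<integral>\<^sup>+t. indicator {f. h f = 0} (f(i := t)) \<partial>lborel) = 0"
  proof (rule AE_mp, intro AE_I2 impI)
    fix f assume f: "f \<in> space ?M" and nz: "h (f(i := f0 i)) \<noteq> 0"
    have fe: "f \<in> extensional I" using f by (auto simp: space_PiM PiE_def)
    obtain q where q: "\<And>t. h (f(i := t)) = poly q t"
    proof -
      have "\<exists>q. \<forall>t. h (f(i := 0, i := t)) = poly q t"
        using insert.prems(2)[OF up1[OF fe, of 0], of i] by blast
      then show thesis using that by (simp only: fun_upd_upd) blast
    qed
    then have "q \<noteq> 0" using nz by auto
    then have "AE t in lborel. poly q t \<noteq> 0" by (rule real_poly_zeros_null)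
    then have "AE t in lborel. indicator {f. h f = 0} (f(i := t)) = (0::ennreal)"
      by (rule AE_mp) (auto simp: q)
    then show "(\<integral>\<^sup>+t. indicator {f. h f = 0} (f(i := t)) \<partial>lborel) = 0"
      by (subst nn_integral_cong_AE) auto
  qed
  then have "(\<integral>\<^sup>+f. (\<integral>\<^sup>+t. indicator {f. h f = 0} (f(i := t)) \<partial>lborel) \<partial>?M) = 0"
    by (subst nn_integral_cong_AE) auto
  moreover have m: "(\<lambda>f. indicator {f. h f = 0} f :: ennreal) \<in> borel_measurable (\<Pi>\<^sub>M j\<in>insert i I. lborel)"
    by measurable
  ultimately have "(\<integral>\<^sup>+f. indicator {f. h f = 0} f \<partial>(\<Pi>\<^sub>M j\<in>insert i I. lborel)) = 0"
    using product_nn_integral_insert[OF insert.hyps(1,2) m] by simp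
  then have "AE f in (\<Pi>\<^sub>M j\<in>insert i I. lborel). indicator {f. h f = 0} f = (0::ennreal)"
    using nn_integral_0_iff_AE[OF m] by simp
  then show ?case by (rule AE_mp) (auto intro!: AE_I2 simp: indicator_def split: if_splits)
qed

text \<open>The only property of polynomials in several variables that the vanishing arguments use; unlike the
explicit representation by coefficients it is invariant under affine substitutions.\<close>

definition line_poly :: "('a::real_vector \<Rightarrow> real) \<Rightarrow> bool" where
  "line_poly p \<longleftrightarrow> (\<forall>x v. \<exists>q. \<forall>t. p (x + t *\<^sub>R v) = poly q t)"

lemma line_poly_zero_on_open:
  fixes p :: "'a::real_normed_vector \<Rightarrow> real"
  assumes p: "line_poly p" and T: "open T" "T \<noteq> {}" and z: "\<And>x. x \<in> T \<Longrightarrow> p x = 0"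
  shows "p y = 0"
proof -
  obtain x where x: "x \<in> T" using T by blast
  obtain q where q: "\<And>t. p (x + t *\<^sub>R (y - x)) = poly q t" using p unfolding line_poly_def by blast
  have "open ((\<lambda>t. x + t *\<^sub>R (y - x)) -` T)"
    by (intro open_vimage T continuous_intros)
  moreover have "0 \<in> (\<lambda>t. x + t *\<^sub>R (y - x)) -` T" using x by simp
  ultimately have "infinite ((\<lambda>t. x + t *\<^sub>R (y - x)) -` T)"
    using finite_imp_not_open[of "(\<lambda>t. x + t *\<^sub>R (y - x)) -` T"] by blast
  moreover have "(\<lambda>t. x + t *\<^sub>R (y - x)) -` T \<subseteq> {t. poly q t = 0}" using z by (auto simp: q[symmetric])
  ultimately have "q = 0" using poly_roots_finite[of q] finite_subset by blast
  then show ?thesis using q[of 1] by simp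
qed

lemma line_poly_zero_on_hyperplane:
  fixes p :: "'a::euclidean_space \<Rightarrow> real"
  assumes n: "norm n = 1" and p: "line_poly p" "continuous_on UNIV p"
    and F: "F \<in> sets borel" "emeasure (flat_lborel {x. n \<bullet> x = \<beta>}) F > 0"
    and z: "AE x in flat_lborel {x. n \<bullet> x = \<beta>}. x \<in> F \<longrightarrow> p x = 0"
    and y: "n \<bullet> y = \<beta>"
  shows "p y = 0"
proof (rule ccontr)
  assume nz: "p y \<noteq> 0"
  let ?\<mu> = "flat_lborel {x. n \<bullet> x = \<beta>}"
  have [measurable]: "p \<in> borel_measurable borel" using p(2) by (rule borel_measurable_continuous_onI)
  obtain B a where B: "finite B" "pairwise orthogonal B" "\<And>b. b \<in> B \<Longrightarrow> norm b = 1"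
    "\<And>b. b \<in> B \<Longrightarrow> n \<bullet> b = 0" "span B = {w. n \<bullet> w = 0}" "card B = DIM('a) - 1" "n \<bullet> a = \<beta>"
    and eq: "?\<mu> = distr (\<Pi>\<^sub>M b\<in>B. lborel) borel (\<lambda>f. a + (\<Sum>b\<in>B. f b *\<^sub>R b))"
    using flat_lborel_hyperplane[OF n, of \<beta>] by blast
  have "y - a \<in> span B" using y B by (simp add: inner_diff_right)
  then obtain c where c: "y - a = (\<Sum>b\<in>B. c b *\<^sub>R b)" using B(1) by (auto simp: span_finite)
  have "AE f in (\<Pi>\<^sub>M b\<in>B. lborel). p (a + (\<Sum>b\<in>B. f b *\<^sub>R b)) \<noteq> 0"
  proof (rule AE_PiM_poly_nonzero[OF B(1)])
    show "(\<lambda>f. p (a + (\<Sum>b\<in>B. f b *\<^sub>R b))) \<in> borel_measurable (\<Pi>\<^sub>M b\<in>B. lborel)" by measurable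
    show "restrict c B \<in> extensional B" by simp
    have "a + (\<Sum>b\<in>B. restrict c B b *\<^sub>R b) = y" using c by (simp add: algebra_simps)
    then show "p (a + (\<Sum>b\<in>B. restrict c B b *\<^sub>R b)) \<noteq> 0" using nz by simp
    fix f b assume b: "b \<in> B"
    have "(\<Sum>b'\<in>B. (f(b := t)) b' *\<^sub>R b') = (\<Sum>b'\<in>B - {b}. f b' *\<^sub>R b') + t *\<^sub>R b" for t
      using B(1) b by (simp add: sum.remove[of B b] add.commute cong: sum.cong_simp)
    then show "\<exists>q. \<forall>t. p (a + (\<Sum>b'\<in>B. (f(b := t)) b' *\<^sub>R b')) = poly q t"
      using p(1)[unfolded line_poly_def, rule_format, of "a + (\<Sum>b'\<in>B - {b}. f b' *\<^sub>R b')" b] by (simp add: add.assoc)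
  qed
  then have "AE x in ?\<mu>. p x \<noteq> 0" unfolding eq by (subst AE_distr_iff) auto
  with z have "AE x in ?\<mu>. x \<notin> F" by eventually_elim auto
  then have "emeasure ?\<mu> F = 0"
    using F(1) by (subst (asm) AE_iff_measurable[of F]) auto
  then show False using F(2) by simp
qed

section \<open>The divergence theorem on polyhedra\<close>

text \<open>Near a point \<open>y\<close> around which the frontier lies in a single face, each of the two half balls cut
off by the hyperplane of the face is connected and misses the frontier.  The normal direction decides
which one lies in \<open>T\<close>; every direction \<open>e\<close> with \<open>n \<bullet> e > 0\<close> then behaves like the normal.\<close>

lemma crossing_transversal:
  fixes n e :: "'a::euclidean_space"
  assumes F: "F \<subseteq> {x. n \<bullet> x = \<beta>}" and y: "y \<in> F"
    and \<delta>: "\<delta> > 0" "frontier T \<inter> ball y \<delta> \<subseteq> F"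
    and nrm: "norm n = 1" "\<epsilon> > 0" "\<And>s. s \<in> {0<..<\<epsilon>} \<Longrightarrow> y - s *\<^sub>R n \<in> T \<and> y + s *\<^sub>R n \<notin> T"
    and e: "norm e = 1" "n \<bullet> e > 0"
    and r: "0 < r" "r < \<delta>"
  shows "y - r *\<^sub>R e \<in> T \<and> y + r *\<^sub>R e \<notin> T"
proof -
  have ny: "n \<bullet> y = \<beta>" using F y by auto
  have nn: "n \<bullet> n = 1" using nrm by (simp add: dot_square_norm)
  define s where "s = min \<epsilon> \<delta> / 2"
  have s: "s \<in> {0<..<\<epsilon>}" "0 < s" "s < \<delta>" using \<delta> nrm by (auto simp: s_def)
  let ?L = "ball y \<delta> \<inter> {z. n \<bullet> z < \<beta>}" and ?U = "ball y \<delta> \<inter> {z. n \<bullet> z > \<beta>}"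
  have cL: "connected ?L" and cU: "connected ?U"
    by (intro convex_connected convex_Int convex_ball convex_halfspace_lt convex_halfspace_gt)+
  have fr: "?L \<inter> frontier T = {}" "?U \<inter> frontier T = {}" using \<delta> F by auto
  have "y - s *\<^sub>R n \<in> ?L" "y + s *\<^sub>R n \<in> ?U"
    using s nrm(1) by (auto simp: dist_norm inner_diff_right inner_add_right ny nn)
  then have "?L \<inter> T \<noteq> {}" "?U - T \<noteq> {}" using nrm(3)[OF s(1)] by blast+
  then have "?L \<subseteq> T" "?U \<inter> T = {}"
    using connected_Int_frontier[OF cL, of T] connected_Int_frontier[OF cU, of T] fr by blast+
  moreover have "y - r *\<^sub>R e \<in> ?L" "y + r *\<^sub>R e \<in> ?U"
    using r e by (auto simp: dist_norm inner_diff_right inner_add_right ny)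
  ultimately show ?thesis by blast
qed

text \<open>The divergence theorem for one component: \<open>h'\<close> is the derivative of \<open>h\<close> in the direction \<open>e\<close>.
The faces may overlap in null sets, and their unit normals need to point outwards at almost every
point only.\<close>

theorem divergence_theorem_direction:
  fixes T :: "'a::euclidean_space set" and \<F> :: "'a set set" and n :: "'a set \<Rightarrow> 'a"
    and h h' :: "'a \<Rightarrow> real" and e :: 'a
  assumes T: "open T" "bounded T"
    and fin: "finite \<F>" and front: "frontier T = \<Union>\<F>"
    and cl: "\<And>F. F \<in> \<F> \<Longrightarrow> closed F"
    and plane: "\<And>F. F \<in> \<F> \<Longrightarrow> F \<subseteq> {x. n F \<bullet> x = \<beta> F}"
    and nrm: "\<And>F. F \<in> \<F> \<Longrightarrow> norm (n F) = 1"
    and overlap: "\<And>F F'. F \<in> \<F> \<Longrightarrow> F' \<in> \<F> \<Longrightarrow> F \<noteq> F' \<Longrightarrow> emeasure (flat_lborel {x. n F \<bullet> x = \<beta> F}) (F \<inter> F') = 0"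
    and outward: "\<And>F. F \<in> \<F> \<Longrightarrow> AE x in flat_lborel {x. n F \<bullet> x = \<beta> F}. x \<in> F \<longrightarrow>
        (\<exists>\<epsilon>>0. \<forall>s\<in>{0<..<\<epsilon>}. x - s *\<^sub>R n F \<in> T \<and> x + s *\<^sub>R n F \<notin> T)"
    and e: "norm e = 1"
    and h: "continuous_on UNIV h" and h': "continuous_on UNIV h'"
    and deriv: "\<And>x t. ((\<lambda>t. h (x + t *\<^sub>R e)) has_real_derivative h' (x + t *\<^sub>R e)) (at t)"
  shows "(LINT x:T|lborel. h' x) = (\<Sum>F\<in>\<F>. (n F \<bullet> e) * (LINT x:F|flat_lborel {x. n F \<bullet> x = \<beta> F}. h x))"
proof -
  define \<mu> where "\<mu> F = flat_lborel {x. n F \<bullet> x = \<beta> F}" for F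
  define G where "G = {F \<in> \<F>. n F \<bullet> e \<noteq> 0}"
  define \<pi> where "\<pi> F x = x + ((\<beta> F - n F \<bullet> x) / (n F \<bullet> e)) *\<^sub>R e" for F x
  \<comment> \<open>a point of \<open>F\<close> is good if the normal there points outwards and no other face contains it\<close>
  define good where "good F y \<longleftrightarrow> (y \<in> F \<longrightarrow>
      (\<exists>\<epsilon>>0. \<forall>s\<in>{0<..<\<epsilon>}. y - s *\<^sub>R n F \<in> T \<and> y + s *\<^sub>R n F \<notin> T) \<and> (\<forall>F'\<in>\<F> - {F}. y \<notin> F'))" for F y
  let ?Q = "{x. x \<bullet> e \<in> {0..1}}"
  have GF: "F \<in> \<F>" "n F \<bullet> e \<noteq> 0" if "F \<in> G" for F using that by (auto simp: G_def)
  have finG: "finite G" using fin by (simp add: G_def)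
  have comp: "compact F" if "F \<in> \<F>" for F
  proof -
    have "F \<subseteq> closure T" using front that by (auto simp: frontier_def)
    then show ?thesis using cl[OF that] bounded_subset[OF bounded_closure[OF T(2)]] compact_eq_bounded_closed by blast
  qed
  have good: "AE y in \<mu> F. good F y" if F: "F \<in> \<F>" for F
  proof -
    have "AE y in \<mu> F. \<forall>F'\<in>\<F> - {F}. y \<notin> F \<inter> F'"
    proof (subst AE_finite_all)
      show "finite (\<F> - {F})" using fin by simp
      show "\<forall>F'\<in>\<F> - {F}. AE y in \<mu> F. y \<notin> F \<inter> F'"
      proof
        fix F' assume F': "F' \<in> \<F> - {F}"
        have "F \<inter> F' \<in> null_sets (\<mu> F)"
          using overlap[OF F, of F'] F' cl[OF F] cl[of F'] by (auto simp: \<mu>_def null_sets_def intro!: borel_closed)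
        then show "AE y in \<mu> F. y \<notin> F \<inter> F'" by (rule AE_not_in)
      qed
    qed
    with outward[OF F] show ?thesis unfolding good_def \<mu>_def by eventually_elim auto
  qed
  \<comment> \<open>faces parallel to \<open>e\<close> are met by a null set of lines only\<close>
  have AEgood: "AE x in lborel. x \<in> ?Q \<longrightarrow> (\<forall>F\<in>G. good F (\<pi> F x)) \<and> (\<forall>F\<in>\<F> - G. n F \<bullet> x \<noteq> \<beta> F)"
  proof -
    have "AE x in lborel. \<forall>F\<in>G. x \<bullet> e \<in> {0..1} \<longrightarrow> good F (\<pi> F x)"
      unfolding AE_finite_all[OF finG] \<pi>_def
      using AE_shadow[OF nrm[OF GF(1)] e GF(2) good[OF GF(1), unfolded \<mu>_def]] by blast
    moreover have "AE x in lborel. \<forall>F\<in>\<F> - G. n F \<bullet> x \<noteq> \<beta> F"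
    proof -
      have "n F \<noteq> 0" if "F \<in> \<F>" for F using nrm[OF that] by auto
      then show ?thesis using fin by (subst AE_finite_all) (auto intro!: AE_lborel_hyperplane)
    qed
    ultimately show ?thesis by eventually_elim auto
  qed
  have line: "(LINT t|lborel. indicator T (x + t *\<^sub>R e) * h' (x + t *\<^sub>R e))
      = (\<Sum>F\<in>G. sgn (n F \<bullet> e) * (indicator F (\<pi> F x) * h (\<pi> F x)))"
    if g: "\<And>F. F \<in> G \<Longrightarrow> good F (\<pi> F x)" and par: "\<And>F. F \<in> \<F> - G \<Longrightarrow> n F \<bullet> x \<noteq> \<beta> F" for x
  proof -
    define A where "A = {t. x + t *\<^sub>R e \<in> T}"
    define s where "s F = (\<beta> F - n F \<bullet> x) / (n F \<bullet> e)" for F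
    define I where "I = {F \<in> G. \<pi> F x \<in> F}"
    have \<pi>s: "\<pi> F x = x + s F *\<^sub>R e" for F by (simp add: \<pi>_def s_def)
    have I: "F \<in> G" "F \<in> \<F>" "\<pi> F x \<in> F" if "F \<in> I" for F using that by (auto simp: I_def G_def)
    \<comment> \<open>the other faces are closed, so the frontier near a good point belongs to one face\<close>
    have clear: "\<exists>\<delta>>0. frontier T \<inter> ball (\<pi> F x) \<delta> \<subseteq> F" if F: "F \<in> I" for F
    proof -
      have "closed (\<Union>(\<F> - {F}))" using fin cl by (intro closed_Union) auto
      moreover have "\<pi> F x \<notin> \<Union>(\<F> - {F})" using g[OF I(1)[OF F]] I(3)[OF F] by (auto simp: good_def)
      ultimately obtain \<delta> where "\<delta> > 0" "ball (\<pi> F x) \<delta> \<subseteq> - \<Union>(\<F> - {F})"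
        by (metis openE open_Compl ComplI)
      then show ?thesis using front by (intro exI[of _ \<delta>]) auto
    qed
    \<comment> \<open>distinct faces are met at distinct parameters since good points lie in one face\<close>
    have "(LINT t|lborel. indicator A t * h' (x + t *\<^sub>R e)) = (\<Sum>F\<in>I. sgn (n F \<bullet> e) * h (x + s F *\<^sub>R e))"
    proof (rule integral_derivative_crossings[where P = "\<lambda>t. h (x + t *\<^sub>R e)" and s = s])
      show "finite I" using finG by (simp add: I_def)
      show "inj_on s I"
      proof (rule inj_onI, rule ccontr)
        fix F F' assume F: "F \<in> I" "F' \<in> I" "s F = s F'" "F \<noteq> F'"
        then have "\<pi> F x \<in> F'" using I(3)[OF F(2)] by (simp add: \<pi>s)
        then show False using g[OF I(1)[OF F(1)]] I F by (auto simp: good_def)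
      qed
      obtain R where R: "\<And>y. y \<in> T \<Longrightarrow> norm y \<le> R" using T(2) unfolding bounded_iff by blast
      have "\<bar>t\<bar> \<le> R + norm x" if "t \<in> A" for t
      proof -
        have "norm (t *\<^sub>R e) \<le> norm (x + t *\<^sub>R e) + norm x"
          using norm_triangle_ineq4[of "x + t *\<^sub>R e" x] by simp
        then show ?thesis using R[of "x + t *\<^sub>R e"] that e by (simp add: A_def)
      qed
      then show "bounded A" unfolding bounded_iff by auto
      have "open A" unfolding A_def using open_vimage[OF T(1), of "\<lambda>t. x + t *\<^sub>R e"]
        by (simp add: vimage_def continuous_on_add continuous_on_scaleR)
      then show "A \<in> sets borel" by simp
      show "((\<lambda>t. h (x + t *\<^sub>R e)) has_real_derivative h' (x + t *\<^sub>R e)) (at t)" for t by (rule deriv)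
      show "continuous_on UNIV (\<lambda>t. h' (x + t *\<^sub>R e))"
        by (intro continuous_on_compose2[OF h'] continuous_intros) auto
      fix t assume t: "t \<notin> s ` I"
      have nf: "x + t *\<^sub>R e \<notin> frontier T"
      proof
        assume "x + t *\<^sub>R e \<in> frontier T"
        then obtain F where F: "F \<in> \<F>" "x + t *\<^sub>R e \<in> F" using front by auto
        then have *: "n F \<bullet> x + t * (n F \<bullet> e) = \<beta> F" using plane[OF F(1)] by (auto simp: inner_add_right)
        show False
        proof (cases "F \<in> G")
          case True
          then have "t = s F" using * GF(2)[OF True] by (simp add: s_def field_simps)
          then show False using t F True by (auto simp: I_def \<pi>s)
        next
          case False
          then show False using par[of F] F * by (simp add: G_def)
        qed
      qed
      obtain S where S: "open S" "t \<in> S" "\<And>u. u \<in> S \<Longrightarrow> (u \<in> A \<longleftrightarrow> t \<in> A)"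
      proof (cases "t \<in> A")
        case True
        then show thesis using that[of A] \<open>open A\<close> by blast
      next
        case False
        have "open ((\<lambda>t. x + t *\<^sub>R e) -` (- closure T))" by (intro open_vimage continuous_intros) auto
        moreover have "x + t *\<^sub>R e \<notin> closure T"
          using nf False T(1) by (simp add: frontier_def A_def interior_open)
        ultimately show thesis using that[of "(\<lambda>t. x + t *\<^sub>R e) -` (- closure T)"] False closure_subset[of T]
          by (auto simp: A_def)
      qed
      then show "\<exists>\<epsilon>>0. \<forall>u. \<bar>u - t\<bar> < \<epsilon> \<longrightarrow> (u \<in> A \<longleftrightarrow> t \<in> A)"
        unfolding open_dist dist_real_def by blast
    next
      fix F assume F: "F \<in> I"
      have "n F \<bullet> e \<noteq> 0" using I(1)[OF F] GF by blast
      then show "sgn (n F \<bullet> e) = 1 \<or> sgn (n F \<bullet> e) = - 1" by (auto simp: sgn_if)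
      have "\<pi> F x \<in> frontier T" using I[OF F] front by auto
      then show "s F \<notin> A" using T(1) by (auto simp: A_def \<pi>s frontier_def interior_open)
      obtain \<delta> where \<delta>: "\<delta> > 0" "frontier T \<inter> ball (\<pi> F x) \<delta> \<subseteq> F" using clear[OF F] by blast
      obtain \<epsilon> where \<epsilon>: "\<epsilon> > 0" "\<And>r. r \<in> {0<..<\<epsilon>} \<Longrightarrow> \<pi> F x - r *\<^sub>R n F \<in> T \<and> \<pi> F x + r *\<^sub>R n F \<notin> T"
        using g[OF I(1)[OF F]] I(3)[OF F] unfolding good_def by blast
      define e' where "e' = sgn (n F \<bullet> e) *\<^sub>R e"
      have e': "norm e' = 1" "n F \<bullet> e' > 0"
        using e \<open>n F \<bullet> e \<noteq> 0\<close> by (auto simp: e'_def sgn_if)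
      have "\<pi> F x - r *\<^sub>R e' \<in> T \<and> \<pi> F x + r *\<^sub>R e' \<notin> T" if "r \<in> {0<..<\<delta>}" for r
        using crossing_transversal[OF plane[OF I(2)[OF F]] I(3)[OF F] \<delta> nrm[OF I(2)[OF F]] \<epsilon>(1) \<epsilon>(2) e'] that by auto
      then show "\<exists>\<delta>>0. \<forall>r\<in>{0<..<\<delta>}. s F - sgn (n F \<bullet> e) * r \<in> A \<and> s F + sgn (n F \<bullet> e) * r \<notin> A"
        using \<delta>(1) by (intro exI[of _ \<delta>]) (auto simp: A_def \<pi>s e'_def algebra_simps)
    qed
    also have "\<dots> = (\<Sum>F\<in>G. sgn (n F \<bullet> e) * (indicator F (\<pi> F x) * h (\<pi> F x)))"
      using finG by (intro sum.mono_neutral_cong_left) (auto simp: I_def \<pi>s)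
    finally show ?thesis by (simp add: A_def indicator_def)
  qed
  have intT: "integrable lborel (\<lambda>x. indicator T x * h' x)"
  proof -
    have "set_integrable lborel (closure T) h'"
      unfolding set_integrable_def using T(2) continuous_on_subset[OF h' subset_UNIV]
      by (intro borel_integrable_compact) (simp_all add: compact_closure)
    then have "set_integrable lborel T h'"
      by (rule set_integrable_subset) (use T(1) closure_subset in auto)
    then show ?thesis by (simp add: set_integrable_def)
  qed
  have hm[measurable]: "h \<in> borel_measurable borel" using h by (rule borel_measurable_continuous_onI)
  have FI: "integrable (\<mu> F) (\<lambda>x. indicator F x * h x)" if "F \<in> \<F>" for F
    using set_integrable_flat_compact[OF nrm[OF that] comp[OF that], of h] h
    by (auto simp: set_integrable_def \<mu>_def intro: continuous_on_subset)
  have Fm[measurable]: "F \<in> sets borel" if "F \<in> \<F>" for F using cl[OF that] by (rule borel_closed)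
  have Fhm: "(\<lambda>x. indicator F x * h x) \<in> borel_measurable borel" if "F \<in> \<F>" for F
    using Fm[OF that] by measurable
  have QI: "integrable lborel (\<lambda>x. indicator ?Q x * (indicator F (\<pi> F x) * h (\<pi> F x)))"
    and QE: "(LINT x|lborel. indicator ?Q x * (indicator F (\<pi> F x) * h (\<pi> F x)))
        = \<bar>n F \<bullet> e\<bar> * (LINT x|\<mu> F. indicator F x * h x)" if F: "F \<in> G" for F
    using integral_shadow[OF nrm[OF GF(1)[OF F]] e GF(2)[OF F] Fhm[OF GF(1)[OF F]], of "\<beta> F"] FI[OF GF(1)[OF F]]
    unfolding \<pi>_def \<mu>_def by blast+
  have "(LINT x:T|lborel. h' x) = (LINT x|lborel. indicator T x * h' x)"
    by (simp add: set_lebesgue_integral_def)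
  also have "\<dots> = (LINT x|lborel. indicator ?Q x * (LINT s|lborel. indicator T (x + s *\<^sub>R e) * h' (x + s *\<^sub>R e)))"
    by (rule integral_lborel_lines[OF e intT])
  also have "\<dots> = (LINT x|lborel. (\<Sum>F\<in>G. sgn (n F \<bullet> e) * (indicator ?Q x * (indicator F (\<pi> F x) * h (\<pi> F x)))))"
  proof (rule integral_cong_AE)
    show RHS: "(\<lambda>x. \<Sum>F\<in>G. sgn (n F \<bullet> e) * (indicator ?Q x * (indicator F (\<pi> F x) * h (\<pi> F x)))) \<in> borel_measurable lborel"
      using borel_measurable_integrable[OF QI] by (intro borel_measurable_sum borel_measurable_times[OF borel_measurable_const]) blast
    have [measurable]: "(\<lambda>x. indicator T x * h' x) \<in> borel_measurable borel" using intT by auto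
    have "(\<lambda>x. LINT s|lborel. (\<lambda>x. indicator T x * h' x) (x + s *\<^sub>R e)) \<in> borel_measurable lborel"
      by measurable
    then show "(\<lambda>x. indicator ?Q x * (LINT s|lborel. indicator T (x + s *\<^sub>R e) * h' (x + s *\<^sub>R e))) \<in> borel_measurable lborel"
      by (intro borel_measurable_times) auto
    show "AE x in lborel. indicator ?Q x * (LINT s|lborel. indicator T (x + s *\<^sub>R e) * h' (x + s *\<^sub>R e))
        = (\<Sum>F\<in>G. sgn (n F \<bullet> e) * (indicator ?Q x * (indicator F (\<pi> F x) * h (\<pi> F x))))"
      using AEgood
    proof (rule AE_mp, intro AE_I2 impI)
      fix x assume "x \<in> ?Q \<longrightarrow> (\<forall>F\<in>G. good F (\<pi> F x)) \<and> (\<forall>F\<in>\<F> - G. n F \<bullet> x \<noteq> \<beta> F)"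
      then show "indicator ?Q x * (LINT s|lborel. indicator T (x + s *\<^sub>R e) * h' (x + s *\<^sub>R e))
        = (\<Sum>F\<in>G. sgn (n F \<bullet> e) * (indicator ?Q x * (indicator F (\<pi> F x) * h (\<pi> F x))))"
        using line[of x] by (cases "x \<in> ?Q") simp_all
    qed
  qed
  also have "\<dots> = (\<Sum>F\<in>G. sgn (n F \<bullet> e) * (\<bar>n F \<bullet> e\<bar> * (LINT x|\<mu> F. indicator F x * h x)))"
  proof -
    have "(LINT x|lborel. (\<Sum>F\<in>G. sgn (n F \<bullet> e) * (indicator ?Q x * (indicator F (\<pi> F x) * h (\<pi> F x)))))
        = (\<Sum>F\<in>G. LINT x|lborel. sgn (n F \<bullet> e) * (indicator ?Q x * (indicator F (\<pi> F x) * h (\<pi> F x))))"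
      by (intro Bochner_Integration.integral_sum integrable_mult_right QI)
    also have "\<dots> = (\<Sum>F\<in>G. sgn (n F \<bullet> e) * (\<bar>n F \<bullet> e\<bar> * (LINT x|\<mu> F. indicator F x * h x)))"
      by (intro sum.cong refl) (simp only: integral_mult_right_zero QE)
    finally show ?thesis .
  qed
  also have "\<dots> = (\<Sum>F\<in>G. (n F \<bullet> e) * (LINT x:F|\<mu> F. h x))"
    by (simp add: set_lebesgue_integral_def mult.assoc[symmetric] sgn_mult_abs)
  also have "\<dots> = (\<Sum>F\<in>\<F>. (n F \<bullet> e) * (LINT x:F|\<mu> F. h x))"
    using fin by (intro sum.mono_neutral_left) (auto simp: G_def)
  finally show ?thesis by (simp add: \<mu>_def)
qed

section \<open>Riesz representation in finite dimension\<close>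

text \<open>Stated through a finite spanning set of the ambient space, so that it passes to subspaces.\<close>

definition fin_dim :: "'v::real_vector set \<Rightarrow> bool" where
  "fin_dim S \<longleftrightarrow> (\<exists>B. finite B \<and> S \<subseteq> span B)"

text \<open>Existence is the Gram--Schmidt process: a representer on the span of \<open>E\<close> is corrected by a multiple of
the component \<open>e'\<close> of the next vector that is \<open>g\<close>-orthogonal to that span.  The form and the functional
have to be well behaved on \<open>S\<close> only, since the integrals that define them are additive only for
integrable functions.\<close>

lemma riesz_representation:
  fixes S :: "'v::real_vector set" and g :: "'v \<Rightarrow> 'v \<Rightarrow> real" and L :: "'v \<Rightarrow> real"
  assumes S: "subspace S" "fin_dim S"
    and g_add: "\<And>x y z. x \<in> S \<Longrightarrow> y \<in> S \<Longrightarrow> z \<in> S \<Longrightarrow> g (x + y) z = g x z + g y z"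
    and g_scale: "\<And>c x z. x \<in> S \<Longrightarrow> z \<in> S \<Longrightarrow> g (c *\<^sub>R x) z = c * g x z"
    and g_sym: "\<And>x z. x \<in> S \<Longrightarrow> z \<in> S \<Longrightarrow> g x z = g z x"
    and g_definite: "\<And>x. x \<in> S \<Longrightarrow> g x x = 0 \<Longrightarrow> x = 0"
    and L_add: "\<And>x y. x \<in> S \<Longrightarrow> y \<in> S \<Longrightarrow> L (x + y) = L x + L y"
    and L_scale: "\<And>c x. x \<in> S \<Longrightarrow> L (c *\<^sub>R x) = c * L x"
  shows "\<exists>!p. p \<in> S \<and> (\<forall>q\<in>S. g p q = L q)"
proof (rule ex_ex1I)
  have g_add': "g z (x + y) = g z x + g z y" if "x \<in> S" "y \<in> S" "z \<in> S" for x y z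
    by (simp only: g_sym[OF that(3) subspace_add[OF S(1) that(1,2)]] g_add[OF that] g_sym[OF that(3,1)] g_sym[OF that(3,2)])
  have g_scale': "g z (c *\<^sub>R x) = c * g z x" if "x \<in> S" "z \<in> S" for c x z
    by (simp only: g_sym[OF that(2) subspace_scale[OF S(1) that(1)]] g_scale[OF that] g_sym[OF that(2,1)])
  obtain B where B: "finite B" "S \<subseteq> span B" using S(2) unfolding fin_dim_def by blast
  obtain E where E: "E \<subseteq> S" "independent E" "S \<subseteq> span E" by (rule basis_exists[of S])
  have finE: "finite E" using independent_span_bound[OF B(1) E(2)] E(1) B(2) by blast
  have "\<exists>p\<in>span E. \<forall>q\<in>span E. g p q = L q"
    if "finite E" "E \<subseteq> S" "\<And>x y. x \<in> S \<Longrightarrow> y \<in> S \<Longrightarrow> L (x + y) = L x + L y"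
      "\<And>c x. x \<in> S \<Longrightarrow> L (c *\<^sub>R x) = c * L x" for E L
    using that
  proof (induction E arbitrary: L rule: finite_induct)
    case empty
    have "0 \<in> S" using S(1) by (rule subspace_0)
    then have "g 0 0 = 0" "L 0 = 0" using g_scale[of 0 0 0] empty.prems(3)[of 0 0] by auto
    then show ?case by simp
  next
    case (insert e E)
    have eS: "e \<in> S" and ES: "E \<subseteq> S" using insert.prems(1) by auto
    have spS: "span E \<subseteq> S" using ES S(1) by (rule span_minimal)
    obtain p0 where p0: "p0 \<in> span E" "\<And>q. q \<in> span E \<Longrightarrow> g p0 q = L q"
      using insert.IH[OF ES insert.prems(2,3)] by blast
    have "\<exists>p\<in>span E. \<forall>q\<in>span E. g p q = g e q"
      by (rule insert.IH[OF ES]) (use eS g_add' g_scale' in auto)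
    then obtain P where P: "P \<in> span E" "\<And>q. q \<in> span E \<Longrightarrow> g P q = g e q" by blast
    define e' where "e' = e - P"
    have PS: "P \<in> S" and pS: "p0 \<in> S" using P p0 spS by auto
    have e'S: "e' \<in> S" unfolding e'_def by (intro subspace_diff[OF S(1)] eS PS)
    have orth: "g e' q = 0" if "q \<in> span E" for q
    proof -
      have qS: "q \<in> S" using that spS by auto
      have "g e q = g (e' + P) q" by (simp add: e'_def)
      also have "\<dots> = g e' q + g P q" by (rule g_add[OF e'S PS qS])
      finally show ?thesis using P(2)[OF that] by simp
    qed
    show ?case
    proof (cases "g e' e' = 0")
      case True
      then have "e = P" using g_definite[OF e'S] by (simp add: e'_def)
      then have "span (insert e E) = span E" using P(1) by (simp add: span_redundant)
      then show ?thesis using p0 by auto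
    next
      case False
      define a where "a = L e' / g e' e'"
      let ?p = "p0 + a *\<^sub>R e'"
      have eE: "e \<in> span (insert e E)" by (simp add: span_base)
      have up: "span E \<subseteq> span (insert e E)" by (rule span_mono) auto
      have "?p \<in> span (insert e E)"
        using p0(1) P(1) up eE unfolding e'_def by (intro span_add span_scale span_diff) auto
      moreover have "g ?p q = L q" if q: "q \<in> span (insert e E)" for q
      proof -
        obtain k where k: "q - k *\<^sub>R e \<in> span E" using q span_breakdown_eq by blast
        define q1 where "q1 = (q - k *\<^sub>R e) + k *\<^sub>R P"
        have q1: "q1 \<in> span E" unfolding q1_def by (intro span_add span_scale k P(1))
        have q1S: "q1 \<in> S" using q1 spS by auto
        have ke: "k *\<^sub>R e' \<in> S" using e'S by (rule subspace_scale[OF S(1)])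
        have qq: "q = k *\<^sub>R e' + q1" by (simp add: q1_def e'_def algebra_simps)
        have qS: "q \<in> S" unfolding qq by (rule subspace_add[OF S(1) ke q1S])
        have "g p0 e' = 0" using orth[OF p0(1)] g_sym[OF e'S pS] by simp
        then have "g p0 q = L q1"
          using p0(2)[OF q1] by (simp add: qq g_add'[OF ke q1S pS] g_scale'[OF e'S pS])
        moreover have "g e' q = k * g e' e'"
          using orth[OF q1] by (simp add: qq g_add'[OF ke q1S e'S] g_scale'[OF e'S e'S])
        ultimately have "g ?p q = L q1 + a * (k * g e' e')"
          using g_add[OF pS subspace_scale[OF S(1) e'S] qS] g_scale[OF e'S qS] by simp
        also have "a * (k * g e' e') = k * L e'" using False by (simp add: a_def)
        also have "L q1 + k * L e' = L q"
          using insert.prems(2)[OF ke q1S] insert.prems(3)[OF e'S] by (simp add: qq)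
        finally show ?thesis .
      qed
      ultimately show ?thesis by blast
    qed
  qed
  from this[OF finE E(1) L_add L_scale] obtain p where "p \<in> span E" "\<forall>q\<in>span E. g p q = L q" by blast
  moreover have "span E \<subseteq> S" using E(1) S(1) by (rule span_minimal)
  ultimately show "\<exists>p. p \<in> S \<and> (\<forall>q\<in>S. g p q = L q)" using E(3) by blast
next
  fix p p' assume p: "p \<in> S \<and> (\<forall>q\<in>S. g p q = L q)" and p': "p' \<in> S \<and> (\<forall>q\<in>S. g p' q = L q)"
  then have d: "p - p' \<in> S" using subspace_diff[OF S(1)] by blast
  have "g p (p - p') = g ((p - p') + p') (p - p')" by simp
  also have "\<dots> = g (p - p') (p - p') + g p' (p - p')" using g_add[OF d _ d] p' by blast
  finally have "g (p - p') (p - p') = 0" using p p' d by simp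
  then show "p = p'" using g_definite[OF d] by simp
qed

lemma fin_dim_image:
  assumes "fin_dim S" "linear f"
  shows "fin_dim (f ` S)"
proof -
  obtain B where "finite B" "S \<subseteq> span B" using assms(1) unfolding fin_dim_def by blast
  then show ?thesis unfolding fin_dim_def using span_linear_image[OF assms(2), of B]
    by (intro exI[of _ "f ` B"]) auto
qed

lemma fin_dim_sum:
  assumes "finite I" "\<And>i. i \<in> I \<Longrightarrow> fin_dim (S i)"
    and "\<And>v. v \<in> V \<Longrightarrow> \<exists>h. (\<forall>i\<in>I. h i \<in> S i) \<and> v = (\<Sum>i\<in>I. h i)"
  shows "fin_dim V"
proof -
  obtain B where B: "\<And>i. i \<in> I \<Longrightarrow> finite (B i) \<and> S i \<subseteq> span (B i)"
    using assms(2) unfolding fin_dim_def by metis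
  have "V \<subseteq> span (\<Union>i\<in>I. B i)"
  proof
    fix v assume "v \<in> V"
    then obtain h where h: "\<And>i. i \<in> I \<Longrightarrow> h i \<in> S i" "v = (\<Sum>i\<in>I. h i)" using assms(3) by blast
    have "h i \<in> span (\<Union>i\<in>I. B i)" if "i \<in> I" for i
      using h(1)[OF that] B[OF that] span_mono[of "B i" "\<Union>i\<in>I. B i"] that by blast
    then show "v \<in> span (\<Union>i\<in>I. B i)" unfolding h(2) by (rule span_sum)
  qed
  moreover have "finite (\<Union>i\<in>I. B i)" using assms(1) B by auto
  ultimately show ?thesis unfolding fin_dim_def by blast
qed

section \<open>Square integrable functions on a set\<close>

text \<open>One inner product for elements and faces alike: \<open>m\<close> is Lebesgue measure or the measure of a face.\<close>

definition ip :: "'a measure \<Rightarrow> 'a set \<Rightarrow> ('a \<Rightarrow> 'b::euclidean_space) \<Rightarrow> ('a \<Rightarrow> 'b) \<Rightarrow> real" where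
  "ip m X f g = (LINT x:X|m. f x \<bullet> g x)"

definition L2 :: "'a measure \<Rightarrow> 'a set \<Rightarrow> ('a \<Rightarrow> 'b::euclidean_space) \<Rightarrow> bool" where
  "L2 m X f \<longleftrightarrow> set_borel_measurable m X f \<and> set_integrable m X (\<lambda>x. (norm (f x))\<^sup>2)"

lemma vol_inner_ip: "vol_inner X = ip lborel X" by (simp add: fun_eq_iff vol_inner_def ip_def)

lemma face_inner_ip: "face_inner F = ip (face_measure F) F" by (simp add: fun_eq_iff face_inner_def ip_def)

lemma L2_fun_L2: "L2_fun X f \<longleftrightarrow> L2 lborel X f" by (simp add: L2_fun_def L2_def)

lemma L2_integrable:
  assumes f: "L2 m X f" and g: "L2 m X g"
  shows "set_integrable m X (\<lambda>x. f x \<bullet> g x)"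
proof -
  have fm[measurable]: "(\<lambda>x. indicator X x *\<^sub>R f x) \<in> borel_measurable m" using f by (simp add: L2_def set_borel_measurable_def)
  have gm[measurable]: "(\<lambda>x. indicator X x *\<^sub>R g x) \<in> borel_measurable m" using g by (simp add: L2_def set_borel_measurable_def)
  have eq: "(\<lambda>x. indicator X x *\<^sub>R (f x \<bullet> g x)) = (\<lambda>x. (indicator X x *\<^sub>R f x) \<bullet> (indicator X x *\<^sub>R g x))"
    by (auto simp: fun_eq_iff indicator_def)
  have "integrable m (\<lambda>x. indicator X x *\<^sub>R (norm (f x))\<^sup>2 + indicator X x *\<^sub>R (norm (g x))\<^sup>2)"
    using f g by (intro Bochner_Integration.integrable_add) (simp_all add: L2_def set_integrable_def)
  then show ?thesis unfolding set_integrable_def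
  proof (rule Bochner_Integration.integrable_bound)
    show "(\<lambda>x. indicator X x *\<^sub>R (f x \<bullet> g x)) \<in> borel_measurable m" unfolding eq by measurable
    show "AE x in m. norm (indicator X x *\<^sub>R (f x \<bullet> g x)) \<le> norm (indicator X x *\<^sub>R (norm (f x))\<^sup>2 + indicator X x *\<^sub>R (norm (g x))\<^sup>2)"
    proof (rule AE_I2)
      fix x
      have "\<bar>f x \<bullet> g x\<bar> \<le> norm (f x) * norm (g x)" by (rule Cauchy_Schwarz_ineq2)
      also have "\<dots> \<le> (norm (f x))\<^sup>2 + (norm (g x))\<^sup>2"
      proof -
        have "0 \<le> norm (f x) * norm (g x)" by simp
        then show ?thesis using sum_squares_bound[of "norm (f x)" "norm (g x)"] by linarith
      qed
      finally show "norm (indicator X x *\<^sub>R (f x \<bullet> g x)) \<le> norm (indicator X x *\<^sub>R (norm (f x))\<^sup>2 + indicator X x *\<^sub>R (norm (g x))\<^sup>2)"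
        by (auto simp: indicator_def)
    qed
  qed
qed

lemma L2_scaleR:
  assumes f: "L2 m X f"
  shows "L2 m X (\<lambda>x. c *\<^sub>R f x)"
proof -
  have "(\<lambda>x. indicator X x *\<^sub>R f x) \<in> borel_measurable m" using f by (simp add: L2_def set_borel_measurable_def)
  then have "(\<lambda>x. c *\<^sub>R (indicator X x *\<^sub>R f x)) \<in> borel_measurable m" by (rule borel_measurable_scaleR[OF borel_measurable_const])
  moreover have "set_integrable m X (\<lambda>x. c\<^sup>2 * (norm (f x))\<^sup>2)"
    using f by (intro set_integrable_mult_right) (simp add: L2_def)
  ultimately show ?thesis
    by (simp add: L2_def set_borel_measurable_def power_mult_distrib mult.commute[of c])
qed

lemma L2_add:
  assumes f: "L2 m X f" and g: "L2 m X g"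
  shows "L2 m X (\<lambda>x. f x + g x)"
  unfolding L2_def
proof
  show "set_borel_measurable m X (\<lambda>x. f x + g x)"
    using f g by (auto simp: L2_def set_borel_measurable_def scaleR_add_right)
  have "set_integrable m X (\<lambda>x. (norm (f x))\<^sup>2 + (norm (g x))\<^sup>2 + 2 * (f x \<bullet> g x))"
    using f g L2_integrable[OF f g] by (intro set_integral_add set_integrable_mult_right) (auto simp: L2_def)
  then show "set_integrable m X (\<lambda>x. (norm (f x + g x))\<^sup>2)"
    by (simp add: power2_norm_eq_inner inner_add_left inner_add_right inner_commute algebra_simps)
qed

lemma L2_diff: "L2 m X f \<Longrightarrow> L2 m X g \<Longrightarrow> L2 m X (\<lambda>x. f x - g x)"
  using L2_add[of m X f "\<lambda>x. (- 1) *\<^sub>R g x"] L2_scaleR[of m X g "- 1"] by simp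

lemma L2_subset:
  assumes "L2 m X f" "Y \<subseteq> X" "Y \<in> sets m"
  shows "L2 m Y f"
proof -
  have [measurable]: "(\<lambda>x. indicator X x *\<^sub>R f x) \<in> borel_measurable m" "Y \<in> sets m"
    using assms by (auto simp: L2_def set_borel_measurable_def)
  have "(\<lambda>x. indicator Y x *\<^sub>R f x) = (\<lambda>x. indicator Y x *\<^sub>R (indicator X x *\<^sub>R f x))"
    using assms(2) by (auto simp: fun_eq_iff indicator_def)
  also have "\<dots> \<in> borel_measurable m" by measurable
  finally have "set_borel_measurable m Y f" by (simp add: set_borel_measurable_def)
  moreover have "set_integrable m Y (\<lambda>x. (norm (f x))\<^sup>2)"
    by (rule set_integrable_subset[of _ X]) (use assms in \<open>auto simp: L2_def\<close>)
  ultimately show ?thesis by (simp add: L2_def)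
qed

lemma ip_commute: "ip m X f g = ip m X g f"
  by (simp add: ip_def inner_commute)

lemma ip_cong: "(\<And>x. x \<in> X \<Longrightarrow> f x = f' x) \<Longrightarrow> (\<And>x. x \<in> X \<Longrightarrow> g x = g' x) \<Longrightarrow> ip m X f g = ip m X f' g'"
  unfolding ip_def set_lebesgue_integral_def by (intro Bochner_Integration.integral_cong) (auto simp: indicator_def)

lemma ip_add_left: "L2 m X f \<Longrightarrow> L2 m X g \<Longrightarrow> L2 m X h \<Longrightarrow> ip m X (\<lambda>x. f x + g x) h = ip m X f h + ip m X g h"
  unfolding ip_def by (simp add: inner_add_left set_integral_add(2) L2_integrable)

lemma ip_diff_left: "L2 m X f \<Longrightarrow> L2 m X g \<Longrightarrow> L2 m X h \<Longrightarrow> ip m X (\<lambda>x. f x - g x) h = ip m X f h - ip m X g h"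
  unfolding ip_def by (simp add: inner_diff_left set_integral_diff(2) L2_integrable)

lemma ip_scaleR_left: "ip m X (\<lambda>x. c *\<^sub>R f x) h = c * ip m X f h"
  unfolding ip_def by simp

lemma ip_zero_left [simp]: "ip m X (\<lambda>x. 0) h = 0" by (simp add: ip_def)

lemma ip_zero_right [simp]: "ip m X h (\<lambda>x. 0) = 0" by (simp add: ip_def)

lemma ip_add_right: "L2 m X f \<Longrightarrow> L2 m X g \<Longrightarrow> L2 m X h \<Longrightarrow> ip m X h (\<lambda>x. f x + g x) = ip m X h f + ip m X h g"
  using ip_add_left[of m X f g h] by (simp add: ip_commute)

lemma ip_diff_right: "L2 m X f \<Longrightarrow> L2 m X g \<Longrightarrow> L2 m X h \<Longrightarrow> ip m X h (\<lambda>x. f x - g x) = ip m X h f - ip m X h g"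
  using ip_diff_left[of m X f g h] by (simp add: ip_commute)

lemma ip_scaleR_right: "ip m X h (\<lambda>x. c *\<^sub>R f x) = c * ip m X h f"
  using ip_scaleR_left[of m X c f h] by (simp add: ip_commute)

lemma ip_self_eq_0:
  assumes "L2 m X f" "ip m X f f = 0"
  shows "AE x in m. x \<in> X \<longrightarrow> f x = 0"
proof -
  have i: "integrable m (\<lambda>x. indicator X x *\<^sub>R (f x \<bullet> f x))"
    using L2_integrable[OF assms(1,1)] by (simp add: set_integrable_def)
  have "AE x in m. indicator X x *\<^sub>R (f x \<bullet> f x) = 0"
    using integral_nonneg_eq_0_iff_AE[OF i] assms(2)
    by (simp add: ip_def set_lebesgue_integral_def)
  then show ?thesis by eventually_elim auto
qed

lemma L2_continuous_bounded:
  assumes "bounded X" "X \<in> sets borel" "continuous_on UNIV f"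
  shows "L2 lborel X (f :: 'a::euclidean_space \<Rightarrow> 'b::euclidean_space)"
proof -
  have [measurable]: "f \<in> borel_measurable borel" "X \<in> sets borel" using assms borel_measurable_continuous_onI by auto
  have "set_integrable lborel (closure X) (\<lambda>x. (norm (f x))\<^sup>2)"
    unfolding set_integrable_def
    by (intro borel_integrable_compact continuous_intros continuous_on_subset[OF assms(3)])
      (use assms(1) in \<open>simp_all add: compact_closure\<close>)
  then have "set_integrable lborel X (\<lambda>x. (norm (f x))\<^sup>2)"
    by (rule set_integrable_subset) (use assms(2) closure_subset in auto)
  moreover have "set_borel_measurable lborel X f" unfolding set_borel_measurable_def by measurable
  ultimately show ?thesis by (simp add: L2_def)
qed

lemma L2_continuous_flat:
  fixes n :: "'a::euclidean_space" and f :: "'a \<Rightarrow> 'b::euclidean_space"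
  assumes n: "norm n = 1" and F: "compact F" "continuous_on F f"
  shows "L2 (flat_lborel {x. n \<bullet> x = \<beta>}) F f"
proof -
  have "set_integrable (flat_lborel {x. n \<bullet> x = \<beta>}) F (\<lambda>x. (norm (f x))\<^sup>2)"
    by (intro set_integrable_flat_compact[OF n F(1)] continuous_intros F)
  moreover have "set_borel_measurable (flat_lborel {x. n \<bullet> x = \<beta>}) F f"
    unfolding set_borel_measurable_def
    using borel_measurable_continuous_on_indicator[OF borel_compact[OF F(1)] F(2)] by simp
  ultimately show ?thesis by (simp add: L2_def)
qed

lemma vol_inner_definite:
  fixes f :: "'a::euclidean_space \<Rightarrow> 'b::euclidean_space"
  assumes "bounded T" "open T" "continuous_on UNIV f" "vol_inner T f f = 0" "x \<in> T"
  shows "f x = 0"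
proof (rule ccontr)
  assume nz: "f x \<noteq> 0"
  have ae: "AE x in lborel. x \<in> T \<longrightarrow> f x = 0"
    using assms by (intro ip_self_eq_0 L2_continuous_bounded) (auto simp: vol_inner_ip)
  define U where "U = T \<inter> f -` (- {0})"
  have U: "open U" unfolding U_def using assms by (intro open_Int open_vimage) auto
  have "AE x in lborel. x \<notin> U" using ae by eventually_elim (auto simp: U_def)
  then have "emeasure lborel U = 0"
    using U by (subst (asm) AE_iff_measurable[of U]) auto
  then have "negligible U" using U by (simp add: negligible_iff_emeasure0)
  moreover have "x \<in> U" using nz assms by (simp add: U_def)
  ultimately show False using open_not_negligible[OF U] by blast
qed

lemma set_integral_component:
  fixes f :: "'a \<Rightarrow> ('b::euclidean_space)^'n"
  assumes "set_integrable m X f"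
  shows "(LINT x:X|m. f x) $ i = (LINT x:X|m. f x $ i)"
  using integral_bounded_linear[OF bounded_linear_vec_nth[of i], of m "\<lambda>x. indicator X x *\<^sub>R f x"] assms
  by (simp add: set_lebesgue_integral_def set_integrable_def)

lemma set_integral_neg: "(LINT x:X|m. - (f x :: 'e::euclidean_space)) = - (LINT x:X|m. f x)"
  by (simp add: set_lebesgue_integral_def)

lemma transpose_linear: "bounded_linear (transpose :: real^'d^'d \<Rightarrow> real^'d^'d)"
  by (intro linear_linear[THEN iffD2] linearI) (simp_all add: transpose_def vec_eq_iff)

lemma transpose_set_integral:
  assumes "set_integrable m X (f :: 'a \<Rightarrow> real^'d^'d)"
  shows "transpose (LINT x:X|m. f x) = (LINT x:X|m. transpose (f x))"
  using integral_bounded_linear[OF transpose_linear, of m "\<lambda>x. indicator X x *\<^sub>R f x"] assms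
  by (simp add: linear_scale[OF bounded_linear.linear[OF transpose_linear]] set_lebesgue_integral_def set_integrable_def)

section \<open>Polynomials\<close>

definition mono_fun :: "('d::finite \<Rightarrow> nat) \<Rightarrow> real^'d \<Rightarrow> real" where
  "mono_fun a x = (\<Prod>i\<in>UNIV. (x $ i) ^ a i)"

lemma finite_multiindices: "finite {a :: 'd::finite \<Rightarrow> nat. (\<Sum>i\<in>UNIV. a i) \<le> l}"
proof (rule finite_subset)
  have "a i \<le> (\<Sum>i\<in>UNIV. a i)" for a :: "'d \<Rightarrow> nat" and i by (rule member_le_sum) auto
  then show "{a :: 'd \<Rightarrow> nat. (\<Sum>i\<in>UNIV. a i) \<le> l} \<subseteq> {a. \<forall>i. (i \<in> UNIV \<longrightarrow> a i \<in> {..l}) \<and> (i \<notin> UNIV \<longrightarrow> a i = 0)}"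
    using order_trans by (fastforce simp: atMost_def)
  show "finite {a :: 'd \<Rightarrow> nat. \<forall>i. (i \<in> UNIV \<longrightarrow> a i \<in> {..l}) \<and> (i \<notin> UNIV \<longrightarrow> a i = 0)}"
    by (rule finite_set_of_finite_funs) auto
qed

text \<open>Gives access to the induction principle of spans.\<close>

lemma polys_eq_span: "polys l = span (mono_fun ` {a. (\<Sum>i\<in>UNIV. a i) \<le> l})"
proof -
  let ?A = "{a :: 'a \<Rightarrow> nat. (\<Sum>i\<in>UNIV. a i) \<le> l}"
  have sum_apply: "(\<Sum>a\<in>A. h a) x = (\<Sum>a\<in>A. h a x)" for A and h :: "('a \<Rightarrow> nat) \<Rightarrow> real^'a \<Rightarrow> real" and x
    by (induction A rule: infinite_finite_induct) auto
  have expand: "(\<lambda>x. \<Sum>a\<in>?A. c a * (\<Prod>i\<in>UNIV. (x $ i) ^ a i)) = (\<Sum>a\<in>?A. c a *\<^sub>R mono_fun a)" for c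
    by (simp add: fun_eq_iff sum_apply mono_fun_def)
  have sub: "subspace (polys l :: (real^'a \<Rightarrow> real) set)"
  proof (rule subspaceI)
    show "0 \<in> polys l" unfolding polys_def by (intro CollectI exI[of _ "\<lambda>_. 0"]) (simp add: fun_eq_iff)
  next
    fix p q :: "real^'a \<Rightarrow> real" assume "p \<in> polys l" "q \<in> polys l"
    then obtain c d where "p = (\<Sum>a\<in>?A. c a *\<^sub>R mono_fun a)" "q = (\<Sum>a\<in>?A. d a *\<^sub>R mono_fun a)"
      unfolding polys_def expand by blast
    then have "p + q = (\<Sum>a\<in>?A. (c a + d a) *\<^sub>R mono_fun a)" by (simp add: scaleR_add_left sum.distrib)
    then show "p + q \<in> polys l" unfolding polys_def expand by (intro CollectI exI[of _ "\<lambda>a. c a + d a"]) simp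
  next
    fix p :: "real^'a \<Rightarrow> real" and r :: real assume "p \<in> polys l"
    then obtain c where "p = (\<Sum>a\<in>?A. c a *\<^sub>R mono_fun a)"
      unfolding polys_def expand by blast
    then have "r *\<^sub>R p = (\<Sum>a\<in>?A. (r * c a) *\<^sub>R mono_fun a)" by (simp add: scaleR_sum_right)
    then show "r *\<^sub>R p \<in> polys l" unfolding polys_def expand by (intro CollectI exI[of _ "\<lambda>a. r * c a"]) simp
  qed
  show ?thesis
  proof
    show "polys l \<subseteq> span (mono_fun ` ?A)"
      unfolding polys_def expand by clarify (intro span_sum span_scale span_base imageI, simp)
    have "mono_fun b \<in> polys l" if b: "b \<in> ?A" for b
    proof -
      have "(\<Sum>a\<in>?A. (if a = b then 1 else 0) *\<^sub>R mono_fun a) = (\<Sum>a\<in>?A. if a = b then mono_fun b else 0)"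
        by (intro sum.cong) auto
      also have "\<dots> = mono_fun b" using b finite_multiindices by (subst sum.delta) auto
      finally have "mono_fun b = (\<Sum>a\<in>?A. (if a = b then 1 else 0) *\<^sub>R mono_fun a)" ..
      then show ?thesis unfolding polys_def expand by (intro CollectI exI[of _ "\<lambda>a. if a = b then 1 else 0"]) simp
    qed
    then show "span (mono_fun ` ?A) \<subseteq> polys l" by (intro span_minimal sub) auto
  qed
qed

lemma subspace_polys: "subspace (polys l)" by (simp add: polys_eq_span subspace_span)

lemma fin_dim_polys: "fin_dim (polys l)"
  unfolding fin_dim_def polys_eq_span using finite_multiindices by blast

lemma mono_fun_polys: "(\<Sum>i\<in>UNIV. a i) \<le> l \<Longrightarrow> mono_fun a \<in> polys l"
  unfolding polys_eq_span by (intro span_base) auto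

lemma polys_le: "l \<le> l' \<Longrightarrow> polys l \<subseteq> polys l'"
  unfolding polys_eq_span by (intro span_mono) auto

lemma polys_add: "p \<in> polys l \<Longrightarrow> q \<in> polys l \<Longrightarrow> (\<lambda>x. p x + q x) \<in> polys l"
  using subspace_add[OF subspace_polys, of p l q] by (simp add: plus_fun_def)

lemma polys_scale: "p \<in> polys l \<Longrightarrow> (\<lambda>x. c * p x) \<in> polys l"
  using subspace_scale[OF subspace_polys, of p l c] by (simp add: scaleR_fun_def)

lemma polys_diff: "p \<in> polys l \<Longrightarrow> q \<in> polys l \<Longrightarrow> (\<lambda>x. p x - q x) \<in> polys l"
  using polys_add[of p l "\<lambda>x. - 1 * q x"] polys_scale[of q l "- 1"] by simp

lemma polys_sum: "(\<And>i. i \<in> I \<Longrightarrow> p i \<in> polys l) \<Longrightarrow> (\<lambda>x. \<Sum>i\<in>I. p i x) \<in> polys l"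
proof (induction I rule: infinite_finite_induct)
  case (insert i I)
  then show ?case by (simp add: polys_add)
qed (use subspace_0[OF subspace_polys] in \<open>simp_all add: zero_fun_def\<close>)

lemma polys_const: "(\<lambda>x. c) \<in> polys l"
proof -
  have "mono_fun (\<lambda>i. 0) \<in> polys l" by (rule mono_fun_polys) simp
  then show ?thesis using polys_scale[of "mono_fun (\<lambda>i. 0)" l c] by (simp add: mono_fun_def)
qed

lemma polys_coord: "1 \<le> l \<Longrightarrow> (\<lambda>x. x $ i) \<in> polys l"
proof -
  assume "1 \<le> l"
  then have "mono_fun (\<lambda>j. if j = i then 1 else 0) \<in> polys l" by (intro mono_fun_polys) simp
  moreover have "mono_fun (\<lambda>j. if j = i then 1 else 0) = (\<lambda>x. x $ i)"
    by (auto simp: mono_fun_def fun_eq_iff if_distrib cong: if_cong)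
  ultimately show ?thesis by simp
qed

lemma mono_fun_mult: "mono_fun a x * mono_fun b x = mono_fun (\<lambda>i. a i + b i) x"
  by (simp add: mono_fun_def power_add prod.distrib)

lemma polys_mult:
  assumes p: "p \<in> polys l" and q: "q \<in> polys m"
  shows "(\<lambda>x. p x * q x) \<in> polys (l + m)"
  using p unfolding polys_eq_span[of l]
proof (induction rule: span_induct_alt)
  case base
  then show ?case using polys_const[of 0] by simp
next
  case (step c f p)
  obtain a where a: "f = mono_fun a" "(\<Sum>i\<in>UNIV. a i) \<le> l" using step(1) by blast
  have "(\<lambda>x. mono_fun a x * q x) \<in> polys (l + m)"
    using q unfolding polys_eq_span[of m]
  proof (induction rule: span_induct_alt)
    case base
    then show ?case using polys_const[of 0] by simp
  next
    case (step d g q)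
    obtain b where b: "g = mono_fun b" "(\<Sum>i\<in>UNIV. b i) \<le> m" using step(1) by blast
    have "mono_fun (\<lambda>i. a i + b i) \<in> polys (l + m)"
      using a b by (intro mono_fun_polys) (simp add: sum.distrib)
    then have "(\<lambda>x. d * mono_fun (\<lambda>i. a i + b i) x + mono_fun a x * q x) \<in> polys (l + m)"
      by (intro polys_add polys_scale step(2))
    then show ?case by (simp add: b distrib_left mono_fun_mult[symmetric] mult_ac)
  qed
  then have "(\<lambda>x. c * (mono_fun a x * q x) + p x * q x) \<in> polys (l + m)"
    by (intro polys_add polys_scale step(2))
  then show ?case by (simp add: a distrib_right mult.assoc)
qed

lemma mono_fun_line_poly: "\<exists>q. \<forall>t. mono_fun a (x + t *\<^sub>R v) = poly q t"
  by (intro exI[of _ "\<Prod>i\<in>UNIV. [:x $ i, v $ i:] ^ a i"])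
    (simp add: mono_fun_def poly_prod mult.commute)

lemma polys_line_poly:
  assumes "p \<in> polys l"
  shows "line_poly p"
  unfolding line_poly_def
proof (intro allI)
  fix x v
  show "\<exists>q. \<forall>t. p (x + t *\<^sub>R v) = poly q t"
    using assms unfolding polys_eq_span
  proof (induction rule: span_induct_alt)
    case base
    show ?case by (intro exI[of _ 0]) simp
  next
    case (step c m p)
    obtain a where a: "m = mono_fun a" using step(1) by blast
    obtain q where q: "\<And>t. p (x + t *\<^sub>R v) = poly q t" using step(2) by blast
    obtain r where r: "\<And>t. mono_fun a (x + t *\<^sub>R v) = poly r t" using mono_fun_line_poly by blast
    show ?case by (intro exI[of _ "smult c r + q"]) (simp add: a q r)
  qed
qed

definition pderivative :: "'d::finite \<Rightarrow> (real^'d \<Rightarrow> real) \<Rightarrow> real^'d \<Rightarrow> real" where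
  "pderivative i p x = frechet_derivative p (at x) (axis i 1)"

text \<open>The case distinction takes care of \<open>a i - 1\<close> for \<open>a i = 0\<close>.\<close>

lemma mono_fun_deriv:
  "(mono_fun a has_derivative (\<lambda>h. \<Sum>i\<in>UNIV. h $ i * (if a i = 0 then 0 else of_nat (a i) * mono_fun (a(i := a i - 1)) x))) (at x)"
proof -
  have "(mono_fun a has_derivative (\<lambda>h. \<Sum>i\<in>UNIV. (of_nat (a i) * h $ i * (x $ i) ^ (a i - 1)) * (\<Prod>j\<in>UNIV - {i}. (x $ j) ^ a j))) (at x)"
    unfolding mono_fun_def[abs_def]
    by (rule has_derivative_prod) (rule bounded_linear_imp_has_derivative[OF bounded_linear_vec_nth] derivative_eq_intros refl | simp)+
  moreover have "(of_nat (a i) * h $ i * (x $ i) ^ (a i - 1)) * (\<Prod>j\<in>UNIV - {i}. (x $ j) ^ a j)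
      = h $ i * (if a i = 0 then 0 else of_nat (a i) * mono_fun (a(i := a i - 1)) x)" for h :: "real^'a" and i
  proof -
    have "mono_fun (a(i := a i - 1)) x = (x $ i) ^ (a i - 1) * (\<Prod>j\<in>UNIV - {i}. (x $ j) ^ a j)"
      unfolding mono_fun_def by (subst prod.remove[of UNIV i]) (auto intro!: prod.cong)
    then show ?thesis by simp
  qed
  ultimately show ?thesis by (simp only:)
qed

lemma polys_deriv:
  assumes "p \<in> polys l"
  shows "p differentiable at x" and "pderivative i p \<in> polys (l - 1)"
proof -
  have "(\<forall>x. p differentiable at x) \<and> pderivative i p \<in> polys (l - 1)"
    using assms unfolding polys_eq_span[of l]
  proof (induction rule: span_induct_alt)
    case base
    have "pderivative i 0 = (\<lambda>x. 0)" by (simp add: pderivative_def[abs_def] zero_fun_def frechet_derivative_const)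
    then show ?case by (simp add: zero_fun_def polys_const)
  next
    case (step c m p)
    obtain a where a: "m = mono_fun a" "(\<Sum>i\<in>UNIV. a i) \<le> l" using step(1) by blast
    let ?m = "\<lambda>x. if a i = 0 then 0 else of_nat (a i) * mono_fun (a(i := a i - 1)) x"
    have dm: "(m has_derivative (\<lambda>h. \<Sum>i\<in>UNIV. h $ i * (if a i = 0 then 0 else of_nat (a i) * mono_fun (a(i := a i - 1)) x))) (at x)" for x
      unfolding a(1) by (rule mono_fun_deriv)
    have d: "((c *\<^sub>R m + p) has_derivative (\<lambda>h. c *\<^sub>R (\<Sum>i\<in>UNIV. h $ i * (if a i = 0 then 0 else of_nat (a i) * mono_fun (a(i := a i - 1)) x))
        + frechet_derivative p (at x) h)) (at x)" for x
      unfolding plus_fun_def scaleR_fun_def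
      by (intro has_derivative_add has_derivative_scaleR_right dm) (use step(2) frechet_derivative_works in blast)
    have pd: "pderivative i (c *\<^sub>R m + p) = (\<lambda>x. c * ?m x + pderivative i p x)"
    proof
      fix x
      have "pderivative i (c *\<^sub>R m + p) x = c *\<^sub>R (\<Sum>j\<in>UNIV. axis i 1 $ j * (if a j = 0 then 0 else of_nat (a j) * mono_fun (a(j := a j - 1)) x))
        + frechet_derivative p (at x) (axis i 1)"
        unfolding pderivative_def frechet_derivative_at[OF d[of x], symmetric] by simp
      also have "(\<Sum>j\<in>UNIV. axis i 1 $ j * (if a j = 0 then 0 else of_nat (a j) * mono_fun (a(j := a j - 1)) x)) = ?m x"
        by (subst sum.remove[of UNIV i]) (auto simp: axis_def intro!: sum.neutral)
      finally show "pderivative i (c *\<^sub>R m + p) x = c * ?m x + pderivative i p x"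
        unfolding pderivative_def real_scaleR_def .
    qed
    have "?m \<in> polys (l - 1)"
    proof (cases "a i = 0")
      case False
      have "(\<Sum>j\<in>UNIV. (a(i := a i - 1)) j) = (a i - 1) + (\<Sum>j\<in>UNIV - {i}. a j)"
        by (subst sum.remove[of UNIV i]) (auto intro!: sum.cong)
      moreover have "(\<Sum>j\<in>UNIV. a j) = a i + (\<Sum>j\<in>UNIV - {i}. a j)"
        by (subst sum.remove[of UNIV i]) auto
      ultimately have "mono_fun (a(i := a i - 1)) \<in> polys (l - 1)"
        using a(2) False by (intro mono_fun_polys) linarith
      then show ?thesis using False polys_scale by simp
    qed (simp add: polys_const)
    then have "pderivative i (c *\<^sub>R m + p) \<in> polys (l - 1)"
      unfolding pd using step(2) by (intro polys_add polys_scale) auto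
    then show ?case using d differentiableI by blast
  qed
  then show "p differentiable at x" "pderivative i p \<in> polys (l - 1)" by auto
qed

lemma polys_continuous:
  assumes "p \<in> polys l"
  shows "continuous_on S p"
  by (intro continuous_at_imp_continuous_on ballI differentiable_imp_continuous_within polys_deriv(1)[OF assms])

lemma polys_deriv_line:
  assumes "p \<in> polys l"
  shows "((\<lambda>t. p (x + t *\<^sub>R axis i 1)) has_real_derivative pderivative i p (x + t *\<^sub>R axis i 1)) (at t)"
proof -
  let ?y = "x + t *\<^sub>R axis i 1"
  have d: "(p has_derivative frechet_derivative p (at ?y)) (at ?y)"
    using polys_deriv(1)[OF assms] frechet_derivative_works by blast
  have l: "((\<lambda>t. x + t *\<^sub>R axis i 1) has_derivative (\<lambda>h. h *\<^sub>R axis i 1)) (at t)"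
    by (auto intro!: derivative_eq_intros)
  have "((\<lambda>t. p (x + t *\<^sub>R axis i 1)) has_derivative (\<lambda>h. frechet_derivative p (at ?y) (h *\<^sub>R axis i 1))) (at t)"
    using diff_chain_at[OF l d] by (simp add: o_def)
  moreover have "(\<lambda>h. frechet_derivative p (at ?y) (h *\<^sub>R axis i 1)) = (\<lambda>h. h * pderivative i p ?y)"
    using linear_scale[OF has_derivative_linear[OF d]] by (simp add: pderivative_def)
  ultimately show ?thesis by (simp add: has_field_derivative_def mult_commute_abs)
qed

lemma polys_zero_on_open:
  assumes "p \<in> polys l" "open T" "T \<noteq> {}" "\<And>x. x \<in> T \<Longrightarrow> p x = 0"
  shows "p y = 0"
  using line_poly_zero_on_open[OF polys_line_poly[OF assms(1)] assms(2-4)] .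

lemma pderivative_add: "p \<in> polys l \<Longrightarrow> q \<in> polys l \<Longrightarrow> pderivative i (\<lambda>x. p x + q x) x = pderivative i p x + pderivative i q x"
proof -
  assume p: "p \<in> polys l" and q: "q \<in> polys l"
  have "((\<lambda>x. p x + q x) has_derivative (\<lambda>h. frechet_derivative p (at x) h + frechet_derivative q (at x) h)) (at x)"
    using polys_deriv(1)[OF p, of x] polys_deriv(1)[OF q, of x] frechet_derivative_works
    by (intro has_derivative_add) auto
  then show ?thesis unfolding pderivative_def by (simp add: frechet_derivative_at[symmetric])
qed

lemma pderivative_scale: "p \<in> polys l \<Longrightarrow> pderivative i (\<lambda>x. c * p x) x = c * pderivative i p x"
proof -
  assume p: "p \<in> polys l"
  have "((\<lambda>x. c * p x) has_derivative (\<lambda>h. c * frechet_derivative p (at x) h)) (at x)"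
    using polys_deriv(1)[OF p, of x] frechet_derivative_works by (intro has_derivative_mult_right) auto
  then show ?thesis unfolding pderivative_def by (simp add: frechet_derivative_at[symmetric])
qed

lemma pderivative_mult:
  assumes p: "p \<in> polys l" and q: "q \<in> polys m"
  shows "pderivative i (\<lambda>x. p x * q x) x = pderivative i p x * q x + p x * pderivative i q x"
proof -
  have "((\<lambda>x. p x * q x) has_derivative (\<lambda>h. p x * frechet_derivative q (at x) h + frechet_derivative p (at x) h * q x)) (at x)"
    using polys_deriv(1)[OF p, of x] polys_deriv(1)[OF q, of x] frechet_derivative_works
    by (intro has_derivative_mult) auto
  then show ?thesis unfolding pderivative_def by (simp add: frechet_derivative_at[symmetric])
qed

lemma grad_pderivative: "grad q x $ i = pderivative i q x"
  by (simp add: grad_def pderivative_def)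

lemma grad_vpolys:
  assumes "q \<in> polys l"
  shows "grad q \<in> vpolys (l - 1)"
proof -
  have "(\<lambda>x. grad q x $ i) = pderivative i q" for i by (simp add: fun_eq_iff grad_pderivative)
  then show ?thesis using polys_deriv(2)[OF assms] by (simp add: vpolys_def)
qed

lemma grad_const: "grad (\<lambda>x. c) = (\<lambda>x. 0)"
  by (simp add: fun_eq_iff grad_def vec_eq_iff frechet_derivative_const)

section \<open>Polynomial fields and families\<close>

definition vec_of :: "('a \<Rightarrow> real) set \<Rightarrow> ('a \<Rightarrow> real^'d) set" where
  "vec_of P = {v. \<forall>i. (\<lambda>x. v x $ i) \<in> P}"

lemma vpolys_vec_of: "vpolys l = vec_of (polys l)" by (simp add: vpolys_def vec_of_def)

lemma face_vpolys_vec_of: "face_vpolys l F = vec_of (face_polys l F)" by (simp add: face_vpolys_def vec_of_def)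

lemma subspace_vec_of:
  assumes "subspace P"
  shows "subspace (vec_of P :: ('a \<Rightarrow> real^'d) set)"
proof (rule subspaceI)
  show "0 \<in> vec_of P" using subspace_0[OF assms] by (simp add: vec_of_def zero_fun_def)
  show "u + v \<in> vec_of P" if "u \<in> vec_of P" "v \<in> vec_of P" for u v :: "'a \<Rightarrow> real^'d"
    using that subspace_add[OF assms] by (auto simp: vec_of_def plus_fun_def)
  show "c *\<^sub>R u \<in> vec_of P" if "u \<in> vec_of P" for c and u :: "'a \<Rightarrow> real^'d"
    using that subspace_scale[OF assms] by (auto simp: vec_of_def scaleR_fun_def)
qed

lemma fin_dim_vec_of:
  assumes "fin_dim P"
  shows "fin_dim (vec_of P :: ('a \<Rightarrow> real^'d) set)"
proof (rule fin_dim_sum[where I = "UNIV :: 'd set" and S = "\<lambda>i. (\<lambda>p x. axis i (p x)) ` P"])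
  show "fin_dim ((\<lambda>p x. axis i (p x) :: real^'d) ` P)" for i
  proof (rule fin_dim_image[OF assms], rule linearI)
    show "(\<lambda>x. axis i ((p + q) x)) = (\<lambda>x. axis i (p x)) + (\<lambda>x. axis i (q x) :: real^'d)" for p q :: "'a \<Rightarrow> real"
      by (auto simp: fun_eq_iff vec_eq_iff axis_def)
    show "(\<lambda>x. axis i ((c *\<^sub>R p) x)) = c *\<^sub>R (\<lambda>x. axis i (p x) :: real^'d)" for c and p :: "'a \<Rightarrow> real"
      by (auto simp: fun_eq_iff vec_eq_iff axis_def)
  qed
  fix v :: "'a \<Rightarrow> real^'d" assume v: "v \<in> vec_of P"
  have "v = (\<Sum>i\<in>UNIV. (\<lambda>x. axis i (v x $ i)))"
    by (auto simp: fun_eq_iff vec_eq_iff sum_fun_apply axis_def if_distrib cong: if_cong)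
  then show "\<exists>h. (\<forall>i\<in>UNIV. h i \<in> (\<lambda>p x. axis i (p x)) ` P) \<and> v = (\<Sum>i\<in>UNIV. h i)"
    using v by (intro exI[of _ "\<lambda>i x. axis i (v x $ i)"]) (auto simp: vec_of_def)
qed simp

text \<open>Families that vanish off their index set, as the broken functions and the functions on the boundary
of an element do.\<close>

definition families :: "'i set \<Rightarrow> ('i \<Rightarrow> 'v::zero set) \<Rightarrow> ('i \<Rightarrow> 'v) set" where
  "families I V = {v. (\<forall>i\<in>I. v i \<in> V i) \<and> (\<forall>i. i \<notin> I \<longrightarrow> v i = 0)}"

lemma subspace_families:
  fixes V :: "'i \<Rightarrow> 'v::real_vector set"
  assumes "\<And>i. i \<in> I \<Longrightarrow> subspace (V i)"
  shows "subspace (families I V)"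
  by (rule subspaceI) (auto simp: families_def intro: subspace_0 subspace_add subspace_scale assms)

lemma fin_dim_families:
  fixes V :: "'i \<Rightarrow> 'v::real_vector set"
  assumes "finite I" "\<And>i. i \<in> I \<Longrightarrow> fin_dim (V i)"
  shows "fin_dim (families I V)"
proof (rule fin_dim_sum[where I = I and S = "\<lambda>i. (\<lambda>v j. if j = i then v else 0) ` V i"])
  show "fin_dim ((\<lambda>v j. if j = i then v else 0) ` V i)" if "i \<in> I" for i
    by (rule fin_dim_image[OF assms(2)[OF that]], rule linearI) (auto simp: fun_eq_iff)
  fix v assume v: "v \<in> families I V"
  have "v = (\<Sum>i\<in>I. (\<lambda>j. if j = i then v i else 0))"
    using v assms(1) by (auto simp: fun_eq_iff sum_fun_apply families_def)
  then show "\<exists>h. (\<forall>i\<in>I. h i \<in> (\<lambda>v j. if j = i then v else 0) ` V i) \<and> v = (\<Sum>i\<in>I. h i)"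
    using v by (intro exI[of _ "\<lambda>i j. if j = i then v i else 0"]) (auto simp: families_def)
qed (rule assms)

definition restr :: "'a set \<Rightarrow> ('a \<Rightarrow> 'b::zero) \<Rightarrow> 'a \<Rightarrow> 'b" where
  "restr F p x = (if x \<in> F then p x else 0)"

lemma face_polys_restr: "face_polys l F = restr F ` polys l"
  unfolding face_polys_def by (auto simp: restr_def[abs_def])

lemma linear_restr: "linear (restr F :: ('a \<Rightarrow> 'b::real_vector) \<Rightarrow> _)"
  by (rule linearI) (auto simp: fun_eq_iff restr_def)

lemma subspace_face_polys: "subspace (face_polys l F)"
  unfolding face_polys_restr by (rule linear_subspace_image[OF linear_restr subspace_polys])

lemma fin_dim_face_polys: "fin_dim (face_polys l F)"
  unfolding face_polys_restr by (rule fin_dim_image[OF fin_dim_polys linear_restr])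

lemma face_polys_continuous: "p \<in> face_polys l F \<Longrightarrow> continuous_on F p"
  unfolding face_polys_def by (auto intro: polys_continuous cong: continuous_on_cong)

lemma subspace_vpolys: "subspace (vpolys l)" by (simp add: vpolys_vec_of subspace_vec_of subspace_polys)

lemma fin_dim_vpolys: "fin_dim (vpolys l)" by (simp add: vpolys_vec_of fin_dim_vec_of fin_dim_polys)

lemma subspace_face_vpolys: "subspace (face_vpolys l F)"
  by (simp add: face_vpolys_vec_of subspace_vec_of subspace_face_polys)

lemma fin_dim_face_vpolys: "fin_dim (face_vpolys l F)"
  by (simp add: face_vpolys_vec_of fin_dim_vec_of fin_dim_face_polys)

lemma vpolys_continuous: "v \<in> vpolys l \<Longrightarrow> continuous_on S v"
  unfolding vpolys_def by (subst continuous_on_componentwise) (auto simp: Basis_vec_def inner_axis intro: polys_continuous)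

lemma face_vpolys_continuous: "v \<in> face_vpolys l F \<Longrightarrow> continuous_on F v"
  unfolding face_vpolys_def by (subst continuous_on_componentwise) (auto simp: Basis_vec_def inner_axis intro: face_polys_continuous)

lemma face_vpolys_outside:
  assumes "v \<in> face_vpolys l F" "x \<notin> F"
  shows "v x = 0"
proof -
  have "v x $ i = 0" for i
  proof -
    obtain p where "(\<lambda>x. v x $ i) = (\<lambda>x. if x \<in> F then p x else 0)"
      using assms(1) unfolding face_vpolys_def face_polys_def by blast
    from fun_cong[OF this, of x] show ?thesis using assms(2) by simp
  qed
  then show ?thesis by (simp add: vec_eq_iff)
qed

lemma vpolys_restr: "v \<in> vpolys l \<Longrightarrow> restr F v \<in> face_vpolys l F"
proof -
  assume v: "v \<in> vpolys l"
  have "(\<lambda>x. restr F v x $ i) = restr F (\<lambda>x. v x $ i)" for i by (auto simp: restr_def)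
  then show ?thesis using v by (auto simp: face_vpolys_def vpolys_def face_polys_restr)
qed

lemma vpolys_add: "v \<in> vpolys l \<Longrightarrow> w \<in> vpolys l \<Longrightarrow> (\<lambda>x. v x + w x) \<in> vpolys l"
  using subspace_add[OF subspace_vpolys, of v l w] by (simp add: plus_fun_def)

lemma vpolys_scale: "v \<in> vpolys l \<Longrightarrow> (\<lambda>x. c *\<^sub>R v x) \<in> vpolys l"
  using subspace_scale[OF subspace_vpolys, of v l c] by (simp add: scaleR_fun_def)

lemma vpolys_zero: "(\<lambda>x. 0) \<in> vpolys l"
  using subspace_0[OF subspace_vpolys, of l] by (simp add: zero_fun_def)

lemma vpolys_const: "(\<lambda>x. c) \<in> vpolys l" by (simp add: vpolys_def polys_const)

lemma vpolys_le: "l \<le> l' \<Longrightarrow> vpolys l \<subseteq> vpolys l'"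
  using polys_le[of l l'] by (auto simp: vpolys_def)

lemma zero_face_vpolys: "(\<lambda>x. 0) \<in> face_vpolys k F"
  using subspace_0[OF subspace_face_vpolys, of k F] by (simp add: zero_fun_def)

lemma component_continuous:
  fixes f :: "real^'d \<Rightarrow> real^'d"
  shows "continuous_on S f \<Longrightarrow> continuous_on S (\<lambda>x. f x $ i)"
  by (intro continuous_intros)

lemma vpolys_differentiable: "v \<in> vpolys l \<Longrightarrow> (v has_derivative (\<lambda>h. \<chi> j. frechet_derivative (\<lambda>x. v x $ j) (at x) h)) (at x)"
proof -
  assume v: "v \<in> vpolys l"
  have "((\<lambda>x. v x $ j) has_derivative frechet_derivative (\<lambda>x. v x $ j) (at x)) (at x)" for j
    using polys_deriv(1)[of "\<lambda>x. v x $ j" l x] v frechet_derivative_works by (auto simp: vpolys_def)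
  then show ?thesis
    by (subst has_derivative_componentwise_within) (auto simp: Basis_vec_def inner_axis)
qed

lemma vgrad_component: "v \<in> vpolys l \<Longrightarrow> vgrad v x $ i $ j = pderivative i (\<lambda>x. v x $ j) x"
  using frechet_derivative_at[OF vpolys_differentiable[of v l x]]
  by (simp add: vgrad_def pderivative_def) (metis vec_lambda_beta)

lemma vgrad_polys: "v \<in> vpolys l \<Longrightarrow> (\<lambda>x. vgrad v x $ i $ j) \<in> polys (l - 1)"
  using polys_deriv(2)[of "\<lambda>x. v x $ j" l i] by (simp add: vgrad_component vpolys_def)

lemma vgrad_const: "vgrad (\<lambda>x. c) x = 0"
  by (simp add: vgrad_def vec_eq_iff frechet_derivative_const)

lemma sgrad_component: "sgrad v x $ i $ j = (1/2) * (vgrad v x $ i $ j + vgrad v x $ j $ i)"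
  by (simp add: sgrad_def transpose_def)

lemma ssgrad_component: "ssgrad v x $ i $ j = (1/2) * (vgrad v x $ i $ j - vgrad v x $ j $ i)"
  by (simp add: ssgrad_def transpose_def)

lemma sgrad_polys: "v \<in> vpolys l \<Longrightarrow> (\<lambda>x. sgrad v x $ i $ j) \<in> polys (l - 1)"
  unfolding sgrad_component by (intro polys_scale polys_add vgrad_polys)

lemma ssgrad_polys: "v \<in> vpolys l \<Longrightarrow> (\<lambda>x. ssgrad v x $ i $ j) \<in> polys (l - 1)"
  unfolding ssgrad_component by (intro polys_scale polys_diff vgrad_polys)

lemma divg_polys: "v \<in> vpolys l \<Longrightarrow> divg v \<in> polys (l - 1)"
  unfolding divg_def[abs_def] trace_def by (intro polys_sum vgrad_polys)

lemma matrix_continuous: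
  fixes f :: "'a::topological_space \<Rightarrow> real^'d^'e"
  assumes "\<And>i j. continuous_on S (\<lambda>x. f x $ i $ j)"
  shows "continuous_on S f"
proof -
  have "continuous_on S (\<lambda>x. \<chi> i. \<chi> j. f x $ i $ j)" by (intro continuous_intros assms)
  then show ?thesis by simp
qed

lemma matrix_mult_continuous:
  fixes A :: "real^'d \<Rightarrow> real^'d^'d"
  shows "continuous_on S A \<Longrightarrow> continuous_on S (\<lambda>x. A x *v n)"
  unfolding matrix_vector_mult_def by (intro continuous_intros)

lemma tensor_continuous:
  fixes f g :: "real^'d \<Rightarrow> real^'d"
  shows "continuous_on S f \<Longrightarrow> continuous_on S g \<Longrightarrow> continuous_on S (\<lambda>x. tensor (f x) (g x))"
  unfolding tensor_def by (intro continuous_intros)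

lemma sgrad_continuous: "v \<in> vpolys l \<Longrightarrow> continuous_on S (sgrad v)"
  by (rule matrix_continuous, rule polys_continuous, rule sgrad_polys)

lemma ssgrad_continuous: "v \<in> vpolys l \<Longrightarrow> continuous_on S (ssgrad v)"
  by (rule matrix_continuous, rule polys_continuous, rule ssgrad_polys)

lemma vgrad_add: "v \<in> vpolys l \<Longrightarrow> w \<in> vpolys l \<Longrightarrow> vgrad (\<lambda>x. v x + w x) x = vgrad v x + vgrad w x"
  using vpolys_add[of v l w]
  by (simp add: vec_eq_iff vgrad_component) (auto simp: vpolys_def intro: pderivative_add)

lemma vgrad_scale: "v \<in> vpolys l \<Longrightarrow> vgrad (\<lambda>x. c *\<^sub>R v x) x = c *\<^sub>R vgrad v x"
  using vpolys_scale[of v l c]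
  by (simp add: vec_eq_iff vgrad_component) (auto simp: vpolys_def intro: pderivative_scale)

lemma sgrad_add: "v \<in> vpolys l \<Longrightarrow> w \<in> vpolys l \<Longrightarrow> sgrad (\<lambda>x. v x + w x) x = sgrad v x + sgrad w x"
  by (simp add: vec_eq_iff sgrad_component vgrad_add[of v l w] algebra_simps)

lemma sgrad_scale: "v \<in> vpolys l \<Longrightarrow> sgrad (\<lambda>x. c *\<^sub>R v x) x = c *\<^sub>R sgrad v x"
  by (simp add: vec_eq_iff sgrad_component vgrad_scale[of v l c] algebra_simps)

lemma sgrad_zero: "sgrad (\<lambda>x. 0) = (\<lambda>x. 0)"
  by (simp add: fun_eq_iff sgrad_def vgrad_const transpose_def vec_eq_iff)

lemma ssgrad_add: "v \<in> vpolys l \<Longrightarrow> w \<in> vpolys l \<Longrightarrow> ssgrad (\<lambda>x. v x + w x) x = ssgrad v x + ssgrad w x"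
  by (simp add: vec_eq_iff ssgrad_component vgrad_add[of v l w] algebra_simps)

lemma ssgrad_scale: "v \<in> vpolys l \<Longrightarrow> ssgrad (\<lambda>x. c *\<^sub>R v x) x = c *\<^sub>R ssgrad v x"
  by (simp add: vec_eq_iff ssgrad_component vgrad_scale[of v l c] algebra_simps)

lemma identity_inner_sgrad: "mat 1 \<bullet> sgrad v x = divg v x"
  by (simp add: inner_vec_def mat_def divg_def trace_def sgrad_component if_distrib if_distribR cong: if_cong)

section \<open>Rigid motions\<close>

text \<open>The symmetric gradient is polynomial and vanishes on an open set, hence everywhere.  Then the derivative of \<open>t \<mapsto> r (y + t (x - y)) \<bullet> (x - y)\<close> is the quadratic
form of the gradient and is zero, so \<open>(r x - r y) \<bullet> (x - y) = 0\<close> for all \<open>x\<close>, \<open>y\<close>.  With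
\<open>s x = r x - r 0\<close> this says \<open>s x \<bullet> y = - (s y \<bullet> x)\<close>, and the right-hand side is linear in \<open>x\<close>.\<close>

lemma rigid_motion:
  fixes r :: "real^'d \<Rightarrow> real^'d"
  assumes r: "r \<in> vpolys l" and T: "open T" "T \<noteq> {}" and z: "\<And>x. x \<in> T \<Longrightarrow> sgrad r x = 0"
  shows "linear (\<lambda>x. r x - r 0)"
proof -
  have sg: "vgrad r x $ i $ j = - vgrad r x $ j $ i" for x i j
  proof -
    have "sgrad r x $ i $ j = 0"
      by (rule polys_zero_on_open[OF sgrad_polys[OF r] T]) (simp add: z)
    then show ?thesis by (simp add: sgrad_component)
  qed
  have Dvv: "frechet_derivative r (at x) v \<bullet> v = 0" for x v
  proof -
    have d: "(r has_derivative frechet_derivative r (at x)) (at x)"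
      using vpolys_differentiable[OF r, of x] differentiableI frechet_derivative_works by blast
    interpret D: linear "frechet_derivative r (at x)" using d by (rule has_derivative_linear)
    have "frechet_derivative r (at x) v = frechet_derivative r (at x) (\<Sum>i\<in>UNIV. v $ i *\<^sub>R axis i 1)"
      using basis_expansion[of v] by (simp add: scalar_mult_eq_scaleR)
    then have "frechet_derivative r (at x) v \<bullet> v = (\<Sum>j\<in>UNIV. \<Sum>i\<in>UNIV. v $ i * v $ j * vgrad r x $ i $ j)"
      by (simp add: D.sum D.scale inner_vec_def vgrad_def sum_distrib_left sum_distrib_right mult_ac)
    moreover have "(\<Sum>j\<in>UNIV. \<Sum>i\<in>UNIV. v $ i * v $ j * vgrad r x $ i $ j)
        = - (\<Sum>j\<in>UNIV. \<Sum>i\<in>UNIV. v $ i * v $ j * vgrad r x $ i $ j)"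
    proof -
      have "(\<Sum>j\<in>UNIV. \<Sum>i\<in>UNIV. v $ i * v $ j * vgrad r x $ i $ j)
          = (\<Sum>i\<in>UNIV. \<Sum>j\<in>UNIV. v $ i * v $ j * vgrad r x $ i $ j)" by (rule sum.swap)
      also have "\<dots> = (\<Sum>i\<in>UNIV. \<Sum>j\<in>UNIV. - (v $ j * v $ i * vgrad r x $ j $ i))"
        by (intro sum.cong refl) (subst sg, simp add: mult_ac)
      finally show ?thesis by (simp add: sum_negf)
    qed
    ultimately show ?thesis by linarith
  qed
  have orth: "(r x - r y) \<bullet> (x - y) = 0" for x y
  proof -
    let ?v = "x - y"
    have "((\<lambda>t. r (y + t *\<^sub>R ?v) \<bullet> ?v) has_real_derivative 0) (at t)" for t
    proof -
      have d: "(r has_derivative frechet_derivative r (at (y + t *\<^sub>R ?v))) (at (y + t *\<^sub>R ?v))"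
        using vpolys_differentiable[OF r] differentiableI frechet_derivative_works by blast
      have l: "((\<lambda>t. y + t *\<^sub>R ?v) has_derivative (\<lambda>h. h *\<^sub>R ?v)) (at t)"
        by (auto intro!: derivative_eq_intros)
      have "((\<lambda>t. r (y + t *\<^sub>R ?v)) has_derivative (\<lambda>h. frechet_derivative r (at (y + t *\<^sub>R ?v)) (h *\<^sub>R ?v))) (at t)"
        using diff_chain_at[OF l d] by (simp add: o_def)
      from has_derivative_inner_left[OF this, of ?v]
      have "((\<lambda>t. r (y + t *\<^sub>R ?v) \<bullet> ?v) has_derivative (\<lambda>h. frechet_derivative r (at (y + t *\<^sub>R ?v)) (h *\<^sub>R ?v) \<bullet> ?v)) (at t)" .
      moreover have "(\<lambda>h. frechet_derivative r (at (y + t *\<^sub>R ?v)) (h *\<^sub>R ?v) \<bullet> ?v) = (\<lambda>h. 0 * h)"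
        using linear_scale[OF has_derivative_linear[OF d]] Dvv by simp
      moreover have "(*) (0::real) = (\<lambda>h. 0)" by auto
      ultimately show ?thesis by (simp add: has_field_derivative_def)
    qed
    then have "r (y + 1 *\<^sub>R ?v) \<bullet> ?v = r (y + 0 *\<^sub>R ?v) \<bullet> ?v"
      by (intro DERIV_isconst_all) blast
    then show ?thesis by (simp add: inner_diff_left)
  qed
  define s where "s x = r x - r 0" for x
  have ss: "s x \<bullet> y = - (s y \<bullet> x)" for x y
    using orth[of x y] orth[of x 0] orth[of y 0]
    by (simp add: s_def inner_diff_left inner_diff_right algebra_simps)
  have "s (x + y) = s x + s y" for x y
  proof -
    have "(s (x + y) - (s x + s y)) \<bullet> z = 0" for z
      using ss[of "x + y" z] ss[of x z] ss[of y z] by (simp add: inner_diff_left inner_add_left inner_add_right)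
    from this[of "s (x + y) - (s x + s y)"] show ?thesis by simp
  qed
  moreover have "s (c *\<^sub>R x) = c *\<^sub>R s x" for c x
  proof -
    have "(s (c *\<^sub>R x) - c *\<^sub>R s x) \<bullet> z = 0" for z
      using ss[of "c *\<^sub>R x" z] ss[of x z] by (simp add: inner_diff_left)
    from this[of "s (c *\<^sub>R x) - c *\<^sub>R s x"] show ?thesis by simp
  qed
  ultimately have "linear s" by (rule linearI)
  then show ?thesis by (simp add: s_def[abs_def])
qed

lemma rigid_motion_vgrad:
  fixes r :: "real^'d \<Rightarrow> real^'d"
  assumes "linear (\<lambda>x. r x - r 0)"
  shows "vgrad r x $ i $ j = (r (axis i 1) - r 0) $ j"
proof -
  have "((\<lambda>x. (r x - r 0) + r 0) has_derivative (\<lambda>h. (r h - r 0) + 0)) (at x)"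
    by (intro has_derivative_add has_derivative_const bounded_linear_imp_has_derivative linear_linear[THEN iffD2] assms)
  then have "(r has_derivative (\<lambda>h. r h - r 0)) (at x)" by simp
  from frechet_derivative_at[OF this] show ?thesis by (simp add: vgrad_def) (metis vector_minus_component)
qed

text \<open>Supplies test functions with a prescribed constant gradient.\<close>

lemma linear_field:
  fixes W :: "real^'d^'d"
  assumes "1 \<le> l"
  shows "(\<lambda>x. x v* W) \<in> vpolys l" and "vgrad (\<lambda>x. x v* W) x = W"
proof -
  have "(\<lambda>x. x $ i * W $ i $ j) \<in> polys l" for i j
    using polys_scale[OF polys_coord[OF assms], of "W $ i $ j" i] by (simp add: mult.commute)
  then show "(\<lambda>x. x v* W) \<in> vpolys l"
    unfolding vpolys_def vector_matrix_mult_def by (auto intro!: polys_sum simp: mult.commute)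
  have lin: "linear (\<lambda>x. x v* W)"
    by (intro linearI) (simp_all add: vector_matrix_mult_def vec_eq_iff sum.distrib sum_distrib_left algebra_simps)
  then have "((\<lambda>x. x v* W) has_derivative (\<lambda>x. x v* W)) (at x)"
    by (intro bounded_linear_imp_has_derivative linear_linear[THEN iffD2])
  note d = frechet_derivative_at[OF this]
  show "vgrad (\<lambda>x. x v* W) x = W"
  proof -
    have "(axis i 1 v* W) $ j = W $ i $ j" for i j
      unfolding vector_matrix_mult_def by (simp, subst sum.remove[of UNIV i]) (auto simp: axis_def intro!: sum.neutral)
    then show ?thesis by (simp only: vgrad_def vec_eq_iff vec_lambda_beta d[symmetric]) simp
  qed
qed

section \<open>Orthogonal projections\<close>

definition oproj :: "'a measure \<Rightarrow> 'a set \<Rightarrow> ('a \<Rightarrow> real) set \<Rightarrow> ('a \<Rightarrow> real) \<Rightarrow> 'a \<Rightarrow> real" where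
  "oproj m X S f = (THE p. p \<in> S \<and> (\<forall>q\<in>S. ip m X p q = ip m X f q))"

lemma proj_oproj: "proj l T = oproj lborel T (polys l)"
  by (simp add: fun_eq_iff proj_def oproj_def vol_inner_ip)

lemma face_proj_oproj: "face_proj l F = oproj (face_measure F) F (face_polys l F)"
  by (simp add: fun_eq_iff face_proj_def oproj_def face_inner_ip)

text \<open>A finite-dimensional space of square integrable functions on \<open>X\<close> in which functions that vanish
almost everywhere on \<open>X\<close> are zero; the polynomials on an element and on a face are instances.\<close>

locale fin_subspace =
  fixes m :: "'a measure" and X :: "'a set" and S :: "('a \<Rightarrow> real) set"
  assumes sub: "subspace S" and fd: "fin_dim S" and L2S: "p \<in> S \<Longrightarrow> L2 m X p"
    and definite: "p \<in> S \<Longrightarrow> ip m X p p = 0 \<Longrightarrow> p = 0"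
begin

lemma oproj_ex1:
  assumes f: "L2 m X f"
  shows "\<exists>!p. p \<in> S \<and> (\<forall>q\<in>S. ip m X p q = ip m X f q)"
proof (rule riesz_representation[OF sub fd])
  show "ip m X (x + y) z = ip m X x z + ip m X y z" if "x \<in> S" "y \<in> S" "z \<in> S" for x y z
    unfolding plus_fun_def by (intro ip_add_left L2S that)
  show "ip m X (c *\<^sub>R x) z = c * ip m X x z" for c x z
    unfolding scaleR_fun_def by (rule ip_scaleR_left)
  show "ip m X f (x + y) = ip m X f x + ip m X f y" if "x \<in> S" "y \<in> S" for x y
    unfolding plus_fun_def by (intro ip_add_right L2S that f)
  show "ip m X f (c *\<^sub>R x) = c * ip m X f x" for c x
    unfolding scaleR_fun_def by (rule ip_scaleR_right)
qed (use definite in \<open>auto simp: ip_commute\<close>)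

lemma oproj_mem: "L2 m X f \<Longrightarrow> oproj m X S f \<in> S"
  and oproj_ip: "L2 m X f \<Longrightarrow> q \<in> S \<Longrightarrow> ip m X (oproj m X S f) q = ip m X f q"
  using theI'[OF oproj_ex1] unfolding oproj_def by blast+

lemma oproj_eqI: "L2 m X f \<Longrightarrow> p \<in> S \<Longrightarrow> (\<And>q. q \<in> S \<Longrightarrow> ip m X p q = ip m X f q) \<Longrightarrow> oproj m X S f = p"
  unfolding oproj_def by (rule the1_equality[OF oproj_ex1]) auto

lemma oproj_id: "p \<in> S \<Longrightarrow> oproj m X S p = p"
  by (rule oproj_eqI) (auto intro: L2S)

lemma oproj_add:
  assumes "L2 m X f" "L2 m X g"
  shows "oproj m X S (\<lambda>x. f x + g x) = (\<lambda>x. oproj m X S f x + oproj m X S g x)"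
proof (rule oproj_eqI)
  show "(\<lambda>x. oproj m X S f x + oproj m X S g x) \<in> S"
    using subspace_add[OF sub oproj_mem[OF assms(1)] oproj_mem[OF assms(2)]] by (simp add: plus_fun_def)
qed (use assms in \<open>simp_all add: L2_add ip_add_left L2S oproj_mem oproj_ip\<close>)

lemma oproj_scale:
  assumes "L2 m X f"
  shows "oproj m X S (\<lambda>x. c * f x) = (\<lambda>x. c * oproj m X S f x)"
proof (rule oproj_eqI)
  show "(\<lambda>x. c * oproj m X S f x) \<in> S"
    using subspace_scale[OF sub oproj_mem[OF assms(1)], of c] by (simp add: scaleR_fun_def)
  show "L2 m X (\<lambda>x. c * f x)" using L2_scaleR[OF assms, of c] by simp
  show "ip m X (\<lambda>x. c * oproj m X S f x) q = ip m X (\<lambda>x. c * f x) q" if "q \<in> S" for q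
    using ip_scaleR_left[of m X c "oproj m X S f" q] ip_scaleR_left[of m X c f q] oproj_ip[OF assms that] by simp
qed

end

section \<open>Elements of the mesh\<close>

text \<open>An open polyhedron is the interior of a compact set, hence regular open; by this an element
lies in the domain and not merely in its closure.\<close>

lemma open_polyhedron_props:
  fixes P :: "'e::euclidean_space set"
  assumes "open_polyhedron P"
  shows "open P" "bounded P" "interior (closure P) = P"
proof -
  obtain Q where Q: "finite Q" "\<And>q. q \<in> Q \<Longrightarrow> polytope q" "P = interior (\<Union>Q)"
    using assms by (auto simp: open_polyhedron_def)
  show op: "open P" using Q(3) by simp
  have comp: "compact (\<Union>Q)" using Q by (intro compact_Union) (auto intro: polytope_imp_compact)
  then show "bounded P" unfolding Q(3) by (intro bounded_interior compact_imp_bounded)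
  have cl: "closure P \<subseteq> \<Union>Q" unfolding Q(3) using comp by (intro closure_minimal interior_subset compact_imp_closed)
  show "interior (closure P) = P"
  proof
    show "interior (closure P) \<subseteq> P" using interior_mono[OF cl] Q(3) by simp
    show "P \<subseteq> interior (closure P)" using op closure_subset by (intro interior_maximal)
  qed
qed

locale mesh_on =
  fixes \<Omega> :: "(real^'d) set" and M :: "(real^'d) mesh"
  assumes domain: "open_polyhedron \<Omega>" and mesh: "polyhedral_mesh \<Omega> M"
begin

lemma partition: "polyhedral_partition \<Omega> (elems M)" using mesh unfolding polyhedral_mesh_def by (elim conjE)

lemma finite_elems [simp]: "finite (elems M)" using partition by (simp add: polyhedral_partition_def)

lemma finite_faces [simp]: "finite (faces M)" using mesh unfolding polyhedral_mesh_def by (elim conjE)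

lemma finite_elem_faces [simp]: "finite (elem_faces M T)" by (simp add: elem_faces_def)

lemma elem_nonempty: "T \<in> elems M \<Longrightarrow> T \<noteq> {}"
  and elem_polyhedron: "T \<in> elems M \<Longrightarrow> open_polyhedron T"
  using partition by (auto simp: polyhedral_partition_def)

lemma elems_disjoint: "T \<in> elems M \<Longrightarrow> T' \<in> elems M \<Longrightarrow> T \<noteq> T' \<Longrightarrow> T \<inter> T' = {}"
  using partition by (auto simp: polyhedral_partition_def pairwise_def disjnt_def)

lemma elem_open: "T \<in> elems M \<Longrightarrow> open T" and elem_bounded: "T \<in> elems M \<Longrightarrow> bounded T"
  using open_polyhedron_props elem_polyhedron by blast+

lemma elem_borel: "T \<in> elems M \<Longrightarrow> T \<in> sets borel" using elem_open by simp

lemma domain_bounded: "bounded \<Omega>"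
  using domain by (rule open_polyhedron_props(2))

lemma closure_domain: "closure \<Omega> = (\<Union>T\<in>elems M. closure T)"
  using partition by (simp add: polyhedral_partition_def)

lemma elem_subset: "T \<in> elems M \<Longrightarrow> T \<subseteq> \<Omega>"
proof -
  assume T: "T \<in> elems M"
  then have "T \<subseteq> closure \<Omega>" unfolding closure_domain using closure_subset by blast
  then show ?thesis using interior_maximal[OF _ elem_open[OF T]] open_polyhedron_props(3)[OF domain] by blast
qed

lemma elem_measure_pos: "T \<in> elems M \<Longrightarrow> measure lborel T > 0"
proof -
  assume T: "T \<in> elems M"
  have "emeasure lborel T \<noteq> 0"
    using open_not_negligible[OF elem_open[OF T] elem_nonempty[OF T]] elem_borel[OF T] by (auto simp: negligible_iff_emeasure0)
  moreover have "emeasure lborel T \<noteq> \<infinity>" using emeasure_bounded_finite[OF elem_bounded[OF T]] by simp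
  ultimately show ?thesis by (simp add: measure_def enn2real_positive_iff top.not_eq_extremum zero_less_iff_neq_zero)
qed

lemma set_integral_const: "T \<in> elems M \<Longrightarrow> (LINT x:T|lborel. c) = measure lborel T *\<^sub>R (c :: 'e::euclidean_space)"
  using elem_borel emeasure_bounded_finite[OF elem_bounded]
  by (simp add: set_lebesgue_integral_def)

lemma glue_elem:
  assumes "T \<in> elems M" "x \<in> T"
  shows "glue M v x = v T x"
proof -
  have "(if x \<in> T' then v T' x else 0) = (if T' = T then v T x else 0)" if "T' \<in> elems M" for T'
    using elems_disjoint[OF that assms(1)] assms(2) by auto
  then have "glue M v x = (\<Sum>T'\<in>elems M. if T' = T then v T x else 0)"
    unfolding glue_def by (rule sum.cong[OF refl])
  then show ?thesis using assms(1) by simp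
qed

lemma glue_outside: "(\<And>T. T \<in> elems M \<Longrightarrow> x \<notin> T) \<Longrightarrow> glue M v x = 0"
  unfolding glue_def by (intro sum.neutral) auto

text \<open>The condition off the elements holds as soon as one of the factors is a glued function.  It makes the
decomposition a pointwise identity, so that the coefficient \<open>\<kappa>\<close> may take arbitrary values on the
skeleton of the mesh.\<close>

lemma vol_inner_split:
  fixes f g :: "real^'d \<Rightarrow> 'b::euclidean_space"
  assumes eq: "\<And>T x. T \<in> elems M \<Longrightarrow> x \<in> T \<Longrightarrow> f x \<bullet> g x = f' T x \<bullet> g' T x"
    and off: "\<And>x. (\<And>T. T \<in> elems M \<Longrightarrow> x \<notin> T) \<Longrightarrow> f x \<bullet> g x = 0"
    and int: "\<And>T. T \<in> elems M \<Longrightarrow> set_integrable lborel T (\<lambda>x. f' T x \<bullet> g' T x)"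
  shows "vol_inner \<Omega> f g = (\<Sum>T\<in>elems M. vol_inner T (f' T) (g' T))"
proof -
  have "indicator \<Omega> x *\<^sub>R (f x \<bullet> g x) = (\<Sum>T\<in>elems M. indicator T x *\<^sub>R (f' T x \<bullet> g' T x))" for x
  proof (cases "\<exists>T\<in>elems M. x \<in> T")
    case True
    then obtain T where T: "T \<in> elems M" "x \<in> T" by blast
    have "(indicator T' x *\<^sub>R (f' T' x \<bullet> g' T' x) :: real) = (if T' = T then f x \<bullet> g x else 0)" if "T' \<in> elems M" for T'
      using elems_disjoint[OF that T(1)] T eq[OF T] by (auto simp: indicator_def)
    then have "(\<Sum>T\<in>elems M. indicator T x *\<^sub>R (f' T x \<bullet> g' T x)) = (\<Sum>T'\<in>elems M. if T' = T then f x \<bullet> g x else 0)"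
      by (rule sum.cong[OF refl])
    then show ?thesis using T elem_subset[OF T(1)] by (auto simp: indicator_def)
  next
    case False
    then have "(\<Sum>T\<in>elems M. indicator T x *\<^sub>R (f' T x \<bullet> g' T x)) = (0::real)"
      by (intro sum.neutral) auto
    then show ?thesis using False off[of x] by simp
  qed
  then have "vol_inner \<Omega> f g = (LINT x|lborel. (\<Sum>T\<in>elems M. indicator T x *\<^sub>R (f' T x \<bullet> g' T x)))"
    unfolding vol_inner_def set_lebesgue_integral_def by (simp only:)
  also have "\<dots> = (\<Sum>T\<in>elems M. LINT x|lborel. indicator T x *\<^sub>R (f' T x \<bullet> g' T x))"
    using int unfolding set_integrable_def by (rule Bochner_Integration.integral_sum)
  finally show ?thesis unfolding vol_inner_def set_lebesgue_integral_def .
qed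

lemma vol_inner_glue:
  fixes f :: "real^'d \<Rightarrow> 'b::euclidean_space"
  assumes "\<And>T. T \<in> elems M \<Longrightarrow> L2 lborel T f" "\<And>T. T \<in> elems M \<Longrightarrow> L2 lborel T (v T)"
  shows "vol_inner \<Omega> f (glue M v) = (\<Sum>T\<in>elems M. vol_inner T f (v T))"
  by (rule vol_inner_split) (use assms in \<open>auto simp: glue_elem glue_outside L2_integrable\<close>)

lemma vol_inner_glue_glue:
  fixes v w :: "(real^'d, 'b::euclidean_space) brk"
  assumes "\<And>T. T \<in> elems M \<Longrightarrow> L2 lborel T (v T)" "\<And>T. T \<in> elems M \<Longrightarrow> L2 lborel T (w T)"
  shows "vol_inner \<Omega> (glue M v) (glue M w) = (\<Sum>T\<in>elems M. vol_inner T (v T) (w T))"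
  by (rule vol_inner_split) (use assms in \<open>auto simp: glue_elem glue_outside L2_integrable\<close>)

section \<open>Faces and normals\<close>

lemma elem_faces_faces: "F \<in> elem_faces M T \<Longrightarrow> F \<in> faces M" by (simp add: elem_faces_def)

lemma frontier_elem: "T \<in> elems M \<Longrightarrow> frontier T = \<Union>(elem_faces M T)"
proof -
  have "\<forall>T\<in>elems M. frontier T = \<Union>(elem_faces M T)" using mesh unfolding polyhedral_mesh_def by (elim conjE)
  then show "T \<in> elems M \<Longrightarrow> frontier T = \<Union>(elem_faces M T)" by (rule bspec)
qed

lemma face_plane: "F \<in> faces M \<Longrightarrow> hyperplanar_face F"
proof -
  have "\<forall>F\<in>faces M. hyperplanar_face F \<and> F \<subseteq> closure \<Omega>" using mesh unfolding polyhedral_mesh_def by (elim conjE)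
  then show "F \<in> faces M \<Longrightarrow> hyperplanar_face F" by simp
qed

lemma face_in_closure: "F \<in> faces M \<Longrightarrow> F \<subseteq> closure \<Omega>"
proof -
  have "\<forall>F\<in>faces M. hyperplanar_face F \<and> F \<subseteq> closure \<Omega>" using mesh unfolding polyhedral_mesh_def by (elim conjE)
  then show "F \<in> faces M \<Longrightarrow> F \<subseteq> closure \<Omega>" by simp
qed

lemma faces_split: "faces M = interfaces M \<union> boundary_faces \<Omega> M"
  using mesh unfolding polyhedral_mesh_def by (elim conjE)

lemma interface_not_boundary: "interfaces M \<inter> boundary_faces \<Omega> M = {}"
  using mesh unfolding polyhedral_mesh_def by (elim conjE)

lemma interface_face: "F \<in> interfaces M \<Longrightarrow> F \<in> faces M" using faces_split by blast

lemma face_compact: "F \<in> faces M \<Longrightarrow> compact F"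
  using face_plane face_in_closure bounded_subset[OF bounded_closure[OF domain_bounded]]
  unfolding hyperplanar_face_def compact_eq_bounded_closed by blast

lemma face_positive: "F \<in> faces M \<Longrightarrow> emeasure (face_measure F) F > 0"
  using face_plane unfolding hyperplanar_face_def by blast

lemma face_overlap: "F \<in> faces M \<Longrightarrow> F' \<in> faces M \<Longrightarrow> F \<noteq> F' \<Longrightarrow> emeasure (face_measure F) (F \<inter> F') = 0"
proof -
  have "\<forall>F\<in>faces M. \<forall>F'\<in>faces M. F \<noteq> F' \<longrightarrow> emeasure (face_measure F) (F \<inter> F') = 0" using mesh unfolding polyhedral_mesh_def by (elim conjE)
  then show "F \<in> faces M \<Longrightarrow> F' \<in> faces M \<Longrightarrow> F \<noteq> F' \<Longrightarrow> emeasure (face_measure F) (F \<inter> F') = 0" by simp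
qed

lemma face_elem: "F \<in> faces M \<Longrightarrow> \<exists>T\<in>elems M. F \<in> elem_faces M T"
proof -
  assume F: "F \<in> faces M"
  then consider "F \<in> interfaces M" | "F \<in> boundary_faces \<Omega> M" using faces_split by blast
  then show ?thesis using F unfolding interfaces_def boundary_faces_def elem_faces_def by cases blast+
qed

text \<open>A face has codimension one, hence spans the whole hyperplane orthogonal to any of its normals.\<close>

lemma hyperplane_of_normal:
  fixes F :: "(real^'d) set"
  assumes F: "hyperplanar_face F" and n: "norm n = 1" "\<And>x y. x \<in> F \<Longrightarrow> y \<in> F \<Longrightarrow> n \<bullet> (x - y) = 0"
  shows "\<exists>\<beta>. affine hull F = {x. n \<bullet> x = \<beta>}"
proof -
  have ad: "aff_dim F = int CARD('d) - 1" using F by (simp add: hyperplanar_face_def)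
  then have "F \<noteq> {}" using aff_dim_empty[of F] by auto
  then obtain x0 where x0: "x0 \<in> F" by blast
  let ?H = "{x. n \<bullet> x = n \<bullet> x0}"
  have "F \<subseteq> ?H" using n(2)[OF _ x0] by (auto simp: inner_diff_right)
  then have "affine hull F \<subseteq> ?H" by (intro hull_minimal) (simp_all add: affine_hyperplane)
  moreover have "n \<noteq> 0" using n by auto
  then have "aff_dim (affine hull F) = aff_dim ?H" using ad by (simp add: aff_dim_hyperplane)
  ultimately have "affine hull F = ?H"
    using \<open>F \<noteq> {}\<close> by (intro affine_dim_equal) (simp_all add: affine_hyperplane)
  then show ?thesis by blast
qed

lemma unit_normal_cases:
  fixes F :: "(real^'d) set"
  assumes F: "hyperplanar_face F" and n: "outward_unit_normal T F n" and n': "outward_unit_normal T' F n'"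
  shows "n' = n \<or> n' = - n"
proof -
  obtain \<beta> where \<beta>: "affine hull F = {x. n \<bullet> x = \<beta>}"
    using hyperplane_of_normal[OF F, of n] n unfolding outward_unit_normal_def by blast
  obtain \<beta>' where \<beta>': "affine hull F = {x. n' \<bullet> x = \<beta>'}"
    using hyperplane_of_normal[OF F, of n'] n' unfolding outward_unit_normal_def by blast
  have nn: "norm n = 1" "norm n' = 1" using n n' by (auto simp: outward_unit_normal_def)
  then have n1: "n \<bullet> n = 1" "n' \<bullet> n' = 1" by (auto simp: dot_square_norm)
  have "n' \<bullet> w = 0" if w: "n \<bullet> w = 0" for w
  proof -
    have "\<beta> *\<^sub>R n \<in> affine hull F" "\<beta> *\<^sub>R n + w \<in> affine hull F" using n1 w by (auto simp: \<beta> inner_add_right)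
    then show ?thesis unfolding \<beta>' by (auto simp: inner_add_right)
  qed
  from this[of "n' - (n \<bullet> n') *\<^sub>R n"] have *: "n' \<bullet> n' = (n \<bullet> n') * (n' \<bullet> n)"
    using n1 by (simp add: inner_diff_right)
  have "(n' - (n \<bullet> n') *\<^sub>R n) \<bullet> (n' - (n \<bullet> n') *\<^sub>R n) = 0"
    using * n1 by (simp add: inner_diff_left inner_diff_right inner_commute)
  then have "n' = (n \<bullet> n') *\<^sub>R n" by simp
  moreover have "n \<bullet> n' = 1 \<or> n \<bullet> n' = - 1"
    using * n1 by (simp add: inner_commute power2_eq_square[symmetric] power2_eq_1_iff)
  ultimately show ?thesis by (metis scaleR_one scaleR_minus1_left)
qed

lemma face_point:
  assumes F: "F \<in> faces M" and "AE x in face_measure F. x \<in> F \<longrightarrow> P x"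
  shows "\<exists>x\<in>F. P x"
proof (rule ccontr)
  assume "\<not> ?thesis"
  then have "AE x in face_measure F. x \<notin> F" using assms(2) by (auto elim: eventually_mono)
  moreover have "F \<in> sets (face_measure F)" "space (face_measure F) = UNIV"
    using borel_compact[OF face_compact[OF F]] by (auto simp: face_measure_def)
  ultimately have "emeasure (face_measure F) F = 0" by (subst (asm) AE_iff_measurable[of F]) auto
  then show False using face_positive[OF F] by simp
qed

text \<open>Two equal normals would place the points \<open>x - s n\<close>, for small \<open>s\<close>, in both elements.\<close>

lemma outward_normals_opposite:
  assumes F: "F \<in> faces M" and n: "outward_unit_normal T F n" and n': "outward_unit_normal T' F n'"
    and disj: "T \<inter> T' = {}"
  shows "n' = - n"
proof (rule ccontr)
  assume "n' \<noteq> - n"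
  then have eq: "n' = n" using unit_normal_cases[OF face_plane[OF F] n n'] by blast
  have "AE x in face_measure F. x \<in> F \<longrightarrow> (\<exists>e>0. \<forall>s\<in>{0<..<e}. x - s *\<^sub>R n \<in> T \<and> x + s *\<^sub>R n \<notin> T)"
    "AE x in face_measure F. x \<in> F \<longrightarrow> (\<exists>e>0. \<forall>s\<in>{0<..<e}. x - s *\<^sub>R n \<in> T' \<and> x + s *\<^sub>R n \<notin> T')"
    using n n' eq by (auto simp: outward_unit_normal_def)
  then have "AE x in face_measure F. x \<in> F \<longrightarrow> False"
  proof eventually_elim
    case (elim x)
    show ?case
    proof
      assume "x \<in> F"
      then obtain e e' where "e > 0" "e' > 0" "\<forall>s\<in>{0<..<e}. x - s *\<^sub>R n \<in> T" "\<forall>s\<in>{0<..<e'}. x - s *\<^sub>R n \<in> T'"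
        using elim by blast
      then have "x - (min e e' / 2) *\<^sub>R n \<in> T \<inter> T'" by auto
      then show False using disj by blast
    qed
  qed
  then show False using face_point[OF F, of "\<lambda>_. False"] by simp
qed

lemma outward_normal_unique:
  assumes F: "F \<in> faces M" and n: "outward_unit_normal T F n" and n': "outward_unit_normal T F n'"
  shows "n' = n"
proof (rule ccontr)
  assume "n' \<noteq> n"
  then have eq: "n' = - n" using unit_normal_cases[OF face_plane[OF F] n n'] by blast
  have "AE x in face_measure F. x \<in> F \<longrightarrow> (\<exists>e>0. \<forall>s\<in>{0<..<e}. x - s *\<^sub>R n \<in> T \<and> x + s *\<^sub>R n \<notin> T)"
    "AE x in face_measure F. x \<in> F \<longrightarrow> (\<exists>e>0. \<forall>s\<in>{0<..<e}. x + s *\<^sub>R n \<in> T \<and> x - s *\<^sub>R n \<notin> T)"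
    using n n' eq by (auto simp: outward_unit_normal_def)
  then have "AE x in face_measure F. x \<in> F \<longrightarrow> False"
  proof eventually_elim
    case (elim x)
    show ?case
    proof
      assume "x \<in> F"
      then obtain e e' where "e > 0" "e' > 0" "\<forall>s\<in>{0<..<e}. x - s *\<^sub>R n \<in> T" "\<forall>s\<in>{0<..<e'}. x - s *\<^sub>R n \<notin> T"
        using elim by blast
      moreover have "min e e' / 2 \<in> {0<..<e}" "min e e' / 2 \<in> {0<..<e'}" using \<open>e > 0\<close> \<open>e' > 0\<close> by auto
      ultimately show False by blast
    qed
  qed
  then show False using face_point[OF F, of "\<lambda>_. False"] by simp
qed

text \<open>The definite description is meaningful because the normal is unique.\<close>

lemma normal_outward:
  assumes "T \<in> elems M" "F \<in> elem_faces M T"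
  shows "outward_unit_normal T F (normal T F)"
proof -
  have "\<forall>T\<in>elems M. \<forall>F\<in>elem_faces M T. \<exists>n. outward_unit_normal T F n" using mesh unfolding polyhedral_mesh_def by (elim conjE)
  then obtain n where n: "outward_unit_normal T F n" using assms by meson
  then have "\<exists>!n. outward_unit_normal T F n"
    using outward_normal_unique[OF elem_faces_faces[OF assms(2)]] by blast
  then show ?thesis unfolding normal_def by (rule theI')
qed

lemma normal_norm: "T \<in> elems M \<Longrightarrow> F \<in> elem_faces M T \<Longrightarrow> norm (normal T F) = 1"
  using normal_outward unfolding outward_unit_normal_def by blast

lemma normal_opposite:
  assumes "T \<in> elems M" "T' \<in> elems M" "T \<noteq> T'" "F \<in> elem_faces M T" "F \<in> elem_faces M T'"
  shows "normal T' F = - normal T F"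
  using outward_normals_opposite[OF elem_faces_faces[OF assms(4)] normal_outward[OF assms(1,4)] normal_outward[OF assms(2,5)]]
    elems_disjoint[OF assms(1-3)] by blast

lemma face_hyperplane:
  assumes "T \<in> elems M" "F \<in> elem_faces M T"
  obtains \<beta> where "affine hull F = {x. normal T F \<bullet> x = \<beta>}" "face_measure F = flat_lborel {x. normal T F \<bullet> x = \<beta>}"
proof -
  have "\<exists>\<beta>. affine hull F = {x. normal T F \<bullet> x = \<beta>}"
    using normal_outward[OF assms] unfolding outward_unit_normal_def
    by (intro hyperplane_of_normal face_plane elem_faces_faces[OF assms(2)]) blast+
  then show thesis using that unfolding face_measure_def by auto
qed

lemma face_L2:
  fixes f :: "real^'d \<Rightarrow> 'b::euclidean_space"
  assumes "F \<in> faces M" "continuous_on F f"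
  shows "L2 (face_measure F) F f"
proof -
  obtain T where T: "T \<in> elems M" "F \<in> elem_faces M T" using face_elem[OF assms(1)] by blast
  obtain \<beta> where "face_measure F = flat_lborel {x. normal T F \<bullet> x = \<beta>}" using face_hyperplane[OF T] by blast
  then show ?thesis using L2_continuous_flat[OF normal_norm[OF T] face_compact[OF assms(1)] assms(2)] by simp
qed

lemma face_integrable:
  fixes f :: "real^'d \<Rightarrow> 'b::euclidean_space"
  assumes "F \<in> faces M" "continuous_on F f"
  shows "set_integrable (face_measure F) F f"
proof -
  obtain T where T: "T \<in> elems M" "F \<in> elem_faces M T" using face_elem[OF assms(1)] by blast
  obtain \<beta> where "face_measure F = flat_lborel {x. normal T F \<bullet> x = \<beta>}" using face_hyperplane[OF T] by blast
  then show ?thesis using set_integrable_flat_compact[OF normal_norm[OF T] face_compact[OF assms(1)] assms(2)] by simp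
qed

lemma face_poly_zero:
  assumes F: "F \<in> faces M" and p: "p \<in> polys l" and z: "AE x in face_measure F. x \<in> F \<longrightarrow> p x = 0" and x: "x \<in> F"
  shows "p x = 0"
proof -
  obtain T where T: "T \<in> elems M" "F \<in> elem_faces M T" using face_elem[OF F] by blast
  obtain \<beta> where \<beta>: "affine hull F = {x. normal T F \<bullet> x = \<beta>}" "face_measure F = flat_lborel {x. normal T F \<bullet> x = \<beta>}"
    using face_hyperplane[OF T] by blast
  have "normal T F \<bullet> x = \<beta>" using hull_subset[of F affine] x \<beta>(1) by auto
  then show ?thesis
    using line_poly_zero_on_hyperplane[OF normal_norm[OF T] polys_line_poly[OF p] polys_continuous[OF p]
        borel_compact[OF face_compact[OF F]]] face_positive[OF F] z unfolding \<beta>(2) by blast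
qed

text \<open>The divergence theorem in the form used for the elements of the mesh.\<close>

lemma green_elem:
  assumes T: "T \<in> elems M" and p: "p \<in> polys l"
  shows "(LINT x:T|lborel. pderivative i p x) = (\<Sum>F\<in>elem_faces M T. normal T F $ i * (LINT x:F|face_measure F. p x))"
proof -
  have "\<forall>F\<in>elem_faces M T. \<exists>\<beta>. affine hull F = {x. normal T F \<bullet> x = \<beta>} \<and> face_measure F = flat_lborel {x. normal T F \<bullet> x = \<beta>}"
    using face_hyperplane[OF T] by metis
  then obtain \<beta> where \<beta>: "\<And>F. F \<in> elem_faces M T \<Longrightarrow> affine hull F = {x. normal T F \<bullet> x = \<beta> F}"
    "\<And>F. F \<in> elem_faces M T \<Longrightarrow> face_measure F = flat_lborel {x. normal T F \<bullet> x = \<beta> F}" by metis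
  have "(LINT x:T|lborel. pderivative i p x)
      = (\<Sum>F\<in>elem_faces M T. (normal T F \<bullet> axis i 1) * (LINT x:F|flat_lborel {x. normal T F \<bullet> x = \<beta> F}. p x))"
  proof (rule divergence_theorem_direction)
    show "F \<subseteq> {x. normal T F \<bullet> x = \<beta> F}" if "F \<in> elem_faces M T" for F
      using \<beta>(1)[OF that] hull_subset[of F affine] by simp
    show "closed F" if "F \<in> elem_faces M T" for F
      using face_compact[OF elem_faces_faces[OF that]] by (rule compact_imp_closed)
    show "emeasure (flat_lborel {x. normal T F \<bullet> x = \<beta> F}) (F \<inter> F') = 0"
      if "F \<in> elem_faces M T" "F' \<in> elem_faces M T" "F \<noteq> F'" for F F'
      using face_overlap[OF elem_faces_faces[OF that(1)] elem_faces_faces[OF that(2)] that(3)] \<beta>(2)[OF that(1)] by simp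
    show "AE x in flat_lborel {x. normal T F \<bullet> x = \<beta> F}. x \<in> F \<longrightarrow>
        (\<exists>\<epsilon>>0. \<forall>s\<in>{0<..<\<epsilon>}. x - s *\<^sub>R normal T F \<in> T \<and> x + s *\<^sub>R normal T F \<notin> T)" if "F \<in> elem_faces M T" for F
      using normal_outward[OF T that] unfolding outward_unit_normal_def \<beta>(2)[OF that] by blast
    show "continuous_on UNIV p" using p by (rule polys_continuous)
    show "continuous_on UNIV (pderivative i p)" using polys_deriv(2)[OF p] by (rule polys_continuous)
    show "((\<lambda>t. p (x + t *\<^sub>R axis i 1)) has_real_derivative pderivative i p (x + t *\<^sub>R axis i 1)) (at t)" for x t
      using p by (rule polys_deriv_line)
  qed (simp_all add: elem_open elem_bounded frontier_elem normal_norm T)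
  also have "\<dots> = (\<Sum>F\<in>elem_faces M T. normal T F $ i * (LINT x:F|face_measure F. p x))"
    by (intro sum.cong) (simp_all add: \<beta>(2) inner_axis)
  finally show ?thesis .
qed

text \<open>No third element contains \<open>F\<close> in its frontier: its normal would be opposite to the normals of both
neighbours, which are themselves opposite.\<close>

lemma interface_neighbours:
  assumes F: "F \<in> interfaces M"
  shows "elem1 M F \<in> elems M" "elem2 M F \<in> elems M" "elem1 M F \<noteq> elem2 M F"
    "F \<in> elem_faces M (elem1 M F)" "F \<in> elem_faces M (elem2 M F)"
    "{T \<in> elems M. F \<in> elem_faces M T} = {elem1 M F, elem2 M F}"
proof -
  have "\<forall>F\<in>interfaces M. elem1 M F \<in> elems M \<and> elem2 M F \<in> elems M \<and> elem1 M F \<noteq> elem2 M F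
      \<and> F \<subseteq> frontier (elem1 M F) \<inter> frontier (elem2 M F)" using mesh unfolding polyhedral_mesh_def by (elim conjE)
  then have "elem1 M F \<in> elems M \<and> elem2 M F \<in> elems M \<and> elem1 M F \<noteq> elem2 M F
        \<and> F \<subseteq> frontier (elem1 M F) \<inter> frontier (elem2 M F)"
    using F by (rule bspec)
  then show *: "elem1 M F \<in> elems M" "elem2 M F \<in> elems M" "elem1 M F \<noteq> elem2 M F"
    "F \<in> elem_faces M (elem1 M F)" "F \<in> elem_faces M (elem2 M F)"
    using F by (auto simp: elem_faces_def interfaces_def)
  have "T = elem1 M F \<or> T = elem2 M F" if T: "T \<in> elems M" "F \<in> elem_faces M T" for T
  proof (rule ccontr)
    assume "\<not> ?thesis"
    then have "normal T F = - normal (elem1 M F) F" "normal T F = - normal (elem2 M F) F"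
      using normal_opposite[OF *(1) T(1) _ *(4) T(2)] normal_opposite[OF *(2) T(1) _ *(5) T(2)] by auto
    then have "normal (elem1 M F) F = - normal (elem1 M F) F"
      using normal_opposite[OF *(1,2,3,4,5)] by simp
    then have "normal (elem1 M F) F = 0" by (simp add: vec_eq_iff)
    then show False using normal_norm[OF *(1,4)] by simp
  qed
  then show "{T \<in> elems M. F \<in> elem_faces M T} = {elem1 M F, elem2 M F}" using * by blast
qed

lemma interface_normals:
  assumes F: "F \<in> interfaces M"
  shows "normal (elem1 M F) F = face_normal M F" "normal (elem2 M F) F = - face_normal M F" "face_normal M F \<bullet> face_normal M F = 1"
  using normal_opposite[OF interface_neighbours(1-5)[OF F]] normal_norm[OF interface_neighbours(1,4)[OF F]]
  by (simp_all add: face_normal_def dot_square_norm)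

lemma interface_pair:
  assumes F: "F \<in> interfaces M" and T: "T1 \<in> elems M" "T2 \<in> elems M" "T1 \<noteq> T2" "F \<in> elem_faces M T1 \<inter> elem_faces M T2"
  shows "T1 = elem1 M F \<and> T2 = elem2 M F \<or> T1 = elem2 M F \<and> T2 = elem1 M F"
  using interface_neighbours(6)[OF F] T by auto

text \<open>A sum over the faces of all elements runs twice through each interface, once from either side.\<close>

lemma sum_elem_faces:
  assumes "\<And>T F. T \<in> elems M \<Longrightarrow> F \<in> elem_faces M T \<Longrightarrow> F \<in> boundary_faces \<Omega> M \<Longrightarrow> (\<phi> T F :: real) = 0"
  shows "(\<Sum>T\<in>elems M. \<Sum>F\<in>elem_faces M T. \<phi> T F) = (\<Sum>F\<in>interfaces M. \<phi> (elem1 M F) F + \<phi> (elem2 M F) F)"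
proof -
  have ef: "elem_faces M T = {F \<in> faces M. F \<subseteq> frontier T}" for T by (simp add: elem_faces_def)
  have "(\<Sum>T\<in>elems M. \<Sum>F\<in>elem_faces M T. \<phi> T F) = (\<Sum>F\<in>faces M. \<Sum>T | T \<in> elems M \<and> F \<subseteq> frontier T. \<phi> T F)"
    unfolding ef by (rule sum.swap_restrict) simp_all
  also have "\<dots> = (\<Sum>F\<in>interfaces M. \<Sum>T | T \<in> elems M \<and> F \<subseteq> frontier T. \<phi> T F)"
  proof (rule sum.mono_neutral_right)
    show "interfaces M \<subseteq> faces M" using faces_split by blast
    show "\<forall>F\<in>faces M - interfaces M. (\<Sum>T | T \<in> elems M \<and> F \<subseteq> frontier T. \<phi> T F) = 0"
    proof
      fix F assume "F \<in> faces M - interfaces M"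
      then have "F \<in> faces M" "F \<in> boundary_faces \<Omega> M" using faces_split by auto
      then show "(\<Sum>T | T \<in> elems M \<and> F \<subseteq> frontier T. \<phi> T F) = 0"
        using assms by (intro sum.neutral) (auto simp: elem_faces_def)
    qed
  qed simp
  also have "\<dots> = (\<Sum>F\<in>interfaces M. \<phi> (elem1 M F) F + \<phi> (elem2 M F) F)"
  proof (rule sum.cong[OF refl])
    fix F assume F: "F \<in> interfaces M"
    then have "{T. T \<in> elems M \<and> F \<subseteq> frontier T} = {elem1 M F, elem2 M F}"
      using interface_neighbours(6)[OF F] by (auto simp: elem_faces_def interfaces_def)
    then show "(\<Sum>T | T \<in> elems M \<and> F \<subseteq> frontier T. \<phi> T F) = \<phi> (elem1 M F) F + \<phi> (elem2 M F) F"
      using interface_neighbours(3)[OF F] by simp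
  qed
  finally show ?thesis .
qed

section \<open>Projections on elements and faces\<close>

lemma elem_L2:
  fixes f :: "real^'d \<Rightarrow> 'b::euclidean_space"
  shows "T \<in> elems M \<Longrightarrow> continuous_on UNIV f \<Longrightarrow> L2 lborel T f"
  by (intro L2_continuous_bounded elem_bounded elem_borel)

lemma elem_polys_L2: "T \<in> elems M \<Longrightarrow> q \<in> polys l \<Longrightarrow> L2 lborel T q"
  by (intro elem_L2 polys_continuous)

lemma elem_vpolys_L2: "T \<in> elems M \<Longrightarrow> v \<in> vpolys l \<Longrightarrow> L2 lborel T v"
  by (intro elem_L2 vpolys_continuous)

lemma elem_integrable:
  fixes f :: "real^'d \<Rightarrow> 'b::euclidean_space"
  assumes T: "T \<in> elems M" and f: "continuous_on UNIV f"
  shows "set_integrable lborel T f"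
proof -
  have "set_integrable lborel (closure T) f"
    unfolding set_integrable_def
    by (intro borel_integrable_compact continuous_on_subset[OF f])
      (use elem_bounded[OF T] in \<open>simp_all add: compact_closure\<close>)
  then show ?thesis
    by (rule set_integrable_subset) (use elem_borel[OF T] closure_subset in auto)
qed

lemma elem_subspace: "T \<in> elems M \<Longrightarrow> fin_subspace lborel T (polys l)"
proof
  assume T: "T \<in> elems M"
  show "L2 lborel T p" if "p \<in> polys l" for p using T polys_continuous[OF that] by (rule elem_L2)
  show "p = 0" if p: "p \<in> polys l" "ip lborel T p p = 0" for p
  proof
    fix x
    have "p x = 0" if "x \<in> T" for x
      using vol_inner_definite[OF elem_bounded[OF T] elem_open[OF T] polys_continuous[OF p(1)]] p(2) that by (simp add: vol_inner_ip)
    then show "p x = 0 x" using polys_zero_on_open[OF p(1) elem_open[OF T] elem_nonempty[OF T]] by simp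
  qed
qed (simp_all add: subspace_polys fin_dim_polys)

lemma face_polys_definite:
  assumes F: "F \<in> faces M" and p: "p \<in> face_polys l F" and z: "ip (face_measure F) F p p = 0"
  shows "p = 0"
proof -
  obtain q where q: "q \<in> polys l" "p = restr F q" using p unfolding face_polys_restr by blast
  have "AE x in face_measure F. x \<in> F \<longrightarrow> p x = 0"
    by (rule ip_self_eq_0[OF face_L2[OF F face_polys_continuous[OF p]] z])
  then have "AE x in face_measure F. x \<in> F \<longrightarrow> q x = 0" by eventually_elim (simp add: q restr_def)
  then have "q x = 0" if "x \<in> F" for x using face_poly_zero[OF F q(1)] that by blast
  then show ?thesis by (simp add: q restr_def fun_eq_iff)
qed

lemma face_vpolys_definite:
  assumes F: "F \<in> faces M" and v: "v \<in> face_vpolys l F" and z: "face_inner F v v = 0"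
  shows "v = 0"
proof -
  have "AE x in face_measure F. x \<in> F \<longrightarrow> v x = 0"
    using z unfolding face_inner_ip by (rule ip_self_eq_0[OF face_L2[OF F face_vpolys_continuous[OF v]]])
  have "v x $ i = 0" for x i
  proof -
    obtain q where q: "q \<in> polys l" "(\<lambda>x. v x $ i) = restr F q"
      using v unfolding face_vpolys_def face_polys_restr by blast
    have vq: "v x $ i = restr F q x" for x using fun_cong[OF q(2)] .
    have "AE x in face_measure F. x \<in> F \<longrightarrow> q x = 0"
      using \<open>AE x in face_measure F. x \<in> F \<longrightarrow> v x = 0\<close>
    proof eventually_elim
      case (elim x)
      then show ?case using vq[of x] by (auto simp: restr_def)
    qed
    then have "x \<in> F \<Longrightarrow> q x = 0" by (rule face_poly_zero[OF F q(1)])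
    then show ?thesis unfolding vq by (simp add: restr_def)
  qed
  then show ?thesis by (simp add: fun_eq_iff vec_eq_iff)
qed

lemma vpolys_definite:
  assumes T: "T \<in> elems M" and v: "v \<in> vpolys l" and z: "vol_inner T v v = 0"
  shows "v = 0"
proof -
  have "v x = 0" if "x \<in> T" for x
    using vol_inner_definite[OF elem_bounded[OF T] elem_open[OF T] vpolys_continuous[OF v] z that] .
  note z = this
  have "v x $ i = 0" for x i
  proof (rule polys_zero_on_open[of "\<lambda>x. v x $ i", OF _ elem_open[OF T] elem_nonempty[OF T]])
    show "(\<lambda>x. v x $ i) \<in> polys l" using v by (simp add: vpolys_def)
  qed (simp add: z)
  then show ?thesis by (simp add: fun_eq_iff vec_eq_iff)
qed

lemma face_subspace: "F \<in> faces M \<Longrightarrow> fin_subspace (face_measure F) F (face_polys l F)"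
  by unfold_locales
    (simp_all add: subspace_face_polys fin_dim_face_polys face_polys_definite face_L2 face_polys_continuous)

lemma vproj_mem:
  assumes "T \<in> elems M" "continuous_on UNIV f"
  shows "vproj l T f \<in> vpolys l"
  unfolding vpolys_def vproj_def proj_oproj
  using fin_subspace.oproj_mem[OF elem_subspace[OF assms(1)] elem_L2[OF assms(1) component_continuous[OF assms(2)]]] by simp

lemma vproj_add:
  assumes "T \<in> elems M" "continuous_on UNIV f" "continuous_on UNIV g"
  shows "vproj l T (\<lambda>x. f x + g x) = (\<lambda>x. vproj l T f x + vproj l T g x)"
  unfolding vproj_def proj_oproj
  using fin_subspace.oproj_add[OF elem_subspace[OF assms(1)] elem_L2[OF assms(1) component_continuous[OF assms(2)]]
      elem_L2[OF assms(1) component_continuous[OF assms(3)]]]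
  by (simp add: vec_eq_iff fun_eq_iff)

lemma vproj_scale:
  assumes "T \<in> elems M" "continuous_on UNIV f"
  shows "vproj l T (\<lambda>x. c *\<^sub>R f x) = (\<lambda>x. c *\<^sub>R vproj l T f x)"
  unfolding vproj_def proj_oproj
  using fin_subspace.oproj_scale[OF elem_subspace[OF assms(1)] elem_L2[OF assms(1) component_continuous[OF assms(2)]]]
  by (simp add: vec_eq_iff fun_eq_iff)

lemma vproj_id: "T \<in> elems M \<Longrightarrow> v \<in> vpolys l \<Longrightarrow> vproj l T v = v"
  unfolding vproj_def proj_oproj vpolys_def
  using fin_subspace.oproj_id[OF elem_subspace] by (auto simp: vec_eq_iff fun_eq_iff)

lemma face_vproj_mem:
  assumes "F \<in> faces M" "continuous_on F f"
  shows "face_vproj l F f \<in> face_vpolys l F"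
  unfolding face_vpolys_def face_vproj_def face_proj_oproj
  using fin_subspace.oproj_mem[OF face_subspace[OF assms(1)] face_L2[OF assms(1) component_continuous[OF assms(2)]]] by simp

lemma face_vproj_add:
  assumes "F \<in> faces M" "continuous_on F f" "continuous_on F g"
  shows "face_vproj l F (\<lambda>x. f x + g x) = (\<lambda>x. face_vproj l F f x + face_vproj l F g x)"
  unfolding face_vproj_def face_proj_oproj
  using fin_subspace.oproj_add[OF face_subspace[OF assms(1)] face_L2[OF assms(1) component_continuous[OF assms(2)]]
      face_L2[OF assms(1) component_continuous[OF assms(3)]]]
  by (simp add: vec_eq_iff fun_eq_iff)

lemma face_vproj_scale:
  assumes "F \<in> faces M" "continuous_on F f"
  shows "face_vproj l F (\<lambda>x. c *\<^sub>R f x) = (\<lambda>x. c *\<^sub>R face_vproj l F f x)"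
  unfolding face_vproj_def face_proj_oproj
  using fin_subspace.oproj_scale[OF face_subspace[OF assms(1)] face_L2[OF assms(1) component_continuous[OF assms(2)]]]
  by (simp add: vec_eq_iff fun_eq_iff)

text \<open>The projection onto a face sees its argument on that face only.\<close>

lemma face_vproj_cong:
  assumes "\<And>x. x \<in> F \<Longrightarrow> f x = g x"
  shows "face_vproj l F f = face_vproj l F g"
  unfolding face_vproj_def face_proj_oproj oproj_def
  using assms by (simp add: ip_cong[where f = "\<lambda>y. f y $ _" and f' = "\<lambda>y. g y $ _"])

lemma face_vproj_id: "F \<in> faces M \<Longrightarrow> v \<in> face_vpolys l F \<Longrightarrow> face_vproj l F v = v"
  unfolding face_vproj_def face_proj_oproj face_vpolys_def
  using fin_subspace.oproj_id[OF face_subspace] by (auto simp: vec_eq_iff fun_eq_iff)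

lemma face_vproj_poly:
  assumes "F \<in> faces M" "v \<in> vpolys l" "x \<in> F"
  shows "face_vproj l F v x = v x"
proof -
  have "face_vproj l F v = face_vproj l F (restr F v)" by (rule face_vproj_cong) (simp add: restr_def)
  also have "\<dots> = restr F v" using assms(1) vpolys_restr[OF assms(2)] by (rule face_vproj_id)
  finally show ?thesis using assms(3) by (simp add: restr_def)
qed

lemma brk_proj_mem:
  assumes "L2_fun \<Omega> f"
  shows "brk_proj k M f \<in> brk_polys k M"
proof -
  have "proj k T f \<in> polys k" if T: "T \<in> elems M" for T
  proof -
    have "L2 lborel T f" using L2_subset[OF assms[unfolded L2_fun_L2] elem_subset[OF T]] elem_borel[OF T] by simp
    then show ?thesis unfolding proj_oproj by (rule fin_subspace.oproj_mem[OF elem_subspace[OF T]])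
  qed
  then show ?thesis by (simp add: brk_polys_def brk_proj_def)
qed

section \<open>The displacement reconstruction\<close>

text \<open>The symmetric gradient controls a field up to a rigid motion; the mean values of the field and of its
skew gradient control the rigid motion.\<close>

definition int_form :: "(real^'d) set \<Rightarrow> (real^'d \<Rightarrow> real^'d) \<Rightarrow> (real^'d \<Rightarrow> real^'d) \<Rightarrow> real" where
  "int_form T r z = vol_inner T (sgrad r) (sgrad z) + (LINT x:T|lborel. r x) \<bullet> (LINT x:T|lborel. z x)
     + (LINT x:T|lborel. ssgrad r x) \<bullet> (LINT x:T|lborel. ssgrad z x)"

text \<open>A field with vanishing symmetric gradient is affine with a constant skew gradient \<open>W\<close>.  The mean of
the skew gradient is \<open>W\<close> times the volume, so \<open>W = 0\<close>, the field is constant, and its mean is zero.\<close>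

lemma int_form_definite:
  assumes T: "T \<in> elems M" and r: "r \<in> vpolys l" and z: "int_form T r r = 0"
  shows "r = 0"
proof -
  have "vol_inner T (sgrad r) (sgrad r) \<ge> 0" unfolding vol_inner_def
    unfolding set_lebesgue_integral_def by (intro Bochner_Integration.integral_nonneg) simp
  then have 0: "vol_inner T (sgrad r) (sgrad r) = 0" "(LINT x:T|lborel. r x) = 0" "(LINT x:T|lborel. ssgrad r x) = 0"
    using z inner_ge_zero[of "LINT x:T|lborel. r x"] inner_ge_zero[of "LINT x:T|lborel. ssgrad r x"]
    unfolding int_form_def by (smt (verit) inner_eq_zero_iff)+
  have lin: "linear (\<lambda>x. r x - r 0)"
    using vol_inner_definite[OF elem_bounded[OF T] elem_open[OF T] sgrad_continuous[OF r] 0(1)]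
    by (intro rigid_motion[OF r elem_open[OF T] elem_nonempty[OF T]])
  note meas = elem_measure_pos[OF T] and const = set_integral_const[OF T]
  have sgz: "vgrad r x $ i $ j = - vgrad r x $ j $ i" for x i j
  proof -
    have "sgrad r x $ i $ j = 0"
      by (rule polys_zero_on_open[OF sgrad_polys[OF r] elem_open[OF T] elem_nonempty[OF T]])
        (simp add: vol_inner_definite[OF elem_bounded[OF T] elem_open[OF T] sgrad_continuous[OF r] 0(1)])
    then show ?thesis by (simp add: sgrad_component)
  qed
  \<comment> \<open>the constant gradient\<close>
  define W where "W = (\<chi> i j. (r (axis i 1) - r 0) $ j)"
  have vg: "vgrad r x = W" for x by (simp add: vec_eq_iff rigid_motion_vgrad[OF lin] W_def)
  have Wsk: "W $ i $ j = - W $ j $ i" for i j using sgz[of 0 i j] unfolding vg .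
  have "ssgrad r x $ i $ j = W $ i $ j" for x i j
    unfolding ssgrad_component vg by (subst (1 2) Wsk[of i j]) simp
  then have sk: "ssgrad r x = W" for x by (simp only: vec_eq_iff) simp
  have "W = 0" using 0(3) meas by (simp add: sk const)
  then have e0: "r (axis i 1) - r 0 = 0" for i by (simp add: W_def vec_eq_iff)
  have "r x - r 0 = 0" for x
  proof -
    have "(\<lambda>x. r x - r 0) x = (\<lambda>x. r x - r 0) (\<Sum>i\<in>UNIV. x $ i *\<^sub>R axis i 1)"
      using basis_expansion[of x] by (simp add: scalar_mult_eq_scaleR)
    also have "\<dots> = (\<Sum>i\<in>UNIV. x $ i *\<^sub>R (r (axis i 1) - r 0))"
      by (simp only: linear_sum[OF lin] linear_scale[OF lin])
    finally show ?thesis by (simp add: e0)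
  qed
  moreover define b where "b = r 0"
  ultimately have rb: "r x = b" for x by (metis eq_iff_diff_eq_0)
  have "b = 0" using 0(2) meas unfolding rb const by simp
  then show ?thesis using rb by (simp add: fun_eq_iff)
qed

definition face_data :: "(real^'d) set \<Rightarrow> (real^'d, real^'d) brk \<Rightarrow> bool" where
  "face_data T \<phi> \<longleftrightarrow> (\<forall>F\<in>elem_faces M T. continuous_on F (\<phi> F))"

text \<open>The right-hand side of the equation that determines the strain of the reconstruction.\<close>

definition strain_load :: "(real^'d) set \<Rightarrow> (real^'d \<Rightarrow> real^'d) \<Rightarrow> (real^'d, real^'d) brk \<Rightarrow> (real^'d \<Rightarrow> real^'d) \<Rightarrow> real" where
  "strain_load T w \<phi> z = vol_inner T (sgrad w) (sgrad z)
     + (\<Sum>F\<in>elem_faces M T. face_inner F (\<lambda>x. \<phi> F x - w x) (\<lambda>x. sgrad z x *v normal T F))"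

text \<open>The prescribed integral of the skew gradient of the reconstruction.\<close>

definition boundary_rotation :: "(real^'d) set \<Rightarrow> (real^'d, real^'d) brk \<Rightarrow> real^'d^'d" where
  "boundary_rotation T \<phi> = (\<Sum>F\<in>elem_faces M T. LINT x:F|face_measure F.
          (1/2) *\<^sub>R (tensor (normal T F) (\<phi> F x) - tensor (\<phi> F x) (normal T F)))"

definition recon_spec where
  "recon_spec k T w \<phi> r \<longleftrightarrow> r \<in> vpolys (k + 1)
     \<and> (\<forall>z\<in>vpolys (k + 1). vol_inner T (sgrad r) (sgrad z) = strain_load T w \<phi> z)
     \<and> (LINT x:T|lborel. r x) = (LINT x:T|lborel. w x)
     \<and> (LINT x:T|lborel. ssgrad r x) = boundary_rotation T \<phi>"

lemma recon_THE: "recon k M T w \<phi> = (THE r. recon_spec k T w \<phi> r)"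
  unfolding recon_def recon_spec_def strain_load_def boundary_rotation_def ..

lemma face_sgrad_L2:
  assumes "F \<in> elem_faces M T" "z \<in> vpolys l"
  shows "L2 (face_measure F) F (\<lambda>x. sgrad z x *v n)"
  by (intro face_L2 elem_faces_faces[OF assms(1)] matrix_mult_continuous sgrad_continuous[OF assms(2)])

lemma face_diff_L2:
  assumes "F \<in> elem_faces M T" "face_data T \<phi>" "w \<in> vpolys l"
  shows "L2 (face_measure F) F (\<lambda>x. \<phi> F x - w x)"
  using assms by (intro face_L2 elem_faces_faces[OF assms(1)] continuous_intros vpolys_continuous[OF assms(3)]) (auto simp: face_data_def)

lemma elem_sgrad_L2: "T \<in> elems M \<Longrightarrow> z \<in> vpolys l \<Longrightarrow> L2 lborel T (sgrad z)"
  by (intro elem_L2 sgrad_continuous)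

lemma strain_load_add:
  assumes T: "T \<in> elems M" and \<phi>: "face_data T \<phi>" and w: "w \<in> vpolys l" and z: "z \<in> vpolys m" "z' \<in> vpolys m"
  shows "strain_load T w \<phi> (z + z') = strain_load T w \<phi> z + strain_load T w \<phi> z'"
proof -
  have "sgrad (z + z') = (\<lambda>x. sgrad z x + sgrad z' x)" unfolding plus_fun_def using sgrad_add[OF z] by (simp add: fun_eq_iff)
  then show ?thesis
    unfolding strain_load_def vol_inner_ip face_inner_ip using T \<phi> w z
    by (simp add: matrix_vector_mult_add_rdistrib ip_add_right elem_sgrad_L2 face_sgrad_L2 face_diff_L2 sum.distrib)
qed

lemma strain_load_scale:
  assumes z: "z \<in> vpolys m"
  shows "strain_load T w \<phi> (c *\<^sub>R z) = c * strain_load T w \<phi> z"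
proof -
  have "sgrad (c *\<^sub>R z) = (\<lambda>x. c *\<^sub>R sgrad z x)" unfolding scaleR_fun_def using sgrad_scale[OF z] by (simp add: fun_eq_iff)
  moreover have "(c *\<^sub>R A) *v n = c *\<^sub>R (A *v n)" for A :: "real^'d^'d" and n
    by (simp add: scaleR_matrix_vector_assoc)
  ultimately show ?thesis
    unfolding strain_load_def vol_inner_ip face_inner_ip
    by (simp add: ip_scaleR_right sum_distrib_left distrib_left)
qed

lemma strain_load_rigid:
  assumes "\<And>x. sgrad z x = 0"
  shows "strain_load T w \<phi> z = 0"
  using assms unfolding strain_load_def vol_inner_def face_inner_def by simp

lemma integral_linear_form:
  assumes T: "T \<in> elems M" and z: "z \<in> vpolys l" "z' \<in> vpolys l"
  shows "(LINT x:T|lborel. (z + z') x) = (LINT x:T|lborel. z x) + (LINT x:T|lborel. z' x)"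
    and "(LINT x:T|lborel. ssgrad (z + z') x) = (LINT x:T|lborel. ssgrad z x) + (LINT x:T|lborel. ssgrad z' x)"
    and "(LINT x:T|lborel. (c *\<^sub>R z) x) = c *\<^sub>R (LINT x:T|lborel. z x)"
    and "(LINT x:T|lborel. ssgrad (c *\<^sub>R z) x) = c *\<^sub>R (LINT x:T|lborel. ssgrad z x)"
proof -
  show "(LINT x:T|lborel. (z + z') x) = (LINT x:T|lborel. z x) + (LINT x:T|lborel. z' x)"
    using z by (simp add: set_integral_add elem_integrable[OF T] vpolys_continuous)
  have "ssgrad (z + z') = (\<lambda>x. ssgrad z x + ssgrad z' x)" unfolding plus_fun_def using ssgrad_add[OF z] by (simp add: fun_eq_iff)
  then show "(LINT x:T|lborel. ssgrad (z + z') x) = (LINT x:T|lborel. ssgrad z x) + (LINT x:T|lborel. ssgrad z' x)"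
    using z by (simp add: set_integral_add elem_integrable[OF T] ssgrad_continuous)
  show "(LINT x:T|lborel. (c *\<^sub>R z) x) = c *\<^sub>R (LINT x:T|lborel. z x)" by simp
  have "ssgrad (c *\<^sub>R z) = (\<lambda>x. c *\<^sub>R ssgrad z x)" unfolding scaleR_fun_def using ssgrad_scale[OF z(1)] by (simp add: fun_eq_iff)
  then show "(LINT x:T|lborel. ssgrad (c *\<^sub>R z) x) = c *\<^sub>R (LINT x:T|lborel. ssgrad z x)" by simp
qed

lemma int_form_riesz:
  assumes T: "T \<in> elems M" and L: "\<And>x y. x \<in> vpolys l \<Longrightarrow> y \<in> vpolys l \<Longrightarrow> L (x + y) = L x + L y"
    "\<And>c x. x \<in> vpolys l \<Longrightarrow> L (c *\<^sub>R x) = c * L x"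
  shows "\<exists>!r. r \<in> vpolys l \<and> (\<forall>z\<in>vpolys l. int_form T r z = L z)"
proof (rule riesz_representation[OF subspace_vpolys fin_dim_vpolys])
  fix x y z :: "real^'d \<Rightarrow> real^'d" and c :: real assume x: "x \<in> vpolys l" and z: "z \<in> vpolys l"
  have "sgrad (c *\<^sub>R x) = (\<lambda>t. c *\<^sub>R sgrad x t)" unfolding scaleR_fun_def using sgrad_scale[OF x] by (simp add: fun_eq_iff)
  then show "int_form T (c *\<^sub>R x) z = c * int_form T x z"
    unfolding int_form_def integral_linear_form[OF T x x] vol_inner_ip by (simp add: ip_scaleR_left distrib_left)
  show "int_form T x z = int_form T z x"
    unfolding int_form_def vol_inner_ip by (simp add: ip_commute inner_commute)
  assume y: "y \<in> vpolys l"
  have "sgrad (x + y) = (\<lambda>t. sgrad x t + sgrad y t)" unfolding plus_fun_def using sgrad_add[OF x y] by (simp add: fun_eq_iff)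
  then show "int_form T (x + y) z = int_form T x z + int_form T y z"
    unfolding int_form_def integral_linear_form[OF T x y] vol_inner_ip using x y z T
    by (simp add: ip_add_left elem_sgrad_L2 inner_add_left)
qed (use L int_form_definite[OF T] in auto)

lemma skew_boundary_rotation:
  assumes T: "T \<in> elems M" and \<phi>: "face_data T \<phi>"
  shows "transpose (boundary_rotation T \<phi>) = - boundary_rotation T \<phi>"
proof -
  have "transpose (LINT x:F|face_measure F. (1/2) *\<^sub>R (tensor (normal T F) (\<phi> F x) - tensor (\<phi> F x) (normal T F)))
      = - (LINT x:F|face_measure F. (1/2) *\<^sub>R (tensor (normal T F) (\<phi> F x) - tensor (\<phi> F x) (normal T F)))"
    (is "transpose (LINT x:F|face_measure F. ?f x) = _") if F: "F \<in> elem_faces M T" for F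
  proof -
    have "continuous_on F ?f" using \<phi> F unfolding face_data_def by (intro continuous_intros tensor_continuous) auto
    then have "transpose (LINT x:F|face_measure F. ?f x) = (LINT x:F|face_measure F. transpose (?f x))"
      by (intro transpose_set_integral face_integrable elem_faces_faces[OF F])
    also have "(\<lambda>x. transpose (?f x)) = (\<lambda>x. - ?f x)"
      by (simp add: fun_eq_iff vec_eq_iff transpose_def tensor_def field_simps)
    finally show ?thesis unfolding set_integral_neg .
  qed
  then show ?thesis unfolding boundary_rotation_def
    by (simp add: linear_sum[OF bounded_linear.linear[OF transpose_linear]] sum_negf)
qed

text \<open>The three conditions on the reconstruction are together equivalent to one variational problem for
\<open>int_form\<close>.  To recover the two conditions on the means, test it with the constant field and with the
rotation whose gradient is the defect of the respective mean: the symmetric gradient of both vanishes,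
so the load does not contribute and the defect is orthogonal to itself.\<close>

lemma recon_ex1:
  assumes T: "T \<in> elems M" and \<phi>: "face_data T \<phi>" and w: "w \<in> vpolys l"
  shows "\<exists>!r. recon_spec k T w \<phi> r"
proof -
  define L where "L z = strain_load T w \<phi> z + (LINT x:T|lborel. w x) \<bullet> (LINT x:T|lborel. z x)
      + boundary_rotation T \<phi> \<bullet> (LINT x:T|lborel. ssgrad z x)" for z
  have "\<exists>!r. r \<in> vpolys (k + 1) \<and> (\<forall>z\<in>vpolys (k + 1). int_form T r z = L z)"
  proof (rule int_form_riesz[OF T])
    show "L (x + y) = L x + L y" if x: "x \<in> vpolys (k + 1)" and y: "y \<in> vpolys (k + 1)" for x y
      unfolding L_def strain_load_add[OF T \<phi> w x y] integral_linear_form[OF T x y] by (simp add: inner_add_right)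
    show "L (c *\<^sub>R x) = c * L x" if x: "x \<in> vpolys (k + 1)" for c x
      unfolding L_def strain_load_scale[OF x] integral_linear_form[OF T x x] by (simp add: distrib_left)
  qed
  moreover have "recon_spec k T w \<phi> r \<longleftrightarrow> r \<in> vpolys (k + 1) \<and> (\<forall>z\<in>vpolys (k + 1). int_form T r z = L z)" for r
  proof
    assume "recon_spec k T w \<phi> r"
    then show "r \<in> vpolys (k + 1) \<and> (\<forall>z\<in>vpolys (k + 1). int_form T r z = L z)"
      by (auto simp: recon_spec_def int_form_def L_def)
  next
    assume r: "r \<in> vpolys (k + 1) \<and> (\<forall>z\<in>vpolys (k + 1). int_form T r z = L z)"
    let ?c = "measure lborel T"
    have c: "?c > 0" by (rule elem_measure_pos[OF T])
    \<comment> \<open>the defect of the mean value\<close>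
    define a where "a = (LINT x:T|lborel. r x) - (LINT x:T|lborel. w x)"
    have ssc: "ssgrad (\<lambda>x. a) x = 0" and sc: "sgrad (\<lambda>x. a) x = 0" for x
      by (simp_all add: ssgrad_def sgrad_def vgrad_const transpose_def vec_eq_iff)
    have "int_form T r (\<lambda>x. a) = L (\<lambda>x. a)" using r vpolys_const by blast
    then have "(LINT x:T|lborel. r x) \<bullet> (?c *\<^sub>R a) = (LINT x:T|lborel. w x) \<bullet> (?c *\<^sub>R a)"
      unfolding int_form_def L_def strain_load_rigid[OF sc] set_integral_const[OF T] ssc[abs_def] sc[abs_def] vol_inner_ip by simp
    then have "?c * (a \<bullet> a) = 0" by (simp add: a_def inner_diff_left algebra_simps)
    then have "a = 0" using c by simp
    then have m: "(LINT x:T|lborel. r x) = (LINT x:T|lborel. w x)" by (simp add: a_def)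
    \<comment> \<open>the defect of the skew gradient, a skew matrix\<close>
    define W where "W = (LINT x:T|lborel. ssgrad r x) - boundary_rotation T \<phi>"
    have "transpose (LINT x:T|lborel. ssgrad r x) = (LINT x:T|lborel. transpose (ssgrad r x))"
      using r by (intro transpose_set_integral elem_integrable[OF T] ssgrad_continuous) auto
    also have "(\<lambda>x. transpose (ssgrad r x)) = (\<lambda>x. - ssgrad r x)"
      by (simp add: fun_eq_iff vec_eq_iff transpose_def ssgrad_def field_simps)
    finally have "transpose (LINT x:T|lborel. ssgrad r x) = - (LINT x:T|lborel. ssgrad r x)"
      unfolding set_integral_neg .
    then have sk: "transpose W = - W"
      using skew_boundary_rotation[OF T \<phi>] by (simp add: W_def linear_diff[OF bounded_linear.linear[OF transpose_linear]])
    let ?z = "\<lambda>x. x v* W"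
    have z: "?z \<in> vpolys (k + 1)" "\<And>x. vgrad ?z x = W" using linear_field[of "k + 1" W] by auto
    have ssz: "ssgrad ?z x = W" and sz: "sgrad ?z x = 0" for x
      unfolding ssgrad_def sgrad_def z(2) sk by (simp_all add: vec_eq_iff)
    have "int_form T r ?z = L ?z" using r z(1) by blast
    then have "(LINT x:T|lborel. ssgrad r x) \<bullet> (?c *\<^sub>R W) = boundary_rotation T \<phi> \<bullet> (?c *\<^sub>R W)"
      unfolding int_form_def L_def strain_load_rigid[OF sz] set_integral_const[OF T] ssz[abs_def] sz[abs_def] m vol_inner_ip by simp
    then have "?c * (W \<bullet> W) = 0" by (simp add: W_def inner_diff_left algebra_simps)
    then have "W = 0" using c by simp
    then have s: "(LINT x:T|lborel. ssgrad r x) = boundary_rotation T \<phi>" by (simp add: W_def)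
    show "recon_spec k T w \<phi> r"
      using r m s unfolding recon_spec_def int_form_def L_def by auto
  qed
  ultimately show ?thesis by simp
qed

lemma recon_holds: "T \<in> elems M \<Longrightarrow> face_data T \<phi> \<Longrightarrow> w \<in> vpolys l \<Longrightarrow> recon_spec k T w \<phi> (recon k M T w \<phi>)"
  unfolding recon_THE by (rule theI'[OF recon_ex1])

lemma recon_eqI: "T \<in> elems M \<Longrightarrow> face_data T \<phi> \<Longrightarrow> w \<in> vpolys l \<Longrightarrow> recon_spec k T w \<phi> r \<Longrightarrow> recon k M T w \<phi> = r"
  unfolding recon_THE by (rule the1_equality[OF recon_ex1])

lemma recon_mem: "T \<in> elems M \<Longrightarrow> face_data T \<phi> \<Longrightarrow> w \<in> vpolys l \<Longrightarrow> recon k M T w \<phi> \<in> vpolys (k + 1)"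
  using recon_holds unfolding recon_spec_def by blast

lemma recon_strain: "T \<in> elems M \<Longrightarrow> face_data T \<phi> \<Longrightarrow> w \<in> vpolys l \<Longrightarrow> z \<in> vpolys (k + 1) \<Longrightarrow>
    vol_inner T (sgrad (recon k M T w \<phi>)) (sgrad z) = strain_load T w \<phi> z"
  using recon_holds unfolding recon_spec_def by blast

lemma face_data_add: "face_data T \<phi> \<Longrightarrow> face_data T \<psi> \<Longrightarrow> face_data T (\<lambda>F x. \<phi> F x + \<psi> F x)"
  unfolding face_data_def by (auto intro: continuous_intros)

lemma face_data_scale: "face_data T \<phi> \<Longrightarrow> face_data T (\<lambda>F x. c *\<^sub>R \<phi> F x)"
  unfolding face_data_def by (auto intro: continuous_intros)

lemma face_data_trace: "w \<in> vpolys l \<Longrightarrow> face_data T (\<lambda>F. w)"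
  unfolding face_data_def by (auto intro: vpolys_continuous)

lemma recon_spec_add:
  assumes T: "T \<in> elems M" and \<phi>: "face_data T \<phi>" "face_data T \<psi>" and w: "w \<in> vpolys l" "v \<in> vpolys l"
    and r: "recon_spec k T w \<phi> r" "recon_spec k T v \<psi> s"
  shows "recon_spec k T (\<lambda>x. w x + v x) (\<lambda>F x. \<phi> F x + \<psi> F x) (\<lambda>x. r x + s x)"
  unfolding recon_spec_def
proof (intro conjI ballI)
  have rs: "r \<in> vpolys (k + 1)" "s \<in> vpolys (k + 1)" using r by (auto simp: recon_spec_def)
  show "(\<lambda>x. r x + s x) \<in> vpolys (k + 1)" using rs by (rule vpolys_add)
  have sa: "sgrad (\<lambda>x. r x + s x) = (\<lambda>x. sgrad r x + sgrad s x)" "sgrad (\<lambda>x. w x + v x) = (\<lambda>x. sgrad w x + sgrad v x)"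
    using sgrad_add[OF rs] sgrad_add[OF w] by (auto simp: fun_eq_iff)
  show "vol_inner T (sgrad (\<lambda>x. r x + s x)) (sgrad z) = strain_load T (\<lambda>x. w x + v x) (\<lambda>F x. \<phi> F x + \<psi> F x) z"
    if z: "z \<in> vpolys (k + 1)" for z
  proof -
    have "ip (face_measure F) F (\<lambda>x. (\<phi> F x + \<psi> F x) - (w x + v x)) (\<lambda>x. sgrad z x *v normal T F)
        = ip (face_measure F) F (\<lambda>x. \<phi> F x - w x) (\<lambda>x. sgrad z x *v normal T F)
        + ip (face_measure F) F (\<lambda>x. \<psi> F x - v x) (\<lambda>x. sgrad z x *v normal T F)" if F: "F \<in> elem_faces M T" for F
      using ip_add_left[OF face_diff_L2[OF F \<phi>(1) w(1)] face_diff_L2[OF F \<phi>(2) w(2)] face_sgrad_L2[OF F z]]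
      by (simp add: algebra_simps)
    moreover have "vol_inner T (sgrad r) (sgrad z) = strain_load T w \<phi> z" "vol_inner T (sgrad s) (sgrad z) = strain_load T v \<psi> z"
      using r z by (auto simp: recon_spec_def)
    ultimately show ?thesis
      unfolding strain_load_def sa vol_inner_ip face_inner_ip
      by (simp add: sum.distrib ip_add_left[OF elem_sgrad_L2[OF T rs(1)] elem_sgrad_L2[OF T rs(2)] elem_sgrad_L2[OF T z]]
          ip_add_left[OF elem_sgrad_L2[OF T w(1)] elem_sgrad_L2[OF T w(2)] elem_sgrad_L2[OF T z]])
  qed
  show "(LINT x:T|lborel. r x + s x) = (LINT x:T|lborel. w x + v x)"
    using set_integral_add(2)[OF elem_integrable[OF T vpolys_continuous[OF rs(1)]] elem_integrable[OF T vpolys_continuous[OF rs(2)]]]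
      set_integral_add(2)[OF elem_integrable[OF T vpolys_continuous[OF w(1)]] elem_integrable[OF T vpolys_continuous[OF w(2)]]] r
    by (simp add: recon_spec_def)
  have ssa: "ssgrad (\<lambda>x. r x + s x) = (\<lambda>x. ssgrad r x + ssgrad s x)"
    using ssgrad_add[OF rs] by (auto simp: fun_eq_iff)
  have "boundary_rotation T (\<lambda>F x. \<phi> F x + \<psi> F x) = boundary_rotation T \<phi> + boundary_rotation T \<psi>"
    unfolding boundary_rotation_def sum.distrib[symmetric]
  proof (rule sum.cong[OF refl])
    fix F assume F: "F \<in> elem_faces M T"
    let ?f = "\<lambda>\<phi> x. (1/2) *\<^sub>R (tensor (normal T F) (\<phi> F x) - tensor (\<phi> F x) (normal T F))"
    have "set_integrable (face_measure F) F (?f \<phi>)" "set_integrable (face_measure F) F (?f \<psi>)"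
      using \<phi> F unfolding face_data_def
      by (auto intro!: face_integrable elem_faces_faces[OF F] continuous_intros tensor_continuous)
    then have "(LINT x:F|face_measure F. ?f \<phi> x + ?f \<psi> x) = (LINT x:F|face_measure F. ?f \<phi> x) + (LINT x:F|face_measure F. ?f \<psi> x)"
      by (rule set_integral_add)
    moreover have "?f (\<lambda>F x. \<phi> F x + \<psi> F x) = (\<lambda>x. ?f \<phi> x + ?f \<psi> x)"
      by (simp add: fun_eq_iff vec_eq_iff tensor_def field_simps)
    ultimately show "(LINT x:F|face_measure F. ?f (\<lambda>F x. \<phi> F x + \<psi> F x) x)
        = (LINT x:F|face_measure F. ?f \<phi> x) + (LINT x:F|face_measure F. ?f \<psi> x)" by (simp only:)
  qed
  then show "(LINT x:T|lborel. ssgrad (\<lambda>x. r x + s x) x) = boundary_rotation T (\<lambda>F x. \<phi> F x + \<psi> F x)"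
    unfolding ssa
    using set_integral_add(2)[OF elem_integrable[OF T ssgrad_continuous[OF rs(1)]] elem_integrable[OF T ssgrad_continuous[OF rs(2)]]] r
    by (simp add: recon_spec_def)
qed

lemma recon_spec_scale:
  assumes w: "w \<in> vpolys l" and r: "recon_spec k T w \<phi> r"
  shows "recon_spec k T (\<lambda>x. c *\<^sub>R w x) (\<lambda>F x. c *\<^sub>R \<phi> F x) (\<lambda>x. c *\<^sub>R r x)"
  unfolding recon_spec_def
proof (intro conjI ballI)
  have rs: "r \<in> vpolys (k + 1)" using r by (auto simp: recon_spec_def)
  show "(\<lambda>x. c *\<^sub>R r x) \<in> vpolys (k + 1)" using rs by (rule vpolys_scale)
  have sa: "sgrad (\<lambda>x. c *\<^sub>R r x) = (\<lambda>x. c *\<^sub>R sgrad r x)" "sgrad (\<lambda>x. c *\<^sub>R w x) = (\<lambda>x. c *\<^sub>R sgrad w x)"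
    and ssa: "ssgrad (\<lambda>x. c *\<^sub>R r x) = (\<lambda>x. c *\<^sub>R ssgrad r x)"
    using sgrad_scale[OF rs] sgrad_scale[OF w] ssgrad_scale[OF rs] by (auto simp: fun_eq_iff)
  show "vol_inner T (sgrad (\<lambda>x. c *\<^sub>R r x)) (sgrad z) = strain_load T (\<lambda>x. c *\<^sub>R w x) (\<lambda>F x. c *\<^sub>R \<phi> F x) z"
    if z: "z \<in> vpolys (k + 1)" for z
  proof -
    have "vol_inner T (sgrad r) (sgrad z) = strain_load T w \<phi> z" using r z by (auto simp: recon_spec_def)
    then show ?thesis
      unfolding strain_load_def sa vol_inner_ip face_inner_ip
      by (simp add: ip_scaleR_left scaleR_diff_right[symmetric] sum_distrib_left distrib_left)
  qed
  show "(LINT x:T|lborel. c *\<^sub>R r x) = (LINT x:T|lborel. c *\<^sub>R w x)" using r by (simp add: recon_spec_def)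
  have "(1/2) *\<^sub>R (tensor n (c *\<^sub>R y) - tensor (c *\<^sub>R y) n) = c *\<^sub>R ((1/2) *\<^sub>R (tensor n y - tensor y n))" for n y :: "real^'d"
    by (simp add: vec_eq_iff tensor_def field_simps)
  then have "boundary_rotation T (\<lambda>F x. c *\<^sub>R \<phi> F x) = c *\<^sub>R boundary_rotation T \<phi>"
    unfolding boundary_rotation_def by (simp only: set_integral_scaleR_right scaleR_sum_right)
  then show "(LINT x:T|lborel. ssgrad (\<lambda>x. c *\<^sub>R r x) x) = boundary_rotation T (\<lambda>F x. c *\<^sub>R \<phi> F x)"
    unfolding ssa using r by (simp add: recon_spec_def)
qed

lemma recon_add:
  assumes "T \<in> elems M" "face_data T \<phi>" "face_data T \<psi>" "w \<in> vpolys l" "v \<in> vpolys l"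
  shows "recon k M T (\<lambda>x. w x + v x) (\<lambda>F x. \<phi> F x + \<psi> F x) = (\<lambda>x. recon k M T w \<phi> x + recon k M T v \<psi> x)"
  by (rule recon_eqI[OF assms(1) face_data_add[OF assms(2,3)] vpolys_add[OF assms(4,5)]
      recon_spec_add[OF assms recon_holds[OF assms(1,2,4)] recon_holds[OF assms(1,3,5)]]])

lemma recon_scale:
  assumes "T \<in> elems M" "face_data T \<phi>" "w \<in> vpolys l"
  shows "recon k M T (\<lambda>x. c *\<^sub>R w x) (\<lambda>F x. c *\<^sub>R \<phi> F x) = (\<lambda>x. c *\<^sub>R recon k M T w \<phi> x)"
  by (rule recon_eqI[OF assms(1) face_data_scale[OF assms(2)] vpolys_scale[OF assms(3)]
      recon_spec_scale[OF assms(3) recon_holds[OF assms]]])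

lemma recon_cong:
  assumes "\<And>F x. F \<in> elem_faces M T \<Longrightarrow> x \<in> F \<Longrightarrow> \<phi> F x = \<psi> F x"
  shows "recon k M T w \<phi> = recon k M T w \<psi>"
proof -
  have "strain_load T w \<phi> = strain_load T w \<psi>"
    unfolding strain_load_def face_inner_ip using assms
    by (intro ext arg_cong2[where f = "(+)"] refl sum.cong ip_cong) auto
  moreover have "boundary_rotation T \<phi> = boundary_rotation T \<psi>"
    unfolding boundary_rotation_def set_lebesgue_integral_def using assms
    by (intro sum.cong refl Bochner_Integration.integral_cong) (auto simp: indicator_def)
  ultimately show ?thesis unfolding recon_THE recon_spec_def by simp
qed

text \<open>Divergence theorem for each entry of the skew gradient.\<close>

lemma boundary_rotation_trace:
  assumes T: "T \<in> elems M" and w: "w \<in> vpolys l"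
  shows "(LINT x:T|lborel. ssgrad w x) = boundary_rotation T (\<lambda>F. w)"
proof -
  have wc: "(\<lambda>x. w x $ i) \<in> polys l" for i using w by (simp add: vpolys_def)
  have "(LINT x:T|lborel. ssgrad w x) $ i $ j = boundary_rotation T (\<lambda>F. w) $ i $ j" for i j
  proof -
    have "(LINT x:T|lborel. ssgrad w x) $ i $ j = (LINT x:T|lborel. ssgrad w x $ i $ j)"
      using T w by (simp add: set_integral_component elem_integrable ssgrad_continuous
          continuous_on_component[OF ssgrad_continuous])
    also have "\<dots> = (LINT x:T|lborel. (1/2) * (pderivative i (\<lambda>x. w x $ j) x - pderivative j (\<lambda>x. w x $ i) x))"
      by (simp add: ssgrad_component vgrad_component[OF w])
    also have "\<dots> = (1/2) * ((LINT x:T|lborel. pderivative i (\<lambda>x. w x $ j) x) - (LINT x:T|lborel. pderivative j (\<lambda>x. w x $ i) x))"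
      by (simp add: set_integral_diff elem_integrable[OF T] polys_continuous[OF polys_deriv(2)[OF wc]])
    also have "\<dots> = (\<Sum>F\<in>elem_faces M T. (1/2) * (normal T F $ i * (LINT x:F|face_measure F. w x $ j) - normal T F $ j * (LINT x:F|face_measure F. w x $ i)))"
      unfolding green_elem[OF T wc] by (simp only: sum_distrib_left[symmetric] sum_subtractf)
    also have "\<dots> = boundary_rotation T (\<lambda>F. w) $ i $ j"
      unfolding boundary_rotation_def sum_component
    proof (rule sum.cong[OF refl])
      fix F assume F: "F \<in> elem_faces M T"
      let ?f = "\<lambda>x. (1/2) *\<^sub>R (tensor (normal T F) (w x) - tensor (w x) (normal T F))"
      have c: "continuous_on F ?f" using vpolys_continuous[OF w] by (intro continuous_intros tensor_continuous)
      have I: "set_integrable (face_measure F) F (\<lambda>x. w x $ i)" for i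
        by (intro face_integrable elem_faces_faces[OF F] polys_continuous[OF wc])
      have "(LINT x:F|face_measure F. ?f x) $ i = (LINT x:F|face_measure F. ?f x $ i)"
        by (intro set_integral_component face_integrable elem_faces_faces[OF F] c)
      moreover have "(LINT x:F|face_measure F. ?f x $ i) $ j = (LINT x:F|face_measure F. ?f x $ i $ j)"
        by (intro set_integral_component face_integrable elem_faces_faces[OF F] continuous_on_component c)
      ultimately have "(LINT x:F|face_measure F. ?f x) $ i $ j = (LINT x:F|face_measure F. ?f x $ i $ j)" by (simp only:)
      also have "\<dots> = (LINT x:F|face_measure F. (1/2) * (normal T F $ i * w x $ j - normal T F $ j * w x $ i))"
        by (simp add: tensor_def mult.commute)
      also have "\<dots> = (1/2) * (normal T F $ i * (LINT x:F|face_measure F. w x $ j) - normal T F $ j * (LINT x:F|face_measure F. w x $ i))"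
        by (simp add: set_integral_diff I)
      finally show "(1/2) * (normal T F $ i * (LINT x:F|face_measure F. w x $ j) - normal T F $ j * (LINT x:F|face_measure F. w x $ i))
        = (LINT x:F|face_measure F. ?f x) $ i $ j" ..
    qed
    finally show ?thesis .
  qed
  then show ?thesis by (simp add: vec_eq_iff)
qed

text \<open>For the traces of \<open>w\<close> itself the face terms of the load vanish, and the boundary integral of the
rotation is the integral of the skew gradient by the divergence theorem.\<close>

lemma recon_trace:
  assumes T: "T \<in> elems M" and w: "w \<in> vpolys (k + 1)"
  shows "recon k M T w (\<lambda>F. w) = w"
proof (rule recon_eqI[OF T face_data_trace[OF w] w])
  show "recon_spec k T w (\<lambda>F. w) w"
    unfolding recon_spec_def strain_load_def face_inner_ip using w boundary_rotation_trace[OF T w] by simp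
qed

lemma face_data_bdry_diff:
  assumes "face_data T \<phi>" "w \<in> vpolys l"
  shows "face_data T (bdry_diff M T w \<phi>)"
  unfolding face_data_def
proof
  fix F assume F: "F \<in> elem_faces M T"
  have "continuous_on F (\<lambda>x. \<phi> F x - w x)"
    by (intro continuous_on_diff vpolys_continuous[OF assms(2)]) (use assms F in \<open>auto simp: face_data_def\<close>)
  then show "continuous_on F (bdry_diff M T w \<phi> F)"
    by (rule continuous_on_eq) (simp add: bdry_diff_def F)
qed

text \<open>Linearity and reproduction of polynomials: the data \<open>(w, \<phi>)\<close> are the traces of \<open>w\<close> plus the data
\<open>(0, \<phi> - w)\<close>.\<close>

lemma recon_split:
  assumes T: "T \<in> elems M" and \<phi>: "face_data T \<phi>" and w: "w \<in> vpolys (k + 1)"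
  shows "recon k M T w \<phi> = (\<lambda>x. w x + recon k M T (\<lambda>x. 0) (bdry_diff M T w \<phi>) x)"
proof -
  have "recon k M T w \<phi> = recon k M T (\<lambda>x. w x + 0) (\<lambda>F x. w x + bdry_diff M T w \<phi> F x)"
    by (simp, rule recon_cong) (simp add: bdry_diff_def)
  also have "\<dots> = (\<lambda>x. recon k M T w (\<lambda>F. w) x + recon k M T (\<lambda>x. 0) (bdry_diff M T w \<phi>) x)"
    by (rule recon_add[OF T face_data_trace[OF w] face_data_bdry_diff[OF \<phi> w] w vpolys_zero])
  finally show ?thesis unfolding recon_trace[OF T w] .
qed

lemma recon_continuous:
  assumes "T \<in> elems M" "face_data T \<phi>" "w \<in> vpolys l"
  shows "continuous_on S (recon k M T w \<phi>)"
  by (rule vpolys_continuous[OF recon_mem[OF assms]])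

section \<open>The divergence reconstruction\<close>

definition div_load where
  "div_load T w \<phi> q = vol_inner T (divg w) q
     + (\<Sum>F\<in>elem_faces M T. face_inner F (\<lambda>x. \<phi> F x - w x) (\<lambda>x. q x *\<^sub>R normal T F))"

lemma face_scaled_L2:
  assumes "F \<in> elem_faces M T" "q \<in> polys l"
  shows "L2 (face_measure F) F (\<lambda>x. q x *\<^sub>R (n :: real^'d))"
  by (intro face_L2 elem_faces_faces[OF assms(1)] continuous_on_scaleR polys_continuous[OF assms(2)] continuous_on_const)

lemma div_recon_ex1:
  assumes T: "T \<in> elems M" and \<phi>: "face_data T \<phi>" and w: "w \<in> vpolys l"
  shows "\<exists>!D. D \<in> polys k \<and> (\<forall>q\<in>polys k. vol_inner T D q = div_load T w \<phi> q)"
proof (rule riesz_representation[OF subspace_polys fin_dim_polys])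
  interpret S: fin_subspace lborel T "polys k :: (real^'d \<Rightarrow> real) set" by (rule elem_subspace[OF T])
  fix x y z :: "real^'d \<Rightarrow> real" and c :: real assume x: "x \<in> polys k"
  show "vol_inner T x x = 0 \<Longrightarrow> x = 0" using S.definite[OF x] by (simp add: vol_inner_ip)
  have "ip (face_measure F) F (\<lambda>t. \<phi> F t - w t) (\<lambda>t. (c * x t) *\<^sub>R normal T F)
      = c * ip (face_measure F) F (\<lambda>t. \<phi> F t - w t) (\<lambda>t. x t *\<^sub>R normal T F)" for F
    unfolding scaleR_scaleR[symmetric] by (rule ip_scaleR_right)
  then show "div_load T w \<phi> (c *\<^sub>R x) = c * div_load T w \<phi> x"
    unfolding div_load_def vol_inner_ip face_inner_ip scaleR_fun_def
    using ip_scaleR_right[of lborel T "divg w" c x] by (simp add: sum_distrib_left distrib_left)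
  {
    assume y: "y \<in> polys k"
    have "ip (face_measure F) F (\<lambda>t. \<phi> F t - w t) (\<lambda>t. (x t + y t) *\<^sub>R normal T F)
        = ip (face_measure F) F (\<lambda>t. \<phi> F t - w t) (\<lambda>t. x t *\<^sub>R normal T F)
          + ip (face_measure F) F (\<lambda>t. \<phi> F t - w t) (\<lambda>t. y t *\<^sub>R normal T F)" if F: "F \<in> elem_faces M T" for F
      unfolding scaleR_add_left by (rule ip_add_right[OF face_scaled_L2[OF F x] face_scaled_L2[OF F y] face_diff_L2[OF F \<phi> w]])
    then show "div_load T w \<phi> (x + y) = div_load T w \<phi> x + div_load T w \<phi> y"
      unfolding div_load_def vol_inner_ip face_inner_ip plus_fun_def
      by (simp add: sum.distrib ip_add_right[OF elem_polys_L2[OF T x] elem_polys_L2[OF T y] elem_polys_L2[OF T divg_polys[OF w]]])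
  }
  assume z: "z \<in> polys k"
  show "vol_inner T (c *\<^sub>R x) z = c * vol_inner T x z"
    unfolding vol_inner_ip scaleR_fun_def by (rule ip_scaleR_left)
  show "vol_inner T x z = vol_inner T z x" unfolding vol_inner_ip by (rule ip_commute)
  assume y: "y \<in> polys k"
  show "vol_inner T (x + y) z = vol_inner T x z + vol_inner T y z"
    unfolding vol_inner_ip plus_fun_def
    by (rule ip_add_left[OF elem_polys_L2[OF T x] elem_polys_L2[OF T y] elem_polys_L2[OF T z]])
qed

lemma div_recon_mem: "T \<in> elems M \<Longrightarrow> face_data T \<phi> \<Longrightarrow> w \<in> vpolys l \<Longrightarrow> div_recon k M T w \<phi> \<in> polys k"
  and div_recon_ip: "T \<in> elems M \<Longrightarrow> face_data T \<phi> \<Longrightarrow> w \<in> vpolys l \<Longrightarrow> q \<in> polys k \<Longrightarrow>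
    vol_inner T (div_recon k M T w \<phi>) q = div_load T w \<phi> q"
  using theI'[OF div_recon_ex1] unfolding div_recon_def div_load_def by blast+

text \<open>The divergence theorem for the products \<open>w\<^sub>i q\<close>, summed over \<open>i\<close>.\<close>

lemma integration_by_parts:
  assumes T: "T \<in> elems M" and w: "w \<in> vpolys l" and q: "q \<in> polys m"
  shows "vol_inner T (divg w) q + vol_inner T w (grad q) = (\<Sum>F\<in>elem_faces M T. face_inner F w (\<lambda>x. q x *\<^sub>R normal T F))"
proof -
  have wc: "(\<lambda>x. w x $ i) \<in> polys l" for i using w by (simp add: vpolys_def)
  have wq: "(\<lambda>x. w x $ i * q x) \<in> polys (l + m)" for i by (rule polys_mult[OF wc q])
  have I: "set_integrable lborel T (\<lambda>x. pderivative i (\<lambda>x. w x $ i * q x) x)" for i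
    by (intro elem_integrable[OF T] polys_continuous[OF polys_deriv(2)[OF wq]])
  have J: "set_integrable (face_measure F) F (\<lambda>x. normal T F $ i * (w x $ i * q x))" if F: "F \<in> elem_faces M T" for F i
    by (intro set_integrable_mult_right face_integrable elem_faces_faces[OF F] polys_continuous[OF wq])
  have "vol_inner T (divg w) q + vol_inner T w (grad q) = (LINT x:T|lborel. divg w x * q x + w x \<bullet> grad q x)"
    unfolding vol_inner_def inner_real_def
    by (intro set_integral_add(2)[symmetric] elem_integrable[OF T] continuous_intros polys_continuous[OF divg_polys[OF w]]
        polys_continuous[OF q] vpolys_continuous[OF w] vpolys_continuous[OF grad_vpolys[OF q]])
  also have "\<dots> = (LINT x:T|lborel. \<Sum>i\<in>UNIV. pderivative i (\<lambda>x. w x $ i * q x) x)"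
    by (simp add: divg_def trace_def vgrad_component[OF w] inner_vec_def grad_pderivative
        pderivative_mult[OF wc q] sum.distrib sum_distrib_right)
  also have "\<dots> = (\<Sum>i\<in>UNIV. LINT x:T|lborel. pderivative i (\<lambda>x. w x $ i * q x) x)"
    using I unfolding set_lebesgue_integral_def set_integrable_def scaleR_sum_right
    by (intro Bochner_Integration.integral_sum) auto
  also have "\<dots> = (\<Sum>i\<in>UNIV. \<Sum>F\<in>elem_faces M T. LINT x:F|face_measure F. normal T F $ i * (w x $ i * q x))"
    by (simp add: green_elem[OF T wq])
  also have "\<dots> = (\<Sum>F\<in>elem_faces M T. \<Sum>i\<in>UNIV. LINT x:F|face_measure F. normal T F $ i * (w x $ i * q x))"
    by (rule sum.swap)
  also have "\<dots> = (\<Sum>F\<in>elem_faces M T. face_inner F w (\<lambda>x. q x *\<^sub>R normal T F))"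
  proof (rule sum.cong[OF refl])
    fix F assume F: "F \<in> elem_faces M T"
    have "(\<Sum>i\<in>UNIV. LINT x:F|face_measure F. normal T F $ i * (w x $ i * q x))
        = (LINT x:F|face_measure F. \<Sum>i\<in>UNIV. normal T F $ i * (w x $ i * q x))"
      using J[OF F] unfolding set_lebesgue_integral_def set_integrable_def scaleR_sum_right
      by (intro Bochner_Integration.integral_sum[symmetric]) auto
    also have "\<dots> = face_inner F w (\<lambda>x. q x *\<^sub>R normal T F)"
      unfolding face_inner_def by (simp add: inner_vec_def mult_ac)
    finally show "(\<Sum>i\<in>UNIV. LINT x:F|face_measure F. normal T F $ i * (w x $ i * q x)) = face_inner F w (\<lambda>x. q x *\<^sub>R normal T F)" .
  qed
  finally show ?thesis .
qed

lemma div_load_by_parts: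
  assumes T: "T \<in> elems M" and \<phi>: "face_data T \<phi>" and w: "w \<in> vpolys l" and q: "q \<in> polys m"
  shows "div_load T w \<phi> q = (\<Sum>F\<in>elem_faces M T. face_inner F (\<lambda>x. \<phi> F x \<bullet> normal T F) q) - vol_inner T w (grad q)"
proof -
  have "face_inner F (\<lambda>x. \<phi> F x - w x) (\<lambda>x. q x *\<^sub>R normal T F)
      = face_inner F (\<lambda>x. \<phi> F x \<bullet> normal T F) q - face_inner F w (\<lambda>x. q x *\<^sub>R normal T F)" if F: "F \<in> elem_faces M T" for F
  proof -
    have "face_inner F (\<lambda>x. \<phi> F x - w x) (\<lambda>x. q x *\<^sub>R normal T F)
      = face_inner F (\<phi> F) (\<lambda>x. q x *\<^sub>R normal T F) - face_inner F w (\<lambda>x. q x *\<^sub>R normal T F)"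
      unfolding face_inner_ip using \<phi> F
      by (intro ip_diff_left face_scaled_L2[OF F q] face_L2 elem_faces_faces[OF F] vpolys_continuous[OF w]) (auto simp: face_data_def)
    also have "face_inner F (\<phi> F) (\<lambda>x. q x *\<^sub>R normal T F) = face_inner F (\<lambda>x. \<phi> F x \<bullet> normal T F) q"
      unfolding face_inner_def by (simp add: mult.commute)
    finally show ?thesis .
  qed
  then show ?thesis unfolding div_load_def
    using integration_by_parts[OF T w q] by (simp add: sum_subtractf)
qed

section \<open>The boundary operator and its adjoint\<close>

lemma bdry_space_families: "bdry_space k M T = families (elem_faces M T) (face_vpolys k)"
  unfolding bdry_space_def families_def zero_fun_def ..

lemma bdry_space_face_data: "\<phi> \<in> bdry_space k M T \<Longrightarrow> face_data T \<phi>"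
  unfolding bdry_space_def face_data_def by (auto intro: face_vpolys_continuous)

lemma face_data_L2: "face_data T \<phi> \<Longrightarrow> F \<in> elem_faces M T \<Longrightarrow> L2 (face_measure F) F (\<phi> F)"
  unfolding face_data_def by (intro face_L2 elem_faces_faces) auto

lemma bdry_inner_definite:
  assumes \<phi>: "\<phi> \<in> bdry_space k M T" and z: "bdry_inner M T \<phi> \<phi> = 0"
  shows "\<phi> = 0"
proof
  fix F
  have nn: "face_inner F' (\<phi> F') (\<phi> F') \<ge> 0" for F'
    unfolding face_inner_def set_lebesgue_integral_def by (intro Bochner_Integration.integral_nonneg) simp
  show "\<phi> F = 0 F"
  proof (cases "F \<in> elem_faces M T")
    case True
    then have "face_inner F (\<phi> F) (\<phi> F) = 0"
      using z nn unfolding bdry_inner_def by (simp add: sum_nonneg_eq_0_iff)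
    then show ?thesis using True \<phi> face_vpolys_definite[OF elem_faces_faces[OF True], of "\<phi> F" k] by (simp add: bdry_space_def)
  qed (use \<phi> in \<open>simp add: bdry_space_def zero_fun_def\<close>)
qed

lemma bdry_op_arg_continuous:
  assumes T: "T \<in> elems M" and \<phi>: "face_data T \<phi>" and F: "F \<in> elem_faces M T"
  shows "continuous_on F (\<lambda>x. \<phi> F x - recon k M T (\<lambda>x. 0) \<phi> x + vproj k T (recon k M T (\<lambda>x. 0) \<phi>) x)"
  using \<phi> F unfolding face_data_def
  by (intro continuous_on_add continuous_on_diff recon_continuous[OF T \<phi> vpolys_zero]
      vpolys_continuous[OF vproj_mem[OF T recon_continuous[OF T \<phi> vpolys_zero]]]) auto

lemma bdry_op_mem:
  assumes T: "T \<in> elems M" and \<phi>: "face_data T \<phi>"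
  shows "bdry_op k M T \<phi> \<in> bdry_space k M T"
  unfolding bdry_space_def bdry_op_def Let_def
  using face_vproj_mem[OF elem_faces_faces bdry_op_arg_continuous[OF T \<phi>]] by auto

lemma bdry_op_add:
  assumes T: "T \<in> elems M" and \<phi>: "face_data T \<phi>" "face_data T \<psi>"
  shows "bdry_op k M T (\<phi> + \<psi>) = bdry_op k M T \<phi> + bdry_op k M T \<psi>"
proof
  fix F
  have r: "recon k M T (\<lambda>x. 0) (\<phi> + \<psi>) = (\<lambda>x. recon k M T (\<lambda>x. 0) \<phi> x + recon k M T (\<lambda>x. 0) \<psi> x)"
    using recon_add[OF T \<phi> vpolys_zero vpolys_zero] by (simp add: plus_fun_def)
  show "bdry_op k M T (\<phi> + \<psi>) F = (bdry_op k M T \<phi> + bdry_op k M T \<psi>) F"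
  proof (cases "F \<in> elem_faces M T")
    case True
    have "face_vproj k F (\<lambda>x. (\<phi> + \<psi>) F x - recon k M T (\<lambda>x. 0) (\<phi> + \<psi>) x + vproj k T (recon k M T (\<lambda>x. 0) (\<phi> + \<psi>)) x)
        = face_vproj k F (\<lambda>x. (\<phi> F x - recon k M T (\<lambda>x. 0) \<phi> x + vproj k T (recon k M T (\<lambda>x. 0) \<phi>) x)
            + (\<psi> F x - recon k M T (\<lambda>x. 0) \<psi> x + vproj k T (recon k M T (\<lambda>x. 0) \<psi>) x))"
      unfolding r vproj_add[OF T recon_continuous[OF T \<phi>(1) vpolys_zero] recon_continuous[OF T \<phi>(2) vpolys_zero]]
      by (simp add: algebra_simps)
    also have "\<dots> = bdry_op k M T \<phi> F + bdry_op k M T \<psi> F"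
      using face_vproj_add[OF elem_faces_faces[OF True] bdry_op_arg_continuous[OF T \<phi>(1) True] bdry_op_arg_continuous[OF T \<phi>(2) True]] True
      by (simp add: bdry_op_def Let_def plus_fun_def)
    finally show ?thesis using True by (simp add: bdry_op_def Let_def)
  qed (simp add: bdry_op_def Let_def fun_eq_iff)
qed

lemma bdry_op_scale:
  assumes T: "T \<in> elems M" and \<phi>: "face_data T \<phi>"
  shows "bdry_op k M T (c *\<^sub>R \<phi>) = c *\<^sub>R bdry_op k M T \<phi>"
proof
  fix F
  have r: "recon k M T (\<lambda>x. 0) (c *\<^sub>R \<phi>) = (\<lambda>x. c *\<^sub>R recon k M T (\<lambda>x. 0) \<phi> x)"
    using recon_scale[OF T \<phi> vpolys_zero] by (simp add: scaleR_fun_def)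
  show "bdry_op k M T (c *\<^sub>R \<phi>) F = (c *\<^sub>R bdry_op k M T \<phi>) F"
  proof (cases "F \<in> elem_faces M T")
    case True
    have "face_vproj k F (\<lambda>x. (c *\<^sub>R \<phi>) F x - recon k M T (\<lambda>x. 0) (c *\<^sub>R \<phi>) x + vproj k T (recon k M T (\<lambda>x. 0) (c *\<^sub>R \<phi>)) x)
        = face_vproj k F (\<lambda>x. c *\<^sub>R (\<phi> F x - recon k M T (\<lambda>x. 0) \<phi> x + vproj k T (recon k M T (\<lambda>x. 0) \<phi>) x))"
      unfolding r vproj_scale[OF T recon_continuous[OF T \<phi> vpolys_zero]]
      by (simp add: algebra_simps)
    also have "\<dots> = c *\<^sub>R bdry_op k M T \<phi> F"
      using face_vproj_scale[OF elem_faces_faces[OF True] bdry_op_arg_continuous[OF T \<phi> True]] True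
      by (simp add: bdry_op_def Let_def scaleR_fun_def)
    finally show ?thesis using True by (simp add: bdry_op_def Let_def)
  qed (simp add: bdry_op_def Let_def fun_eq_iff)
qed

lemma bdry_inner_add:
  assumes "face_data T \<phi>" "face_data T \<psi>" "face_data T \<eta>"
  shows "bdry_inner M T (\<phi> + \<psi>) \<eta> = bdry_inner M T \<phi> \<eta> + bdry_inner M T \<psi> \<eta>"
  unfolding bdry_inner_def face_inner_ip sum.distrib[symmetric] plus_fun_def
  by (rule sum.cong[OF refl], rule ip_add_left) (use assms in \<open>auto intro: face_data_L2\<close>)

lemma bdry_inner_commute: "bdry_inner M T \<phi> \<eta> = bdry_inner M T \<eta> \<phi>"
  unfolding bdry_inner_def face_inner_ip by (simp add: ip_commute)

lemma bdry_inner_scale: "bdry_inner M T (c *\<^sub>R \<phi>) \<eta> = c * bdry_inner M T \<phi> \<eta>"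
  unfolding bdry_inner_def face_inner_ip sum_distrib_left scaleR_fun_def by (simp only: ip_scaleR_left)

text \<open>The adjoint of \<open>L\<^sub>T\<^sup>k\<close> at \<open>\<phi>\<close> represents the functional that maps \<open>\<eta>\<close> to the inner product of \<open>\<phi>\<close> and
\<open>L\<^sub>T\<^sup>k \<eta>\<close>.  Here \<open>\<phi>\<close> may be any family of functions continuous on the faces, which covers the
weighted family \<open>h\<^sub>F\<^sup>-\<^sup>1 L\<^sub>T\<^sup>k(\<dots>)\<close> without a separate argument.\<close>

lemma bdry_adj_ex1:
  assumes T: "T \<in> elems M" and \<phi>: "face_data T \<phi>"
  shows "\<exists>!\<psi>. \<psi> \<in> bdry_space k M T \<and> (\<forall>\<eta>\<in>bdry_space k M T. bdry_inner M T \<psi> \<eta> = bdry_inner M T \<phi> (bdry_op k M T \<eta>))"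
proof (rule riesz_representation)
  show "subspace (bdry_space k M T)" "fin_dim (bdry_space k M T)"
    unfolding bdry_space_families
    by (auto intro: subspace_families fin_dim_families subspace_face_vpolys fin_dim_face_vpolys)
  note fd = bdry_space_face_data
  show "bdry_inner M T (x + y) z = bdry_inner M T x z + bdry_inner M T y z"
    if "x \<in> bdry_space k M T" "y \<in> bdry_space k M T" "z \<in> bdry_space k M T" for x y z
    by (rule bdry_inner_add[OF fd[OF that(1)] fd[OF that(2)] fd[OF that(3)]])
  show "bdry_inner M T \<phi> (bdry_op k M T (x + y)) = bdry_inner M T \<phi> (bdry_op k M T x) + bdry_inner M T \<phi> (bdry_op k M T y)"
    if "x \<in> bdry_space k M T" "y \<in> bdry_space k M T" for x y
    using bdry_inner_add[OF fd[OF bdry_op_mem[OF T fd[OF that(1)]]] fd[OF bdry_op_mem[OF T fd[OF that(2)]]] \<phi>]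
    by (simp add: bdry_op_add[OF T fd[OF that(1)] fd[OF that(2)]] bdry_inner_commute)
  show "bdry_inner M T \<phi> (bdry_op k M T (c *\<^sub>R x)) = c * bdry_inner M T \<phi> (bdry_op k M T x)"
    if "x \<in> bdry_space k M T" for c x
    using bdry_inner_scale[of T c "bdry_op k M T x" \<phi>] by (simp add: bdry_op_scale[OF T fd[OF that]] bdry_inner_commute)
qed (use bdry_inner_definite bdry_inner_scale bdry_inner_commute in blast)+

lemma bdry_adj_mem: "T \<in> elems M \<Longrightarrow> face_data T \<phi> \<Longrightarrow> bdry_adj k M T \<phi> \<in> bdry_space k M T"
  and bdry_adj_inner: "T \<in> elems M \<Longrightarrow> face_data T \<phi> \<Longrightarrow> \<eta> \<in> bdry_space k M T \<Longrightarrow>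
    bdry_inner M T (bdry_adj k M T \<phi>) \<eta> = bdry_inner M T \<phi> (bdry_op k M T \<eta>)"
  using theI'[OF bdry_adj_ex1] unfolding bdry_adj_def by blast+

section \<open>Stress and traction of an element\<close>

lemma hyb_space_face_data: "v \<in> hyb_space k M \<Longrightarrow> face_data T (snd v)"
  unfolding hyb_space_def face_data_def elem_faces_def by (auto intro: face_vpolys_continuous)

lemma hyb_space_elem: "v \<in> hyb_space k M \<Longrightarrow> T \<in> elems M \<Longrightarrow> fst v T \<in> vpolys k"
  unfolding hyb_space_def brk_vpolys_def by blast

lemma bdry_diff_mem:
  assumes v: "v \<in> hyb_space k M" and T: "T \<in> elems M"
  shows "bdry_diff M T (fst v T) (snd v) \<in> bdry_space k M T"
  unfolding bdry_space_def
proof (intro CollectI conjI ballI allI impI)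
  fix F assume F: "F \<in> elem_faces M T"
  have m: "snd v F \<in> face_vpolys k F" using v elem_faces_faces[OF F] by (simp add: hyb_space_def)
  have "bdry_diff M T (fst v T) (snd v) F = snd v F - restr F (fst v T)"
    using face_vpolys_outside[OF m] F by (auto simp: bdry_diff_def restr_def fun_eq_iff)
  then show "bdry_diff M T (fst v T) (snd v) F \<in> face_vpolys k F"
    using subspace_diff[OF subspace_face_vpolys m vpolys_restr[OF hyb_space_elem[OF v T]]] by simp
qed (simp add: bdry_diff_def fun_eq_iff)

text \<open>By \<open>recon_split\<close> the reconstruction of \<open>v\<close> is \<open>v\<^sub>T\<close> plus the reconstruction of \<open>v\<^sub>F - v\<^sub>T\<close>.  The
projections leave \<open>v\<^sub>T\<close> unchanged, so that it cancels from the residual.\<close>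

lemma face_resid_bdry_op:
  assumes v: "v \<in> hyb_space k M" and T: "T \<in> elems M" and F: "F \<in> elem_faces M T" and x: "x \<in> F"
  shows "face_resid k M T F (fst v T) (snd v) x = - bdry_op k M T (bdry_diff M T (fst v T) (snd v)) F x"
proof -
  let ?w = "fst v T" and ?\<delta> = "bdry_diff M T (fst v T) (snd v)"
  let ?r = "recon k M T (\<lambda>x. 0) ?\<delta>"
  note Ff = elem_faces_faces[OF F]
  have w: "?w \<in> vpolys k" by (rule hyb_space_elem[OF v T])
  then have w1: "?w \<in> vpolys (k + 1)" using vpolys_le[of k "k + 1"] by auto
  have fd: "face_data T ?\<delta>" using bdry_space_face_data[OF bdry_diff_mem[OF v T]] .
  have rc: "continuous_on S ?r" for S by (rule recon_continuous[OF T fd vpolys_zero])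
  have pc: "continuous_on S (vproj k T ?r)" for S by (rule vpolys_continuous[OF vproj_mem[OF T rc]])
  have dm: "?\<delta> F \<in> face_vpolys k F" using bdry_diff_mem[OF v T] F by (simp add: bdry_space_def)
  have dc: "continuous_on F (?\<delta> F)" by (rule face_vpolys_continuous[OF dm])
  have split: "recon k M T ?w (snd v) = (\<lambda>x. ?w x + ?r x)"
    by (rule recon_split[OF T hyb_space_face_data[OF v] w1])
  have "bdry_op k M T ?\<delta> F = face_vproj k F (\<lambda>x. (?\<delta> F x + (- 1) *\<^sub>R ?r x) + vproj k T ?r x)"
    using F by (simp add: bdry_op_def Let_def)
  also have "\<dots> = (\<lambda>x. (face_vproj k F (?\<delta> F) x + (- 1) *\<^sub>R face_vproj k F ?r x) + face_vproj k F (vproj k T ?r) x)"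
    using rc pc dc by (simp only: face_vproj_add[OF Ff] face_vproj_scale[OF Ff] continuous_on_add continuous_on_scaleR continuous_on_const)
  finally have op: "bdry_op k M T ?\<delta> F
      = (\<lambda>x. (face_vproj k F (?\<delta> F) x + (- 1) *\<^sub>R face_vproj k F ?r x) + face_vproj k F (vproj k T ?r) x)" .
  have 1: "bdry_op k M T ?\<delta> F x = (snd v F x - ?w x) - face_vproj k F ?r x + vproj k T ?r x"
    unfolding op face_vproj_id[OF Ff dm] face_vproj_poly[OF Ff vproj_mem[OF T rc] x] by (simp add: bdry_diff_def F x)
  have 2: "vproj k T (recon k M T ?w (snd v)) x = ?w x + vproj k T ?r x"
    unfolding split vproj_add[OF T vpolys_continuous[OF w] rc] vproj_id[OF T w] ..
  have "face_vproj k F (recon k M T ?w (snd v)) x = ?w x + face_vproj k F ?r x"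
    unfolding split face_vproj_add[OF Ff vpolys_continuous[OF w] rc] face_vproj_poly[OF Ff w x] ..
  then show ?thesis unfolding face_resid_def 1 2 by simp
qed

text \<open>The family \<open>h\<^sub>F\<^sup>-\<^sup>1 L\<^sub>T\<^sup>k(\<phi> - w)\<close> to which the adjoint is applied in the traction.\<close>

definition jump_load where
  "jump_load k T w \<phi> = (\<lambda>F y. bdry_op k M T (bdry_diff M T w \<phi>) F y /\<^sub>R face_len M F)"

lemma jump_load_face_data:
  assumes "u \<in> hyb_space k M" "T \<in> elems M"
  shows "face_data T (jump_load k T (fst u T) (snd u))"
proof -
  have "face_data T (bdry_op k M T (bdry_diff M T (fst u T) (snd u)))"
    by (rule bdry_space_face_data[OF bdry_op_mem[OF assms(2) bdry_space_face_data[OF bdry_diff_mem[OF assms]]]])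
  then show ?thesis unfolding face_data_def jump_load_def by (auto intro: continuous_intros)
qed

lemma stab_adjoint:
  assumes u: "u \<in> hyb_space k M" and v: "v \<in> hyb_space k M" and T: "T \<in> elems M"
  shows "stab k M T u v = (\<Sum>F\<in>elem_faces M T.
    face_inner F (bdry_adj k M T (jump_load k T (fst u T) (snd u)) F) (\<lambda>x. snd v F x - fst v T x))"
proof -
  let ?\<delta>u = "bdry_diff M T (fst u T) (snd u)" and ?\<delta>v = "bdry_diff M T (fst v T) (snd v)"
  have "stab k M T u v = bdry_inner M T (jump_load k T (fst u T) (snd u)) (bdry_op k M T ?\<delta>v)"
    unfolding stab_def bdry_inner_def
  proof (rule sum.cong[OF refl])
    fix F assume F: "F \<in> elem_faces M T"
    have "face_inner F (face_resid k M T F (fst u T) (snd u)) (face_resid k M T F (fst v T) (snd v))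
        = face_inner F (\<lambda>x. - bdry_op k M T ?\<delta>u F x) (\<lambda>x. - bdry_op k M T ?\<delta>v F x)"
      unfolding face_inner_ip
      by (rule ip_cong) (simp_all only: face_resid_bdry_op[OF u T F] face_resid_bdry_op[OF v T F])
    also have "\<dots> = face_inner F (bdry_op k M T ?\<delta>u F) (bdry_op k M T ?\<delta>v F)"
      by (simp add: face_inner_def)
    finally show "inverse (face_len M F) * face_inner F (face_resid k M T F (fst u T) (snd u)) (face_resid k M T F (fst v T) (snd v))
      = face_inner F (jump_load k T (fst u T) (snd u) F) (bdry_op k M T ?\<delta>v F)"
      unfolding jump_load_def face_inner_ip ip_scaleR_left by simp
  qed
  also have "\<dots> = bdry_inner M T (bdry_adj k M T (jump_load k T (fst u T) (snd u))) ?\<delta>v"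
    by (rule bdry_adj_inner[OF T jump_load_face_data[OF u T] bdry_diff_mem[OF v T], symmetric])
  also have "\<dots> = (\<Sum>F\<in>elem_faces M T.
    face_inner F (bdry_adj k M T (jump_load k T (fst u T) (snd u)) F) (\<lambda>x. snd v F x - fst v T x))"
    unfolding bdry_inner_def face_inner_ip by (intro sum.cong refl ip_cong) (simp_all add: bdry_diff_def)
  finally show ?thesis .
qed

definition elem_form where
  "elem_form k \<mu> lam T u v = 2 * \<mu> * (vol_inner T (sgrad (recon k M T (fst u T) (snd u))) (sgrad (recon k M T (fst v T) (snd v)))
              + stab k M T u v)
     + lam * vol_inner T (div_recon k M T (fst u T) (snd u)) (div_recon k M T (fst v T) (snd v))"

text \<open>The reconstruction of \<open>u\<close> and the polynomial \<open>d = lam D u - q\<close> are admissible in the definitions of the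
reconstructions of \<open>v\<close>.  This produces the stress \<open>2 \<mu> sgrad (r u) + d I\<close> in the volume and on the
faces; the stabilisation contributes the remaining part of the traction.\<close>

lemma elem_momentum:
  assumes u: "u \<in> hyb_space k M" and v: "v \<in> hyb_space k M" and T: "T \<in> elems M" and q: "q \<in> polys k"
  shows "elem_form k \<mu> lam T u v - vol_inner T (div_recon k M T (fst v T) (snd v)) q
    = vol_inner T (\<lambda>x. stress k M \<mu> lam T (fst u T) (snd u) x - q x *\<^sub>R mat 1) (sgrad (fst v T))
      + (\<Sum>F\<in>elem_faces M T. face_inner F (traction k M \<mu> lam T F (fst u T) (snd u) q) (\<lambda>x. snd v F x - fst v T x))"
proof -
  let ?r = "recon k M T (fst u T) (snd u)" and ?s = "recon k M T (fst v T) (snd v)"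
  let ?D = "div_recon k M T (fst u T) (snd u)" and ?E = "div_recon k M T (fst v T) (snd v)"
  let ?a = "bdry_adj k M T (jump_load k T (fst u T) (snd u))"
  note ut = hyb_space_elem[OF u T] and vt = hyb_space_elem[OF v T]
  note uf = hyb_space_face_data[OF u, of T] and vf = hyb_space_face_data[OF v, of T]
  \<comment> \<open>the scalar that multiplies the identity matrix in the total stress\<close>
  define d where "d x = lam * ?D x - q x" for x
  have Dm: "?D \<in> polys k" by (rule div_recon_mem[OF T uf ut])
  have Em: "?E \<in> polys k" by (rule div_recon_mem[OF T vf vt])
  have d: "d \<in> polys k" unfolding d_def[abs_def] by (intro polys_diff polys_scale Dm q)
  have rm: "?r \<in> vpolys (k + 1)" by (rule recon_mem[OF T uf ut])
  have sigma: "stress k M \<mu> lam T (fst u T) (snd u) x - q x *\<^sub>R mat 1 = (2 * \<mu>) *\<^sub>R sgrad ?r x + d x *\<^sub>R mat 1" for x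
    by (simp add: stress_def d_def scaleR_diff_left)
  have strain: "vol_inner T (sgrad ?r) (sgrad ?s) = strain_load T (fst v T) (snd v) ?r"
    using recon_strain[OF T vf vt rm] by (simp add: vol_inner_ip ip_commute)
  have div: "lam * vol_inner T ?D ?E - vol_inner T ?E q = div_load T (fst v T) (snd v) d"
  proof -
    have "vol_inner T ?E d = vol_inner T ?E (\<lambda>x. lam *\<^sub>R ?D x) - vol_inner T ?E q"
      unfolding d_def[abs_def] vol_inner_ip real_scaleR_def
      by (rule ip_diff_right[OF elem_polys_L2[OF T polys_scale[OF Dm]] elem_polys_L2[OF T q] elem_polys_L2[OF T Em]])
    then show ?thesis using div_recon_ip[OF T vf vt d]
      by (simp only: vol_inner_ip ip_scaleR_right ip_commute[of lborel T ?D])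
  qed
  have V: "vol_inner T (\<lambda>x. stress k M \<mu> lam T (fst u T) (snd u) x - q x *\<^sub>R mat 1) (sgrad (fst v T))
      = 2 * \<mu> * vol_inner T (sgrad (fst v T)) (sgrad ?r) + vol_inner T (divg (fst v T)) d"
  proof -
    have "vol_inner T (\<lambda>x. stress k M \<mu> lam T (fst u T) (snd u) x - q x *\<^sub>R mat 1) (sgrad (fst v T))
        = ip lborel T (\<lambda>x. (2 * \<mu>) *\<^sub>R sgrad ?r x) (sgrad (fst v T)) + ip lborel T (\<lambda>x. d x *\<^sub>R mat 1) (sgrad (fst v T))"
      unfolding sigma vol_inner_ip
      by (rule ip_add_left[OF L2_scaleR[OF elem_sgrad_L2[OF T rm]] _ elem_sgrad_L2[OF T vt]])
        (intro elem_L2[OF T] continuous_on_scaleR polys_continuous[OF d] continuous_on_const)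
    also have "ip lborel T (\<lambda>x. d x *\<^sub>R mat 1) (sgrad (fst v T)) = vol_inner T (divg (fst v T)) d"
      unfolding ip_def vol_inner_def by (simp add: identity_inner_sgrad mult.commute)
    finally show ?thesis unfolding ip_scaleR_left by (simp add: vol_inner_ip ip_commute)
  qed
  have B: "face_inner F (traction k M \<mu> lam T F (fst u T) (snd u) q) (\<lambda>x. snd v F x - fst v T x)
      = 2 * \<mu> * face_inner F (\<lambda>x. snd v F x - fst v T x) (\<lambda>x. sgrad ?r x *v normal T F)
        + face_inner F (\<lambda>x. snd v F x - fst v T x) (\<lambda>x. d x *\<^sub>R normal T F)
        + 2 * \<mu> * face_inner F (?a F) (\<lambda>x. snd v F x - fst v T x)" if F: "F \<in> elem_faces M T" for F
  proof -
    have t: "traction k M \<mu> lam T F (fst u T) (snd u) q x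
        = ((2 * \<mu>) *\<^sub>R (sgrad ?r x *v normal T F) + d x *\<^sub>R normal T F) + (2 * \<mu>) *\<^sub>R ?a F x" for x
      unfolding traction_def sigma jump_load_def
      by (simp add: matrix_vector_mult_add_rdistrib scaleR_matrix_vector_assoc[symmetric] matrix_vector_mul_lid)
    have l1: "L2 (face_measure F) F (\<lambda>x. (2 * \<mu>) *\<^sub>R (sgrad ?r x *v normal T F))"
      by (rule L2_scaleR[OF face_sgrad_L2[OF F rm]])
    have l2: "L2 (face_measure F) F (\<lambda>x. d x *\<^sub>R normal T F)" by (rule face_scaled_L2[OF F d])
    have l3: "L2 (face_measure F) F (\<lambda>x. (2 * \<mu>) *\<^sub>R ?a F x)"
      by (rule L2_scaleR[OF face_data_L2[OF bdry_space_face_data[OF bdry_adj_mem[OF T jump_load_face_data[OF u T]]] F]])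
    have l4: "L2 (face_measure F) F (\<lambda>x. snd v F x - fst v T x)" by (rule face_diff_L2[OF F vf vt])
    have "traction k M \<mu> lam T F (fst u T) (snd u) q
        = (\<lambda>x. ((2 * \<mu>) *\<^sub>R (sgrad ?r x *v normal T F) + d x *\<^sub>R normal T F) + (2 * \<mu>) *\<^sub>R ?a F x)"
      by (rule ext) (rule t)
    then show ?thesis unfolding face_inner_ip
      by (simp only: ip_add_left[OF L2_add[OF l1 l2] l3 l4] ip_add_left[OF l1 l2 l4] ip_scaleR_left)
        (simp add: ip_commute)
  qed
  have "elem_form k \<mu> lam T u v - vol_inner T ?E q
      = 2 * \<mu> * strain_load T (fst v T) (snd v) ?r + 2 * \<mu> * stab k M T u v + div_load T (fst v T) (snd v) d"
    using div unfolding elem_form_def strain distrib_left by linarith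
  also have "\<dots> = vol_inner T (\<lambda>x. stress k M \<mu> lam T (fst u T) (snd u) x - q x *\<^sub>R mat 1) (sgrad (fst v T))
      + (\<Sum>F\<in>elem_faces M T. face_inner F (traction k M \<mu> lam T F (fst u T) (snd u) q) (\<lambda>x. snd v F x - fst v T x))"
    unfolding V strain_load_def div_load_def stab_adjoint[OF u v T]
    by (simp add: sum.cong[OF refl B] sum.distrib sum_distrib_left distrib_left mult.assoc)
  finally show ?thesis .
qed

text \<open>On the face the traction is a polynomial of degree \<open>k\<close>, hence determined by its inner products
with the face unknowns.\<close>

lemma traction_face_poly:
  assumes u: "u \<in> hyb_space k M" and T: "T \<in> elems M" and q: "q \<in> polys k" and F: "F \<in> elem_faces M T"
  shows "restr F (traction k M \<mu> lam T F (fst u T) (snd u) q) \<in> face_vpolys k F"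
proof -
  let ?r = "recon k M T (fst u T) (snd u)" and ?D = "div_recon k M T (fst u T) (snd u)"
  let ?a = "bdry_adj k M T (jump_load k T (fst u T) (snd u))"
  note ut = hyb_space_elem[OF u T] and uf = hyb_space_face_data[OF u, of T]
  have a: "?a F \<in> face_vpolys k F"
    using bdry_adj_mem[OF T jump_load_face_data[OF u T]] F by (simp add: bdry_space_def)
  let ?p = "\<lambda>x. (stress k M \<mu> lam T (fst u T) (snd u) x - q x *\<^sub>R mat 1) *v normal T F"
  have sg: "(\<lambda>x. sgrad ?r x $ i $ j) \<in> polys k" for i j
    using sgrad_polys[OF recon_mem[OF T uf ut]] by simp
  have "(\<lambda>x. normal T F $ j * ((2 * \<mu>) * sgrad ?r x $ i $ j + (mat 1 :: real^'d^'d) $ i $ j * (lam * ?D x - q x))) \<in> polys k" for i j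
    by (intro polys_scale polys_add polys_diff sg q div_recon_mem[OF T uf ut])
  then have "(\<lambda>x. ?p x $ i) \<in> polys k" for i
    unfolding stress_def matrix_vector_mult_def by (simp add: polys_sum algebra_simps)
  then have "?p \<in> vpolys k" by (simp add: vpolys_def)
  then have "restr F ?p + (2 * \<mu>) *\<^sub>R ?a F \<in> face_vpolys k F"
    by (intro subspace_add[OF subspace_face_vpolys] subspace_scale[OF subspace_face_vpolys] vpolys_restr a)
  moreover have "restr F (traction k M \<mu> lam T F (fst u T) (snd u) q) = restr F ?p + (2 * \<mu>) *\<^sub>R ?a F"
    using face_vpolys_outside[OF a] by (auto simp: fun_eq_iff restr_def traction_def jump_load_def)
  ultimately show ?thesis by simp
qed

lemma traction_continuous:
  assumes "u \<in> hyb_space k M" "T \<in> elems M" "q \<in> polys k" "F \<in> elem_faces M T"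
  shows "continuous_on F (traction k M \<mu> lam T F (fst u T) (snd u) q)"
  by (rule continuous_on_eq[OF face_vpolys_continuous[OF traction_face_poly[OF assms]]]) (simp add: restr_def)

lemma traction_L2:
  assumes "u \<in> hyb_space k M" "T \<in> elems M" "q \<in> polys k" "F \<in> elem_faces M T"
  shows "L2 (face_measure F) F (traction k M \<mu> lam T F (fst u T) (snd u) q)"
  by (rule face_L2[OF elem_faces_faces[OF assms(4)] traction_continuous[OF assms]])

section \<open>Momentum balance\<close>

definition momentum_form where
  "momentum_form k \<mu> lam u q T w \<phi> =
     vol_inner T (\<lambda>x. stress k M \<mu> lam T (fst u T) (snd u) x - q x *\<^sub>R mat 1) (sgrad w)
      + (\<Sum>F\<in>elem_faces M T. face_inner F (traction k M \<mu> lam T F (fst u T) (snd u) q) (\<lambda>x. \<phi> F x - w x))"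

lemma a_form_elem_form: "a_form k M \<mu> lam u v = (\<Sum>T\<in>elems M. elem_form k \<mu> lam T u v)"
  unfolding a_form_def elem_form_def ..

lemma hyb_space0_space: "v \<in> hyb_space0 \<Omega> k M \<Longrightarrow> v \<in> hyb_space k M" by (simp add: hyb_space0_def)

lemma brk_polys_elem: "q \<in> brk_polys k M \<Longrightarrow> T \<in> elems M \<Longrightarrow> q T \<in> polys k" by (simp add: brk_polys_def)

text \<open>The coupling term joins the elasticity form element by element, so that both are covered by
\<open>elem_momentum\<close>.\<close>

lemma global_momentum:
  assumes u: "u \<in> hyb_space k M" and v: "v \<in> hyb_space k M" and q: "q \<in> brk_polys k M"
  shows "a_form k M \<mu> lam u v + b_form k M v q = (\<Sum>T\<in>elems M. momentum_form k \<mu> lam u (q T) T (fst v T) (snd v))"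
proof -
  have "a_form k M \<mu> lam u v + b_form k M v q
      = (\<Sum>T\<in>elems M. elem_form k \<mu> lam T u v - vol_inner T (div_recon k M T (fst v T) (snd v)) (q T))"
    unfolding a_form_elem_form b_form_def by (simp add: sum_subtractf)
  also have "\<dots> = (\<Sum>T\<in>elems M. momentum_form k \<mu> lam u (q T) T (fst v T) (snd v))"
    unfolding momentum_form_def by (intro sum.cong refl elem_momentum[OF u v _ brk_polys_elem[OF q]])
  finally show ?thesis .
qed

lemma momentum_form_split:
  assumes u: "u \<in> hyb_space k M" and v: "v \<in> hyb_space k M" and q: "q \<in> polys k" and T: "T \<in> elems M"
  shows "momentum_form k \<mu> lam u q T (fst v T) (snd v) = momentum_form k \<mu> lam u q T (fst v T) (\<lambda>F x. 0)
    + (\<Sum>F\<in>elem_faces M T. face_inner F (traction k M \<mu> lam T F (fst u T) (snd u) q) (snd v F))"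
proof -
  have "face_inner F (traction k M \<mu> lam T F (fst u T) (snd u) q) (\<lambda>x. snd v F x - fst v T x)
      = face_inner F (traction k M \<mu> lam T F (fst u T) (snd u) q) (\<lambda>x. 0 - fst v T x)
        + face_inner F (traction k M \<mu> lam T F (fst u T) (snd u) q) (snd v F)" if F: "F \<in> elem_faces M T" for F
  proof -
    note fd = hyb_space_face_data[OF v, of T]
    have l: "L2 (face_measure F) F (fst v T)"
      by (rule face_L2[OF elem_faces_faces[OF F] vpolys_continuous[OF hyb_space_elem[OF v T]]])
    have "ip (face_measure F) F (traction k M \<mu> lam T F (fst u T) (snd u) q) (\<lambda>x. (- 1) *\<^sub>R fst v T x + snd v F x)
      = ip (face_measure F) F (traction k M \<mu> lam T F (fst u T) (snd u) q) (\<lambda>x. (- 1) *\<^sub>R fst v T x)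
        + ip (face_measure F) F (traction k M \<mu> lam T F (fst u T) (snd u) q) (snd v F)"
      by (rule ip_add_right[OF L2_scaleR[OF l] face_data_L2[OF fd F] traction_L2[OF u T q F]])
    then show ?thesis by (simp add: face_inner_ip)
  qed
  then show ?thesis unfolding momentum_form_def by (simp add: sum.distrib)
qed

lemma momentum_form_zero [simp]: "momentum_form k \<mu> lam u q T (\<lambda>x. 0) (\<lambda>F x. 0) = 0"
  unfolding momentum_form_def sgrad_zero by (simp add: vol_inner_ip face_inner_ip)

lemma momentum_form_cong:
  assumes "\<And>F. F \<in> elem_faces M T \<Longrightarrow> \<phi> F = \<psi> F"
  shows "momentum_form k \<mu> lam u q T w \<phi> = momentum_form k \<mu> lam u q T w \<psi>"
  unfolding momentum_form_def using assms by simp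

text \<open>After \<open>sum_elem_faces\<close> the global residual is a sum over elements, which involves the element
unknowns, plus the pairing of the face unknowns with the sum of the two tractions on each interface.
Boundary faces do not contribute since the unknowns vanish there.\<close>

lemma momentum_equivalence:
  assumes u: "u \<in> hyb_space0 \<Omega> k M" and q: "q \<in> brk_polys k M" and f: "L2_fun \<Omega> f"
  shows "(\<forall>v\<in>hyb_space0 \<Omega> k M. a_form k M \<mu> lam u v + b_form k M v q = vol_inner \<Omega> f (glue M (fst v)))
    \<longleftrightarrow> (\<forall>v\<in>hyb_space0 \<Omega> k M. \<forall>T\<in>elems M. (\<forall>F\<in>elem_faces M T. snd v F = (\<lambda>x. 0)) \<longrightarrow>
          momentum_form k \<mu> lam u (q T) T (fst v T) (snd v) = vol_inner T f (fst v T))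
      \<and> (\<forall>F\<in>interfaces M. \<forall>x\<in>F. traction k M \<mu> lam (elem1 M F) F (fst u (elem1 M F)) (snd u) (q (elem1 M F)) x
          + traction k M \<mu> lam (elem2 M F) F (fst u (elem2 M F)) (snd u) (q (elem2 M F)) x = 0)"
    (is "?G \<longleftrightarrow> ?L \<and> ?C")
proof -
  note us = hyb_space0_space[OF u]
  let ?t = "\<lambda>T F. traction k M \<mu> lam T F (fst u T) (snd u) (q T)"
  have fT: "L2 lborel T f" if "T \<in> elems M" for T
    using L2_subset[OF f[unfolded L2_fun_L2] elem_subset[OF that]] elem_borel[OF that] by simp
  have load: "vol_inner \<Omega> f (glue M (fst v)) = (\<Sum>T\<in>elems M. vol_inner T f (fst v T))" if "v \<in> hyb_space0 \<Omega> k M" for v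
    by (rule vol_inner_glue[OF fT elem_vpolys_L2[OF _ hyb_space_elem[OF hyb_space0_space[OF that]]]])
  have glob: "a_form k M \<mu> lam u v + b_form k M v q = (\<Sum>T\<in>elems M. momentum_form k \<mu> lam u (q T) T (fst v T) (\<lambda>F x. 0))
      + (\<Sum>F\<in>interfaces M. face_inner F (?t (elem1 M F) F) (snd v F) + face_inner F (?t (elem2 M F) F) (snd v F))"
    if v: "v \<in> hyb_space0 \<Omega> k M" for v
  proof -
    have "(\<Sum>T\<in>elems M. \<Sum>F\<in>elem_faces M T. face_inner F (?t T F) (snd v F))
        = (\<Sum>F\<in>interfaces M. face_inner F (?t (elem1 M F) F) (snd v F) + face_inner F (?t (elem2 M F) F) (snd v F))"
      using v by (intro sum_elem_faces) (simp add: hyb_space0_def face_inner_ip)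
    then show ?thesis
      unfolding global_momentum[OF us hyb_space0_space[OF v] q]
      using momentum_form_split[OF us hyb_space0_space[OF v] brk_polys_elem[OF q]] by (simp add: sum.distrib)
  qed
  have add: "face_inner F (?t (elem1 M F) F) \<psi> + face_inner F (?t (elem2 M F) F) \<psi>
      = face_inner F (\<lambda>x. ?t (elem1 M F) F x + ?t (elem2 M F) F x) \<psi>"
    if F: "F \<in> interfaces M" and \<psi>: "\<psi> \<in> face_vpolys k F" for F \<psi>
    unfolding face_inner_ip
    using interface_neighbours[OF F] elem_faces_faces
    by (intro ip_add_left[symmetric] traction_L2[OF us] brk_polys_elem[OF q] face_L2 face_vpolys_continuous[OF \<psi>]) auto
  show ?thesis
  proof
    assume G: ?G
    have ?L
    proof (intro ballI impI)
      fix v T assume v: "v \<in> hyb_space0 \<Omega> k M" and T: "T \<in> elems M" and z: "\<forall>F\<in>elem_faces M T. snd v F = (\<lambda>x. 0)"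
      \<comment> \<open>carried by the element \<open>T\<close>\<close>
      define v' where "v' = (\<lambda>T'. if T' = T then fst v T else (\<lambda>x. 0), \<lambda>F :: (real^'d) set. \<lambda>x :: real^'d. 0 :: real^'d)"
      have v': "v' \<in> hyb_space0 \<Omega> k M"
        using v T by (auto simp: v'_def hyb_space0_def hyb_space_def brk_vpolys_def vpolys_zero zero_face_vpolys)
      have "(\<Sum>T\<in>elems M. momentum_form k \<mu> lam u (q T) T (fst v' T) (\<lambda>F x. 0)) = (\<Sum>T\<in>elems M. vol_inner T f (fst v' T))"
        using bspec[OF G v'] unfolding glob[OF v'] load[OF v'] by (simp add: v'_def face_inner_ip)
      moreover have "(\<Sum>T'\<in>elems M. momentum_form k \<mu> lam u (q T') T' (fst v' T') (\<lambda>F x. 0)) = momentum_form k \<mu> lam u (q T) T (fst v T) (\<lambda>F x. 0)"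
        using T by (subst sum.remove[OF finite_elems T]) (auto simp: v'_def intro!: sum.neutral)
      moreover have "(\<Sum>T'\<in>elems M. vol_inner T' f (fst v' T')) = vol_inner T f (fst v T)"
        using T by (subst sum.remove[OF finite_elems T]) (auto simp: v'_def vol_inner_ip intro!: sum.neutral)
      moreover have "momentum_form k \<mu> lam u (q T) T (fst v T) (snd v) = momentum_form k \<mu> lam u (q T) T (fst v T) (\<lambda>F x. 0)"
        using z by (intro momentum_form_cong) auto
      ultimately show "momentum_form k \<mu> lam u (q T) T (fst v T) (snd v) = vol_inner T f (fst v T)" by simp
    qed
    moreover have ?C
    proof (intro ballI)
      fix F x assume F: "F \<in> interfaces M" and x: "x \<in> F"
      note nb = interface_neighbours[OF F]
      have Ff: "F \<in> faces M" using F faces_split by blast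
      define \<psi> where "\<psi> = restr F (?t (elem1 M F) F) + restr F (?t (elem2 M F) F)"
      have \<psi>: "\<psi> \<in> face_vpolys k F" unfolding \<psi>_def
        using nb by (intro subspace_add[OF subspace_face_vpolys] traction_face_poly us brk_polys_elem[OF q])
      \<comment> \<open>carried by the interface \<open>F\<close>, with the sum of the two tractions as face unknown\<close>
      define v where "v = (\<lambda>T :: (real^'d) set. \<lambda>x :: real^'d. 0 :: real^'d, \<lambda>F'. if F' = F then \<psi> else (\<lambda>x. 0))"
      have v: "v \<in> hyb_space0 \<Omega> k M"
        using \<psi> Ff F interface_not_boundary
        by (auto simp: v_def hyb_space0_def hyb_space_def brk_vpolys_def vpolys_zero zero_face_vpolys)
      have "(\<Sum>F\<in>interfaces M. face_inner F (?t (elem1 M F) F) (snd v F) + face_inner F (?t (elem2 M F) F) (snd v F)) = 0"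
      proof -
        have "momentum_form k \<mu> lam u (q T) T (fst v T) (\<lambda>F x. 0) = 0" "vol_inner T f (fst v T) = 0" for T
          by (simp_all add: v_def vol_inner_ip)
        then show ?thesis using bspec[OF G v] unfolding glob[OF v] load[OF v] by (simp only: sum.neutral_const add_0)
      qed
      moreover have "(\<Sum>F'\<in>interfaces M. face_inner F' (?t (elem1 M F') F') (snd v F') + face_inner F' (?t (elem2 M F') F') (snd v F'))
          = face_inner F (?t (elem1 M F) F) \<psi> + face_inner F (?t (elem2 M F) F) \<psi>"
      proof -
        have fi: "finite (interfaces M)"
          by (rule finite_subset[OF _ finite_faces]) (simp add: faces_split)
        show ?thesis using F by (subst sum.remove[OF fi F]) (auto simp: v_def face_inner_ip intro!: sum.neutral)
      qed
      moreover have "face_inner F (\<lambda>x. ?t (elem1 M F) F x + ?t (elem2 M F) F x) \<psi> = face_inner F \<psi> \<psi>"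
        unfolding face_inner_ip by (rule ip_cong) (simp_all add: \<psi>_def restr_def)
      ultimately have "face_inner F \<psi> \<psi> = 0" using add[OF F \<psi>] by simp
      then have "\<psi> = 0" by (rule face_vpolys_definite[OF Ff \<psi>])
      from fun_cong[OF this, of x] show "?t (elem1 M F) F x + ?t (elem2 M F) F x = 0"
        using x by (simp add: \<psi>_def restr_def)
    qed
    ultimately show "?L \<and> ?C" ..
  next
    assume LC: "?L \<and> ?C"
    show ?G
    proof
      fix v assume v: "v \<in> hyb_space0 \<Omega> k M"
      \<comment> \<open>the element equations hold for the element part alone\<close>
      define v' where "v' = (fst v, \<lambda>F :: (real^'d) set. \<lambda>x :: real^'d. 0 :: real^'d)"
      have v': "v' \<in> hyb_space0 \<Omega> k M"
        using v by (auto simp: v'_def hyb_space0_def hyb_space_def zero_face_vpolys)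
      have "momentum_form k \<mu> lam u (q T) T (fst v T) (\<lambda>F x. 0) = vol_inner T f (fst v T)" if "T \<in> elems M" for T
        using LC v' that by (auto simp: v'_def)
      moreover have "face_inner F (?t (elem1 M F) F) (snd v F) + face_inner F (?t (elem2 M F) F) (snd v F) = 0" if F: "F \<in> interfaces M" for F
      proof -
        have "snd v F \<in> face_vpolys k F" using v F faces_split by (auto simp: hyb_space0_def hyb_space_def)
        then have "face_inner F (?t (elem1 M F) F) (snd v F) + face_inner F (?t (elem2 M F) F) (snd v F)
            = face_inner F (\<lambda>x. ?t (elem1 M F) F x + ?t (elem2 M F) F x) (snd v F)" by (rule add[OF F])
        also have "\<dots> = face_inner F (\<lambda>x. 0) (snd v F)"
          unfolding face_inner_ip using LC F by (intro ip_cong) auto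
        finally show ?thesis by (simp add: face_inner_ip)
      qed
      ultimately show "a_form k M \<mu> lam u v + b_form k M v q = vol_inner \<Omega> f (glue M (fst v))"
        unfolding glob[OF v] load[OF v] by simp
    qed
  qed
qed

section \<open>The lifting of jumps\<close>

lemma brk_vpolys_families: "brk_vpolys l M = families (elems M) (\<lambda>_. vpolys l)"
  unfolding brk_vpolys_def families_def zero_fun_def ..

lemma brk_vpolys_elem: "v \<in> brk_vpolys l M \<Longrightarrow> T \<in> elems M \<Longrightarrow> v T \<in> vpolys l" by (simp add: brk_vpolys_def)

lemma vol_inner_brk:
  assumes "v \<in> brk_vpolys l M" "w \<in> brk_vpolys m M"
  shows "vol_inner \<Omega> (glue M v) (glue M w) = (\<Sum>T\<in>elems M. vol_inner T (v T) (w T))"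
  by (rule vol_inner_glue_glue[OF elem_vpolys_L2[OF _ brk_vpolys_elem[OF assms(1)]] elem_vpolys_L2[OF _ brk_vpolys_elem[OF assms(2)]]])

lemma jump_continuous:
  assumes "F \<in> interfaces M" "q \<in> brk_polys k M"
  shows "continuous_on S (jump M F q)"
  unfolding jump_def[abs_def]
  by (intro continuous_on_diff polys_continuous[OF brk_polys_elem[OF assms(2)]] interface_neighbours[OF assms(1)])

lemma avg_continuous:
  assumes "F \<in> interfaces M" "v \<in> brk_vpolys l M"
  shows "continuous_on S (\<lambda>x. avg M \<kappa> F (kscale \<kappa> v) x \<bullet> n)"
  unfolding avg_def Let_def kscale_def
  by (intro continuous_on_inner continuous_on_add continuous_on_scaleR continuous_on_const
      vpolys_continuous[OF brk_vpolys_elem[OF assms(2)]] interface_neighbours[OF assms(1)])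

text \<open>The lifting represents the functional \<open>\<xi> \<mapsto> \<Sum>F. ([q], {\<kappa> \<xi>} \<bullet> n)\<^sub>F\<close>; the form is definite because
its value is the sum of the squared norms over the elements.\<close>

lemma lifting_ex1:
  assumes q: "q \<in> brk_polys k M"
  shows "\<exists>!R. R \<in> brk_vpolys l M \<and> (\<forall>\<xi>\<in>brk_vpolys l M. vol_inner \<Omega> (glue M R) (glue M \<xi>)
     = (\<Sum>F\<in>interfaces M. face_inner F (jump M F q) (\<lambda>x. avg M \<kappa> F (kscale \<kappa> \<xi>) x \<bullet> face_normal M F)))"
proof (rule riesz_representation)
  show sub: "subspace (brk_vpolys l M)" unfolding brk_vpolys_families by (rule subspace_families) (rule subspace_vpolys)
  show "fin_dim (brk_vpolys l M)" unfolding brk_vpolys_families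
    by (rule fin_dim_families) (simp_all add: fin_dim_vpolys)
  fix x y z :: "(real^'d, real^'d) brk" and c :: real assume x: "x \<in> brk_vpolys l M"
  have cx: "c *\<^sub>R x \<in> brk_vpolys l M" using subspace_scale[OF sub x] .
  show "(\<Sum>F\<in>interfaces M. face_inner F (jump M F q) (\<lambda>t. avg M \<kappa> F (kscale \<kappa> (c *\<^sub>R x)) t \<bullet> face_normal M F))
      = c * (\<Sum>F\<in>interfaces M. face_inner F (jump M F q) (\<lambda>t. avg M \<kappa> F (kscale \<kappa> x) t \<bullet> face_normal M F))"
    unfolding sum_distrib_left face_inner_ip
  proof (rule sum.cong[OF refl])
    fix F
    have "avg M \<kappa> F (kscale \<kappa> (c *\<^sub>R x)) t \<bullet> face_normal M F = c *\<^sub>R (avg M \<kappa> F (kscale \<kappa> x) t \<bullet> face_normal M F)" for t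
      by (simp add: avg_def kscale_def Let_def inner_add_left distrib_left mult_ac)
    then show "ip (face_measure F) F (jump M F q) (\<lambda>t. avg M \<kappa> F (kscale \<kappa> (c *\<^sub>R x)) t \<bullet> face_normal M F)
      = c * ip (face_measure F) F (jump M F q) (\<lambda>t. avg M \<kappa> F (kscale \<kappa> x) t \<bullet> face_normal M F)"
      by (simp only: ip_scaleR_right)
  qed
  { assume z: "vol_inner \<Omega> (glue M x) (glue M x) = 0"
    have "vol_inner T (x T) (x T) = 0" if "T \<in> elems M" for T
    proof -
      have "vol_inner T (x T) (x T) \<ge> 0" for T
        unfolding vol_inner_def set_lebesgue_integral_def by (intro Bochner_Integration.integral_nonneg) simp
      then show ?thesis using z that unfolding vol_inner_brk[OF x x] by (simp add: sum_nonneg_eq_0_iff)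
    qed
    then have "x T = 0 T" for T
      using vpolys_definite[OF _ brk_vpolys_elem[OF x], of T] x
      by (cases "T \<in> elems M") (auto simp: brk_vpolys_def zero_fun_def)
    then show "x = 0" by (rule ext) }
  { assume y: "y \<in> brk_vpolys l M"
    show "(\<Sum>F\<in>interfaces M. face_inner F (jump M F q) (\<lambda>t. avg M \<kappa> F (kscale \<kappa> (x + y)) t \<bullet> face_normal M F))
      = (\<Sum>F\<in>interfaces M. face_inner F (jump M F q) (\<lambda>t. avg M \<kappa> F (kscale \<kappa> x) t \<bullet> face_normal M F))
        + (\<Sum>F\<in>interfaces M. face_inner F (jump M F q) (\<lambda>t. avg M \<kappa> F (kscale \<kappa> y) t \<bullet> face_normal M F))"
      unfolding sum.distrib[symmetric] face_inner_ip
    proof (rule sum.cong[OF refl])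
      fix F assume F: "F \<in> interfaces M"
      have "avg M \<kappa> F (kscale \<kappa> (x + y)) t \<bullet> face_normal M F
          = avg M \<kappa> F (kscale \<kappa> x) t \<bullet> face_normal M F + avg M \<kappa> F (kscale \<kappa> y) t \<bullet> face_normal M F" for t
        by (simp add: avg_def kscale_def Let_def inner_add_left distrib_left)
      then show "ip (face_measure F) F (jump M F q) (\<lambda>t. avg M \<kappa> F (kscale \<kappa> (x + y)) t \<bullet> face_normal M F)
        = ip (face_measure F) F (jump M F q) (\<lambda>t. avg M \<kappa> F (kscale \<kappa> x) t \<bullet> face_normal M F)
        + ip (face_measure F) F (jump M F q) (\<lambda>t. avg M \<kappa> F (kscale \<kappa> y) t \<bullet> face_normal M F)"
        using ip_add_right[OF face_L2[OF interface_face[OF F] avg_continuous[OF F x]] face_L2[OF interface_face[OF F] avg_continuous[OF F y]]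
            face_L2[OF interface_face[OF F] jump_continuous[OF F q]]] by (simp only:)
    qed }
  assume z: "z \<in> brk_vpolys l M"
  show "vol_inner \<Omega> (glue M x) (glue M z) = vol_inner \<Omega> (glue M z) (glue M x)"
    unfolding vol_inner_ip by (rule ip_commute)
  show "vol_inner \<Omega> (glue M (c *\<^sub>R x)) (glue M z) = c * vol_inner \<Omega> (glue M x) (glue M z)"
    unfolding vol_inner_brk[OF cx z] vol_inner_brk[OF x z] sum_distrib_left
    by (simp add: vol_inner_ip scaleR_fun_def ip_scaleR_left)
  assume y: "y \<in> brk_vpolys l M"
  have xy: "x + y \<in> brk_vpolys l M" using subspace_add[OF sub x y] .
  show "vol_inner \<Omega> (glue M (x + y)) (glue M z) = vol_inner \<Omega> (glue M x) (glue M z) + vol_inner \<Omega> (glue M y) (glue M z)"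
    unfolding vol_inner_brk[OF xy z] vol_inner_brk[OF x z] vol_inner_brk[OF y z] sum.distrib[symmetric]
  proof (rule sum.cong[OF refl])
    fix T assume T: "T \<in> elems M"
    show "vol_inner T ((x + y) T) (z T) = vol_inner T (x T) (z T) + vol_inner T (y T) (z T)"
      unfolding vol_inner_ip plus_fun_def
      by (rule ip_add_left[OF elem_vpolys_L2[OF T brk_vpolys_elem[OF x T]] elem_vpolys_L2[OF T brk_vpolys_elem[OF y T]] elem_vpolys_L2[OF T brk_vpolys_elem[OF z T]]])
  qed
qed

lemma lifting_mem: "q \<in> brk_polys k M \<Longrightarrow> lifting \<Omega> k M \<kappa> q \<in> brk_vpolys (k - 1) M"
  and lifting_inner: "q \<in> brk_polys k M \<Longrightarrow> \<xi> \<in> brk_vpolys (k - 1) M \<Longrightarrow>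
    vol_inner \<Omega> (glue M (lifting \<Omega> k M \<kappa> q)) (glue M \<xi>)
     = (\<Sum>F\<in>interfaces M. face_inner F (jump M F q) (\<lambda>x. avg M \<kappa> F (kscale \<kappa> \<xi>) x \<bullet> face_normal M F))"
  using theI'[OF lifting_ex1] unfolding lifting_def by blast+

section \<open>Mass balance\<close>

text \<open>Differentiation lowers the degree, so broken gradients are admissible in the definition of the lifting.\<close>

lemma brk_grad_mem: "q \<in> brk_polys k M \<Longrightarrow> brk_grad q \<in> brk_vpolys (k - 1) M"
  using grad_vpolys[of _ k] by (auto simp: brk_polys_def brk_vpolys_def brk_grad_def grad_const)

lemma elem_val_eq:
  assumes "\<exists>c. \<forall>x\<in>T. \<kappa> x = c" "x \<in> T"
  shows "\<kappa> x = elem_val \<kappa> T"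
proof -
  obtain c where c: "\<And>x. x \<in> T \<Longrightarrow> \<kappa> x = c" using assms(1) by blast
  have "elem_val \<kappa> T = c" unfolding elem_val_def using c assms(2) by (intro the_equality) auto
  then show ?thesis using c assms(2) by simp
qed

text \<open>The part of the mass flux that does not involve the displacement.\<close>

definition darcy_flux where
  "darcy_flux \<kappa> \<sigma> F n p x = avg M \<kappa> F (kscale \<kappa> (brk_grad p)) x \<bullet> n
      - \<sigma> * harm_mean M \<kappa> F / face_len M F * jump M F p x * (n \<bullet> face_normal M F)"

lemma mass_flux_darcy:
  "mass_flux M \<kappa> \<sigma> T F w p x = (if F \<in> interfaces M then darcy_flux \<kappa> \<sigma> F (normal T F) p x - w x \<bullet> normal T F else 0)"
  by (simp add: mass_flux_def darcy_flux_def inner_diff_left)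

lemma darcy_flux_continuous:
  assumes "F \<in> interfaces M" "p \<in> brk_polys k M"
  shows "continuous_on S (darcy_flux \<kappa> \<sigma> F n p)"
  unfolding darcy_flux_def[abs_def]
  by (intro continuous_on_diff continuous_on_mult continuous_on_const jump_continuous[OF assms]
      avg_continuous[OF assms(1) brk_grad_mem[OF assms(2)]])

lemma darcy_flux_minus: "darcy_flux \<kappa> \<sigma> F (- n) p x = - darcy_flux \<kappa> \<sigma> F n p x"
  by (simp add: darcy_flux_def)

text \<open>Linearity in the normal and the opposite signs on the two sides turn the traces of \<open>q\<close> into its jump.\<close>

lemma interface_darcy:
  assumes F: "F \<in> interfaces M" and p: "p \<in> brk_polys k M" and q: "q \<in> brk_polys k M"
  shows "face_inner F (darcy_flux \<kappa> \<sigma> F (normal (elem1 M F) F) p) (q (elem1 M F))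
      + face_inner F (darcy_flux \<kappa> \<sigma> F (normal (elem2 M F) F) p) (q (elem2 M F))
    = face_inner F (\<lambda>x. avg M \<kappa> F (kscale \<kappa> (brk_grad p)) x \<bullet> face_normal M F) (jump M F q)
      - \<sigma> * harm_mean M \<kappa> F / face_len M F * face_inner F (jump M F p) (jump M F q)"
proof -
  note Ff = interface_face[OF F]
  let ?n = "face_normal M F" and ?d = "darcy_flux \<kappa> \<sigma> F (face_normal M F) p"
  let ?s = "\<sigma> * harm_mean M \<kappa> F / face_len M F"
  have q1: "L2 (face_measure F) F (q (elem1 M F))" and q2: "L2 (face_measure F) F (q (elem2 M F))"
    by (intro face_L2[OF Ff] polys_continuous[OF brk_polys_elem[OF q]] interface_neighbours[OF F])+
  have d: "L2 (face_measure F) F ?d" by (rule face_L2[OF Ff darcy_flux_continuous[OF F p]])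
  have jq: "L2 (face_measure F) F (jump M F q)" and jp: "L2 (face_measure F) F (jump M F p)"
    by (rule face_L2[OF Ff jump_continuous[OF F q]], rule face_L2[OF Ff jump_continuous[OF F p]])
  have a: "L2 (face_measure F) F (\<lambda>x. avg M \<kappa> F (kscale \<kappa> (brk_grad p)) x \<bullet> ?n)"
    by (rule face_L2[OF Ff avg_continuous[OF F brk_grad_mem[OF p]]])
  have "darcy_flux \<kappa> \<sigma> F (- ?n) p = (\<lambda>x. (- 1) *\<^sub>R ?d x)" by (simp add: fun_eq_iff darcy_flux_minus)
  then have "face_inner F (darcy_flux \<kappa> \<sigma> F (normal (elem1 M F) F) p) (q (elem1 M F))
      + face_inner F (darcy_flux \<kappa> \<sigma> F (normal (elem2 M F) F) p) (q (elem2 M F))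
    = face_inner F ?d (q (elem1 M F)) - face_inner F ?d (q (elem2 M F))"
    unfolding interface_normals[OF F] face_inner_ip by (simp only: ip_scaleR_left)
  also have "\<dots> = face_inner F ?d (jump M F q)"
    unfolding face_inner_ip jump_def[abs_def] by (rule ip_diff_right[OF q1 q2 d, symmetric])
  also have "\<dots> = face_inner F (\<lambda>x. avg M \<kappa> F (kscale \<kappa> (brk_grad p)) x \<bullet> ?n - ?s *\<^sub>R jump M F p x) (jump M F q)"
    unfolding darcy_flux_def[abs_def] interface_normals(3)[OF F] by simp
  also have "\<dots> = face_inner F (\<lambda>x. avg M \<kappa> F (kscale \<kappa> (brk_grad p)) x \<bullet> ?n) (jump M F q) - ?s * face_inner F (jump M F p) (jump M F q)"
    unfolding face_inner_ip ip_diff_left[OF a L2_scaleR[OF jp] jq] ip_scaleR_left ..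
  finally show ?thesis .
qed

definition mass_form where
  "mass_form k \<kappa> \<sigma> c dp w \<phi> p T r = vol_inner T (\<lambda>x. c * dp T x) r
     - vol_inner T (\<lambda>x. w T x - (\<kappa> x *\<^sub>R brk_grad p T x - lifting \<Omega> k M \<kappa> p T x)) (grad r)
     - (\<Sum>F\<in>elem_faces M T. face_inner F (mass_flux M \<kappa> \<sigma> T F (\<phi> F) p) r)"

text \<open>The coupling term gives the volume term with \<open>\<nabla>q\<close> and the normal trace of the face displacement, by
parts.  Of the terms of the Darcy form, the volume term and, through the lifting, the symmetry term
are sums over elements; consistency and penalty terms are the Darcy fluxes summed over the interfaces.\<close>

lemma global_mass:
  assumes v: "v \<in> hyb_space0 \<Omega> k M" and p: "p \<in> brk_polys k M" and q: "q \<in> brk_polys k M"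
    and \<kappa>: "\<And>T. T \<in> elems M \<Longrightarrow> \<exists>c. \<forall>x\<in>T. \<kappa> x = c"
    and dp: "\<And>T. T \<in> elems M \<Longrightarrow> L2 lborel T (\<lambda>x. c * dp T x)"
  shows "vol_inner \<Omega> (\<lambda>x. c * glue M dp x) (glue M q) - b_form k M v q + c_form \<Omega> M \<kappa> \<sigma> p q
    = (\<Sum>T\<in>elems M. mass_form k \<kappa> \<sigma> c dp (fst v) (snd v) p T (q T))"
proof -
  note vs = hyb_space0_space[OF v]
  let ?R = "lifting \<Omega> k M \<kappa> p"
  let ?kg = "\<lambda>T x. elem_val \<kappa> T *\<^sub>R brk_grad p T x"
  note gp = brk_grad_mem[OF p] and gq = brk_grad_mem[OF q] and Rm = lifting_mem[OF p, of \<kappa>]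
  have A: "vol_inner \<Omega> (\<lambda>x. c * glue M dp x) (glue M q) = (\<Sum>T\<in>elems M. vol_inner T (\<lambda>x. c * dp T x) (q T))"
    by (rule vol_inner_split)
      (use L2_integrable[OF dp elem_polys_L2[OF _ brk_polys_elem[OF q]]] in \<open>auto simp: glue_elem glue_outside\<close>)
  have kg: "L2 lborel T (?kg T)" and Rl: "L2 lborel T (?R T)" and gql: "L2 lborel T (brk_grad q T)"
    and vl: "L2 lborel T (fst v T)" if T: "T \<in> elems M" for T
    using L2_scaleR[OF elem_vpolys_L2[OF T brk_vpolys_elem[OF gp T]]] elem_vpolys_L2[OF T brk_vpolys_elem[OF Rm T]]
      elem_vpolys_L2[OF T brk_vpolys_elem[OF gq T]] elem_vpolys_L2[OF T hyb_space_elem[OF vs T]] by blast+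
  have K: "vol_inner \<Omega> (\<lambda>x. \<kappa> x *\<^sub>R glue M (brk_grad p) x) (glue M (brk_grad q)) = (\<Sum>T\<in>elems M. vol_inner T (?kg T) (brk_grad q T))"
    by (rule vol_inner_split)
      (use L2_integrable[OF kg gql] elem_val_eq[OF \<kappa>] in \<open>auto simp: glue_elem glue_outside\<close>)
  have L: "(\<Sum>F\<in>interfaces M. face_inner F (jump M F p) (\<lambda>x. avg M \<kappa> F (kscale \<kappa> (brk_grad q)) x \<bullet> face_normal M F))
      = (\<Sum>T\<in>elems M. vol_inner T (?R T) (brk_grad q T))"
    using lifting_inner[OF p gq, of \<kappa>] unfolding vol_inner_brk[OF Rm gq] by simp
  have B: "- b_form k M v q = (\<Sum>T\<in>elems M. (\<Sum>F\<in>elem_faces M T. face_inner F (\<lambda>x. snd v F x \<bullet> normal T F) (q T)) - vol_inner T (fst v T) (brk_grad q T))"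
    unfolding b_form_def brk_grad_def minus_minus
    using div_recon_ip[OF _ hyb_space_face_data[OF vs] hyb_space_elem[OF vs] brk_polys_elem[OF q]]
      div_load_by_parts[OF _ hyb_space_face_data[OF vs] hyb_space_elem[OF vs] brk_polys_elem[OF q]]
    by (intro sum.cong) auto
  let ?d = "\<lambda>T F. if F \<in> interfaces M then face_inner F (darcy_flux \<kappa> \<sigma> F (normal T F) p) (q T) else 0"
  have D: "(\<Sum>T\<in>elems M. \<Sum>F\<in>elem_faces M T. ?d T F)
      = (\<Sum>F\<in>interfaces M. face_inner F (\<lambda>x. avg M \<kappa> F (kscale \<kappa> (brk_grad p)) x \<bullet> face_normal M F) (jump M F q)
      - \<sigma> * harm_mean M \<kappa> F / face_len M F * face_inner F (jump M F p) (jump M F q))"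
  proof -
    have "(\<Sum>T\<in>elems M. \<Sum>F\<in>elem_faces M T. ?d T F) = (\<Sum>F\<in>interfaces M. ?d (elem1 M F) F + ?d (elem2 M F) F)"
      using interface_not_boundary by (intro sum_elem_faces) auto
    also have "\<dots> = (\<Sum>F\<in>interfaces M. face_inner F (\<lambda>x. avg M \<kappa> F (kscale \<kappa> (brk_grad p)) x \<bullet> face_normal M F) (jump M F q)
      - \<sigma> * harm_mean M \<kappa> F / face_len M F * face_inner F (jump M F p) (jump M F q))"
      by (intro sum.cong refl) (simp only: if_True interface_darcy[OF _ p q])
    finally show ?thesis .
  qed
  have flux: "face_inner F (mass_flux M \<kappa> \<sigma> T F (snd v F) p) (q T) = ?d T F - face_inner F (\<lambda>x. snd v F x \<bullet> normal T F) (q T)"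
    if T: "T \<in> elems M" and F: "F \<in> elem_faces M T" for T F
  proof (cases "F \<in> interfaces M")
    case True
    note Ff = interface_face[OF True]
    have "mass_flux M \<kappa> \<sigma> T F (snd v F) p = (\<lambda>x. darcy_flux \<kappa> \<sigma> F (normal T F) p x - snd v F x \<bullet> normal T F)"
      using True by (simp add: fun_eq_iff mass_flux_darcy)
    moreover have "L2 (face_measure F) F (\<lambda>x. snd v F x \<bullet> normal T F)"
      using hyb_space_face_data[OF vs, of T] F unfolding face_data_def
      by (intro face_L2[OF Ff] continuous_on_inner continuous_on_const) auto
    ultimately show ?thesis using True unfolding face_inner_ip
      by (simp add: ip_diff_left[OF face_L2[OF Ff darcy_flux_continuous[OF True p]] _ face_L2[OF Ff polys_continuous[OF brk_polys_elem[OF q T]]]])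
  next
    case False
    then have "F \<in> boundary_faces \<Omega> M" using elem_faces_faces[OF F] faces_split by blast
    then have "snd v F = (\<lambda>x. 0)" using v by (simp add: hyb_space0_def)
    moreover have "mass_flux M \<kappa> \<sigma> T F (snd v F) p = (\<lambda>x. 0)" using False by (simp add: fun_eq_iff mass_flux_darcy)
    ultimately show ?thesis using False by (simp add: face_inner_ip)
  qed
  have loc: "vol_inner T (\<lambda>x. fst v T x - (\<kappa> x *\<^sub>R brk_grad p T x - ?R T x)) (grad (q T))
      = vol_inner T (fst v T) (brk_grad q T) - (vol_inner T (?kg T) (brk_grad q T) - vol_inner T (?R T) (brk_grad q T))"
    if T: "T \<in> elems M" for T
  proof -
    have "vol_inner T (\<lambda>x. fst v T x - (\<kappa> x *\<^sub>R brk_grad p T x - ?R T x)) (grad (q T))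
        = vol_inner T (\<lambda>x. fst v T x - (?kg T x - ?R T x)) (brk_grad q T)"
      unfolding vol_inner_ip by (rule ip_cong) (simp_all add: elem_val_eq[OF \<kappa>[OF T]] brk_grad_def)
    then show ?thesis
      by (simp only: vol_inner_ip ip_diff_left[OF vl[OF T] L2_diff[OF kg[OF T] Rl[OF T]] gql[OF T]] ip_diff_left[OF kg[OF T] Rl[OF T] gql[OF T]])
  qed
  have "(\<Sum>T\<in>elems M. mass_form k \<kappa> \<sigma> c dp (fst v) (snd v) p T (q T))
      = (\<Sum>T\<in>elems M. vol_inner T (\<lambda>x. c * dp T x) (q T))
        + ((\<Sum>T\<in>elems M. \<Sum>F\<in>elem_faces M T. face_inner F (\<lambda>x. snd v F x \<bullet> normal T F) (q T)) - (\<Sum>T\<in>elems M. vol_inner T (fst v T) (brk_grad q T)))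
        + ((\<Sum>T\<in>elems M. vol_inner T (?kg T) (brk_grad q T)) - (\<Sum>T\<in>elems M. vol_inner T (?R T) (brk_grad q T)))
        - (\<Sum>T\<in>elems M. \<Sum>F\<in>elem_faces M T. ?d T F)"
  proof -
    have "mass_form k \<kappa> \<sigma> c dp (fst v) (snd v) p T (q T) = vol_inner T (\<lambda>x. c * dp T x) (q T)
        - (vol_inner T (fst v T) (brk_grad q T) - (vol_inner T (?kg T) (brk_grad q T) - vol_inner T (?R T) (brk_grad q T)))
        - ((\<Sum>F\<in>elem_faces M T. ?d T F) - (\<Sum>F\<in>elem_faces M T. face_inner F (\<lambda>x. snd v F x \<bullet> normal T F) (q T)))"
      if T: "T \<in> elems M" for T
      unfolding mass_form_def loc[OF T] sum_subtractf[symmetric] by (simp only: sum.cong[OF refl flux[OF T]])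
    then show ?thesis by (simp add: sum.distrib sum_subtractf)
  qed
  also have "\<dots> = vol_inner \<Omega> (\<lambda>x. c * glue M dp x) (glue M q) - b_form k M v q + c_form \<Omega> M \<kappa> \<sigma> p q"
    unfolding A c_form_def K sum.distrib L D sum_subtractf using B by (simp add: sum_subtractf)
  finally show ?thesis ..
qed

lemma mass_form_zero [simp]: "mass_form k \<kappa> \<sigma> c dp w \<phi> p T (\<lambda>x. 0) = 0"
  unfolding mass_form_def grad_const by (simp add: vol_inner_ip face_inner_ip)

text \<open>Setting a broken polynomial to zero off one element is again a broken polynomial.\<close>

lemma mass_equivalence:
  assumes v: "v \<in> hyb_space0 \<Omega> k M" and p: "p \<in> brk_polys k M"
    and \<kappa>: "\<And>T. T \<in> elems M \<Longrightarrow> \<exists>c. \<forall>x\<in>T. \<kappa> x = c"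
    and dp: "\<And>T. T \<in> elems M \<Longrightarrow> L2 lborel T (\<lambda>x. c * dp T x)"
    and g: "L2_fun \<Omega> g"
  shows "(\<forall>q\<in>brk_polys k M. vol_inner \<Omega> (\<lambda>x. c * glue M dp x) (glue M q) - b_form k M v q + c_form \<Omega> M \<kappa> \<sigma> p q
        = vol_inner \<Omega> g (glue M q))
    \<longleftrightarrow> (\<forall>q\<in>brk_polys k M. \<forall>T\<in>elems M. mass_form k \<kappa> \<sigma> c dp (fst v) (snd v) p T (q T) = vol_inner T g (q T))"
    (is "?G \<longleftrightarrow> ?L")
proof -
  have gT: "L2 lborel T g" if "T \<in> elems M" for T
    using L2_subset[OF g[unfolded L2_fun_L2] elem_subset[OF that]] elem_borel[OF that] by simp
  have load: "vol_inner \<Omega> g (glue M q) = (\<Sum>T\<in>elems M. vol_inner T g (q T))" if "q \<in> brk_polys k M" for q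
    by (rule vol_inner_glue[OF gT elem_polys_L2[OF _ brk_polys_elem[OF that]]])
  have glob: "vol_inner \<Omega> (\<lambda>x. c * glue M dp x) (glue M q) - b_form k M v q + c_form \<Omega> M \<kappa> \<sigma> p q
      = (\<Sum>T\<in>elems M. mass_form k \<kappa> \<sigma> c dp (fst v) (snd v) p T (q T))" if "q \<in> brk_polys k M" for q
    by (rule global_mass[OF v p that \<kappa> dp])
  show ?thesis
  proof
    assume G: ?G
    show ?L
    proof (intro ballI)
      fix q T assume q: "q \<in> brk_polys k M" and T: "T \<in> elems M"
      define q' where "q' = (\<lambda>T'. if T' = T then q T else (\<lambda>x. 0))"
      have q': "q' \<in> brk_polys k M" using q T by (auto simp: q'_def brk_polys_def polys_const)
      have "(\<Sum>T\<in>elems M. mass_form k \<kappa> \<sigma> c dp (fst v) (snd v) p T (q' T)) = (\<Sum>T\<in>elems M. vol_inner T g (q' T))"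
        using bspec[OF G q'] unfolding glob[OF q'] load[OF q'] .
      moreover have "(\<Sum>T'\<in>elems M. mass_form k \<kappa> \<sigma> c dp (fst v) (snd v) p T' (q' T')) = mass_form k \<kappa> \<sigma> c dp (fst v) (snd v) p T (q T)"
        by (subst sum.remove[OF finite_elems T]) (auto simp: q'_def intro!: sum.neutral)
      moreover have "(\<Sum>T'\<in>elems M. vol_inner T' g (q' T')) = vol_inner T g (q T)"
        by (subst sum.remove[OF finite_elems T]) (auto simp: q'_def vol_inner_ip intro!: sum.neutral)
      ultimately show "mass_form k \<kappa> \<sigma> c dp (fst v) (snd v) p T (q T) = vol_inner T g (q T)" by simp
    qed
  next
    assume L: ?L
    show ?G
    proof
      fix q assume q: "q \<in> brk_polys k M"
      show "vol_inner \<Omega> (\<lambda>x. c * glue M dp x) (glue M q) - b_form k M v q + c_form \<Omega> M \<kappa> \<sigma> p q = vol_inner \<Omega> g (glue M q)"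
        unfolding glob[OF q] load[OF q] using L q by (intro sum.cong) auto
    qed
  qed
qed

text \<open>The face displacement is single valued and the two normals are opposite.\<close>

lemma mass_flux_conservative:
  assumes F: "F \<in> interfaces M"
  shows "mass_flux M \<kappa> \<sigma> (elem1 M F) F w p x + mass_flux M \<kappa> \<sigma> (elem2 M F) F w p x = 0"
  using F by (simp add: mass_flux_darcy interface_normals darcy_flux_minus)

section \<open>The discrete Biot problem in flux form\<close>

lemma press_space_polys: "p \<in> press_space \<Omega> k M c0 \<Longrightarrow> p \<in> brk_polys k M"
  by (auto simp: press_space_def split: if_splits)

lemma dt_hyb_mem:
  assumes "u n \<in> hyb_space0 \<Omega> k M" "u (n - 1) \<in> hyb_space0 \<Omega> k M"
  shows "dt_hyb \<tau> u n \<in> hyb_space0 \<Omega> k M"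
proof -
  have eq: "dt_brk \<tau> w n X = (1 / \<tau>) *\<^sub>R (w n X - w (n - 1) X)" for w :: "nat \<Rightarrow> (real^'d, real^'d) brk" and X
    by (simp add: dt_brk_def fun_eq_iff divide_inverse)
  have "dt_brk \<tau> (\<lambda>m. fst (u m)) n \<in> brk_vpolys k M"
    using assms unfolding brk_vpolys_def hyb_space0_def hyb_space_def eq
    by (auto intro!: subspace_scale[OF subspace_vpolys] subspace_diff[OF subspace_vpolys] simp: fun_eq_iff)
  moreover have "dt_brk \<tau> (\<lambda>m. snd (u m)) n F \<in> face_vpolys k F" if "F \<in> faces M" for F
    using assms that unfolding hyb_space0_def hyb_space_def eq
    by (auto intro!: subspace_scale[OF subspace_face_vpolys] subspace_diff[OF subspace_face_vpolys])
  ultimately show ?thesis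
    using assms unfolding hyb_space0_def hyb_space_def dt_hyb_def by (auto simp: dt_brk_def fun_eq_iff)
qed

end

text \<open>The equivalence at step \<open>n\<close> may use that the unknowns of all steps, in particular of step \<open>n - 1\<close>,
lie in their discrete spaces.\<close>

lemma ball_conj_equiv:
  assumes "\<And>n. n \<in> A \<Longrightarrow> (\<And>m. m \<in> A \<Longrightarrow> S m) \<Longrightarrow> G n \<longleftrightarrow> L n"
  shows "(\<forall>n\<in>A. S n \<and> G n) \<longleftrightarrow> (\<forall>n\<in>A. S n \<and> L n)"
  using assms by blast

lemma ball_conj_prod:
  assumes "x0 \<in> V" "y0 \<in> Q"
  shows "(\<forall>v\<in>V. A v) \<and> (\<forall>q\<in>Q. B q) \<longleftrightarrow> (\<forall>v\<in>V. \<forall>q\<in>Q. A v \<and> B q)"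
    and "(\<forall>v\<in>V. \<forall>T\<in>E. A' v T) \<and> (\<forall>q\<in>Q. \<forall>T\<in>E. B' q T) \<longleftrightarrow> (\<forall>v\<in>V. \<forall>q\<in>Q. \<forall>T\<in>E. A' v T \<and> B' q T)"
  using assms by blast+

theorem lemma18:
  fixes \<Omega> :: "(real^'d) set" and M :: "(real^'d) mesh" and \<P> :: "(real^'d) set set"
    and \<kappa> :: "real^'d \<Rightarrow> real" and f :: "real \<Rightarrow> real^'d \<Rightarrow> real^'d" and g :: "real \<Rightarrow> real^'d \<Rightarrow> real"
    and p0 :: "real^'d \<Rightarrow> real" and u :: "nat \<Rightarrow> (real^'d) hyb" and p :: "nat \<Rightarrow> (real^'d, real) brk"
    and tF c0 lam \<mu> \<kappa>lo \<kappa>hi \<rho> Ctr \<sigma> \<tau> :: real and k N Nd :: nat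
  assumes "CARD('d) \<in> {1, 2, 3}"
    and "\<Omega> \<noteq> {}" "connected \<Omega>" "open_polyhedron \<Omega>"
    and "tF > 0" "c0 \<ge> 0" "lam \<ge> 0" "\<mu> > 0"
    and "polyhedral_partition \<Omega> \<P>" "\<forall>P\<in>\<P>. \<exists>c. \<forall>x\<in>P. \<kappa> x = c"
    and "0 < \<kappa>lo" "AE x in lborel. x \<in> \<Omega> \<longrightarrow> \<kappa>lo \<le> \<kappa> x \<and> \<kappa> x \<le> \<kappa>hi"
    and "C0_L2 tF \<Omega> f" "C0_L2 tF \<Omega> g" "L2_fun \<Omega> p0"
    and "c0 = 0 \<Longrightarrow> \<forall>t\<in>{0..tF}. (LINT x:\<Omega>|lborel. g t x) = 0"
    and "polyhedral_mesh \<Omega> M" "\<rho> > 0" "shape_regular \<Omega> M \<rho>"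
    and "\<forall>T\<in>elems M. \<exists>P\<in>\<P>. T \<subseteq> P"
    and "\<forall>T\<in>elems M. card (elem_faces M T) \<le> Nd"
    and "k \<ge> 1"
    and "trace_constant M k Ctr" "\<sigma> > Ctr\<^sup>2 * real Nd"
    and "N \<ge> 1" "\<tau> = tF / real N"
    and "u 0 \<in> hyb_space0 \<Omega> k M"
    and "\<forall>v\<in>hyb_space0 \<Omega> k M. a_form k M \<mu> lam (u 0) v
           = vol_inner \<Omega> (f 0) (glue M (fst v)) - b_form k M v (brk_proj k M p0)"
    and "c0 > 0 \<Longrightarrow> p 0 = brk_proj k M p0"
  shows
    "(\<forall>n\<in>{1..N}. u n \<in> hyb_space0 \<Omega> k M \<and> p n \<in> press_space \<Omega> k M c0 \<and>
       (\<forall>v\<in>hyb_space0 \<Omega> k M. \<forall>q\<in>brk_polys k M.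
          a_form k M \<mu> lam (u n) v + b_form k M v (p n)
            = vol_inner \<Omega> (f (real n * \<tau>)) (glue M (fst v)) \<and>
          vol_inner \<Omega> (\<lambda>x. c0 * glue M (dt_brk \<tau> p n) x) (glue M q)
            - b_form k M (dt_hyb \<tau> u n) q + c_form \<Omega> M \<kappa> \<sigma> (p n) q
            = vol_inner \<Omega> (g (real n * \<tau>)) (glue M q)))
     \<longleftrightarrow>
     (\<forall>n\<in>{1..N}. u n \<in> hyb_space0 \<Omega> k M \<and> p n \<in> press_space \<Omega> k M c0 \<and>
       (\<forall>v\<in>hyb_space0 \<Omega> k M. \<forall>q\<in>brk_polys k M. \<forall>T\<in>elems M.
          ((\<forall>F\<in>elem_faces M T. snd v F = (\<lambda>x. 0)) \<longrightarrow>
            vol_inner T (\<lambda>x. stress k M \<mu> lam T (fst (u n) T) (snd (u n)) x - p n T x *\<^sub>R mat 1)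
                (sgrad (fst v T))
              + (\<Sum>F\<in>elem_faces M T.
                   face_inner F (traction k M \<mu> lam T F (fst (u n) T) (snd (u n)) (p n T))
                     (\<lambda>x. snd v F x - fst v T x))
              = vol_inner T (f (real n * \<tau>)) (fst v T)) \<and>
          vol_inner T (\<lambda>x. c0 * dt_brk \<tau> p n T x) (q T)
            - vol_inner T (\<lambda>x. fst (dt_hyb \<tau> u n) T x
                  - (\<kappa> x *\<^sub>R brk_grad (p n) T x - lifting \<Omega> k M \<kappa> (p n) T x)) (brk_grad q T)
            - (\<Sum>F\<in>elem_faces M T.
                 face_inner F (mass_flux M \<kappa> \<sigma> T F (snd (dt_hyb \<tau> u n) F) (p n)) (q T))
            = vol_inner T (g (real n * \<tau>)) (q T)) \<and>
       (\<forall>F\<in>interfaces M. \<forall>T1\<in>elems M. \<forall>T2\<in>elems M.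
          T1 \<noteq> T2 \<and> F \<in> elem_faces M T1 \<inter> elem_faces M T2 \<longrightarrow>
          (\<forall>x\<in>F.
            traction k M \<mu> lam T1 F (fst (u n) T1) (snd (u n)) (p n T1) x
              + traction k M \<mu> lam T2 F (fst (u n) T2) (snd (u n)) (p n T2) x = 0 \<and>
            mass_flux M \<kappa> \<sigma> T1 F (snd (dt_hyb \<tau> u n) F) (p n) x
              + mass_flux M \<kappa> \<sigma> T2 F (snd (dt_hyb \<tau> u n) F) (p n) x = 0)))"
proof -
  interpret mesh_on \<Omega> M by unfold_locales (fact assms(4), fact assms(17))
  have \<kappa>: "\<exists>c. \<forall>x\<in>T. \<kappa> x = c" if T: "T \<in> elems M" for T
  proof -
    obtain P where "P \<in> \<P>" "T \<subseteq> P" using assms(20) T by blast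
    moreover then obtain c where "\<forall>x\<in>P. \<kappa> x = c" using assms(10) by blast
    ultimately show ?thesis by blast
  qed
  have time: "real n * \<tau> \<in> {0..tF}" if "n \<in> {1..N}" for n
  proof -
    have N: "real N * \<tau> = tF" using assms(25,26) by simp
    have "\<tau> \<ge> 0" using assms(5,26) by simp
    then have "real n * \<tau> \<le> real N * \<tau>" using that by (intro mult_right_mono) auto
    then show ?thesis using \<open>\<tau> \<ge> 0\<close> by (simp add: N)
  qed
  have f: "L2_fun \<Omega> (f (real n * \<tau>))" and g: "L2_fun \<Omega> (g (real n * \<tau>))" if "n \<in> {1..N}" for n
    using time[OF that] assms(13,14) unfolding C0_L2_def by blast+
  let ?space = "\<lambda>n. u n \<in> hyb_space0 \<Omega> k M \<and> p n \<in> press_space \<Omega> k M c0"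
  let ?Gu = "\<lambda>n. \<forall>v\<in>hyb_space0 \<Omega> k M. a_form k M \<mu> lam (u n) v + b_form k M v (p n)
            = vol_inner \<Omega> (f (real n * \<tau>)) (glue M (fst v))"
  let ?Gp = "\<lambda>n. \<forall>q\<in>brk_polys k M. vol_inner \<Omega> (\<lambda>x. c0 * glue M (dt_brk \<tau> p n) x) (glue M q)
            - b_form k M (dt_hyb \<tau> u n) q + c_form \<Omega> M \<kappa> \<sigma> (p n) q
            = vol_inner \<Omega> (g (real n * \<tau>)) (glue M q)"
  let ?Lu = "\<lambda>n. \<forall>v\<in>hyb_space0 \<Omega> k M. \<forall>T\<in>elems M. (\<forall>F\<in>elem_faces M T. snd v F = (\<lambda>x. 0)) \<longrightarrow>
          momentum_form k \<mu> lam (u n) (p n T) T (fst v T) (snd v) = vol_inner T (f (real n * \<tau>)) (fst v T)"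
  let ?Lp = "\<lambda>n. \<forall>q\<in>brk_polys k M. \<forall>T\<in>elems M.
          mass_form k \<kappa> \<sigma> c0 (dt_brk \<tau> p n) (fst (dt_hyb \<tau> u n)) (snd (dt_hyb \<tau> u n)) (p n) T (q T)
            = vol_inner T (g (real n * \<tau>)) (q T)"
  let ?t = "\<lambda>n T F. traction k M \<mu> lam T F (fst (u n) T) (snd (u n)) (p n T)"
  let ?m = "\<lambda>n T F. mass_flux M \<kappa> \<sigma> T F (snd (dt_hyb \<tau> u n) F) (p n)"
  let ?C = "\<lambda>n. \<forall>F\<in>interfaces M. \<forall>x\<in>F. ?t n (elem1 M F) F x + ?t n (elem2 M F) F x = 0"
  let ?C' = "\<lambda>n. \<forall>F\<in>interfaces M. \<forall>T1\<in>elems M. \<forall>T2\<in>elems M.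
          T1 \<noteq> T2 \<and> F \<in> elem_faces M T1 \<inter> elem_faces M T2 \<longrightarrow>
          (\<forall>x\<in>F. ?t n T1 F x + ?t n T2 F x = 0 \<and> ?m n T1 F x + ?m n T2 F x = 0)"
  have hyb0: "(\<lambda>T x. 0, \<lambda>F x. 0) \<in> hyb_space0 \<Omega> k M"
    by (auto simp: hyb_space0_def hyb_space_def brk_vpolys_def vpolys_zero zero_face_vpolys)
  have brk0: "(\<lambda>T x. 0) \<in> brk_polys k M" by (auto simp: brk_polys_def polys_const)
  \<comment> \<open>the ordering of the two neighbours of an interface is immaterial, and the mass flux is always conservative\<close>
  have flux: "?C n \<longleftrightarrow> ?C' n" for n
  proof
    assume C: "?C n"
    show "?C' n"
    proof (intro ballI impI)
      fix F T1 T2 x assume F: "F \<in> interfaces M" and T: "T1 \<in> elems M" "T2 \<in> elems M"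
        and ne: "T1 \<noteq> T2 \<and> F \<in> elem_faces M T1 \<inter> elem_faces M T2" and x: "x \<in> F"
      have t: "?t n (elem1 M F) F x + ?t n (elem2 M F) F x = 0" using C F x by blast
      have m: "?m n (elem1 M F) F x + ?m n (elem2 M F) F x = 0" by (rule mass_flux_conservative[OF F])
      from interface_pair[OF F T] ne
      have "T1 = elem1 M F \<and> T2 = elem2 M F \<or> T1 = elem2 M F \<and> T2 = elem1 M F" by blast
      then show "?t n T1 F x + ?t n T2 F x = 0 \<and> ?m n T1 F x + ?m n T2 F x = 0"
        using t m by (elim disjE conjE) (simp_all only: add.commute simp_thms)
    qed
  next
    assume C': "?C' n"
    show "?C n"
    proof (intro ballI)
      fix F x assume F: "F \<in> interfaces M" and x: "x \<in> F"
      show "?t n (elem1 M F) F x + ?t n (elem2 M F) F x = 0"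
        using C'[rule_format, OF F interface_neighbours(1,2)[OF F] _ x] interface_neighbours(3-5)[OF F] by blast
    qed
  qed
  \<comment> \<open>the two equations of the global problem are tested independently of each other\<close>
  have step: "?Gu n \<and> ?Gp n \<longleftrightarrow> (?Lu n \<and> ?Lp n) \<and> ?C' n"
    if n: "n \<in> {1..N}" and sp: "\<And>m. m \<in> {1..N} \<Longrightarrow> ?space m" for n
  proof -
    have un: "u n \<in> hyb_space0 \<Omega> k M" and pn: "p n \<in> brk_polys k M"
      using sp[OF n] press_space_polys by blast+
    have u1: "u (n - 1) \<in> hyb_space0 \<Omega> k M"
    proof (cases "n = 1")
      case True
      then show ?thesis using assms(27) by simp
    next
      case False
      then have "n - 1 \<in> {1..N}" using n by auto
      then show ?thesis using sp by blast
    qed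
    \<comment> \<open>for \<open>n = 1\<close> the pressure of the previous step is the projected initial pressure if \<open>c0 > 0\<close> and enters with the factor \<open>c0 = 0\<close> otherwise\<close>
    have dp: "L2 lborel T (\<lambda>x. c0 * dt_brk \<tau> p n T x)" if T: "T \<in> elems M" for T
    proof (cases "c0 = 0")
      case True
      then show ?thesis using elem_polys_L2[OF T polys_const[of 0]] by simp
    next
      case False
      then have c: "c0 > 0" using assms(6) by simp
      have p1: "p (n - 1) \<in> brk_polys k M"
      proof (cases "n = 1")
        case True
        then show ?thesis using assms(29)[OF c] brk_proj_mem[OF assms(15)] by simp
      next
        case False
        then have "n - 1 \<in> {1..N}" using n by auto
        then show ?thesis using sp press_space_polys by blast
      qed
      have "(\<lambda>x. c0 * ((1 / \<tau>) * (p n T x - p (n - 1) T x))) \<in> polys k"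
        by (intro polys_scale polys_diff brk_polys_elem[OF pn T] brk_polys_elem[OF p1 T])
      then show ?thesis using elem_polys_L2[OF T] by (simp add: dt_brk_def divide_inverse)
    qed
    have conj: "A = (B \<and> C) \<Longrightarrow> D = E \<Longrightarrow> (A \<and> D) = ((B \<and> E) \<and> C)" for A B C D E by blast
    have "?Gu n \<longleftrightarrow> ?Lu n \<and> ?C n" by (rule momentum_equivalence[OF un pn f[OF n]])
    then have "?Gu n \<longleftrightarrow> ?Lu n \<and> ?C' n" unfolding flux .
    moreover have "?Gp n \<longleftrightarrow> ?Lp n" by (rule mass_equivalence[OF dt_hyb_mem[OF un u1] pn \<kappa> dp g[OF n]])
    ultimately show ?thesis by (rule conj)
  qed
  have "(\<forall>n\<in>{1..N}. ?space n \<and> ?Gu n \<and> ?Gp n) \<longleftrightarrow> (\<forall>n\<in>{1..N}. ?space n \<and> (?Lu n \<and> ?Lp n) \<and> ?C' n)"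
    by (rule ball_conj_equiv[OF step])
  moreover have "?Gu n \<and> ?Gp n \<longleftrightarrow> (\<forall>v\<in>hyb_space0 \<Omega> k M. \<forall>q\<in>brk_polys k M.
          a_form k M \<mu> lam (u n) v + b_form k M v (p n)
            = vol_inner \<Omega> (f (real n * \<tau>)) (glue M (fst v)) \<and>
          vol_inner \<Omega> (\<lambda>x. c0 * glue M (dt_brk \<tau> p n) x) (glue M q)
            - b_form k M (dt_hyb \<tau> u n) q + c_form \<Omega> M \<kappa> \<sigma> (p n) q
            = vol_inner \<Omega> (g (real n * \<tau>)) (glue M q))" for n
    by (rule ball_conj_prod(1)[OF hyb0 brk0])
  moreover have "?Lu n \<and> ?Lp n \<longleftrightarrow> (\<forall>v\<in>hyb_space0 \<Omega> k M. \<forall>q\<in>brk_polys k M. \<forall>T\<in>elems M.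
          ((\<forall>F\<in>elem_faces M T. snd v F = (\<lambda>x. 0)) \<longrightarrow>
            vol_inner T (\<lambda>x. stress k M \<mu> lam T (fst (u n) T) (snd (u n)) x - p n T x *\<^sub>R mat 1)
                (sgrad (fst v T))
              + (\<Sum>F\<in>elem_faces M T.
                   face_inner F (traction k M \<mu> lam T F (fst (u n) T) (snd (u n)) (p n T))
                     (\<lambda>x. snd v F x - fst v T x))
              = vol_inner T (f (real n * \<tau>)) (fst v T)) \<and>
          vol_inner T (\<lambda>x. c0 * dt_brk \<tau> p n T x) (q T)
            - vol_inner T (\<lambda>x. fst (dt_hyb \<tau> u n) T x
                  - (\<kappa> x *\<^sub>R brk_grad (p n) T x - lifting \<Omega> k M \<kappa> (p n) T x)) (brk_grad q T)
            - (\<Sum>F\<in>elem_faces M T.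
                 face_inner F (mass_flux M \<kappa> \<sigma> T F (snd (dt_hyb \<tau> u n) F) (p n)) (q T))
            = vol_inner T (g (real n * \<tau>)) (q T))" for n
    unfolding momentum_form_def mass_form_def brk_grad_def by (rule ball_conj_prod(2)[OF hyb0 brk0])
  ultimately show ?thesis by (simp only: conj_assoc)
qed

end
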